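(* Let $G$ be a profinite group of type (F) and let $\phi$ be an open self-embedding of $G$. Then $\mathrm{Con}(\phi)$ is (isomorphic, as a topological group, to) an open subgroup of a direct product of finitely many nilpotent groups, each of which is a uniform (in particular, torsion-free) pro-$p$ group for some prime $p$ (the prime may depend on the factor), and a pronilpotent soluble group of finite exponent.
   Context: All homomorphisms between profinite groups are understood to be continuous. A profinite group $G$ is of type (F) if for every positive integer $n$ it has only finitely many open subgroups of index $n$. An open self-embedding of $G$ is an injective (continuous) endomorphism of $G$ whose image is open in $G$. For an endomorphism $\phi$ of $G$, $\mathrm{Con}(\phi) = \{x \in G \mid \lim_{n\to+\infty} \phi^n(x) = 1\}$. *)

theory Defs
  imports
    "HOL-Analysis.Abstract_Topological_Spaces"
    "HOL-Algebra.Product_Groups"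
    "HOL-Algebra.Solvable_Groups"
    "HOL-Computational_Algebra.Primes"
begin

section \<open>Topological and profinite groups\<close>

locale topological_group = group G for G (structure) +
  fixes T
  assumes topspace_eq: "topspace T = carrier G"
    and continuous_mult: "continuous_map (prod_topology T T) T (\<lambda>(x, y). x \<otimes> y)"
    and continuous_inv: "continuous_map T T (\<lambda>x. inv x)"

text \<open>Profinite groups are taken to be the compact Hausdorff totally disconnected groups.\<close>

locale profinite_group = topological_group +
  assumes compact: "compact_space T"
    and hausdorff: "Hausdorff_space T"
    and totally_disconnected: "connectedin T S \<Longrightarrow> \<exists>x. S \<subseteq> {x}"

text \<open>The index of a subgroup of infinite index is \<open>0\<close> here, whence the restriction to
  positive \<open>n\<close> is essential.\<close>

definition type_F :: "('a, 'm) monoid_scheme \<Rightarrow> 'a topology \<Rightarrow> bool" where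
  "type_F G T \<longleftrightarrow>
     (\<forall>n>0. finite {H. subgroup H G \<and> openin T H \<and> card (rcosets\<^bsub>G\<^esub> H) = n})"

definition open_self_embedding ::
    "('a, 'm) monoid_scheme \<Rightarrow> 'a topology \<Rightarrow> ('a \<Rightarrow> 'a) \<Rightarrow> bool" where
  "open_self_embedding G T \<phi> \<longleftrightarrow>
     \<phi> \<in> hom G G \<and> continuous_map T T \<phi> \<and> inj_on \<phi> (carrier G) \<and> openin T (\<phi> ` carrier G)"

definition Con :: "('a, 'm) monoid_scheme \<Rightarrow> 'a topology \<Rightarrow> ('a \<Rightarrow> 'a) \<Rightarrow> 'a set" where
  "Con G T \<phi> = {x \<in> carrier G. limitin T (\<lambda>n. (\<phi> ^^ n) x) \<one>\<^bsub>G\<^esub> sequentially}"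

definition topological_group_iso ::
    "('a, 'm) monoid_scheme \<Rightarrow> 'a topology \<Rightarrow> ('b, 'n) monoid_scheme \<Rightarrow> 'b topology \<Rightarrow> bool" where
  "topological_group_iso G T H S \<longleftrightarrow>
     topological_group G T \<and> topological_group H S \<and>
     (\<exists>f. f \<in> iso G H \<and> homeomorphic_map T S f)"


section \<open>Nilpotency, torsion and exponent\<close>

definition commutator_subgroup :: "('a, 'm) monoid_scheme \<Rightarrow> 'a set \<Rightarrow> 'a set \<Rightarrow> 'a set" where
  "commutator_subgroup G A B =
     generate G (\<Union>a\<in>A. \<Union>b\<in>B. {a \<otimes>\<^bsub>G\<^esub> b \<otimes>\<^bsub>G\<^esub> inv\<^bsub>G\<^esub> a \<otimes>\<^bsub>G\<^esub> inv\<^bsub>G\<^esub> b})"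

text \<open>Indexed from \<open>0\<close>: \<open>lower_central G n\<close> is the term usually written \<open>\<gamma>\<close> with
  index \<open>n + 1\<close>.\<close>

primrec lower_central :: "('a, 'm) monoid_scheme \<Rightarrow> nat \<Rightarrow> 'a set" where
  "lower_central G 0 = carrier G"
| "lower_central G (Suc n) = commutator_subgroup G (lower_central G n) (carrier G)"

definition nilpotent_group :: "('a, 'm) monoid_scheme \<Rightarrow> bool" where
  "nilpotent_group G \<longleftrightarrow> group G \<and> (\<exists>n. lower_central G n = {\<one>\<^bsub>G\<^esub>})"

definition pronilpotent_group :: "('a, 'm) monoid_scheme \<Rightarrow> 'a topology \<Rightarrow> bool" where
  "pronilpotent_group G T \<longleftrightarrow>
     profinite_group G T \<and> (\<forall>N. N \<lhd> G \<and> openin T N \<longrightarrow> nilpotent_group (G Mod N))"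

definition torsion_free_group :: "('a, 'm) monoid_scheme \<Rightarrow> bool" where
  "torsion_free_group G \<longleftrightarrow>
     (\<forall>x\<in>carrier G. \<forall>n::nat. n > 0 \<and> x [^]\<^bsub>G\<^esub> n = \<one>\<^bsub>G\<^esub> \<longrightarrow> x = \<one>\<^bsub>G\<^esub>)"

definition finite_exponent :: "('a, 'm) monoid_scheme \<Rightarrow> bool" where
  "finite_exponent G \<longleftrightarrow> (\<exists>n::nat. n > 0 \<and> (\<forall>x\<in>carrier G. x [^]\<^bsub>G\<^esub> n = \<one>\<^bsub>G\<^esub>))"


section \<open>Uniform pro-p groups\<close>

definition pro_p_group :: "nat \<Rightarrow> ('a, 'm) monoid_scheme \<Rightarrow> 'a topology \<Rightarrow> bool" where
  "pro_p_group p G T \<longleftrightarrow>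
     prime p \<and> profinite_group G T \<and>
     (\<forall>N. N \<lhd> G \<and> openin T N \<longrightarrow> (\<exists>k. card (rcosets\<^bsub>G\<^esub> N) = p ^ k))"

definition topologically_finitely_generated ::
    "('a, 'm) monoid_scheme \<Rightarrow> 'a topology \<Rightarrow> bool" where
  "topologically_finitely_generated G T \<longleftrightarrow>
     (\<exists>S. finite S \<and> S \<subseteq> carrier G \<and> T closure_of (generate G S) = carrier G)"

definition power_subgroup :: "('a, 'm) monoid_scheme \<Rightarrow> nat \<Rightarrow> 'a set \<Rightarrow> 'a set" where
  "power_subgroup G n A = generate G ((\<lambda>x. x [^]\<^bsub>G\<^esub> n) ` A)"

definition powerful_pro_p_group :: "nat \<Rightarrow> ('a, 'm) monoid_scheme \<Rightarrow> 'a topology \<Rightarrow> bool" where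
  "powerful_pro_p_group p G T \<longleftrightarrow>
     pro_p_group p G T \<and>
     comm_group (G Mod (T closure_of power_subgroup G (if p = 2 then 4 else p) (carrier G)))"

text \<open>The lower \<open>p\<close>-series of Dixon, du Sautoy, Mann and Segal (Analytic pro-p groups,
  Definition 1.15), indexed from \<open>0\<close> instead of \<open>1\<close>.\<close>

primrec lower_p_series ::
    "nat \<Rightarrow> ('a, 'm) monoid_scheme \<Rightarrow> 'a topology \<Rightarrow> nat \<Rightarrow> 'a set" where
  "lower_p_series p G T 0 = carrier G"
| "lower_p_series p G T (Suc i) =
     T closure_of (power_subgroup G p (lower_p_series p G T i) <#>\<^bsub>G\<^esub>
                   commutator_subgroup G (lower_p_series p G T i) (carrier G))"

text \<open>Uniform (uniformly powerful) pro-p groups as in Definition 4.1 of the same book: all the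
  indices of successive terms of the lower \<open>p\<close>-series are equal.\<close>

definition uniform_pro_p_group :: "nat \<Rightarrow> ('a, 'm) monoid_scheme \<Rightarrow> 'a topology \<Rightarrow> bool" where
  "uniform_pro_p_group p G T \<longleftrightarrow>
     powerful_pro_p_group p G T \<and>
     topologically_finitely_generated G T \<and>
     (\<forall>i. card (rcosets\<^bsub>G\<lparr>carrier := lower_p_series p G T i\<rparr>\<^esub> (lower_p_series p G T (Suc i)))
        = card (rcosets\<^bsub>G\<^esub> (lower_p_series p G T 1)))"

end

theory Submission
  imports Defs "HOL-Algebra.Multiplicative_Group" "HOL-Algebra.Sylow"
begin

text \<open>By type (F) the intersection \<open>I n\<close> of the open subgroups of index at most \<open>n\<close> is open,
  and it centralises every normal section of order at most \<open>n\<close>. Some power of \<open>\<phi>\<close> maps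
  \<open>C = Con \<phi>\<close> into \<open>I n\<close>, so up to powers of \<open>\<phi>\<close> the group \<open>C\<close> acts trivially on every normal
  section of bounded order.

  A closed normal subgroup \<open>P\<close> of \<open>C\<close> with \<open>\<phi> P \<subseteq> P\<close> is called pure if \<open>\<phi> x \<in> P\<close> implies
  \<open>x \<in> P\<close> for \<open>x \<in> C\<close>. The index of \<open>\<phi> P\<close> in \<open>P\<close> is bounded by that of \<open>\<phi> C\<close> in \<open>C\<close> and grows
  strictly with \<open>P\<close>, so chains of pure subgroups are finite. Descend from \<open>C\<close> through pure
  subgroups with abelian quotients of finite exponent as long as possible; the last term \<open>D\<close>
  has a finite central series with torsion-free factors. The elements of finite order in \<open>C\<close> form
  a soluble normal subgroup \<open>E\<close> of finite exponent which centralises \<open>D\<close> and meets it trivially,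
  and some power of \<open>\<phi>\<close> maps \<open>C\<close> into \<open>D E\<close>.

  Finally \<open>D\<close> is the direct product of its pro-\<open>p\<close> parts for the primes \<open>p\<close> dividing the index of
  \<open>\<phi> C\<close> in \<open>C\<close>. In each of them the iterated closed subgroups of \<open>p\<close>-th powers are eventually
  uniform, because the index of two successive ones does not increase. A further power of \<open>\<phi>\<close>
  maps \<open>C\<close> onto an open subgroup of the product of such uniform subgroups with \<open>E\<close>.\<close>

section \<open>Commutators and indices\<close>

text \<open>That \<open>I n\<close> centralises sections of order at most \<open>n\<close> is a
  count: the elements that commute with a given \<open>a\<close> modulo \<open>B\<close> form an
  open subgroup whose index is at most that of \<open>B\<close> in \<open>A\<close>. The obstacle is
  that \<phi> need not be onto, so the image of a normal subgroup is normal only in the image of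
  \<open>G\<close>. Hence subgroups are pulled back along \<phi>, and what has been shown after a
  power of \<phi> is brought back by purity. Centrality in \<open>D\<close> comes from filtrations
  that \<phi> shifts by exactly one step: their factors have order at most \<open>m\<close>, so a
  nontrivial action on a simple section yields an abelian quotient of exponent dividing
  \<open>m!\<close>, which \<open>D\<close> does not have. Torsion-freeness is a comparison of
  cokernels: on an abelian section \<phi> commutes with the \<open>n\<close>-th power map, and equal
  orders of the cokernels force the kernel of the latter to vanish. For uniformity the centraliser
  argument is applied modulo \<open>p * p\<close>-th powers. Commutators then fall two steps, so
  \<open>p\<close>-th powers give homomorphisms between successive factors, and the exponent
  \<open>4\<close> demanded for \<open>p = 2\<close> is covered as well.\<close>

lemma card_image_same_kernel:
  assumes "\<And>x y. x \<in> P \<Longrightarrow> y \<in> P \<Longrightarrow> f x = f y \<longleftrightarrow> g x = g y"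
  shows "card (f ` P) = card (g ` P)" and "finite (f ` P) \<longleftrightarrow> finite (g ` P)"
proof -
  define h where "h = (\<lambda>c. g (inv_into P f c))"
  have h: "h (f x) = g x" if "x \<in> P" for x
    using assms[of "inv_into P f (f x)" x] that unfolding h_def
    by (metis f_inv_into_f image_eqI inv_into_into)
  have "bij_betw h (f ` P) (g ` P)"
    unfolding bij_betw_def inj_on_def using h assms by (auto simp: image_iff)
  then show "card (f ` P) = card (g ` P)" "finite (f ` P) \<longleftrightarrow> finite (g ` P)"
    by (auto simp: bij_betw_same_card bij_betw_finite)
qed

context group
begin

text \<open>The convention agrees with the generators of \<open>commutator_subgroup\<close>, so
  bounds on \<open>cm\<close> transfer directly to \<open>lower_central\<close> and
  \<open>lower_p_series\<close>.\<close>

definition cm :: "'a \<Rightarrow> 'a \<Rightarrow> 'a" where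
  "cm x y = x \<otimes> y \<otimes> inv x \<otimes> inv y"

lemma cancel_left [simp]:
  assumes "x \<in> carrier G" "y \<in> carrier G"
  shows "x \<otimes> (inv x \<otimes> y) = y" "inv x \<otimes> (x \<otimes> y) = y"
  using assms by (simp_all flip: m_assoc)

lemma cm_closed [simp, intro]: "x \<in> carrier G \<Longrightarrow> y \<in> carrier G \<Longrightarrow> cm x y \<in> carrier G"
  by (simp add: cm_def)

lemma inv_cm: "x \<in> carrier G \<Longrightarrow> y \<in> carrier G \<Longrightarrow> inv (cm x y) = cm y x"
  by (simp add: cm_def inv_mult_group m_assoc)

lemma cm_mult: "x \<in> carrier G \<Longrightarrow> y \<in> carrier G \<Longrightarrow> cm x y \<otimes> (y \<otimes> x) = x \<otimes> y"
  by (simp add: cm_def inv_mult_group m_assoc)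

lemma cm_eq_one_iff:
  assumes "x \<in> carrier G" "y \<in> carrier G"
  shows "cm x y = \<one> \<longleftrightarrow> x \<otimes> y = y \<otimes> x"
  by (metis assms cm_closed cm_mult l_one m_closed one_closed right_cancel)

lemma cm_mult_left:
  assumes "x \<in> carrier G" "y \<in> carrier G" "w \<in> carrier G"
  shows "cm (x \<otimes> y) w = x \<otimes> cm y w \<otimes> inv x \<otimes> cm x w"
  using assms by (simp add: cm_def inv_mult_group m_assoc)

lemma cm_mult_right:
  assumes "x \<in> carrier G" "y \<in> carrier G" "w \<in> carrier G"
  shows "cm w (x \<otimes> y) = cm w x \<otimes> (x \<otimes> cm w y \<otimes> inv x)"
  using assms by (simp add: cm_def inv_mult_group m_assoc)

lemma cm_inv_left:
  assumes "x \<in> carrier G" "w \<in> carrier G"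
  shows "cm (inv x) w = inv x \<otimes> inv (cm x w) \<otimes> x"
  using assms by (simp add: cm_def inv_mult_group m_assoc)

lemma conj_eq_cm:
  assumes "x \<in> carrier G" "y \<in> carrier G"
  shows "x \<otimes> y \<otimes> inv x = cm x y \<otimes> y"
  using assms by (simp add: cm_def inv_mult_group m_assoc)

lemma cm_one [simp]: "x \<in> carrier G \<Longrightarrow> cm \<one> x = \<one>" "x \<in> carrier G \<Longrightarrow> cm x \<one> = \<one>"
  by (simp_all add: cm_def)

lemma cm_conj:
  assumes "x \<in> carrier G" "y \<in> carrier G" "g \<in> carrier G"
  shows "g \<otimes> cm x y \<otimes> inv g = cm (g \<otimes> x \<otimes> inv g) (g \<otimes> y \<otimes> inv g)"
  using assms by (simp add: cm_def inv_mult_group m_assoc)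

lemma cm_swap_mem:
  assumes "subgroup N G" "x \<in> carrier G" "y \<in> carrier G" "cm x y \<in> N"
  shows "cm y x \<in> N"
  using assms inv_cm subgroup.m_inv_closed by metis

lemma normal_cm:
  assumes "N \<lhd> G" "x \<in> N" "y \<in> carrier G"
  shows "cm x y \<in> N" and "cm y x \<in> N"
proof -
  interpret N: normal N G by fact
  have x: "x \<in> carrier G" using assms N.mem_carrier by blast
  have "y \<otimes> x \<otimes> inv y \<otimes> inv x \<in> N"
    using assms N.inv_op_closed2 by (simp add: x)
  then show "cm y x \<in> N" by (simp add: cm_def)
  then show "cm x y \<in> N"
    using cm_swap_mem N.subgroup_axioms assms x by blast
qed

lemma normalI':
  assumes "subgroup N G" "\<And>x g. x \<in> N \<Longrightarrow> g \<in> carrier G \<Longrightarrow> g \<otimes> x \<otimes> inv g \<in> N"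
  shows "N \<lhd> G"
  using assms normal_inv_iff by blast

lemma hom_cm:
  assumes "h \<in> hom G H" "group H" "x \<in> carrier G" "y \<in> carrier G"
  shows "h (cm x y) = group.cm H (h x) (h y)"
proof -
  interpret H: group H by fact
  interpret h: group_hom G H h
    using assms by (simp add: group_hom_def group_hom_axioms_def)
  show ?thesis using assms by (simp add: cm_def H.cm_def)
qed

lemma coset_eq_iff:
  assumes "subgroup Q G" "x \<in> carrier G" "y \<in> carrier G"
  shows "Q #> x = Q #> y \<longleftrightarrow> x \<otimes> inv y \<in> Q"
proof -
  interpret subgroup Q G by fact
  show ?thesis
  proof
    assume "Q #> x = Q #> y"
    then have "x \<in> Q #> y"
      using assms rcos_self by blast
    then show "x \<otimes> inv y \<in> Q"
      using assms rcos_module group_axioms by blast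
  next
    assume "x \<otimes> inv y \<in> Q"
    then have "x \<in> Q #> y"
      using assms rcos_module_rev[OF group_axioms] by blast
    then show "Q #> x = Q #> y"
      using assms repr_independence by metis
  qed
qed

lemma coset_eq_self_iff:
  assumes "subgroup Q G" "x \<in> carrier G"
  shows "Q #> x = Q \<longleftrightarrow> x \<in> Q"
  using coset_eq_iff[OF assms(1), of x \<one>] assms by (simp add: subgroup.subset)

text \<open>Induction with \<open>cm_mult_left\<close>: the conjugation by \<open>x\<close> that
  occurs there fixes the powers of \<open>cm x w\<close>.\<close>

lemma pow_cm_central:
  assumes "x \<in> carrier G" "w \<in> carrier G" "x \<otimes> cm x w = cm x w \<otimes> x"
  shows "cm (x [^] (n::nat)) w = cm x w [^] n"
proof (induction n)
  case (Suc n)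
  have c: "x \<otimes> (cm x w [^] n) = (cm x w [^] n) \<otimes> x"
    using assms by (metis cm_closed group_commutes_pow)
  have "cm (x [^] Suc n) w = cm (x \<otimes> x [^] n) w"
    by (metis assms(1) nat_pow_Suc2)
  also have "\<dots> = x \<otimes> (cm x w [^] n) \<otimes> inv x \<otimes> cm x w"
    using assms Suc by (simp add: cm_mult_left)
  also have "\<dots> = cm x w [^] n \<otimes> cm x w"
    using assms by (simp add: c m_assoc)
  finally show ?case by simp
qed (use assms in simp)

text \<open>The images of \<open>x\<close> and \<open>y\<close> in \<open>G Mod N\<close> commute,
  so powers distribute there. The result is stated as membership in \<open>N\<close> because later
  arguments stay inside \<open>G\<close> while \<open>N\<close> varies.\<close>

lemma pow_mult_mod:
  assumes "N \<lhd> G" "x \<in> carrier G" "y \<in> carrier G" "cm x y \<in> N"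
  shows "(x \<otimes> y) [^] (n::nat) \<otimes> inv (x [^] n \<otimes> y [^] n) \<in> N"
proof -
  interpret N: normal N G by fact
  interpret Q: group "G Mod N" by (rule N.factorgroup_is_group)
  have hom: "(#>) N \<in> hom G (G Mod N)" by (rule N.r_coset_hom_Mod)
  interpret h: group_hom G "G Mod N" "(#>) N"
    using hom by unfold_locales
  note [simp del] = mult_FactGroup one_FactGroup
  have "Q.cm (N #> x) (N #> y) = \<one>\<^bsub>G Mod N\<^esub>"
    using hom_cm[OF hom Q.is_group, of x y] assms coset_eq_self_iff[OF N.subgroup_axioms]
    by (metis cm_closed one_FactGroup)
  then have c: "(N #> x) \<otimes>\<^bsub>G Mod N\<^esub> (N #> y) = (N #> y) \<otimes>\<^bsub>G Mod N\<^esub> (N #> x)"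
    using assms Q.cm_eq_one_iff by simp
  have "N #> ((x \<otimes> y) [^] n) = (N #> x [^] n \<otimes> y [^] n)"
    using assms Q.pow_mult_distrib[OF c] by (simp add: h.hom_nat_pow)
  then show ?thesis
    using assms coset_eq_iff[OF N.subgroup_axioms, of "(x \<otimes> y) [^] n" "x [^] n \<otimes> y [^] n"] by simp
qed

lemma pow_cm_mod:
  assumes "N \<lhd> G" "x \<in> carrier G" "w \<in> carrier G" "cm x (cm x w) \<in> N"
  shows "cm (x [^] (n::nat)) w \<otimes> inv (cm x w [^] n) \<in> N"
proof -
  interpret N: normal N G by fact
  interpret Q: group "G Mod N" by (rule N.factorgroup_is_group)
  have hom: "(#>) N \<in> hom G (G Mod N)" by (rule N.r_coset_hom_Mod)
  interpret h: group_hom G "G Mod N" "(#>) N"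
    using hom by unfold_locales
  note [simp del] = mult_FactGroup one_FactGroup
  note hc = hom_cm[OF hom Q.is_group]
  have "Q.cm (N #> x) (Q.cm (N #> x) (N #> w)) = \<one>\<^bsub>G Mod N\<^esub>"
    using assms coset_eq_self_iff[OF N.subgroup_axioms]
    by (metis cm_closed one_FactGroup hc)
  then have c: "(N #> x) \<otimes>\<^bsub>G Mod N\<^esub> Q.cm (N #> x) (N #> w) = Q.cm (N #> x) (N #> w) \<otimes>\<^bsub>G Mod N\<^esub> (N #> x)"
    using assms Q.cm_eq_one_iff by simp
  have "N #> (cm (x [^] n) w) = (N #> cm x w [^] n)"
    using assms Q.pow_cm_central[OF _ _ c] by (simp add: h.hom_nat_pow hc)
  then show ?thesis
    using assms coset_eq_iff[OF N.subgroup_axioms] by simp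
qed

text \<open>Only cosets \<open>Q x\<close> with \<open>x\<close> in \<open>P\<close> are counted, so
  for subgroups this is the index of the intersection of \<open>P\<close> and \<open>Q\<close> in
  \<open>P\<close>; no inclusion is built in. An infinite count gives \<open>0\<close>, which is why
  \<open>fin_idx\<close> accompanies the bounds.\<close>

definition idx :: "'a set \<Rightarrow> 'a set \<Rightarrow> nat" where
  "idx P Q = card ((\<lambda>x. Q #> x) ` P)"

definition fin_idx :: "'a set \<Rightarrow> 'a set \<Rightarrow> bool" where
  "fin_idx P Q \<longleftrightarrow> finite ((\<lambda>x. Q #> x) ` P)"

text \<open>Any function whose fibres on \<open>P\<close> are the cosets of \<open>Q\<close>
  computes the index. This replaces factor groups, and so applies to subgroups that are not
  normal.\<close>

lemma idx_kernel:
  assumes "subgroup Q G" "P \<subseteq> carrier G"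
    and "\<And>x y. x \<in> P \<Longrightarrow> y \<in> P \<Longrightarrow> x \<otimes> inv y \<in> Q \<longleftrightarrow> g x = g y"
  shows "idx P Q = card (g ` P)" "fin_idx P Q \<longleftrightarrow> finite (g ` P)"
proof -
  have "Q #> x = Q #> y \<longleftrightarrow> g x = g y" if "x \<in> P" "y \<in> P" for x y
    using coset_eq_iff[OF assms(1), of x y] assms that by blast
  from card_image_same_kernel[of P "\<lambda>x. Q #> x" g, OF this]
  show "idx P Q = card (g ` P)" "fin_idx P Q \<longleftrightarrow> finite (g ` P)"
    by (simp_all add: idx_def fin_idx_def)
qed

lemma idx_map_le:
  assumes "subgroup Q G" "P \<subseteq> carrier G" "subgroup Q' G" "P' \<subseteq> carrier G"
    and "\<And>x y. x \<in> P \<Longrightarrow> y \<in> P \<Longrightarrow> x \<otimes> inv y \<in> Q \<longleftrightarrow> h x \<otimes> inv (h y) \<in> Q'"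
    and "h ` P \<subseteq> P'" and "fin_idx P' Q'"
  shows "fin_idx P Q" "idx P Q \<le> idx P' Q'"
proof -
  have k: "x \<otimes> inv y \<in> Q \<longleftrightarrow> Q' #> h x = Q' #> h y" if "x \<in> P" "y \<in> P" for x y
    using coset_eq_iff[OF assms(3), of "h x" "h y"] assms that by blast
  have sub: "(\<lambda>x. Q' #> h x) ` P \<subseteq> (\<lambda>x. Q' #> x) ` P'"
    using assms(6) by blast
  note f = idx_kernel[OF assms(1,2), of "\<lambda>x. Q' #> h x", OF k]
  show "fin_idx P Q" "idx P Q \<le> idx P' Q'"
    using f finite_subset[OF sub] card_mono[OF _ sub] assms(7)
    by (simp_all add: fin_idx_def idx_def)
qed

text \<open>\<open>h\<close> induces a bijection between the two sets of cosets. It is not assumed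
  to be a homomorphism, so power maps qualify.\<close>

lemma idx_map_eq:
  assumes "subgroup Q G" "P \<subseteq> carrier G" "subgroup Q' G" "P' \<subseteq> carrier G"
    and "\<And>x y. x \<in> P \<Longrightarrow> y \<in> P \<Longrightarrow> x \<otimes> inv y \<in> Q \<longleftrightarrow> h x \<otimes> inv (h y) \<in> Q'"
    and "h ` P \<subseteq> P'" and "\<And>z. z \<in> P' \<Longrightarrow> \<exists>x\<in>P. z \<otimes> inv (h x) \<in> Q'"
  shows "fin_idx P Q \<longleftrightarrow> fin_idx P' Q'" "idx P Q = idx P' Q'"
proof -
  have k: "x \<otimes> inv y \<in> Q \<longleftrightarrow> Q' #> h x = Q' #> h y" if "x \<in> P" "y \<in> P" for x y
    using coset_eq_iff[OF assms(3), of "h x" "h y"] assms that by blast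
  have "(\<lambda>x. Q' #> h x) ` P = (\<lambda>x. Q' #> x) ` P'"
  proof
    show "(\<lambda>x. Q' #> h x) ` P \<subseteq> (\<lambda>x. Q' #> x) ` P'"
      using assms(6) by blast
    show "(\<lambda>x. Q' #> x) ` P' \<subseteq> (\<lambda>x. Q' #> h x) ` P"
    proof clarify
      fix z assume z: "z \<in> P'"
      then obtain x where "x \<in> P" "z \<otimes> inv (h x) \<in> Q'" using assms(7) by blast
      then show "Q' #> z \<in> (\<lambda>x. Q' #> h x) ` P"
        using coset_eq_iff[OF assms(3), of z "h x"] assms z by blast
    qed
  qed
  then show "fin_idx P Q \<longleftrightarrow> fin_idx P' Q'" "idx P Q = idx P' Q'"
    using idx_kernel[OF assms(1,2), of "\<lambda>x. Q' #> h x", OF k]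
    by (simp_all add: fin_idx_def idx_def)
qed

lemma idx_mono:
  assumes "subgroup Q G" "P \<subseteq> P'" "P' \<subseteq> carrier G" "fin_idx P' Q"
  shows "fin_idx P Q" "idx P Q \<le> idx P' Q"
  using finite_subset[OF image_mono[OF assms(2)]] card_mono[OF _ image_mono[OF assms(2)]] assms(4)
  unfolding fin_idx_def idx_def by blast+

text \<open>With a transversal \<open>t\<close> of \<open>Q\<close> in \<open>P\<close>, the pair of
  \<open>Q x\<close> and the \<open>R\<close>-coset of \<open>x\<close> times the inverse of its
  representative is a complete invariant of \<open>R x\<close>, and it takes all values in the
  product. The product formula includes infinite indices, since both sides are then
  \<open>0\<close>.\<close>

lemma idx_trans:
  assumes "subgroup P G" "subgroup Q G" "subgroup R G" "R \<subseteq> Q" "Q \<subseteq> P"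
  shows "idx P R = idx P Q * idx Q R"
    and "fin_idx P Q \<Longrightarrow> fin_idx Q R \<Longrightarrow> fin_idx P R"
    and "fin_idx P R \<Longrightarrow> fin_idx P Q"
    and "fin_idx P R \<Longrightarrow> fin_idx Q R"
proof -
  interpret P: subgroup P G by fact
  interpret Q: subgroup Q G by fact
  interpret R: subgroup R G by fact
  define t where "t = (\<lambda>c. SOME x. x \<in> P \<and> Q #> x = c)"
  have t: "t (Q #> x) \<in> P" "Q #> (t (Q #> x)) = Q #> x" if "x \<in> P" for x
  proof -
    have "t (Q #> x) \<in> P \<and> Q #> (t (Q #> x)) = Q #> x"
      unfolding t_def by (rule someI[of _ x]) (use that in simp)
    then show "t (Q #> x) \<in> P" "Q #> (t (Q #> x)) = Q #> x" by auto
  qed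
  have xt: "x \<otimes> inv (t (Q #> x)) \<in> Q" if "x \<in> P" for x
    using coset_eq_iff[OF assms(2), of x "t (Q #> x)"] t[OF that] that by simp
  define g where "g = (\<lambda>x. (Q #> x, R #> (x \<otimes> inv (t (Q #> x)))))"
  have k: "x \<otimes> inv y \<in> R \<longleftrightarrow> g x = g y" if "x \<in> P" "y \<in> P" for x y
  proof (cases "Q #> x = Q #> y")
    case True
    have "x \<otimes> inv (t (Q #> x)) \<otimes> inv (y \<otimes> inv (t (Q #> x))) = x \<otimes> inv y"
      using that t[OF that(1)] by (simp add: inv_mult_group m_assoc)
    then show ?thesis
      using True that t[OF that(1)] coset_eq_iff[OF assms(3), of "x \<otimes> inv (t (Q #> x))" "y \<otimes> inv (t (Q #> x))"]
      by (simp add: g_def)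
  next
    case False
    then have "x \<otimes> inv y \<notin> Q" using coset_eq_iff[OF assms(2)] that by simp
    then show ?thesis using False assms(4) by (auto simp: g_def)
  qed
  have im: "g ` P = (\<lambda>x. Q #> x) ` P \<times> (\<lambda>x. R #> x) ` Q"
  proof
    show "g ` P \<subseteq> (\<lambda>x. Q #> x) ` P \<times> (\<lambda>x. R #> x) ` Q"
      using xt by (auto simp: g_def)
    show "(\<lambda>x. Q #> x) ` P \<times> (\<lambda>x. R #> x) ` Q \<subseteq> g ` P"
    proof clarify
      fix x q assume x: "x \<in> P" and q: "q \<in> Q"
      let ?y = "q \<otimes> t (Q #> x)"
      have y: "?y \<in> P" using q t[OF x] assms(5) by blast
      have "Q #> ?y = Q #> t (Q #> x)"
        using coset_eq_iff[OF assms(2), of ?y "t (Q #> x)"] q t[OF x] by (simp add: m_assoc)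
      then have 1: "Q #> ?y = Q #> x" using t[OF x] by simp
      have "?y \<otimes> inv (t (Q #> x)) = q"
        using q t[OF x] by (simp add: m_assoc)
      then have "g ?y = (Q #> x, R #> q)" using 1 by (simp add: g_def)
      then show "(Q #> x, R #> q) \<in> g ` P" using y by (metis imageI)
    qed
  qed
  have ne: "(\<lambda>x. Q #> x) ` P \<noteq> {}" "(\<lambda>x. R #> x) ` Q \<noteq> {}"
    using P.one_closed Q.one_closed by blast+
  note ik = idx_kernel[OF assms(3), of P g, OF P.subset k]
  show "idx P R = idx P Q * idx Q R"
    using ik im by (simp add: idx_def card_cartesian_product)
  show "fin_idx P Q \<Longrightarrow> fin_idx Q R \<Longrightarrow> fin_idx P R"
    using ik im by (simp add: fin_idx_def)
  show "fin_idx P R \<Longrightarrow> fin_idx P Q" "fin_idx P R \<Longrightarrow> fin_idx Q R"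
    using ik im ne by (auto simp: fin_idx_def finite_cartesian_product_iff)
qed

lemma idx_pos: "subgroup P G \<Longrightarrow> fin_idx P Q \<Longrightarrow> idx P Q > 0"
  using subgroup.one_closed by (fastforce simp: idx_def fin_idx_def card_gt_0_iff)

lemma idx_one_imp_eq:
  assumes "subgroup P G" "subgroup Q G" "Q \<subseteq> P" "idx P Q = 1"
  shows "P = Q"
proof -
  obtain c where c: "(\<lambda>x. Q #> x) ` P = {c}"
    using assms(4) by (metis card_1_singletonE idx_def)
  have "x \<in> Q" if "x \<in> P" for x
  proof -
    have "Q #> x = Q #> \<one>" using c that subgroup.one_closed[OF assms(1)] by blast
    then show ?thesis
      using coset_eq_iff[OF assms(2), of x \<one>] that subgroup.mem_carrier[OF assms(1)] by simp
  qed
  then show ?thesis using assms(3) by blast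
qed

lemma idx_strict:
  assumes "subgroup P G" "subgroup Q G" "subgroup R G" "R \<subseteq> Q" "Q \<subseteq> P" "fin_idx P R" "Q \<noteq> P"
  shows "idx Q R < idx P R"
proof -
  have "idx P R = idx P Q * idx Q R" "idx Q R > 0" "idx P Q > 0"
    using idx_trans[OF assms(1-5)] assms idx_pos by auto
  moreover have "idx P Q \<noteq> 1" using assms idx_one_imp_eq by blast
  ultimately show ?thesis by (metis One_nat_def Suc_lessI n_less_m_mult_n mult.commute)
qed

text \<open>Pigeonhole: two of the powers of \<open>x\<close> with exponents from \<open>0\<close>
  to \<open>b\<close> lie in the same coset, so a power with exponent between \<open>1\<close> and
  \<open>b\<close> lies in \<open>Q\<close>, and this exponent divides \<open>b!\<close>. The
  factorial stands in for the index because \<open>Q\<close> is not assumed normal.\<close>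

lemma pow_fact_mem:
  assumes "subgroup P G" "subgroup Q G" "fin_idx P Q" "idx P Q \<le> b" "x \<in> P"
  shows "x [^] (fact b :: nat) \<in> Q"
proof -
  interpret P: subgroup P G by fact
  interpret Q: subgroup Q G by fact
  have xc: "x \<in> carrier G" using assms by simp
  have xi: "x [^] (i::nat) \<in> P" for i
    using assms(5) by (induction i) auto
  let ?f = "\<lambda>i::nat. Q #> (x [^] i)"
  have sub: "?f ` {0..b} \<subseteq> (\<lambda>x. Q #> x) ` P" using xi by auto
  have "card (?f ` {0..b}) \<le> b"
    using card_mono[OF _ sub] assms by (simp add: fin_idx_def idx_def)
  then have "\<not> inj_on ?f {0..b}"
    using card_image[of ?f "{0..b}"] by auto
  then obtain i j where ij: "i < j" "j \<le> b" "?f i = ?f j"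
    unfolding inj_on_def by (metis atLeastAtMost_iff linorder_neqE_nat)
  have "x [^] j \<otimes> inv (x [^] i) \<in> Q"
    using ij coset_eq_iff[OF assms(2)] xc by (metis nat_pow_closed)
  moreover have "x [^] j \<otimes> inv (x [^] i) = x [^] (j - i)"
    using xc ij nat_pow_mult[of x "j - i" i]
      by (metis inv_solve_right le_add_diff_inverse2 less_imp_le nat_pow_closed)
  ultimately have "x [^] (j - i) \<in> Q" by simp
  moreover have "(j - i) dvd (fact b :: nat)"
    using ij by (intro dvd_fact) auto
  then obtain k where "(fact b :: nat) = (j - i) * k" by blast
  moreover have "y [^] n \<in> Q" if "y \<in> Q" for y and n :: nat
    using that by (induction n) auto
  ultimately show ?thesis
    using xc by (metis nat_pow_pow)
qed

end

section \<open>Closed and open subgroups\<close>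

context topological_group
begin

lemma continuous_map_mult:
  assumes "continuous_map X T f" "continuous_map X T g"
  shows "continuous_map X T (\<lambda>x. f x \<otimes> g x)"
proof -
  have "continuous_map X (prod_topology T T) (\<lambda>x. (f x, g x))"
    using assms by (simp add: continuous_map_pairedI)
  from continuous_map_compose[OF this continuous_mult] show ?thesis
    by (simp add: o_def)
qed

lemma continuous_map_inv:
  "continuous_map X T f \<Longrightarrow> continuous_map X T (\<lambda>x. inv (f x))"
  using continuous_map_compose[OF _ continuous_inv] by (fastforce simp: o_def)

lemma continuous_map_const': "a \<in> carrier G \<Longrightarrow> continuous_map X T (\<lambda>x. a)"
  by (simp add: topspace_eq)

lemma continuous_map_id': "continuous_map T T (\<lambda>x. x)"
  by (rule continuous_map_id[unfolded id_def])

lemma continuous_map_pow: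
  "continuous_map X T f \<Longrightarrow> continuous_map X T (\<lambda>x. f x [^] (n::nat))"
  by (induction n) (auto intro: continuous_map_mult simp: topspace_eq)

lemma continuous_map_cm:
  "continuous_map X T f \<Longrightarrow> continuous_map X T g \<Longrightarrow> continuous_map X T (\<lambda>x. cm (f x) (g x))"
  unfolding cm_def by (intro continuous_map_mult continuous_map_inv)

lemma openin_translate:
  assumes "openin T U" "a \<in> carrier G"
  shows "openin T {x \<in> carrier G. a \<otimes> x \<in> U}" "openin T {x \<in> carrier G. x \<otimes> a \<in> U}"
  using openin_continuous_map_preimage[OF continuous_map_mult[OF continuous_map_const'[OF assms(2)]
      continuous_map_id'] assms(1)]
    openin_continuous_map_preimage[OF continuous_map_mult[OF continuous_map_id' continuous_map_const'[OF
        assms(2)]] assms(1)]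
  by (simp_all add: topspace_eq)

lemma closedin_preimage:
  assumes "continuous_map T T f" "closedin T S"
  shows "closedin T {x \<in> carrier G. f x \<in> S}"
  using closedin_continuous_map_preimage[OF assms] by (simp add: topspace_eq)

lemma closedin_subset_carrier: "closedin T S \<Longrightarrow> S \<subseteq> carrier G"
  using closedin_subset topspace_eq by auto

lemma openin_subset_carrier: "openin T S \<Longrightarrow> S \<subseteq> carrier G"
  using openin_subset topspace_eq by auto

lemma openin_carrier: "openin T (carrier G)"
  using topspace_eq by (metis openin_topspace)

lemma openin_coset:
  assumes "openin T U" "U \<subseteq> carrier G" "a \<in> carrier G"
  shows "openin T (U #> a)"
proof -
  have "U #> a = {x \<in> carrier G. x \<otimes> inv a \<in> U}"
  proof (intro equalityI subsetI)
    fix x assume "x \<in> U #> a"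
    then obtain u where "u \<in> U" "x = u \<otimes> a" by (auto simp: r_coset_def)
    then show "x \<in> {x \<in> carrier G. x \<otimes> inv a \<in> U}" using assms by (auto simp: m_assoc)
  next
    fix x assume "x \<in> {x \<in> carrier G. x \<otimes> inv a \<in> U}"
    then have "x = (x \<otimes> inv a) \<otimes> a" "x \<otimes> inv a \<in> U" using assms by (auto simp: m_assoc)
    then show "x \<in> U #> a" by (auto simp: r_coset_def)
  qed
  then show ?thesis using openin_translate(2)[OF assms(1)] assms by simp
qed

lemma closedin_coset:
  assumes "closedin T U" "a \<in> carrier G"
  shows "closedin T (U #> a)"
proof -
  have U: "U \<subseteq> carrier G" using assms closedin_subset_carrier by blast
  have "U #> a = {x \<in> carrier G. x \<otimes> inv a \<in> U}"
  proof (intro equalityI subsetI)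
    fix x assume "x \<in> U #> a"
    then obtain u where "u \<in> U" "x = u \<otimes> a" by (auto simp: r_coset_def)
    then show "x \<in> {x \<in> carrier G. x \<otimes> inv a \<in> U}" using assms U by (auto simp: m_assoc)
  next
    fix x assume "x \<in> {x \<in> carrier G. x \<otimes> inv a \<in> U}"
    then have "x = (x \<otimes> inv a) \<otimes> a" "x \<otimes> inv a \<in> U" using assms by (auto simp: m_assoc)
    then show "x \<in> U #> a" by (auto simp: r_coset_def)
  qed
  then show ?thesis
    using closedin_preimage[OF continuous_map_mult[OF continuous_map_id' continuous_map_const'] assms(1),
        of "inv a"] assms by simp
qed

lemma subgroup_openI:
  assumes "subgroup H G" "openin T U" "\<one> \<in> U" "U \<subseteq> H"
  shows "openin T H"
proof (subst openin_subopen, clarify)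
  interpret H: subgroup H G by fact
  fix h assume h: "h \<in> H"
  have "openin T (U #> h)" using assms h by (intro openin_coset) auto
  moreover have "h \<in> U #> h" using assms(3) h by (force simp: r_coset_def)
  moreover have "U #> h \<subseteq> H" using assms(4) h by (auto simp: r_coset_def)
  ultimately show "\<exists>V. openin T V \<and> h \<in> V \<and> V \<subseteq> H" by blast
qed

lemma open_subgroup_closed:
  assumes "subgroup H G" "openin T H"
  shows "closedin T H"
proof -
  interpret H: subgroup H G by fact
  have "carrier G - H = (\<Union>x\<in>carrier G - H. H #> x)"
  proof (intro equalityI subsetI)
    fix x assume "x \<in> carrier G - H"
    then show "x \<in> (\<Union>x\<in>carrier G - H. H #> x)" using rcos_self[OF _ assms(1), of x] by blast
  next
    fix y assume "y \<in> (\<Union>x\<in>carrier G - H. H #> x)"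
    then obtain x h where "x \<in> carrier G" "x \<notin> H" "h \<in> H" "y = h \<otimes> x" by (auto simp: r_coset_def)
    moreover from this have "y \<notin> H"
      by (metis H.m_closed H.m_inv_closed H.mem_carrier cancel_left(2))
    ultimately show "y \<in> carrier G - H" by simp
  qed
  moreover have "openin T (\<Union>x\<in>carrier G - H. H #> x)"
    using assms openin_coset H.subset by (intro openin_Union) auto
  ultimately show ?thesis
    using assms(2) topspace_eq H.subset by (simp add: closedin_def)
qed

text \<open>The finitely many cosets of \<open>Q\<close> by elements of \<open>P\<close> other than
  \<open>Q\<close> itself have a closed union that misses \<open>\<one>\<close>. So \<open>Q\<close>
  is relatively open in \<open>P\<close>.\<close>

lemma closed_subgroup_nbhd:
  assumes "subgroup P G" "subgroup Q G" "closedin T Q" "fin_idx P Q"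
  obtains U where "openin T U" "\<one> \<in> U" "P \<inter> U \<subseteq> Q"
proof -
  interpret P: subgroup P G by fact
  interpret Q: subgroup Q G by fact
  define S where "S = \<Union> ((\<lambda>x. Q #> x) ` P - {Q})"
  have "closedin T S"
    unfolding S_def using assms closedin_coset by (intro closedin_Union) (auto simp: fin_idx_def)
  then have "openin T (carrier G - S)" using topspace_eq by (metis openin_diff openin_topspace)
  moreover have "\<one> \<notin> S"
  proof
    assume "\<one> \<in> S"
    then obtain x where x: "x \<in> P" "Q #> x \<noteq> Q" "\<one> \<in> Q #> x" by (auto simp: S_def)
    then have "Q #> x = Q #> \<one>" using repr_independence[of \<one> Q x] Q.subgroup_axioms by simp
    then show False using x Q.subset by simp
  qed
  moreover have "P \<inter> (carrier G - S) \<subseteq> Q"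
  proof
    fix x assume x: "x \<in> P \<inter> (carrier G - S)"
    then have "x \<in> Q #> x" using rcos_self assms(2) by simp
    then have "Q #> x = Q" using x by (auto simp: S_def)
    then show "x \<in> Q" using coset_eq_self_iff[OF assms(2)] x by simp
  qed
  ultimately show ?thesis using that[of "carrier G - S"] by simp
qed

lemma rcosets_card_idx: "card (rcosets\<^bsub>G\<^esub> H) = idx (carrier G) H"
    "finite (rcosets\<^bsub>G\<^esub> H) = fin_idx (carrier G) H"
proof -
  have "rcosets\<^bsub>G\<^esub> H = (\<lambda>x. H #> x) ` carrier G" by (auto simp: RCOSETS_def)
  then show "card (rcosets\<^bsub>G\<^esub> H) = idx (carrier G) H" "finite (rcosets\<^bsub>G\<^esub> H) = fin_idx (carrier G) H"
    by (simp_all add: idx_def fin_idx_def)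
qed

end

section \<open>Compactness and open subgroups of profinite groups\<close>

context profinite_group
begin

lemma closed_imp_compact: "closedin T S \<Longrightarrow> compactin T S"
  using compact closedin_compact_space by blast

lemma compact_imp_closed: "compactin T S \<Longrightarrow> closedin T S"
  using hausdorff compactin_imp_closedin by blast

lemma closedin_image:
  assumes "continuous_map T T f" "closedin T S"
  shows "closedin T (f ` S)"
  using assms closed_imp_compact compact_imp_closed image_compactin by blast

lemma closedin_image2:
  assumes "continuous_map (prod_topology T T) T (\<lambda>(x, y). f x y)" "closedin T R" "closedin T S"
  shows "closedin T {f x y |x y. x \<in> R \<and> y \<in> S}"
proof -
  have "compactin (prod_topology T T) (R \<times> S)"
    using assms closed_imp_compact by (simp add: compactin_Times)
  from image_compactin[OF this assms(1)]
  have "closedin T ((\<lambda>(x, y). f x y) ` (R \<times> S))" by (rule compact_imp_closed)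
  moreover have "(\<lambda>(x, y). f x y) ` (R \<times> S) = {f x y |x y. x \<in> R \<and> y \<in> S}" by auto
  ultimately show ?thesis by simp
qed

lemma closedin_set_mult:
  assumes "closedin T R" "closedin T S"
  shows "closedin T (R <#> S)"
proof -
  have "R <#> S = {x \<otimes> y |x y. x \<in> R \<and> y \<in> S}" by (auto simp: set_mult_def)
  then show ?thesis using closedin_image2[OF continuous_mult assms] by simp
qed

lemma closedin_one: "closedin T {\<one>}"
  using hausdorff by (simp add: Hausdorff_imp_t1_space closedin_Hausdorff_singleton topspace_eq)

lemma open_subgroup_fin_idx:
  assumes "subgroup H G" "openin T H"
  shows "fin_idx (carrier G) H"
proof -
  interpret H: subgroup H G by fact
  let ?U = "(\<lambda>x. H #> x) ` carrier G"
  have "\<Union> ?U = topspace T"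
    unfolding topspace_eq
    using rcos_self[OF _ assms(1)] r_coset_subset_G[OF H.subset] by blast
  moreover have "openin T V" if "V \<in> ?U" for V using that assms openin_coset H.subset by auto
  ultimately obtain F where F: "finite F" "F \<subseteq> ?U" "topspace T \<subseteq> \<Union>F"
    using compact unfolding compact_space_alt by (metis order_refl)
  have "?U \<subseteq> F"
  proof clarify
    fix x assume x: "x \<in> carrier G"
    then obtain V where V: "V \<in> F" "x \<in> V" using F(3) topspace_eq by blast
    then obtain y where y: "y \<in> carrier G" "H #> y \<in> F" "x \<in> H #> y" using F(2) by blast
    then have "H #> y = H #> x" using repr_independence[OF y(3,1) assms(1)] by simp
    then show "H #> x \<in> F" using y by simp
  qed
  then show ?thesis using F finite_subset by (auto simp: fin_idx_def)
qed

text \<open>In a compact Hausdorff space components are quasi-components. Total disconnectedness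
  thus makes \<open>{\<one>}\<close> a quasi-component, which a clopen set separates from the
  compact complement of \<open>U\<close>.\<close>

lemma clopen_nbhd_one:
  assumes "openin T U" "\<one> \<in> U"
  obtains K where "openin T K" "closedin T K" "\<one> \<in> K" "K \<subseteq> U"
proof -
  have "connected_component_of_set T \<one> \<subseteq> {\<one>}"
  proof -
    obtain x where "connected_component_of_set T \<one> \<subseteq> {x}"
      using totally_disconnected[OF connectedin_connected_component_of[of T \<one>]] by metis
    moreover have "\<one> \<in> connected_component_of_set T \<one>"
      by (simp add: connected_component_of_refl topspace_eq)
    ultimately show ?thesis by auto
  qed
  then have "connected_component_of_set T \<one> = {\<one>}"
    using connected_component_of_refl[of T \<one>] topspace_eq by auto
  then have "{\<one>} \<in> connected_components_of T"
    unfolding connected_components_of_def using topspace_eq by force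
  then have q: "{\<one>} \<in> quasi_components_of T"
    using quasi_eq_connected_components_of compact hausdorff by blast
  have "closedin T (carrier G - U)" using assms topspace_eq by (metis closedin_diff closedin_topspace)
  then have "compactin T (carrier G - U)" by (rule closed_imp_compact)
  then have "separated_between T {\<one>} (carrier G - U)"
    using separated_between_quasi_component_compact[OF q] assms by simp
  then obtain K V where KV: "openin T K" "openin T V" "K \<union> V = topspace T" "disjnt K V"
    "{\<one>} \<subseteq> K" "carrier G - U \<subseteq> V" unfolding separated_between_def by blast
  then have "K = topspace T - V" using openin_subset by (auto simp: disjnt_def)
  then have "closedin T K" using KV by blast
  then show ?thesis using that[of K] KV topspace_eq by (auto simp: disjnt_def)
qed

text \<open>\<open>H\<close> is the stabiliser of a clopen \<open>K\<close> under right translation.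
  It lies in \<open>K\<close> because \<open>\<one>\<close> does, and it is open because
  \<open>K\<close> is compact and open.\<close>

lemma open_subgroup_base:
  assumes "openin T U" "\<one> \<in> U"
  obtains H where "subgroup H G" "openin T H" "H \<subseteq> U"
proof -
  obtain K where K: "openin T K" "closedin T K" "\<one> \<in> K" "K \<subseteq> U"
    using clopen_nbhd_one[OF assms] .
  have Kc: "K \<subseteq> carrier G" using K openin_subset_carrier by blast
  \<comment> \<open>\<open>B\<close> collects the elements that move some point of \<open>K\<close>
    out of \<open>K\<close>. It is the projection of a compact set of pairs, hence closed; its
    complement \<open>V\<close> consists of the \<open>g\<close> with \<open>K g\<close> inside
    \<open>K\<close>.\<close>
  define B where "B = {g \<in> carrier G. \<exists>k\<in>K. k \<otimes> g \<notin> K}"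
  define V where "V = carrier G - B"
  have "closedin T B"
  proof -
    let ?W = "{z \<in> topspace (prod_topology T T). (case z of (x, y) \<Rightarrow> x \<otimes> y) \<in> carrier G - K}"
    have "closedin T (carrier G - K)" using K topspace_eq by (metis closedin_diff closedin_topspace)
    then have "closedin (prod_topology T T) ?W"
      using continuous_mult by (intro closedin_continuous_map_preimage)
    moreover have "closedin (prod_topology T T) (K \<times> topspace T)"
      using K by (simp add: closedin_prod_Times_iff)
    ultimately have "closedin (prod_topology T T) (?W \<inter> (K \<times> topspace T))" by blast
    moreover have "compact_space (prod_topology T T)"
      using compact by (simp add: compact_space_prod_topology)
    ultimately have "compactin (prod_topology T T) (?W \<inter> (K \<times> topspace T))"
      by (rule closedin_compact_space[rotated])
    then have "compactin T (snd ` (?W \<inter> (K \<times> topspace T)))"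
      using continuous_map_snd by (rule image_compactin)
    moreover have "snd ` (?W \<inter> (K \<times> topspace T)) = B"
      unfolding B_def using Kc by (force simp: topspace_eq)
    ultimately show ?thesis using compact_imp_closed by simp
  qed
  then have V: "openin T V" unfolding V_def using topspace_eq by (metis openin_diff openin_topspace)
  define V' where "V' = V \<inter> {x \<in> carrier G. inv x \<in> V}"
  have V': "openin T V'"
    unfolding V'_def using openin_continuous_map_preimage[OF continuous_inv V] V
    by (simp add: topspace_eq openin_Int)
  have V1: "\<one> \<in> V'" using Kc by (auto simp: V'_def V_def B_def)
  have VK: "k \<otimes> v \<in> K" if "k \<in> K" "v \<in> V" for k v using that by (auto simp: V_def B_def)
  define H where "H = {g \<in> carrier G. \<forall>k\<in>carrier G. k \<in> K \<longleftrightarrow> k \<otimes> g \<in> K}"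
  have H: "subgroup H G"
  proof (rule subgroupI)
    show "H \<subseteq> carrier G" by (auto simp: H_def)
    show "H \<noteq> {}" by (auto simp: H_def intro: exI[of _ \<one>])
    show "inv a \<in> H" if "a \<in> H" for a
    proof -
      have "k \<in> K \<longleftrightarrow> k \<otimes> inv a \<in> K" if k: "k \<in> carrier G" for k
      proof -
        have a: "a \<in> carrier G" "\<And>k. k \<in> carrier G \<Longrightarrow> k \<in> K \<longleftrightarrow> k \<otimes> a \<in> K"
          using \<open>a \<in> H\<close> by (auto simp: H_def)
        show ?thesis using a(2)[of "k \<otimes> inv a"] a(1) k by (simp add: m_assoc)
      qed
      moreover have "a \<in> carrier G" using that unfolding H_def by blast
      ultimately show ?thesis unfolding H_def by (intro CollectI conjI ballI inv_closed)
    qed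
    show "a \<otimes> b \<in> H" if "a \<in> H" "b \<in> H" for a b
    proof -
      have "k \<in> K \<longleftrightarrow> k \<otimes> (a \<otimes> b) \<in> K" if k: "k \<in> carrier G" for k
      proof -
        have ab: "a \<in> carrier G" "\<And>k. k \<in> carrier G \<Longrightarrow> k \<in> K \<longleftrightarrow> k \<otimes> a \<in> K"
          "b \<in> carrier G" "\<And>k. k \<in> carrier G \<Longrightarrow> k \<in> K \<longleftrightarrow> k \<otimes> b \<in> K"
          using \<open>a \<in> H\<close> \<open>b \<in> H\<close> unfolding H_def by blast+
        show ?thesis using ab(2)[OF k] ab(4)[of "k \<otimes> a"] ab(1,3) k by (simp add: m_assoc)
      qed
      moreover have "a \<in> carrier G" "b \<in> carrier G" using that unfolding H_def by blast+
      ultimately show ?thesis unfolding H_def by (intro CollectI conjI ballI m_closed)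
    qed
  qed
  have "V' \<subseteq> H"
  proof
    fix g assume g: "g \<in> V'"
    then have gc: "g \<in> carrier G" by (simp add: V'_def)
    have "k \<in> K \<longleftrightarrow> k \<otimes> g \<in> K" if k: "k \<in> carrier G" for k
    proof
      show "k \<in> K \<Longrightarrow> k \<otimes> g \<in> K" using VK g by (simp add: V'_def)
      assume "k \<otimes> g \<in> K"
      then have "k \<otimes> g \<otimes> inv g \<in> K" using VK[of "k \<otimes> g" "inv g"] g by (simp add: V'_def)
      then show "k \<in> K" using k gc by (simp add: m_assoc)
    qed
    then show "g \<in> H" using gc by (simp add: H_def)
  qed
  then have "openin T H" using subgroup_openI[OF H V' V1] by blast
  moreover have "H \<subseteq> U"
  proof
    fix h assume "h \<in> H"
    then have "\<one> \<otimes> h \<in> K" "h \<in> carrier G" using K(3) unfolding H_def by blast+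
    then show "h \<in> U" using K(4) by auto
  qed
  ultimately show ?thesis using that H by blast
qed

end

section \<open>Pure subgroups\<close>

context group
begin

lemma subgroup_set_mult:
  assumes "subgroup A G" "B \<lhd> G"
  shows "subgroup (A <#> B) G"
proof -
  interpret A: subgroup A G by fact
  interpret B: normal B G by fact
  show ?thesis
  proof (rule subgroupI)
    show "A <#> B \<subseteq> carrier G" by (auto simp: set_mult_def)
    show "A <#> B \<noteq> {}" unfolding set_mult_def using A.one_closed B.one_closed by blast
    fix x assume "x \<in> A <#> B"
    then obtain a b where ab: "a \<in> A" "b \<in> B" "x = a \<otimes> b" by (auto simp: set_mult_def)
    have "inv x = inv a \<otimes> (a \<otimes> inv b \<otimes> inv a)"
      using ab by (simp add: inv_mult_group m_assoc)
    then show "inv x \<in> A <#> B"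
      using ab B.inv_op_closed2[of a "inv b"] by (auto simp: set_mult_def)
    fix y assume "y \<in> A <#> B"
    then obtain c d where cd: "c \<in> A" "d \<in> B" "y = c \<otimes> d" by (auto simp: set_mult_def)
    have "x \<otimes> y = (a \<otimes> c) \<otimes> ((inv c \<otimes> b \<otimes> c) \<otimes> d)"
      using ab cd by (simp add: m_assoc)
    moreover have "inv c \<otimes> b \<otimes> c \<in> B"
      using ab cd B.inv_op_closed1 by simp
    ultimately show "x \<otimes> y \<in> A <#> B"
      using ab cd by (auto simp: set_mult_def)
  qed
qed

lemma normal_set_mult:
  assumes "A \<lhd> G" "B \<lhd> G"
  shows "A <#> B \<lhd> G"
proof (rule normalI')
  interpret A: normal A G by fact
  interpret B: normal B G by fact
  show "subgroup (A <#> B) G"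
    using assms subgroup_set_mult A.subgroup_axioms by blast
  fix x g assume "x \<in> A <#> B" and g: "g \<in> carrier G"
  then obtain a b where ab: "a \<in> A" "b \<in> B" "x = a \<otimes> b" by (auto simp: set_mult_def)
  have "g \<otimes> x \<otimes> inv g = (g \<otimes> a \<otimes> inv g) \<otimes> (g \<otimes> b \<otimes> inv g)"
    using ab g by (simp add: m_assoc)
  then show "g \<otimes> x \<otimes> inv g \<in> A <#> B"
    using A.inv_op_closed2[OF g ab(1)] B.inv_op_closed2[OF g ab(2)] by (auto simp: set_mult_def)
qed

lemma set_mult_supset:
  assumes "subgroup A G" "subgroup B G"
  shows "A \<subseteq> A <#> B" "B \<subseteq> A <#> B"
proof -
  interpret A: subgroup A G by fact
  interpret B: subgroup B G by fact
  show "A \<subseteq> A <#> B"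
  proof
    fix x assume "x \<in> A" then have "x = x \<otimes> \<one>" "\<one> \<in> B" by auto
    then show "x \<in> A <#> B" using \<open>x \<in> A\<close> unfolding set_mult_def by blast
  qed
  show "B \<subseteq> A <#> B"
  proof
    fix x assume "x \<in> B" then have "x = \<one> \<otimes> x" "\<one> \<in> A" by auto
    then show "x \<in> A <#> B" using \<open>x \<in> B\<close> unfolding set_mult_def by blast
  qed
qed

lemma set_mult_subset:
  assumes "subgroup H G" "A \<subseteq> H" "B \<subseteq> H"
  shows "A <#> B \<subseteq> H"
  using assms subgroup.m_closed by (fastforce simp: set_mult_def)

lemma normal_conj:
  "N \<lhd> G \<Longrightarrow> x \<in> N \<Longrightarrow> g \<in> carrier G \<Longrightarrow> g \<otimes> x \<otimes> inv g \<in> N"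
  by (rule normal.inv_op_closed2)

lemma subgroup_pow: "subgroup H G \<Longrightarrow> x \<in> H \<Longrightarrow> x [^] (n::nat) \<in> H"
  by (induction n) (auto simp: subgroup.one_closed subgroup.m_closed)

lemma subgroup_cm: "subgroup H G \<Longrightarrow> x \<in> H \<Longrightarrow> y \<in> H \<Longrightarrow> cm x y \<in> H"
  unfolding cm_def by (intro subgroup.m_closed subgroup.m_inv_closed)

text \<open>The second isomorphism theorem as an equality of indices: \<open>N\<close> meets every
  coset of \<open>Q\<close> in \<open>Q <#> N\<close>.\<close>

lemma idx_same_add:
  assumes "subgroup Q G" "subgroup P G" "N \<lhd> G"
  shows "idx (Q <#> N) Q = idx N (N \<inter> Q)" "fin_idx (Q <#> N) Q \<longleftrightarrow> fin_idx N (N \<inter> Q)"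
proof -
  interpret Q: subgroup Q G by fact
  interpret N: normal N G by fact
  have NQ: "subgroup (N \<inter> Q) G" using N.subgroup_axioms assms(1) subgroups_Inter_pair by blast
  have 1: "x \<otimes> inv y \<in> N \<inter> Q \<longleftrightarrow> x \<otimes> inv y \<in> Q" if "x \<in> N" "y \<in> N" for x y
    using that by auto
  have 2: "N \<subseteq> Q <#> N" using set_mult_supset assms N.subgroup_axioms by blast
  have 3: "\<exists>x\<in>N. z \<otimes> inv x \<in> Q" if z: "z \<in> Q <#> N" for z
  proof -
    obtain q n where "q \<in> Q" "n \<in> N" "z = q \<otimes> n" using z by (auto simp: set_mult_def)
    then have "z \<otimes> inv n = q" by (simp add: m_assoc)
    then show ?thesis using \<open>q \<in> Q\<close> \<open>n \<in> N\<close> by blast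
  qed
  have 4: "Q <#> N \<subseteq> carrier G" by (auto simp: set_mult_def)
  show "idx (Q <#> N) Q = idx N (N \<inter> Q)" "fin_idx (Q <#> N) Q \<longleftrightarrow> fin_idx N (N \<inter> Q)"
    using idx_map_eq[OF NQ N.subset assms(1) 4, of "\<lambda>x. x"] 1 2 3 by simp_all
qed

end

text \<open>What remains of type (F) and of the definition of \<open>Con\<close>; it is later
  instantiated with \<open>core\<close> for \<open>I\<close> and \<open>Con G T \<phi>\<close> for
  \<open>C\<close>. \<open>C_contr\<close> says that \<phi> contracts uniformly on \<open>C\<close>,
  and \<open>phi_C_open\<close> that \<open>\<phi> C\<close> is relatively open in \<open>C\<close>.
  The bound \<open>b\<close> in \<open>I_centralizes\<close> may exceed the index, so that one
  \<open>I b\<close> serves many sections.\<close>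

locale contraction = profinite_group G T for G (structure) and T +
  fixes \<phi> :: "'a \<Rightarrow> 'a" and I :: "nat \<Rightarrow> 'a set" and C :: "'a set"
  assumes phi_hom: "\<phi> \<in> hom G G"
    and phi_inj: "inj_on \<phi> (carrier G)"
    and phi_cont: "continuous_map T T \<phi>"
    and I_normal: "I n \<lhd> G"
    and I_open: "openin T (I n)"
    and I_anti: "n \<le> n' \<Longrightarrow> I n' \<subseteq> I n"
    and I_phi: "x \<in> I n \<Longrightarrow> \<phi> x \<in> I n"
    and I_base: "openin T U \<Longrightarrow> \<one> \<in> U \<Longrightarrow> \<exists>n. I n \<subseteq> U"
    and C_normal: "C \<lhd> G"
    and C_closed: "closedin T C"
    and C_phi: "x \<in> C \<Longrightarrow> \<phi> x \<in> C"
    and C_contr: "\<exists>k. \<forall>x\<in>C. (\<phi> ^^ k) x \<in> I n"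
    and phi_C_open: "\<exists>n. C \<inter> I n \<subseteq> \<phi> ` C"
    and I_centralizes: "A \<lhd> G \<Longrightarrow> B \<lhd> G \<Longrightarrow> closedin T B \<Longrightarrow> B \<subseteq> A \<Longrightarrow> fin_idx A B \<Longrightarrow> idx A B \<le> b
      \<Longrightarrow> a \<in> A \<Longrightarrow> g \<in> I b \<Longrightarrow> cm a g \<in> B"
begin

lemma phi_closed [simp, intro]: "x \<in> carrier G \<Longrightarrow> \<phi> x \<in> carrier G"
  using phi_hom by (rule hom_in_carrier)

lemma phi_mult [simp]: "x \<in> carrier G \<Longrightarrow> y \<in> carrier G \<Longrightarrow> \<phi> (x \<otimes> y) = \<phi> x \<otimes> \<phi> y"
  using phi_hom hom_mult by metis

sublocale phi: group_hom G G \<phi>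
  using phi_hom by unfold_locales

lemma phi_inv [simp]: "x \<in> carrier G \<Longrightarrow> \<phi> (inv x) = inv (\<phi> x)"
  by simp

lemma phi_eq [simp]: "x \<in> carrier G \<Longrightarrow> y \<in> carrier G \<Longrightarrow> \<phi> x = \<phi> y \<longleftrightarrow> x = y"
  using phi_inj by (auto dest: inj_onD)

lemma phi_pow [simp]: "x \<in> carrier G \<Longrightarrow> \<phi> (x [^] (n::nat)) = \<phi> x [^] n"
  by (rule phi.hom_nat_pow)

lemma phi_cm [simp]: "x \<in> carrier G \<Longrightarrow> y \<in> carrier G \<Longrightarrow> \<phi> (cm x y) = cm (\<phi> x) (\<phi> y)"
  by (simp add: cm_def)

lemma phik_closed [simp, intro]: "x \<in> carrier G \<Longrightarrow> (\<phi> ^^ k) x \<in> carrier G"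
  by (induction k) auto

lemma phik_mult [simp]: "x \<in> carrier G \<Longrightarrow> y \<in> carrier G \<Longrightarrow> (\<phi> ^^ k) (x \<otimes> y) = (\<phi> ^^ k) x \<otimes> (\<phi> ^^ k) y"
  by (induction k) auto

lemma phik_hom: "(\<phi> ^^ k) \<in> hom G G"
  by (simp add: hom_def)

lemma phik_group_hom: "group_hom G G (\<phi> ^^ k)"
  using phik_hom by unfold_locales

lemma phik_one [simp]: "(\<phi> ^^ k) \<one> = \<one>"
  by (induction k) auto

lemma phik_inv [simp]: "x \<in> carrier G \<Longrightarrow> (\<phi> ^^ k) (inv x) = inv ((\<phi> ^^ k) x)"
  by (induction k) auto

lemma phik_eq [simp]: "x \<in> carrier G \<Longrightarrow> y \<in> carrier G \<Longrightarrow> (\<phi> ^^ k) x = (\<phi> ^^ k) y \<longleftrightarrow> x = y"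
  by (induction k) auto

lemma phik_pow [simp]: "x \<in> carrier G \<Longrightarrow> (\<phi> ^^ k) (x [^] (n::nat)) = (\<phi> ^^ k) x [^] n"
  by (induction k) auto

lemma phik_cm [simp]: "x \<in> carrier G \<Longrightarrow> y \<in> carrier G \<Longrightarrow> (\<phi> ^^ k) (cm x y) = cm ((\<phi> ^^ k) x) ((\<phi> ^^ k) y)"
  by (induction k) auto

lemma phik_cont: "continuous_map T T (\<phi> ^^ k)"
proof (induction k)
  case (Suc k)
  then show ?case using continuous_map_compose[OF Suc phi_cont] by (simp add: o_def)
qed (simp add: id_def)

lemma phik_add: "(\<phi> ^^ (j + k)) x = (\<phi> ^^ j) ((\<phi> ^^ k) x)"
  by (simp add: funpow_add)

lemma subgroup_phi_image: "subgroup P G \<Longrightarrow> subgroup (\<phi> ` P) G"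
  by (rule phi.subgroup_img_is_subgroup)

lemma subgroup_phik_image: "subgroup P G \<Longrightarrow> subgroup ((\<phi> ^^ k) ` P) G"
  using phik_group_hom group_hom.subgroup_img_is_subgroup by metis

lemma I_subgroup: "subgroup (I n) G"
  using I_normal normal_imp_subgroup by blast

lemma C_subgroup: "subgroup C G"
  using C_normal normal_imp_subgroup by blast

lemma C_carrier [simp]: "x \<in> C \<Longrightarrow> x \<in> carrier G"
  using C_subgroup subgroup.mem_carrier by metis

lemma C_phik: "x \<in> C \<Longrightarrow> (\<phi> ^^ k) x \<in> C"
  by (induction k) (auto intro: C_phi)

lemma closed_mem:
  assumes "closedin T P" "x \<in> carrier G" "\<And>n. \<exists>y\<in>I n. x \<otimes> y \<in> P"
  shows "x \<in> P"
proof (rule ccontr)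
  assume "x \<notin> P"
  have "openin T (carrier G - P)" using assms(1) topspace_eq by (metis openin_diff openin_topspace)
  from openin_translate(1)[OF this assms(2)]
  have "openin T {y \<in> carrier G. x \<otimes> y \<in> carrier G - P}" .
  moreover have "\<one> \<in> {y \<in> carrier G. x \<otimes> y \<in> carrier G - P}"
    using \<open>x \<notin> P\<close> assms(2) by simp
  ultimately obtain n where "I n \<subseteq> {y \<in> carrier G. x \<otimes> y \<in> carrier G - P}"
    using I_base by blast
  then show False using assms(3)[of n] by blast
qed

text \<open>Uniform contraction puts \<open>(\<phi> ^^ k) c\<close> into any prescribed
  \<open>I n\<close>, so \<open>x\<close> is a limit of elements of the closed set.\<close>

lemma closed_mem_contr:
  assumes "closedin T P" "x \<in> carrier G" "\<And>k. \<exists>c\<in>C. x \<otimes> (\<phi> ^^ k) c \<in> P"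
  shows "x \<in> P"
proof (rule closed_mem[OF assms(1,2)])
  fix n
  obtain k where "\<forall>x\<in>C. (\<phi> ^^ k) x \<in> I n" using C_contr by blast
  then show "\<exists>y\<in>I n. x \<otimes> y \<in> P" using assms(3)[of k] by blast
qed

lemma I_inter_one:
  assumes "x \<in> carrier G" "\<And>n. x \<in> I n"
  shows "x = \<one>"
proof -
  have "\<exists>y\<in>I n. x \<otimes> y \<in> {\<one>}" for n
    using assms I_subgroup[of n] subgroup.m_inv_closed[of "I n" G x] by (intro bexI[of _ "inv x"]) auto
  then show ?thesis using closed_mem[OF closedin_one assms(1)] by blast
qed

lemma fin_idx_I:
  assumes "subgroup P G"
  shows "fin_idx P (P \<inter> I n)"
proof -
  interpret P: subgroup P G by fact
  interpret N: subgroup "I n" G by (rule I_subgroup)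
  have "subgroup (P \<inter> I n) G" by (intro subgroups_Inter_pair assms I_subgroup)
  then show ?thesis
    using idx_map_le(1)[of "P \<inter> I n" P "I n" "carrier G" "\<lambda>x. x"] I_subgroup
      open_subgroup_fin_idx[OF I_subgroup I_open] P.subset
    by (auto simp: subset_iff)
qed

lemma closed_subgroup_I:
  assumes "subgroup P G" "subgroup Q G" "closedin T Q" "fin_idx P Q"
  obtains n where "P \<inter> I n \<subseteq> Q"
proof -
  obtain U where U: "openin T U" "\<one> \<in> U" "P \<inter> U \<subseteq> Q"
    using closed_subgroup_nbhd[OF assms] .
  obtain n where "I n \<subseteq> U" using I_base U by blast
  then show ?thesis using U that[of n] by blast
qed

definition good :: "'a set \<Rightarrow> bool" where
  "good L \<longleftrightarrow> L \<lhd> G \<and> closedin T L \<and> L \<subseteq> C \<and> (\<forall>x\<in>L. \<phi> x \<in> L)"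

definition pure :: "'a set \<Rightarrow> bool" where
  "pure P \<longleftrightarrow> good P \<and> (\<forall>x\<in>C. \<phi> x \<in> P \<longrightarrow> x \<in> P)"

lemma goodD:
  assumes "good L"
  shows "L \<lhd> G" "subgroup L G" "closedin T L" "L \<subseteq> C" "\<And>x. x \<in> L \<Longrightarrow> \<phi> x \<in> L"
    "\<And>x k. x \<in> L \<Longrightarrow> (\<phi> ^^ k) x \<in> L" "L \<subseteq> carrier G"
proof -
  show "L \<lhd> G" "subgroup L G" "closedin T L" "L \<subseteq> C" and 1: "\<And>x. x \<in> L \<Longrightarrow> \<phi> x \<in> L"
    using assms normal_imp_subgroup by (auto simp: good_def)
  show "(\<phi> ^^ k) x \<in> L" if "x \<in> L" for x k using that by (induction k) (auto intro: 1)
  show "L \<subseteq> carrier G" using \<open>L \<subseteq> C\<close> by auto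
qed

lemma pure_good: "pure P \<Longrightarrow> good P"
  by (simp add: pure_def)

lemmas pureD = goodD[OF pure_good]

lemma pure_phi: "pure P \<Longrightarrow> x \<in> C \<Longrightarrow> \<phi> x \<in> P \<longleftrightarrow> x \<in> P"
  using pureD(5)[of P x] unfolding pure_def by blast

lemma pure_phik: "pure P \<Longrightarrow> x \<in> C \<Longrightarrow> (\<phi> ^^ k) x \<in> P \<longleftrightarrow> x \<in> P"
  by (induction k) (auto simp: pure_phi C_phik)

lemma good_Int: "good A \<Longrightarrow> good B \<Longrightarrow> good (A \<inter> B)"
  using normal_subgroup_intersect[of A B] by (auto simp: good_def)

lemma good_set_mult:
  assumes A: "good A" and B: "good B"
  shows "good (A <#> B)"
  unfolding good_def
proof (intro conjI ballI)
  show "A <#> B \<lhd> G" "closedin T (A <#> B)" "A <#> B \<subseteq> C"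
    using goodD[OF A] goodD[OF B] normal_set_mult closedin_set_mult set_mult_subset C_subgroup by auto
  fix x assume "x \<in> A <#> B"
  then obtain a b where ab: "a \<in> A" "b \<in> B" "x = a \<otimes> b" by (auto simp: set_mult_def)
  then have "\<phi> x = \<phi> a \<otimes> \<phi> b" using goodD(7)[OF A] goodD(7)[OF B] by (simp add: subset_iff)
  then show "\<phi> x \<in> A <#> B" using goodD(5)[OF A ab(1)] goodD(5)[OF B ab(2)] by (auto simp: set_mult_def)
qed

lemma good_C: "good C"
  by (simp add: good_def C_normal C_closed C_phi)

lemma pure_C: "pure C"
  by (simp add: pure_def good_C)

lemma good_CI: "good (C \<inter> I n)"
  using normal_subgroup_intersect[OF C_normal I_normal] C_closed open_subgroup_closed[OF I_subgroup I_open]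
  by (auto simp: good_def C_phi I_phi)

lemma good_HI: "good H \<Longrightarrow> good (H \<inter> I n)"
  using good_Int[OF _ good_CI, of H n] goodD(4)[of H] by (simp add: Int_assoc[symmetric] inf_absorb1)

lemma pure_one: "pure {\<one>}"
  unfolding pure_def good_def
  using one_is_normal closedin_one subgroup.one_closed[OF C_subgroup] phi_eq[of _ \<one>] by auto

lemma normal_phik_preimage:
  assumes "N \<lhd> G" "M \<lhd> G"
  shows "{x \<in> M. (\<phi> ^^ k) x \<in> N} \<lhd> G"
proof (rule normalI')
  interpret N: normal N G by fact
  interpret M: normal M G by fact
  show "subgroup {x \<in> M. (\<phi> ^^ k) x \<in> N} G"
    by (rule subgroupI) (auto intro: exI[of _ \<one>])
  show "g \<otimes> x \<otimes> inv g \<in> {x \<in> M. (\<phi> ^^ k) x \<in> N}" if "x \<in> {x \<in> M. (\<phi> ^^ k) x \<in> N}" "g \<in> carrier G" for x g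
    using that M.inv_op_closed2 N.inv_op_closed2 M.mem_carrier by simp
qed

lemma closedin_phik_preimage:
  assumes "closedin T N" "closedin T M"
  shows "closedin T {x \<in> M. (\<phi> ^^ k) x \<in> N}"
proof -
  have "{x \<in> M. (\<phi> ^^ k) x \<in> N} = M \<inter> {x \<in> carrier G. (\<phi> ^^ k) x \<in> N}"
    using closedin_subset_carrier[OF assms(2)] by auto
  then show ?thesis using closedin_preimage[OF phik_cont assms(1)] assms by auto
qed

lemma good_preimage:
  assumes L: "good L"
  shows "good {x \<in> C. (\<phi> ^^ k) x \<in> L}"
  unfolding good_def
  using normal_phik_preimage[OF goodD(1)[OF L] C_normal] closedin_phik_preimage[OF goodD(3)[OF L] C_closed]
    goodD(5)[OF L] C_phi by (auto simp: funpow_swap1[symmetric])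

section \<open>Indices of \<phi>-images and the chain condition\<close>

lemma idx_phi:
  assumes "subgroup Q G" "P \<subseteq> carrier G"
  shows "idx (\<phi> ` P) (\<phi> ` Q) = idx P Q" "fin_idx (\<phi> ` P) (\<phi> ` Q) \<longleftrightarrow> fin_idx P Q"
proof -
  interpret Q: subgroup Q G by fact
  have 1: "x \<otimes> inv y \<in> Q \<longleftrightarrow> \<phi> x \<otimes> inv (\<phi> y) \<in> \<phi> ` Q" if "x \<in> P" "y \<in> P" for x y
  proof -
    have c: "x \<in> carrier G" "y \<in> carrier G" using that assms by auto
    then have "\<phi> x \<otimes> inv (\<phi> y) = \<phi> (x \<otimes> inv y)" by simp
    then show ?thesis using c phi_eq[of "x \<otimes> inv y"] by (auto simp: image_iff)
  qed
  have 2: "\<exists>x\<in>P. z \<otimes> inv (\<phi> x) \<in> \<phi> ` Q" if "z \<in> \<phi> ` P" for z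
    using that assms Q.one_closed image_eqI[of \<one> \<phi> \<one> Q] by (auto simp: subset_iff intro!: bexI)
  have pc: "\<phi> ` P \<subseteq> carrier G" using assms by auto
  show "idx (\<phi> ` P) (\<phi> ` Q) = idx P Q" "fin_idx (\<phi> ` P) (\<phi> ` Q) \<longleftrightarrow> fin_idx P Q"
    using idx_map_eq[OF assms subgroup_phi_image[OF assms(1)] pc 1 order_refl 2] by simp_all
qed

text \<open>The global constant of the proof: it bounds the index of \<open>\<phi> L\<close> in
  \<open>L\<close> for every good \<open>L\<close>, hence the orders of filtration factors, and its
  prime divisors index the uniform factors of the final product.\<close>

definition m :: nat where "m = idx C (\<phi> ` C)"

lemma phi_C: "\<phi> ` C \<subseteq> C" using C_phi by blast

lemma fin_phi_C: "fin_idx C (\<phi> ` C)"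
proof -
  obtain n where n: "C \<inter> I n \<subseteq> \<phi> ` C" using phi_C_open by blast
  have "fin_idx C (C \<inter> I n)" using fin_idx_I[OF C_subgroup] .
  then show ?thesis
    using idx_trans(3)[OF C_subgroup subgroup_phi_image[OF C_subgroup] goodD(2)[OF good_CI] n phi_C] by blast
qed

lemma m_pos: "m > 0"
  unfolding m_def using idx_pos[OF C_subgroup fin_phi_C] .

text \<open>The index of \<open>\<phi> S\<close> in \<open>P\<close> is computed through
  \<open>S\<close> and through \<open>\<phi> P\<close>. By injectivity the index of
  \<open>\<phi> S\<close> in \<open>\<phi> P\<close> is that of \<open>S\<close> in
  \<open>P\<close>, and it cancels.\<close>

lemma idx_phi_commensurable:
  assumes P: "subgroup P G" "\<phi> ` P \<subseteq> P" "fin_idx P (\<phi> ` P)"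
    and S: "subgroup S G" "\<phi> ` S \<subseteq> S" "S \<subseteq> P" "fin_idx P S"
  shows "idx S (\<phi> ` S) = idx P (\<phi> ` P)" "fin_idx S (\<phi> ` S)"
proof -
  note sub = subgroup_phi_image[OF P(1)] subgroup_phi_image[OF S(1)]
  have im: "\<phi> ` S \<subseteq> \<phi> ` P" using S by blast
  note t1 = idx_trans[OF P(1) S(1) sub(2) S(2,3)]
  note t2 = idx_trans[OF P(1) sub(1) sub(2) im P(2)]
  have e: "idx (\<phi> ` P) (\<phi> ` S) = idx P S" "fin_idx (\<phi> ` P) (\<phi> ` S)"
    using idx_phi[OF S(1) subgroup.subset[OF P(1)]] S by auto
  have "idx P S > 0" using idx_pos P S by blast
  then show "idx S (\<phi> ` S) = idx P (\<phi> ` P)" using t1(1) t2(1) e by simp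
  show "fin_idx S (\<phi> ` S)" using t1 t2 P e by blast
qed

text \<open>A good \<open>L\<close> may have infinite index in \<open>C\<close>, so it is thickened
  to \<open>Ln n\<close>, which has finite index and therefore index exactly \<open>m\<close> over
  its \<phi>-image. The subgroups \<open>\<phi> (Ln n)\<close> intersect in \<open>\<phi> L\<close>,
  so finitely many distinct cosets of \<open>\<phi> L\<close> in \<open>L\<close> stay distinct
  modulo one of them.\<close>

lemma idx_good:
  assumes L: "good L"
  shows "fin_idx L (\<phi> ` L)" "idx L (\<phi> ` L) \<le> m"
proof -
  note Ls = goodD(2)[OF L]
  interpret L: subgroup L G by (rule Ls)
  define Ln where "Ln = (\<lambda>n. L <#> (C \<inter> I n))"
  have Lng: "good (Ln n)" for n unfolding Ln_def using good_set_mult[OF L good_CI] .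
  have CILn: "C \<inter> I n \<subseteq> Ln n" for n
    unfolding Ln_def using set_mult_supset(2)[OF Ls goodD(2)[OF good_CI]] .
  have LLn: "L \<subseteq> Ln n" for n
    unfolding Ln_def using set_mult_supset(1)[OF Ls goodD(2)[OF good_CI]] .
  have fLn: "fin_idx C (Ln n)" for n
    using idx_trans(3)[OF C_subgroup goodD(2)[OF Lng] goodD(2)[OF good_CI] CILn goodD(4)[OF Lng]]
      fin_idx_I[OF C_subgroup] by blast
  have iLn: "idx (Ln n) (\<phi> ` Ln n) = m" "fin_idx (Ln n) (\<phi> ` Ln n)" for n
    unfolding m_def
    using idx_phi_commensurable[OF C_subgroup phi_C fin_phi_C goodD(2)[OF Lng] _ goodD(4)[OF Lng] fLn]
      goodD(5)[OF Lng] by auto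
  have sphi: "subgroup (\<phi> ` L) G" using subgroup_phi_image[OF Ls] .
  have anti: "Ln n' \<subseteq> Ln n" if "n \<le> n'" for n n'
    unfolding Ln_def using I_anti[OF that] by (intro mono_set_mult) auto
  have sep: "\<exists>n. z \<notin> \<phi> ` Ln n" if z: "z \<in> carrier G" "z \<notin> \<phi> ` L" for z
  proof (rule ccontr)
    assume "\<not> ?thesis"
    then have a: "z \<in> \<phi> ` Ln n" for n by blast
    then obtain x where x: "x \<in> Ln 0" "z = \<phi> x" by blast
    have xc: "x \<in> carrier G" using x goodD(7)[OF Lng] by blast
    have xn: "x \<in> Ln n" for n
    proof -
      obtain y where "y \<in> Ln n" "z = \<phi> y" using a by blast
      then show ?thesis using x xc goodD(7)[OF Lng] by (metis phi_eq subsetD)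
    qed
    have "x \<in> L"
    proof (rule closed_mem[OF goodD(3)[OF L] xc])
      fix n
      interpret In: subgroup "I n" G by (rule I_subgroup)
      obtain l i where "l \<in> L" "i \<in> I n" "x = l \<otimes> i" using xn[of n] by (auto simp: Ln_def set_mult_def)
      then have "x \<otimes> inv i = l" "inv i \<in> I n" by (auto simp: m_assoc)
      then show "\<exists>y\<in>I n. x \<otimes> y \<in> L" using \<open>l \<in> L\<close> by blast
    qed
    then show False using x z by blast
  qed
  define cs where "cs = (\<lambda>x. \<phi> ` L #> x)"
  have "finite (cs ` L) \<and> card (cs ` L) \<le> m"
  proof (rule finite_if_finite_subsets_card_bdd)
    fix F assume F: "F \<subseteq> cs ` L" "finite F"
    then obtain S where S: "S \<subseteq> L" "finite S" "inj_on cs S" "F = cs ` S"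
      by (metis subset_image_inj finite_image_iff)
    \<comment> \<open>A single \<open>n\<close> has to separate all quotients of elements of the
      finite set \<open>S\<close>; a maximum works because \<open>Ln\<close> is decreasing.\<close>
    have "\<exists>n. \<forall>z\<in>{x \<otimes> inv y |x y. x \<in> S \<and> y \<in> S} - \<phi> ` L. z \<notin> \<phi> ` Ln n"
    proof -
      let ?Z = "{x \<otimes> inv y |x y. x \<in> S \<and> y \<in> S} - \<phi> ` L"
      have "finite ((\<lambda>(x, y). x \<otimes> inv y) ` (S \<times> S))" using S(2) by simp
      then have fin: "finite ?Z" by (rule rev_finite_subset) auto
      have "\<forall>z\<in>?Z. \<exists>n. z \<notin> \<phi> ` Ln n"
      proof
        fix z assume z: "z \<in> ?Z"
        then have "z \<in> carrier G" using S(1) L.subset by (auto intro!: m_closed inv_closed dest: subsetD)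
        then show "\<exists>n. z \<notin> \<phi> ` Ln n" using sep z by blast
      qed
      from bchoice[OF this] obtain f where f: "\<forall>z\<in>?Z. z \<notin> \<phi> ` Ln (f z)" by blast
      have "z \<notin> \<phi> ` Ln (Max (f ` ?Z))" if z: "z \<in> ?Z" for z
      proof -
        have "f z \<le> Max (f ` ?Z)" using fin z by (intro Max_ge) auto
        then have "\<phi> ` Ln (Max (f ` ?Z)) \<subseteq> \<phi> ` Ln (f z)" using anti by blast
        then show ?thesis using f z by blast
      qed
      then show ?thesis by blast
    qed
    then obtain n where n: "\<forall>z\<in>{x \<otimes> inv y |x y. x \<in> S \<and> y \<in> S} - \<phi> ` L. z \<notin> \<phi> ` Ln n" ..
    have "inj_on (\<lambda>x. \<phi> ` Ln n #> x) S"
    proof (rule inj_onI)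
      fix x y assume xy: "x \<in> S" "y \<in> S" "\<phi> ` Ln n #> x = \<phi> ` Ln n #> y"
      then have c: "x \<in> carrier G" "y \<in> carrier G" using S by auto
      have "x \<otimes> inv y \<in> \<phi> ` Ln n"
        using coset_eq_iff[OF subgroup_phi_image[OF goodD(2)[OF Lng]] c] xy by simp
      then have "x \<otimes> inv y \<in> \<phi> ` L" using n xy by blast
      then have "cs x = cs y" using coset_eq_iff[OF sphi c] by (simp add: cs_def)
      then show "x = y" using S xy by (auto dest: inj_onD)
    qed
    then have "card S = card ((\<lambda>x. \<phi> ` Ln n #> x) ` S)" by (simp add: card_image)
    also have "\<dots> \<le> card ((\<lambda>x. \<phi> ` Ln n #> x) ` Ln n)"
      using iLn(2)[of n] S(1) LLn by (intro card_mono image_mono) (auto simp: fin_idx_def)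
    also have "\<dots> = m" using iLn(1)[of n] by (simp add: idx_def)
    finally show "card F \<le> m" using S card_image by metis
  qed
  then show "fin_idx L (\<phi> ` L)" "idx L (\<phi> ` L) \<le> m"
    by (simp_all add: fin_idx_def idx_def cs_def)
qed

lemma good_shrink:
  assumes P: "subgroup P G" "P \<subseteq> C" and Q: "subgroup Q G" "closedin T Q" and f: "fin_idx P Q"
  obtains k where "\<And>x. x \<in> C \<Longrightarrow> (\<phi> ^^ k) x \<in> P \<Longrightarrow> (\<phi> ^^ k) x \<in> Q"
proof -
  obtain n where n: "P \<inter> I n \<subseteq> Q" using closed_subgroup_I[OF P(1) Q f] .
  obtain k where "\<forall>x\<in>C. (\<phi> ^^ k) x \<in> I n" using C_contr by blast
  then show ?thesis using n by (intro that[of k]) blast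
qed

text \<open>The preimages of \<open>L\<close> under powers of \<phi> increase. Since
  \<open>L\<close> has finite index in its preimage \<open>L1\<close>, for large \<open>j\<close>
  the image of \<open>C\<close> under \<open>\<phi> ^^ j\<close> meets \<open>L1\<close> only inside
  \<open>L\<close>, and the chain stops.\<close>

lemma hull:
  assumes L: "good L"
  obtains j where "pure {x \<in> C. (\<phi> ^^ j) x \<in> L}"
proof -
  define L1 where "L1 = {x \<in> C. (\<phi> ^^ 1) x \<in> L}"
  have g1: "good L1" unfolding L1_def by (rule good_preimage[OF L])
  have sub: "L \<subseteq> L1" "\<phi> ` L1 \<subseteq> L" using goodD(4,5)[OF L] by (auto simp: L1_def)
  have "fin_idx (\<phi> ` L1) (\<phi> ` L)"
    using idx_mono(1)[OF subgroup_phi_image[OF goodD(2)[OF L]] sub(2) goodD(7)[OF L] idx_good(1)[OF L]] .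
  then have "fin_idx L1 L" using idx_phi(2)[OF goodD(2)[OF L] goodD(7)[OF g1]] by simp
  then obtain j where j: "\<And>x. x \<in> C \<Longrightarrow> (\<phi> ^^ j) x \<in> L1 \<Longrightarrow> (\<phi> ^^ j) x \<in> L"
    using good_shrink[OF goodD(2)[OF g1] goodD(4)[OF g1] goodD(2,3)[OF L]] by blast
  have "pure {x \<in> C. (\<phi> ^^ j) x \<in> L}"
    unfolding pure_def
  proof (intro conjI ballI impI)
    show "good {x \<in> C. (\<phi> ^^ j) x \<in> L}" by (rule good_preimage[OF L])
    fix x assume x: "x \<in> C" "\<phi> x \<in> {x \<in> C. (\<phi> ^^ j) x \<in> L}"
    then have "(\<phi> ^^ j) x \<in> L1" using C_phik by (simp add: L1_def funpow_swap1)
    then show "x \<in> {x \<in> C. (\<phi> ^^ j) x \<in> L}" using x j by simp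
  qed
  then show ?thesis by (rule that)
qed

text \<open>The rank used in chain arguments: on pure subgroups it is bounded by \<open>m\<close>
  and strictly monotone.\<close>

definition mu :: "'a set \<Rightarrow> nat" where
  "mu P = idx P (\<phi> ` P)"

text \<open>A form of Nakayama's lemma. Iterating the inclusion puts \<open>P\<close> inside the
  product of \<open>(\<phi> ^^ k) P\<close> and \<open>Q\<close> for every \<open>k\<close>; the
  first factor shrinks to \<open>\<one>\<close> and \<open>Q\<close> is closed.\<close>

lemma pure_eqI:
  assumes P: "pure P" and Q: "pure Q" "Q \<subseteq> P" and sub: "P \<subseteq> (\<phi> ` P) <#> Q"
  shows "P = Q"
proof -
  interpret P: subgroup P G using pureD(2)[OF P] .
  interpret Q: normal Q G using pureD(1)[OF Q(1)] .
  have *: "\<exists>c\<in>P. x \<otimes> (\<phi> ^^ k) c \<in> Q" if "x \<in> P" for x k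
    using that
  proof (induction k arbitrary: x)
    case 0
    then show ?case using Q.one_closed by (intro bexI[of _ "inv x"]) auto
  next
    case (Suc k)
    obtain y q where yq: "y \<in> P" "q \<in> Q" "x = \<phi> y \<otimes> q" using Suc.prems sub by (auto simp: set_mult_def)
    obtain c where c: "c \<in> P" "y \<otimes> (\<phi> ^^ k) c \<in> Q" using Suc.IH[OF yq(1)] by blast
    have car: "y \<in> carrier G" "q \<in> carrier G" "c \<in> carrier G" using yq c by auto
    let ?w = "(\<phi> ^^ Suc k) c"
    have "x \<otimes> ?w = \<phi> (y \<otimes> (\<phi> ^^ k) c) \<otimes> (inv ?w \<otimes> q \<otimes> ?w)"
      using yq(3) car by (simp add: m_assoc)
    moreover have "\<phi> (y \<otimes> (\<phi> ^^ k) c) \<in> Q" using pureD(5)[OF Q(1)] c by blast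
    moreover have "inv ?w \<otimes> q \<otimes> ?w \<in> Q" using Q.inv_op_closed1[of ?w q] car yq by simp
    ultimately show ?case using c by (intro bexI[of _ c]) auto
  qed
  have "P \<subseteq> Q"
  proof
    fix x assume "x \<in> P"
    then show "x \<in> Q"
      using closed_mem_contr[OF pureD(3)[OF Q(1)], of x] * pureD(4)[OF P] P.mem_carrier by blast
  qed
  then show ?thesis using Q(2) by blast
qed

lemma mu_le: "pure P \<Longrightarrow> mu P \<le> m"
  using idx_good[OF pure_good] by (simp add: mu_def)

text \<open>By purity the intersection of \<open>Q\<close> with \<open>\<phi> P\<close> is
  \<open>\<phi> Q\<close>, so \<open>mu Q\<close> is the index of \<open>\<phi> P\<close> in its
  product with \<open>Q\<close>, and by \<open>pure_eqI\<close> that product is smaller than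
  \<open>P\<close>.\<close>

lemma mu_strict:
  assumes P: "pure P" and Q: "pure Q" "Q \<subseteq> P" "Q \<noteq> P"
  shows "mu Q < mu P"
proof -
  have sp: "subgroup (\<phi> ` P) G" using subgroup_phi_image pureD(2)[OF P] .
  let ?R = "(\<phi> ` P) <#> Q"
  have R: "subgroup ?R G" using subgroup_set_mult[OF sp pureD(1)[OF Q(1)]] .
  have PR: "\<phi> ` P \<subseteq> ?R" using set_mult_supset(1)[OF sp pureD(2)[OF Q(1)]] .
  have phiP: "\<phi> ` P \<subseteq> P" using pureD(5)[OF P] by blast
  have RP: "?R \<subseteq> P" using set_mult_subset[OF pureD(2)[OF P] phiP Q(2)] .
  have "?R \<noteq> P" using pure_eqI[OF P Q(1,2)] Q(3) by blast
  then have "idx ?R (\<phi> ` P) < idx P (\<phi> ` P)"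
    using idx_strict[OF pureD(2)[OF P] R sp PR RP idx_good(1)[OF pure_good[OF P]]] by blast
  moreover have "Q \<inter> \<phi> ` P = \<phi> ` Q"
    using pureD(4,5)[OF Q(1)] pureD(4)[OF P] pure_phi[OF Q(1)] Q(2) by (auto simp: subset_iff)
  ultimately show ?thesis
    using idx_same_add(1)[OF sp pureD(2)[OF P] pureD(1)[OF Q(1)]] by (simp add: mu_def)
qed

lemma pure_Inter:
  assumes "\<P> \<noteq> {}" "\<And>P. P \<in> \<P> \<Longrightarrow> pure P"
  shows "pure (\<Inter>\<P>)"
proof -
  have n: "\<Inter>\<P> \<lhd> G"
  proof (rule normalI')
    show "subgroup (\<Inter>\<P>) G" using subgroups_Inter[OF pureD(2)] assms by blast
    show "g \<otimes> x \<otimes> inv g \<in> \<Inter>\<P>" if "x \<in> \<Inter>\<P>" "g \<in> carrier G" for x g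
      using that normal_conj pureD(1) assms(2) by blast
  qed
  have "closedin T (\<Inter>\<P>)" using assms pureD(3) by (intro closedin_Inter) auto
  moreover have "\<Inter>\<P> \<subseteq> C" using assms pureD(4) by blast
  ultimately show ?thesis
    unfolding pure_def good_def using n assms pure_phi pureD(4,5) by auto
qed

definition pure_closure :: "'a set \<Rightarrow> 'a set" where
  "pure_closure S = \<Inter>{P. pure P \<and> S \<subseteq> P}"

lemma pure_pure_closure: "S \<subseteq> C \<Longrightarrow> pure (pure_closure S)"
  unfolding pure_closure_def using pure_C by (intro pure_Inter) auto

lemma pure_closure_supset: "S \<subseteq> pure_closure S"
  by (auto simp: pure_closure_def)

lemma pure_closure_least: "pure P \<Longrightarrow> S \<subseteq> P \<Longrightarrow> pure_closure S \<subseteq> P"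
  by (auto simp: pure_closure_def)

text \<open>By \<open>hull\<close> some preimage of \<open>L\<close> under a power of \<phi> is
  pure, and it contains \<open>L\<close>. This turns generation up to purity into an inclusion after
  a power of \<phi>.\<close>

lemma pure_closure_good:
  assumes "good L" "\<And>P. pure P \<Longrightarrow> L \<subseteq> P \<Longrightarrow> H \<subseteq> P"
  obtains k where "\<And>x. x \<in> H \<Longrightarrow> (\<phi> ^^ k) x \<in> L"
proof -
  obtain j where j: "pure {x \<in> C. (\<phi> ^^ j) x \<in> L}" using hull[OF assms(1)] .
  then have "H \<subseteq> {x \<in> C. (\<phi> ^^ j) x \<in> L}"
    using goodD(4,6)[OF assms(1)] assms(2) by blast
  then show ?thesis using that by blast
qed

end

section \<open>Simple sections\<close>

context group
begin

lemma cm_mult_commuting: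
  assumes "x \<in> carrier G" "y \<in> carrier G" "w \<in> carrier G" "x \<otimes> cm y w = cm y w \<otimes> x"
  shows "cm (x \<otimes> y) w = cm y w \<otimes> cm x w"
  using assms by (simp add: cm_mult_left m_assoc)

text \<open>If the commutators with \<open>w\<close> are centralised by \<open>X\<close> and commute with each other,
  then \<open>x \<mapsto> cm x w\<close> is a homomorphism to an abelian group.\<close>

lemma cm_cm_eq_one:
  assumes X: "subgroup X G" and w: "w \<in> carrier G"
    and c: "\<And>x y. x \<in> X \<Longrightarrow> y \<in> X \<Longrightarrow> x \<otimes> cm y w = cm y w \<otimes> x"
    and a: "\<And>x y. x \<in> X \<Longrightarrow> y \<in> X \<Longrightarrow> cm x w \<otimes> cm y w = cm y w \<otimes> cm x w"
    and xy: "x \<in> X" "y \<in> X"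
  shows "cm (cm x y) w = \<one>"
proof -
  interpret X: subgroup X G by fact
  have z: "cm x y \<in> X" "y \<otimes> x \<in> X" "x \<otimes> y \<in> X" using xy subgroup_cm[OF X] by auto
  have "cm x y \<otimes> (y \<otimes> x) = x \<otimes> y" using xy cm_mult by simp
  then have "cm (x \<otimes> y) w = cm (y \<otimes> x) w \<otimes> cm (cm x y) w"
    using cm_mult_commuting[OF _ _ w c[OF z(1,2)]] xy by simp
  moreover have "cm (x \<otimes> y) w = cm y w \<otimes> cm x w" "cm (y \<otimes> x) w = cm x w \<otimes> cm y w"
    using cm_mult_commuting[OF _ _ w c] xy by auto
  ultimately have "cm y w \<otimes> cm x w = cm y w \<otimes> cm x w \<otimes> cm (cm x y) w"
    using a[OF xy] by simp
  then show ?thesis using xy w by simp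
qed

lemma cm_cm_mod:
  assumes N: "N \<lhd> G" and X: "subgroup X G" and w: "w \<in> carrier G"
    and c: "\<And>x y. x \<in> X \<Longrightarrow> y \<in> X \<Longrightarrow> cm x (cm y w) \<in> N"
    and a: "\<And>x y. x \<in> X \<Longrightarrow> y \<in> X \<Longrightarrow> cm (cm x w) (cm y w) \<in> N"
    and xy: "x \<in> X" "y \<in> X"
  shows "cm (cm x y) w \<in> N"
proof -
  interpret N: normal N G by fact
  interpret X: subgroup X G by fact
  interpret Q: group "G Mod N" by (rule N.factorgroup_is_group)
  have hom: "(#>) N \<in> hom G (G Mod N)" by (rule N.r_coset_hom_Mod)
  interpret h: group_hom G "G Mod N" "(#>) N"
    using hom by unfold_locales
  note [simp del] = mult_FactGroup one_FactGroup
  note hc = hom_cm[OF hom Q.is_group]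
  have one: "N #> z = \<one>\<^bsub>G Mod N\<^esub> \<longleftrightarrow> z \<in> N" if "z \<in> carrier G" for z
    using coset_eq_self_iff[OF N.subgroup_axioms that] by (simp add: one_FactGroup)
  have "Q.cm (Q.cm (N #> x) (N #> y)) (N #> w) = \<one>\<^bsub>G Mod N\<^esub>"
  proof (rule Q.cm_cm_eq_one[of "(#>) N ` X"])
    show "subgroup ((#>) N ` X) (G Mod N)" using h.subgroup_img_is_subgroup[OF X] .
    show "N #> w \<in> carrier (G Mod N)" using w by simp
    show "u \<otimes>\<^bsub>G Mod N\<^esub> Q.cm v (N #> w) = Q.cm v (N #> w) \<otimes>\<^bsub>G Mod N\<^esub> u"
      if uv: "u \<in> (#>) N ` X" "v \<in> (#>) N ` X" for u v
    proof -
      obtain x y where xy: "x \<in> X" "y \<in> X" "u = N #> x" "v = N #> y" using uv by blast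
      have "N #> cm x (cm y w) = \<one>\<^bsub>G Mod N\<^esub>" using c xy w by (subst one) auto
      then have "Q.cm u (Q.cm v (N #> w)) = \<one>\<^bsub>G Mod N\<^esub>" using xy w by (simp add: hc)
      then show ?thesis using Q.cm_eq_one_iff[of u "Q.cm v (N #> w)"] xy w by simp
    qed
    show "Q.cm u (N #> w) \<otimes>\<^bsub>G Mod N\<^esub> Q.cm v (N #> w) = Q.cm v (N #> w) \<otimes>\<^bsub>G Mod N\<^esub> Q.cm u (N #> w)"
      if uv: "u \<in> (#>) N ` X" "v \<in> (#>) N ` X" for u v
    proof -
      obtain x y where xy: "x \<in> X" "y \<in> X" "u = N #> x" "v = N #> y" using uv by blast
      have "N #> cm (cm x w) (cm y w) = \<one>\<^bsub>G Mod N\<^esub>" using a xy w by (subst one) auto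
      then have "Q.cm (Q.cm u (N #> w)) (Q.cm v (N #> w)) = \<one>\<^bsub>G Mod N\<^esub>" using xy w by (simp add: hc)
      then show ?thesis using Q.cm_eq_one_iff[of "Q.cm u (N #> w)" "Q.cm v (N #> w)"] xy w by simp
    qed
  qed (use xy in auto)
  then have "N #> cm (cm x y) w = \<one>\<^bsub>G Mod N\<^esub>" using xy w by (simp add: hc)
  then show ?thesis using one[of "cm (cm x y) w"] xy w by simp
qed

end

section \<open>Filtrations of simple sections that \<phi> shifts\<close>

context contraction
begin

definition simple_section :: "'a set \<Rightarrow> 'a set \<Rightarrow> bool" where
  "simple_section H K \<longleftrightarrow> pure H \<and> pure K \<and> K \<subseteq> H \<and> K \<noteq> H \<and>
     (\<forall>P. pure P \<longrightarrow> K \<subseteq> P \<longrightarrow> P \<subseteq> H \<longrightarrow> P = K \<or> P = H)"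

text \<open>On \<open>C\<close> the map \<phi> raises the level by exactly one, in both directions.
  A statement about \<open>(\<phi> ^^ j) x\<close> and \<open>W (i + j)\<close> is therefore one
  about \<open>x\<close> and \<open>W i\<close>.\<close>

definition filtration :: "(nat \<Rightarrow> 'a set) \<Rightarrow> 'a set \<Rightarrow> 'a set \<Rightarrow> bool" where
  "filtration W H K \<longleftrightarrow> (\<forall>i. good (W i)) \<and> (\<forall>i. K \<subseteq> W i \<and> W i \<subseteq> H \<and> W (Suc i) \<subseteq> W i) \<and>
     (\<forall>i. \<forall>x\<in>C. \<phi> x \<in> W (Suc i) \<longleftrightarrow> x \<in> W i) \<and>
     (\<forall>i. fin_idx (W i) (W (Suc i)) \<and> idx (W i) (W (Suc i)) \<le> m) \<and>
     (\<forall>x. (\<forall>i. x \<in> W i) \<longrightarrow> x \<in> K) \<and> (\<exists>k. \<forall>x\<in>H. (\<phi> ^^ k) x \<in> W 0)"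

lemma pure_Int: "pure A \<Longrightarrow> pure B \<Longrightarrow> pure (A \<inter> B)"
  using pure_Inter[of "{A, B}"] by auto

lemma fin_idx_phik:
  assumes "good H"
  shows "fin_idx H ((\<phi> ^^ k) ` H)"
proof (induction k)
  case 0
  then show ?case using goodD[OF assms] idx_good(1)[OF assms]
    idx_trans(3)[OF goodD(2)[OF assms] goodD(2)[OF assms] subgroup_phi_image[OF goodD(2)[OF assms]]]
    by (simp add: image_subset_iff)
next
  case (Suc k)
  have s: "subgroup ((\<phi> ^^ k) ` H) G" "subgroup ((\<phi> ^^ Suc k) ` H) G"
    using subgroup_phik_image[OF goodD(2)[OF assms]] by blast+
  have e: "(\<phi> ^^ Suc k) ` H = \<phi> ` ((\<phi> ^^ k) ` H)" by (auto simp: image_comp)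
  have "\<phi> ` ((\<phi> ^^ k) ` H) \<subseteq> \<phi> ` H" using goodD(6)[OF assms] by blast
  moreover have "\<phi> ` H \<subseteq> H" using goodD(5)[OF assms] by blast
  moreover have "fin_idx (\<phi> ` H) (\<phi> ` ((\<phi> ^^ k) ` H))"
    using idx_phi(2)[OF s(1) goodD(7)[OF assms]] Suc by simp
  ultimately show ?case
    unfolding e using idx_trans(2)[OF goodD(2)[OF assms] subgroup_phi_image[OF goodD(2)[OF assms]]
        s(2)[unfolded e]]
      idx_good(1)[OF assms] by blast
qed

lemma good_Inter:
  assumes "\<And>i::nat. good (B i)"
  shows "good (\<Inter>i. B i)"
proof -
  have "(\<Inter>i. B i) \<lhd> G"
  proof (rule normalI')
    show "subgroup (\<Inter>i. B i) G" using subgroups_Inter[of "range B"] goodD(2)[OF assms] by auto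
    show "g \<otimes> x \<otimes> inv g \<in> (\<Inter>i. B i)" if "x \<in> (\<Inter>i. B i)" "g \<in> carrier G" for x g
      using that normal_conj goodD(1)[OF assms] by blast
  qed
  then show ?thesis
    unfolding good_def using goodD(3,5)[OF assms] goodD(4)[OF assms[of 0]] by (auto intro!: closedin_Inter)
qed

lemma compact_nest_subset:
  assumes "\<And>i::nat. closedin T (S i)" "\<And>i. S (Suc i) \<subseteq> S i" "openin T U" "(\<Inter>i. S i) \<subseteq> U"
  obtains i where "S i \<subseteq> U"
proof (rule ccontr)
  assume "\<not> thesis"
  then have "S i - U \<noteq> {}" for i using that by auto
  moreover have "closedin T (S i - U)" for i using assms(1,3) by (intro closedin_diff)
  moreover have "decseq (\<lambda>i. S i - U)" using assms(2) by (intro decseq_SucI) auto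
  ultimately have "(\<Inter>i. S i - U) \<noteq> {}" using compact compact_space_imp_nest by metis
  then show False using assms(4) by auto
qed

lemma open_set_mult_I:
  assumes "good K"
  shows "openin T (K <#> I n)"
  using subgroup_openI[OF subgroup_set_mult[OF goodD(2)[OF assms] I_normal] I_open]
    subgroup.one_closed[OF I_subgroup] set_mult_supset(2)[OF goodD(2)[OF assms] I_subgroup] by blast

text \<open>The obvious subgroups \<open>R i\<close> shrink to \<open>K\<close> but need not be
  normal in \<open>G\<close>. The largest good subgroups \<open>J i\<close> inside them are normal,
  but only one half of the shift condition is clear for them. Simplicity of the section forces the
  other half from some level \<open>i0\<close> on.\<close>

lemma simple_section_filtration:
  assumes "simple_section H K"
  obtains W where "filtration W H K"
proof -
  have pH: "pure H" and pK: "pure K" and KH: "K \<subseteq> H" "K \<noteq> H"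
    and simp: "\<And>P. pure P \<Longrightarrow> K \<subseteq> P \<Longrightarrow> P \<subseteq> H \<Longrightarrow> P = K \<or> P = H"
    using assms by (auto simp: simple_section_def)
  interpret H: normal H G using pureD(1)[OF pH] .
  interpret K: normal K G using pureD(1)[OF pK] .
  have Cc: "\<And>x. x \<in> C \<Longrightarrow> x \<in> carrier G" and HC: "\<And>x. x \<in> H \<Longrightarrow> x \<in> C"
    using pureD(4)[OF pH] by auto
  define R where "R = (\<lambda>i. (\<phi> ^^ i) ` H <#> K)"
  have Rmem: "x \<in> R i \<longleftrightarrow> (\<exists>h\<in>H. \<exists>k\<in>K. x = (\<phi> ^^ i) h \<otimes> k)" for x i
    by (auto simp: R_def set_mult_def)
  have Rsub: "subgroup (R i) G" for i
    unfolding R_def using subgroup_set_mult subgroup_phik_image[OF H.subgroup_axioms] pureD(1)[OF pK] by blast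
  have KR: "K \<subseteq> R i" and PR: "(\<phi> ^^ i) ` H \<subseteq> R i" for i
    unfolding R_def using set_mult_supset subgroup_phik_image[OF H.subgroup_axioms] K.subgroup_axioms by blast+
  have RH: "R i \<subseteq> H" for i
    unfolding R_def using pureD(6)[OF pH] KH by (intro set_mult_subset H.subgroup_axioms) auto
  have Rcl: "closedin T (R i)" for i
    unfolding R_def by (intro closedin_set_mult closedin_image phik_cont pureD(3) pH pK)
  have Rdec: "R (Suc i) \<subseteq> R i" for i
    unfolding R_def using pureD(5)[OF pH] by (intro mono_set_mult) (auto simp: funpow_swap1)
  have Rback: "x \<in> R i" if x: "x \<in> C" "\<phi> x \<in> R (Suc i)" for x i
  proof -
    obtain h k where hk: "h \<in> H" "k \<in> K" "\<phi> x = (\<phi> ^^ Suc i) h \<otimes> k" using x(2) Rmem by blast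
    have "inv ((\<phi> ^^ i) h) \<otimes> x \<in> C" using hk x HC C_phik C_subgroup
      by (simp add: subgroup.m_closed subgroup.m_inv_closed)
    moreover have "\<phi> (inv ((\<phi> ^^ i) h) \<otimes> x) = k" using hk x by simp
    ultimately have "inv ((\<phi> ^^ i) h) \<otimes> x \<in> K" using pure_phi[OF pK] hk(2) by metis
    moreover have "x = (\<phi> ^^ i) h \<otimes> (inv ((\<phi> ^^ i) h) \<otimes> x)" using hk x by simp
    ultimately show ?thesis using hk(1) Rmem by blast
  qed
  have Rint: "x \<in> K" if xR: "\<And>i. x \<in> R (i0 + i)" for x i0
  proof (rule closed_mem_contr[OF pureD(3)[OF pK]])
    show "x \<in> carrier G" using xR[of 0] subgroup.mem_carrier[OF Rsub] by blast
    fix k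
    obtain h y where hy: "h \<in> H" "y \<in> K" "x = (\<phi> ^^ (i0 + k)) h \<otimes> y" using xR[of k] Rmem by blast
    have "x \<otimes> (\<phi> ^^ k) (inv ((\<phi> ^^ i0) h)) = (\<phi> ^^ (i0 + k)) h \<otimes> y \<otimes> inv ((\<phi> ^^ (i0 + k)) h)"
      using hy by (simp add: phik_add add.commute[of i0])
    then have "x \<otimes> (\<phi> ^^ k) (inv ((\<phi> ^^ i0) h)) \<in> K" using hy K.inv_op_closed2 by simp
    then show "\<exists>c\<in>C. x \<otimes> (\<phi> ^^ k) c \<in> K"
      using hy HC C_phik C_subgroup subgroup.m_inv_closed by metis
  qed
  \<comment> \<open>Asking for all conjugates of all \<phi>-iterates makes \<open>J i\<close> the
    largest good subgroup contained in \<open>R i\<close>.\<close>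
  define J where "J = (\<lambda>i. {x \<in> C. \<forall>j. \<forall>g\<in>carrier G. g \<otimes> (\<phi> ^^ j) x \<otimes> inv g \<in> R i})"
  have JR: "J i \<subseteq> R i" for i
  proof
    fix x assume "x \<in> J i"
    then have "\<one> \<otimes> (\<phi> ^^ 0) x \<otimes> inv \<one> \<in> R i" "x \<in> C" unfolding J_def by blast+
    then show "x \<in> R i" by simp
  qed
  have Jgood: "good (J i)" for i
    unfolding good_def
  proof (intro conjI ballI)
    interpret Ri: subgroup "R i" G by (rule Rsub)
    show "J i \<lhd> G"
    proof (rule normalI')
      show "subgroup (J i) G"
      proof (rule subgroupI)
        show "J i \<subseteq> carrier G" by (auto simp: J_def)
        have "\<one> \<in> J i" using subgroup.one_closed[OF C_subgroup] by (simp add: J_def)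
        then show "J i \<noteq> {}" by blast
        fix a assume a: "a \<in> J i"
        have "g \<otimes> (\<phi> ^^ j) (inv a) \<otimes> inv g = inv (g \<otimes> (\<phi> ^^ j) a \<otimes> inv g)" if "g \<in> carrier G" for g j
          using a that by (simp add: J_def inv_mult_group m_assoc)
        then show "inv a \<in> J i" using a subgroup.m_inv_closed[OF C_subgroup] by (simp add: J_def)
        fix b assume b: "b \<in> J i"
        have "g \<otimes> (\<phi> ^^ j) (a \<otimes> b) \<otimes> inv g = (g \<otimes> (\<phi> ^^ j) a \<otimes> inv g) \<otimes> (g \<otimes> (\<phi> ^^ j) b \<otimes> inv g)"
          if "g \<in> carrier G" for g j
          using a b that by (simp add: J_def m_assoc)
        then show "a \<otimes> b \<in> J i" using a b subgroup.m_closed[OF C_subgroup] by (simp add: J_def)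
      qed
      fix x h assume x: "x \<in> J i" and h: "h \<in> carrier G"
      have "g \<otimes> (\<phi> ^^ j) (h \<otimes> x \<otimes> inv h) \<otimes> inv g = (g \<otimes> (\<phi> ^^ j) h) \<otimes> (\<phi> ^^ j) x \<otimes> inv (g \<otimes> (\<phi> ^^ j) h)"
        if "g \<in> carrier G" for g j
        using x h that by (simp add: J_def m_assoc inv_mult_group)
      then show "h \<otimes> x \<otimes> inv h \<in> J i"
        using x h normal_conj[OF C_normal] by (simp add: J_def)
    qed
    show "closedin T (J i)"
    proof -
      have ne: "UNIV \<times> carrier G \<noteq> {}" by blast
      have "J i = (\<Inter>z\<in>UNIV \<times> carrier G. C \<inter> {x \<in> carrier G. snd z \<otimes> (\<phi> ^^ (fst z)) x \<otimes> inv (snd z) \<in> R i})"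
        by (force simp: J_def)
      moreover have "closedin T (C \<inter> {x \<in> carrier G. snd z \<otimes> (\<phi> ^^ (fst z)) x \<otimes> inv (snd z) \<in> R i})"
        if "z \<in> UNIV \<times> carrier G" for z
      proof (intro closedin_Int C_closed closedin_preimage[OF _ Rcl])
        show "continuous_map T T (\<lambda>x. snd z \<otimes> (\<phi> ^^ (fst z)) x \<otimes> inv (snd z))"
          using that by (intro continuous_map_mult continuous_map_const' phik_cont) auto
      qed
      ultimately show ?thesis using ne by (simp only:) (rule closedin_INT)
    qed
    show "J i \<subseteq> C" by (auto simp: J_def)
    fix x assume x: "x \<in> J i"
    have "g \<otimes> (\<phi> ^^ j) (\<phi> x) \<otimes> inv g \<in> R i" if "g \<in> carrier G" for g j
    proof -
      have "g \<otimes> (\<phi> ^^ (Suc j)) x \<otimes> inv g \<in> R i" using x that unfolding J_def by blast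
      then show ?thesis by (simp add: funpow_swap1)
    qed
    then show "\<phi> x \<in> J i" using x C_phi by (simp add: J_def)
  qed
  have Jlargest: "L \<subseteq> J i" if L: "good L" "L \<subseteq> R i" for L i
  proof
    fix x assume x: "x \<in> L"
    then show "x \<in> J i"
      using goodD(4)[OF L(1)] normal_conj[OF goodD(1)[OF L(1)] goodD(6)[OF L(1) x]] L(2)
      by (auto simp: J_def)
  qed
  have Jback: "x \<in> J i" if x: "x \<in> C" "\<phi> x \<in> J (Suc i)" for x i
  proof -
    have "good {x \<in> C. (\<phi> ^^ 1) x \<in> J (Suc i)}" by (rule good_preimage[OF Jgood])
    moreover have "{x \<in> C. (\<phi> ^^ 1) x \<in> J (Suc i)} \<subseteq> R i" using Rback JR by auto
    ultimately have "{x \<in> C. (\<phi> ^^ 1) x \<in> J (Suc i)} \<subseteq> J i" by (rule Jlargest)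
    then show ?thesis using x by auto
  qed
  have Jdec: "J (Suc i) \<subseteq> J i" for i using Jlargest[OF Jgood] JR Rdec by blast
  have KJ: "K \<subseteq> J i" for i using Jlargest[OF pure_good[OF pK] KR] .
  have HJ: "\<exists>n. H \<inter> I n \<subseteq> J i" for i
  proof -
    have "fin_idx H (R i)"
      using idx_trans(3)[OF H.subgroup_axioms Rsub subgroup_phik_image[OF H.subgroup_axioms] PR RH]
        fin_idx_phik[OF pure_good[OF pH]] by blast
    then obtain n where "H \<inter> I n \<subseteq> R i"
      using closed_subgroup_I[OF H.subgroup_axioms Rsub Rcl] by blast
    then show ?thesis using Jlargest[OF good_HI[OF pure_good[OF pH]]] by blast
  qed
  have HkJ: "\<exists>k. \<forall>x\<in>H. (\<phi> ^^ k) x \<in> J i" for i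
  proof -
    obtain n where "H \<inter> I n \<subseteq> J i" using HJ by blast
    moreover obtain k where "\<forall>x\<in>C. (\<phi> ^^ k) x \<in> I n" using C_contr by blast
    ultimately have "(\<phi> ^^ k) x \<in> J i" if "x \<in> H" for x
      using HC[OF that] pureD(6)[OF pH that] by blast
    then show ?thesis by blast
  qed
  \<comment> \<open>\<open>B i\<close> measures the missing half of the shift: it consists of the
    \<open>x\<close> for which \<open>(\<phi> ^^ i) x\<close> lies in \<open>J i\<close>. The chain
    decreases, and where it is constant \<phi> maps \<open>J i\<close> into
    \<open>J (Suc i)\<close>.\<close>
  define B where "B = (\<lambda>i. {x \<in> C. (\<phi> ^^ i) x \<in> J i})"
  have Bgood: "good (B i)" for i unfolding B_def by (rule good_preimage[OF Jgood])
  have Bdec: "B (Suc i) \<subseteq> B i" for i using Jback C_phik by (auto simp: B_def)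
  have Bdec': "B j \<subseteq> B i" if "i \<le> j" for i j
    using that Bdec by (rule lift_Suc_antimono_le[rotated])
  have BH: "B i \<subseteq> H" for i
  proof
    fix x assume "x \<in> B i"
    then show "x \<in> H" using JR RH pure_phik[OF pH, of x i] by (auto simp: B_def)
  qed
  have KB: "K \<subseteq> B i" for i using KJ[of i] pureD(4)[OF pK] pureD(6)[OF pK] unfolding B_def by blast
  have JB: "\<exists>h\<in>B i. \<exists>k\<in>K. x = (\<phi> ^^ i) h \<otimes> k" if x: "x \<in> J i" for x i
  proof -
    interpret J: subgroup "J i" G using goodD(2)[OF Jgood] .
    obtain h k where hk: "h \<in> H" "k \<in> K" "x = (\<phi> ^^ i) h \<otimes> k" using x JR Rmem by blast
    have "x \<otimes> inv k \<in> J i" using x hk KJ by blast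
    moreover have "x \<otimes> inv k = (\<phi> ^^ i) h" using hk by (simp add: m_assoc)
    ultimately have "h \<in> B i" using hk HC by (simp add: B_def)
    then show ?thesis using hk by blast
  qed
  define L where "L = (\<Inter>i. B i)"
  have Lgood: "good L" unfolding L_def by (rule good_Inter[OF Bgood])
  have KL: "K \<subseteq> L" and LH: "L \<subseteq> H" and LB: "L \<subseteq> B i" for i
    using KB BH[of 0] by (auto simp: L_def)
  \<comment> \<open>If the intersection were \<open>K\<close>, compactness would put some
    \<open>B i0\<close> inside \<open>R 1\<close>. Then \<open>J\<close> would not decrease after
    \<open>i0\<close>, so \<open>J i0\<close> would lie in all later \<open>R\<close> and hence in
    \<open>K\<close>, although a power of \<phi> maps \<open>H\<close> into
    \<open>J i0\<close>.\<close>
  have LK: "L \<noteq> K"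
  proof
    assume "L = K"
    obtain n where n: "H \<inter> I n \<subseteq> J 1" using HJ by blast
    have "(\<Inter>i. B i) \<subseteq> K <#> I n"
      using \<open>L = K\<close> set_mult_supset(1)[OF K.subgroup_axioms I_subgroup] by (simp add: L_def)
    then obtain i0 where i0: "B i0 \<subseteq> K <#> I n"
      using compact_nest_subset[of B "K <#> I n"] goodD(3)[OF Bgood] Bdec
          open_set_mult_I[OF pure_good[OF pK]] by metis
    have B1: "B i0 \<subseteq> R 1"
    proof
      interpret R1: subgroup "R 1" G by (rule Rsub)
      fix x assume x: "x \<in> B i0"
      then obtain k y where ky: "k \<in> K" "y \<in> I n" "x = k \<otimes> y" using i0 by (auto simp: set_mult_def)
      have yc: "y \<in> carrier G" using ky subgroup.mem_carrier[OF I_subgroup] by blast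
      have "y = inv k \<otimes> x" using ky yc by simp
      then have "y \<in> H" using x BH ky KH by blast
      then have "y \<in> R 1" using n ky JR by blast
      then show "x \<in> R 1" using ky KR by blast
    qed
    have Jinc: "J (i0 + i) \<subseteq> J (i0 + Suc i)" for i
    proof -
      have "J (i0 + i) \<subseteq> R (i0 + Suc i)"
      proof
        fix x assume "x \<in> J (i0 + i)"
        then obtain h k where hk: "h \<in> B (i0 + i)" "k \<in> K" "x = (\<phi> ^^ (i0 + i)) h \<otimes> k" using JB by blast
        have "h \<in> R 1" using hk Bdec'[of i0 "i0 + i"] B1 by auto
        then obtain h' k' where hk': "h' \<in> H" "k' \<in> K" "h = \<phi> h' \<otimes> k'" using Rmem by auto
        have "x = (\<phi> ^^ (i0 + Suc i)) h' \<otimes> ((\<phi> ^^ (i0 + i)) k' \<otimes> k)"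
          using hk hk' by (simp add: m_assoc funpow_swap1)
        moreover have "(\<phi> ^^ (i0 + i)) k' \<otimes> k \<in> K" using hk hk' pureD(6)[OF pK] by blast
        ultimately show "x \<in> R (i0 + Suc i)" using hk' Rmem by blast
      qed
      then show ?thesis using Jlargest[OF Jgood] by blast
    qed
    have "J i0 \<subseteq> J (i0 + i)" for i by (induction i) (use Jinc in auto)
    then have "J i0 \<subseteq> K" using Rint JR by blast
    then show False using HkJ[of i0] pure_phik[OF pK] HC KH by blast
  qed
  have hull: "H \<subseteq> P" if P: "pure P" "L \<subseteq> P" for P
  proof -
    have "P \<inter> H = K \<or> P \<inter> H = H" using simp[OF pure_Int[OF P(1) pH]] P KL KH by blast
    then show "H \<subseteq> P" using P LK KL LH by blast
  qed
  \<comment> \<open>So \<open>L\<close> has finite index in \<open>H\<close>, and the chain of the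
    \<open>B i\<close>, all of which contain \<open>L\<close>, becomes constant.\<close>
  obtain k where k: "\<And>x. x \<in> H \<Longrightarrow> (\<phi> ^^ k) x \<in> L"
    using pure_closure_good[OF Lgood hull] by metis
  have fHL: "fin_idx H L"
    using idx_trans(3)[OF H.subgroup_axioms goodD(2)[OF Lgood] subgroup_phik_image[OF H.subgroup_axioms,
        of k] _ LH]
      fin_idx_phik[OF pure_good[OF pH]] k by blast
  obtain i0 where i0: "\<And>i. idx (B i0) L \<le> idx (B i) L"
    using ex_has_least_nat[of "\<lambda>_. True" _ "\<lambda>i. idx (B i) L"] by blast
  have Bst: "B i = B i0" if "i0 \<le> i" for i
  proof (rule ccontr)
    assume "B i \<noteq> B i0"
    moreover have "fin_idx (B i0) L" using idx_mono(1)[OF goodD(2)[OF Lgood] BH _ fHL] H.subset by blast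
    ultimately have "idx (B i) L < idx (B i0) L"
      using idx_strict[OF goodD(2)[OF Bgood] goodD(2)[OF Bgood] goodD(2)[OF Lgood] LB Bdec'[OF that]] by blast
    then show False using i0[of i] by simp
  qed
  define W where "W = (\<lambda>i. J (i0 + i))"
  have "filtration W H K"
    unfolding filtration_def
  proof (intro conjI allI ballI impI)
    show "good (W i)" "K \<subseteq> W i" "W i \<subseteq> H" "W (Suc i) \<subseteq> W i" for i
      using Jgood KJ Jdec JR[of "i0 + i"] RH[of "i0 + i"] by (auto simp: W_def)
    show fw: "\<phi> x \<in> W (Suc i) \<longleftrightarrow> x \<in> W i" if x: "x \<in> C" for x i
    proof
      show "\<phi> x \<in> W (Suc i) \<Longrightarrow> x \<in> W i" using Jback x by (simp add: W_def)
      assume "x \<in> W i"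
      then obtain h k where hk: "h \<in> B (i0 + i)" "k \<in> K" "x = (\<phi> ^^ (i0 + i)) h \<otimes> k" using JB W_def by blast
      have "h \<in> B (Suc (i0 + i))" using hk Bst[of "i0 + i"] Bst[of "Suc (i0 + i)"] by simp
      then have "(\<phi> ^^ Suc (i0 + i)) h \<in> J (Suc (i0 + i))" "h \<in> carrier G" by (auto simp: B_def)
      moreover have "\<phi> k \<in> J (Suc (i0 + i))" using hk KJ pureD(5)[OF pK] by blast
      moreover have "\<phi> x = (\<phi> ^^ Suc (i0 + i)) h \<otimes> \<phi> k" using hk \<open>h \<in> carrier G\<close> by simp
      ultimately show "\<phi> x \<in> W (Suc i)"
        using subgroup.m_closed[OF goodD(2)[OF Jgood]] by (simp add: W_def)
    qed
    fix i
    \<comment> \<open>\<open>W (Suc i)\<close> lies between \<open>\<phi> (W i)\<close> and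
      \<open>W i\<close>, which bounds the order of the factor by \<open>m\<close>.\<close>
    have s: "\<phi> ` W i \<subseteq> W (Suc i)" using fw goodD(4)[OF Jgood] by (auto simp: W_def)
    have sub: "subgroup (W i) G" "subgroup (W (Suc i)) G" "subgroup (\<phi> ` W i) G" "W (Suc i) \<subseteq> W i"
      using goodD(2)[OF Jgood] Jdec subgroup_phi_image by (auto simp: W_def)
    have ig: "fin_idx (W i) (\<phi> ` W i)" "idx (W i) (\<phi> ` W i) \<le> m"
      using idx_good[OF Jgood] by (auto simp: W_def)
    note t = idx_trans[OF sub(1,2,3) s sub(4)]
    show f: "fin_idx (W i) (W (Suc i))" using t(3) ig by blast
    have "idx (W (Suc i)) (\<phi> ` W i) > 0" using idx_pos[OF sub(2) t(4)[OF ig(1)]] .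
    then show "idx (W i) (W (Suc i)) \<le> m" using t(1) ig(2)
      by (metis One_nat_def Suc_leI le_trans mult.right_neutral mult_le_mono2)
  next
    show "x \<in> K" if "\<forall>i. x \<in> W i" for x using that Rint JR by (force simp: W_def)
    show "\<exists>k. \<forall>x\<in>H. (\<phi> ^^ k) x \<in> W 0" using HkJ by (simp add: W_def)
  qed
  then show ?thesis by (rule that)
qed

text \<open>Quantifying over all iterates makes the centraliser invariant under \<phi>, and
  normality of the \<open>W i\<close> makes it invariant under conjugation. Families are used so
  that a whole filtration can be treated at once.\<close>

lemma good_centralizer:
  assumes X: "good X" and W: "\<And>i::nat. W i \<lhd> G" and N: "\<And>i. N i \<lhd> G" "\<And>i. closedin T (N i)"
  shows "good {x \<in> X. \<forall>k i. \<forall>w\<in>W i. cm ((\<phi> ^^ k) x) w \<in> N i}"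
proof -
  define A where "A = {x \<in> X. \<forall>k i. \<forall>w\<in>W i. cm ((\<phi> ^^ k) x) w \<in> N i}"
  interpret X: normal X G using goodD(1)[OF X] .
  have Wc: "w \<in> carrier G" if "w \<in> W i" for w i
    using that W normal_imp_subgroup subgroup.mem_carrier by metis
  have Ns: "subgroup (N i) G" for i using N(1) normal_imp_subgroup by blast
  have Ak: "cm ((\<phi> ^^ k) a) w \<in> N i" if "a \<in> A" "w \<in> W i" for a w k i
    using that unfolding A_def by blast
  have Ac: "a \<in> carrier G" "a \<in> X" if "a \<in> A" for a using that by (auto simp: A_def)
  have "A \<lhd> G"
  proof (rule normalI')
    show "subgroup A G"
    proof (rule subgroupI)
      show "A \<subseteq> carrier G" by (auto simp: A_def)
      have "\<one> \<in> A" using Wc subgroup.one_closed[OF Ns] by (simp add: A_def)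
      then show "A \<noteq> {}" by blast
      fix a assume a: "a \<in> A"
      have "cm ((\<phi> ^^ k) (inv a)) w \<in> N i" if w: "w \<in> W i" for k w i
      proof -
        interpret N: normal "N i" G by (rule N(1))
        show ?thesis
          using N.inv_op_closed1[OF phik_closed[OF Ac(1)[OF a]] N.m_inv_closed[OF Ak[OF a w]]] Ac[OF a] Wc[OF w]
          by (simp add: cm_inv_left)
      qed
      then show "inv a \<in> A" using Ac[OF a] by (simp add: A_def)
      fix b assume b: "b \<in> A"
      have "cm ((\<phi> ^^ k) (a \<otimes> b)) w \<in> N i" if w: "w \<in> W i" for k w i
      proof -
        interpret N: normal "N i" G by (rule N(1))
        show ?thesis
          using N.m_closed[OF N.inv_op_closed2[OF phik_closed[OF Ac(1)[OF a]] Ak[OF b w]] Ak[OF a w]]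
            Ac[OF a] Ac[OF b] Wc[OF w] by (simp add: cm_mult_left)
      qed
      then show "a \<otimes> b \<in> A" using Ac[OF a] Ac[OF b] by (simp add: A_def)
    qed
    fix x g assume x: "x \<in> A" and g: "g \<in> carrier G"
    have "cm ((\<phi> ^^ k) (g \<otimes> x \<otimes> inv g)) w \<in> N i" if w: "w \<in> W i" for k w i
    proof -
      let ?g = "(\<phi> ^^ k) g"
      have gc: "?g \<in> carrier G" using g by simp
      have wc: "w \<in> carrier G" using Wc[OF w] .
      have "inv ?g \<otimes> w \<otimes> inv (inv ?g) \<in> W i" using normal_conj[OF W w] gc by blast
      then have w': "inv ?g \<otimes> w \<otimes> ?g \<in> W i" using gc by simp
      have "?g \<otimes> cm ((\<phi> ^^ k) x) (inv ?g \<otimes> w \<otimes> ?g) \<otimes> inv ?g \<in> N i"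
        using normal_conj[OF N(1) Ak[OF x w'] gc] .
      moreover have "?g \<otimes> (inv ?g \<otimes> w \<otimes> ?g) \<otimes> inv ?g = w" using gc wc by (simp add: m_assoc)
      ultimately show ?thesis using Ac[OF x] g gc wc by (simp add: cm_conj)
    qed
    then show "g \<otimes> x \<otimes> inv g \<in> A" using X.inv_op_closed2[OF g Ac(2)[OF x]] by (simp add: A_def)
  qed
  moreover have "closedin T A"
  proof -
    let ?Z = "SIGMA k:UNIV. SIGMA i:UNIV. W i"
    have ne: "?Z \<noteq> {}" using subgroup.one_closed[OF normal_imp_subgroup[OF W]] by blast
    have "A = (\<Inter>z\<in>?Z. X \<inter> {x \<in> carrier G. cm ((\<phi> ^^ (fst z)) x) (snd (snd z)) \<in> N (fst (snd z))})"
      using ne by (force simp: A_def)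
    moreover have "closedin T (X \<inter> {x \<in> carrier G. cm ((\<phi> ^^ (fst z)) x) (snd (snd z)) \<in> N (fst (snd z))})"
      if "z \<in> ?Z" for z
    proof (intro closedin_Int goodD(3)[OF X] closedin_preimage[OF _ N(2)])
      show "continuous_map T T (\<lambda>x. cm ((\<phi> ^^ (fst z)) x) (snd (snd z)))"
        using that Wc by (intro continuous_map_cm continuous_map_const' phik_cont) auto
    qed
    ultimately show ?thesis using ne by (simp only:) (rule closedin_INT)
  qed
  moreover have "A \<subseteq> C" using goodD(4)[OF X] by (auto simp: A_def)
  moreover have "\<phi> x \<in> A" if x: "x \<in> A" for x
    using Ak[OF x, of _ _ "Suc _"] goodD(5)[OF X Ac(2)[OF x]] by (simp add: A_def funpow_swap1)
  ultimately show ?thesis by (simp add: good_def A_def)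
qed

lemma filtrationD:
  assumes "filtration W H K"
  shows "good (W i)" "K \<subseteq> W i" "W i \<subseteq> H" "W (Suc i) \<subseteq> W i"
    "x \<in> C \<Longrightarrow> \<phi> x \<in> W (Suc i) \<longleftrightarrow> x \<in> W i"
    "x \<in> C \<Longrightarrow> (\<phi> ^^ j) x \<in> W (i + j) \<longleftrightarrow> x \<in> W i"
    "fin_idx (W i) (W (Suc i))" "idx (W i) (W (Suc i)) \<le> m"
    "(\<And>i. x \<in> W i) \<Longrightarrow> x \<in> K" "\<exists>k. \<forall>x\<in>H. (\<phi> ^^ k) x \<in> W 0"
    "W (i + j) \<subseteq> W i"
proof -
  show "good (W i)" "K \<subseteq> W i" "W i \<subseteq> H" and dec: "\<And>i. W (Suc i) \<subseteq> W i"
    and fw: "\<And>x i. x \<in> C \<Longrightarrow> \<phi> x \<in> W (Suc i) \<longleftrightarrow> x \<in> W i"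
    and "fin_idx (W i) (W (Suc i))" "idx (W i) (W (Suc i)) \<le> m"
    "(\<And>i. x \<in> W i) \<Longrightarrow> x \<in> K" "\<exists>k. \<forall>x\<in>H. (\<phi> ^^ k) x \<in> W 0"
    using assms unfolding filtration_def by blast+
  show "(\<phi> ^^ j) x \<in> W (i + j) \<longleftrightarrow> x \<in> W i" if "x \<in> C"
    using that by (induction j) (auto simp: fw C_phik)
  show "W (i + j) \<subseteq> W i" using dec by (induction j) auto
qed

text \<open>\<open>I m\<close> centralises the factors, whose order is at most \<open>m\<close>, and
  a power of \<phi> maps \<open>C\<close> into \<open>I m\<close>; the shift property brings the
  conclusion back to level \<open>i\<close>. So \<open>C\<close> acts trivially on every
  factor.\<close>

lemma filtration_cm:
  assumes W: "filtration W H K" and w: "w \<in> W i" and c: "c \<in> C"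
  shows "cm w c \<in> W (Suc i)" "cm c w \<in> W (Suc i)"
proof -
  note D = filtrationD[OF W]
  have wC: "w \<in> C" using w goodD(4)[OF D(1)] by blast
  obtain j where j: "\<forall>x\<in>C. (\<phi> ^^ j) x \<in> I m" using C_contr by blast
  have "cm ((\<phi> ^^ j) w) ((\<phi> ^^ j) c) \<in> W (Suc (i + j))"
    using I_centralizes[OF goodD(1)[OF D(1)] goodD(1,3)[OF D(1)] D(4,7,8)] D(6) wC w c j by blast
  then have "(\<phi> ^^ j) (cm w c) \<in> W (Suc i + j)" using wC c by simp
  then show "cm w c \<in> W (Suc i)" using D(6)[of "cm w c"] subgroup_cm[OF C_subgroup wC c] by blast
  then show "cm c w \<in> W (Suc i)" using cm_swap_mem[OF goodD(2)[OF D(1)]] wC c by simp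
qed

text \<open>Let \<open>r\<close> be maximal such that commutators with \<open>X\<close> raise every
  level by \<open>r\<close>. For \<open>w\<close> in \<open>W i\<close> the map
  \<open>x \<mapsto> cm x w\<close> is then a homomorphism from \<open>X\<close> to the abelian
  factor of \<open>W (i + r)\<close> by \<open>W (i + Suc r)\<close>, of order at most
  \<open>m\<close>. The intersection of these kernels, over all levels and \<phi>-iterates, is
  \<open>A\<close>; its purity is again the shift.\<close>

theorem simple_section_alternative:
  assumes X: "pure X" and s: "simple_section H K"
    and nc: "\<exists>x\<in>X. \<exists>h\<in>H. cm x h \<notin> K"
  obtains A where "pure A" "A \<subseteq> X" "A \<noteq> X" "\<And>x y. x \<in> X \<Longrightarrow> y \<in> X \<Longrightarrow> cm x y \<in> A"
    "\<And>x. x \<in> X \<Longrightarrow> x [^] (fact m :: nat) \<in> A"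
proof -
  obtain W where W: "filtration W H K" using simple_section_filtration[OF s] .
  note D = filtrationD[OF W]
  have pK: "pure K" and pH: "pure H" using s by (auto simp: simple_section_def)
  interpret X: normal X G using pureD(1)[OF X] .
  have XC: "x \<in> C" if "x \<in> X" for x using that pureD(4)[OF X] by blast
  have WC: "w \<in> C" if "w \<in> W i" for w i using that goodD(4)[OF D(1)] by blast
  have XCc: "x \<in> carrier G" if "x \<in> X" for x using that XC by auto
  have WCc: "w \<in> carrier G" if "w \<in> W i" for w i using that WC by auto
  define c where "c = (\<lambda>r. \<forall>i. \<forall>x\<in>X. \<forall>w\<in>W i. cm x w \<in> W (i + r))"
  \<comment> \<open>If every \<open>r\<close> worked, then after a power of \<phi> the commutators
    of \<open>X\<close> with \<open>H\<close> would lie in all \<open>W r\<close>, hence in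
    \<open>K\<close>, and purity of \<open>K\<close> would contradict \<open>nc\<close>.\<close>
  have "\<exists>r. \<not> c r"
  proof (rule ccontr)
    assume "\<not> ?thesis"
    then have all: "c r" for r by blast
    have "cm x h \<in> K" if x: "x \<in> X" and h: "h \<in> H" for x h
    proof -
      obtain k where k: "\<forall>x\<in>H. (\<phi> ^^ k) x \<in> W 0" using D(10) by blast
      have hC: "h \<in> C" using h pureD(4)[OF pH] by blast
      have "cm ((\<phi> ^^ k) x) ((\<phi> ^^ k) h) \<in> W r" for r
      proof -
        have "cm ((\<phi> ^^ k) x) ((\<phi> ^^ k) h) \<in> W (0 + r)"
          using all[of r] pureD(6)[OF X x] k h unfolding c_def by blast
        then show ?thesis by simp
      qed
      then have "cm ((\<phi> ^^ k) x) ((\<phi> ^^ k) h) \<in> K" by (rule D(9))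
      then have "(\<phi> ^^ k) (cm x h) \<in> K" using XC[OF x] hC by simp
      then show ?thesis using pure_phik[OF pK] subgroup_cm[OF C_subgroup XC[OF x] hC] by blast
    qed
    then show False using nc by blast
  qed
  moreover have "c 0" unfolding c_def
    using filtration_cm(2)[OF W _ XC] D(4) by fastforce
  ultimately obtain r0 where "\<not> c (Suc r0)" "\<forall>r\<le>r0. c r"
    using ex_least_nat_less[of "\<lambda>r. \<not> c r"] by auto
  moreover have "c 1" unfolding c_def using filtration_cm(2)[OF W _ XC] by simp
  ultimately obtain r where r: "c r" "\<not> c (Suc r)" "r \<ge> 1"
    by (metis One_nat_def le_refl less_one not_le)
  define A where "A = {x \<in> X. \<forall>k i. \<forall>w\<in>W i. cm ((\<phi> ^^ k) x) w \<in> W (i + Suc r)}"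
  have cr: "cm x w \<in> W (i + r)" if "x \<in> X" "w \<in> W i" for x w i
    using r(1) that unfolding c_def by blast
  have cent: "cm x z \<in> W (i + Suc r)" if "x \<in> C" "z \<in> W (i + r)" for x z i
    using filtration_cm(2)[OF W that(2,1)] by simp
  have 1: "cm (cm x y) w \<in> W (i + Suc r)" if xy: "x \<in> X" "y \<in> X" and w: "w \<in> W i" for x y w i
  proof (rule cm_cm_mod[OF goodD(1)[OF D(1)] X.subgroup_axioms WCc[OF w] _ _ xy])
    fix x y assume x: "x \<in> X" and y: "y \<in> X"
    show "cm x (cm y w) \<in> W (i + Suc r)" using cent[OF XC[OF x] cr[OF y w]] .
    show "cm (cm x w) (cm y w) \<in> W (i + Suc r)" using cent[OF WC[OF cr[OF x w]] cr[OF y w]] .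
  qed
  have 2: "cm (x [^] (fact m :: nat)) w \<in> W (i + Suc r)" if x: "x \<in> X" and w: "w \<in> W i" for x w i
  proof -
    have sub: "subgroup (W (i + r)) G" "subgroup (W (i + Suc r)) G" using goodD(2)[OF D(1)] by auto
    have "cm x w [^] (fact m :: nat) \<in> W (i + Suc r)"
      using pow_fact_mem[OF sub _ _ cr[OF x w]] D(7,8)[of "i + r"] by simp
    moreover have "cm (x [^] (fact m :: nat)) w \<otimes> inv (cm x w [^] (fact m :: nat)) \<in> W (i + Suc r)"
      using pow_cm_mod[OF goodD(1)[OF D(1)] XCc[OF x] WCc[OF w] cent[OF XC[OF x] cr[OF x w]]] .
    ultimately have "cm (x [^] (fact m :: nat)) w \<otimes> inv (cm x w [^] (fact m :: nat)) \<otimes> cm x w [^] (fact m :: nat) \<in> W (i + Suc r)"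
      using subgroup.m_closed[OF sub(2)] by blast
    then show ?thesis using XCc[OF x] WCc[OF w] by (simp add: m_assoc)
  qed
  show ?thesis
  proof (rule that[of A])
    have xk: "(\<phi> ^^ k) x \<in> X" if "x \<in> X" for x k using that pureD(6)[OF X] by blast
    show "A \<subseteq> X" by (auto simp: A_def)
    show "A \<noteq> X"
    proof
      assume "A = X"
      then have "cm ((\<phi> ^^ 0) x) w \<in> W (i + Suc r)" if "x \<in> X" "w \<in> W i" for x w i
        using that unfolding A_def by blast
      then show False using r(2) unfolding c_def by simp
    qed
    show "cm x y \<in> A" if "x \<in> X" "y \<in> X" for x y
      using 1[OF xk xk] subgroup_cm[OF X.subgroup_axioms] that XCc by (simp add: A_def)
    show "x [^] (fact m :: nat) \<in> A" if "x \<in> X" for x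
      using 2[OF xk] subgroup_pow[OF X.subgroup_axioms] that XCc by (simp add: A_def)
    show "pure A"
      unfolding pure_def
    proof (intro conjI ballI impI)
      show "good A" unfolding A_def
        by (rule good_centralizer[OF pure_good[OF X] goodD(1)[OF D(1)] goodD(1,3)[OF D(1)]])
      fix x assume x: "x \<in> C" "\<phi> x \<in> A"
      then have xX: "x \<in> X" using pure_phi[OF X] by (simp add: A_def)
      have "cm ((\<phi> ^^ k) x) w \<in> W (i + Suc r)" if w: "w \<in> W i" for k w i
      proof -
        have "\<phi> w \<in> W (Suc i)" using D(5) w WC by blast
        then have "cm ((\<phi> ^^ k) (\<phi> x)) (\<phi> w) \<in> W (Suc i + Suc r)" using x(2) unfolding A_def by blast
        then have "\<phi> (cm ((\<phi> ^^ k) x) w) \<in> W (Suc (i + Suc r))" using XCc[OF xX] WCc[OF w]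
          by (simp add: funpow_swap1)
        moreover have "cm ((\<phi> ^^ k) x) w \<in> C" using subgroup_cm[OF C_subgroup C_phik[OF x(1)] WC[OF w]] .
        ultimately show ?thesis using D(5) by blast
      qed
      then show "x \<in> A" using xX by (simp add: A_def)
    qed
  qed
qed

end

section \<open>Radicable subgroups\<close>

context group
begin

lemma conj_pow:
  assumes "g \<in> carrier G" "x \<in> carrier G"
  shows "(g \<otimes> x \<otimes> inv g) [^] (n::nat) = g \<otimes> x [^] n \<otimes> inv g"
proof (induction n)
  case (Suc n)
  then show ?case using assms by (simp add: m_assoc)
qed (use assms in simp)

lemma pow_mult_coset:
  assumes "N \<lhd> G" "x \<in> carrier G" "y \<in> carrier G" "cm x y \<in> N"
  shows "N #> (x \<otimes> y) [^] (n::nat) = N #> (x [^] n \<otimes> y [^] n)"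
  using pow_mult_mod[OF assms] assms coset_eq_iff[OF normal_imp_subgroup[OF assms(1)]] by simp

lemma pow_mult_inv_coset:
  assumes "N \<lhd> G" "x \<in> carrier G" "y \<in> carrier G" "cm x (inv y) \<in> N"
  shows "N #> (x \<otimes> inv y) [^] (n::nat) = N #> (x [^] n \<otimes> inv (y [^] n))"
  using pow_mult_coset[of N x "inv y" n] assms by (simp add: nat_pow_inv)

text \<open>For \<open>Q\<close> inside \<open>P\<close> this is the preimage in \<open>P\<close> of
  the set of \<open>n\<close>-th powers of \<open>P/Q\<close>. When \<open>P/Q\<close> is abelian it
  is already a subgroup, and compactness makes it closed, so neither generation nor closure has to
  be taken.\<close>

definition powers_mod :: "nat \<Rightarrow> 'a set \<Rightarrow> 'a set \<Rightarrow> 'a set" where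
  "powers_mod n P Q = {q \<otimes> x [^] n |q x. q \<in> Q \<and> x \<in> P}"

lemma powers_mod_iff:
  assumes "P \<subseteq> carrier G" "Q \<lhd> G" "z \<in> carrier G"
  shows "z \<in> powers_mod n P Q \<longleftrightarrow> (\<exists>x\<in>P. Q #> z = Q #> x [^] n)"
proof -
  interpret Q: normal Q G by fact
  have "z \<in> powers_mod n P Q \<longleftrightarrow> (\<exists>x\<in>P. z \<otimes> inv (x [^] n) \<in> Q)"
  proof
    assume "z \<in> powers_mod n P Q"
    then obtain q x where qx: "q \<in> Q" "x \<in> P" "z = q \<otimes> x [^] n" by (auto simp: powers_mod_def)
    then have "z \<otimes> inv (x [^] n) = q" using assms by (simp add: m_assoc subset_iff)
    then show "\<exists>x\<in>P. z \<otimes> inv (x [^] n) \<in> Q" using qx by blast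
  next
    assume "\<exists>x\<in>P. z \<otimes> inv (x [^] n) \<in> Q"
    then obtain x where x: "x \<in> P" "z \<otimes> inv (x [^] n) \<in> Q" by blast
    then have "z = (z \<otimes> inv (x [^] n)) \<otimes> x [^] n" using assms by (simp add: m_assoc subset_iff)
    with x have "\<exists>q y. z = q \<otimes> y [^] n \<and> q \<in> Q \<and> y \<in> P" by (intro exI conjI)
    then show "z \<in> powers_mod n P Q" by (simp add: powers_mod_def)
  qed
  then show ?thesis using assms coset_eq_iff[OF Q.subgroup_axioms assms(3)] by (metis nat_pow_closed subsetD)
qed

lemma powers_mod_normal:
  assumes P: "P \<lhd> G" and Q: "Q \<lhd> G" "Q \<subseteq> P" and c: "\<And>x y. x \<in> P \<Longrightarrow> y \<in> P \<Longrightarrow> cm x y \<in> Q"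
  shows "powers_mod n P Q \<lhd> G"
proof -
  interpret P: normal P G by fact
  interpret Q: normal Q G by fact
  have mem: "\<And>z. z \<in> carrier G \<Longrightarrow> z \<in> powers_mod n P Q \<longleftrightarrow> (\<exists>x\<in>P. Q #> z = Q #> x [^] n)"
    using powers_mod_iff[OF P.subset Q(1)] .
  have sub: "powers_mod n P Q \<subseteq> carrier G" by (auto simp: powers_mod_def)
  have ex: "\<exists>x\<in>P. z \<in> carrier G \<and> Q #> z = Q #> x [^] n" if "z \<in> powers_mod n P Q" for z
    using mem sub that by blast
  have Qm: "Q #> (u \<otimes> v) = (Q #> u) <#> (Q #> v)" if "u \<in> carrier G" "v \<in> carrier G" for u v
    using Q.rcos_sum that by simp
  show ?thesis
  proof (rule normalI')
    show "subgroup (powers_mod n P Q) G"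
    proof (rule subgroupI)
      show "powers_mod n P Q \<subseteq> carrier G" by (rule sub)
      have "\<one> \<in> powers_mod n P Q" using mem[of \<one>] P.one_closed by (metis nat_pow_one one_closed)
      then show "powers_mod n P Q \<noteq> {}" by blast
      fix a assume "a \<in> powers_mod n P Q"
      then obtain x where x: "x \<in> P" "a \<in> carrier G" "Q #> a = Q #> x [^] n" using ex by blast
      have "Q #> inv a = Q #> (inv x) [^] n" using x Q.rcos_inv[of a] Q.rcos_inv[of "x [^] n"]
        by (simp add: nat_pow_inv)
      then show "inv a \<in> powers_mod n P Q" using mem x by blast
      fix b assume "b \<in> powers_mod n P Q"
      then obtain y where y: "y \<in> P" "b \<in> carrier G" "Q #> b = Q #> y [^] n" using ex by blast
      have "Q #> (a \<otimes> b) = Q #> (x \<otimes> y) [^] n"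
        using x y Qm pow_mult_coset[OF Q(1) _ _ c[OF x(1) y(1)]] by simp
      then show "a \<otimes> b \<in> powers_mod n P Q" using mem x y by blast
    qed
    fix a g assume "a \<in> powers_mod n P Q" and g: "g \<in> carrier G"
    then obtain q x where qx: "q \<in> Q" "x \<in> P" "a = q \<otimes> x [^] n" by (auto simp: powers_mod_def)
    have "g \<otimes> a \<otimes> inv g = (g \<otimes> q \<otimes> inv g) \<otimes> (g \<otimes> x \<otimes> inv g) [^] n"
      using qx g by (simp add: conj_pow) (simp add: m_assoc)
    then show "g \<otimes> a \<otimes> inv g \<in> powers_mod n P Q"
      using Q.inv_op_closed2[OF g qx(1)] P.inv_op_closed2[OF g qx(2)] unfolding powers_mod_def by blast
  qed
qed

lemma powers_mod_subset: "subgroup P G \<Longrightarrow> Q \<subseteq> P \<Longrightarrow> powers_mod n P Q \<subseteq> P"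
  using subgroup_pow subgroup.m_closed by (fastforce simp: powers_mod_def)

lemma powers_mod_supset:
  assumes "subgroup P G" "Q \<lhd> G"
  shows "Q \<subseteq> powers_mod n P Q" "x \<in> P \<Longrightarrow> x [^] n \<in> powers_mod n P Q"
proof -
  interpret P: subgroup P G by fact
  interpret Q: normal Q G by fact
  have "q = q \<otimes> \<one> [^] n" if "q \<in> Q" for q using that by simp
  then show "Q \<subseteq> powers_mod n P Q" using P.one_closed unfolding powers_mod_def by blast
  have "x [^] n = \<one> \<otimes> x [^] n" if "x \<in> P" using that by simp
  then show "x \<in> P \<Longrightarrow> x [^] n \<in> powers_mod n P Q" using Q.one_closed unfolding powers_mod_def by blast
qed

end

section \<open>Torsion-free sections and the pure lower central series\<close>

context contraction
begin

lemma good_powers_mod: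
  assumes P: "good P" and Q: "good Q" "Q \<subseteq> P" and c: "\<And>x y. x \<in> P \<Longrightarrow> y \<in> P \<Longrightarrow> cm x y \<in> Q"
  shows "good (powers_mod n P Q)"
  unfolding good_def
proof (intro conjI ballI)
  show "powers_mod n P Q \<lhd> G" using powers_mod_normal goodD(1) assms by blast
  have "continuous_map (prod_topology T T) T (\<lambda>(q, x). q \<otimes> x [^] n)"
    unfolding case_prod_unfold
    by (intro continuous_map_mult continuous_map_pow continuous_map_fst continuous_map_snd)
  from closedin_image2[OF this goodD(3)[OF Q(1)] goodD(3)[OF P]]
  show "closedin T (powers_mod n P Q)" by (simp add: powers_mod_def)
  show "powers_mod n P Q \<subseteq> C" using powers_mod_subset[OF goodD(2)[OF P] Q(2)] goodD(4)[OF P] by blast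
  fix z assume "z \<in> powers_mod n P Q"
  then obtain q x where qx: "q \<in> Q" "x \<in> P" "z = q \<otimes> x [^] n" by (auto simp: powers_mod_def)
  then have "\<phi> z = \<phi> q \<otimes> (\<phi> x) [^] n" using goodD(7)[OF P] goodD(7)[OF Q(1)] by (simp add: subset_iff)
  then show "\<phi> z \<in> powers_mod n P Q" using goodD(5)[OF P qx(2)] goodD(5)[OF Q(1) qx(1)]
    unfolding powers_mod_def by blast
qed

text \<open>Multiplying two commuting injective endomorphisms of an abelian section: their
  cokernels have the same finite order, whence \<open>x \<mapsto> x [^] n\<close> has trivial kernel.\<close>

lemma section_torsion_free:
  assumes P: "pure P" and Q: "pure Q" "Q \<subseteq> P" and c: "\<And>x y. x \<in> P \<Longrightarrow> y \<in> P \<Longrightarrow> cm x y \<in> Q"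
    and k: "\<And>x. x \<in> P \<Longrightarrow> (\<phi> ^^ k) x \<in> powers_mod n P Q"
    and x: "x \<in> P" "x [^] n \<in> Q"
  shows "x \<in> Q"
proof -
  interpret P: normal P G using pureD(1)[OF P] .
  interpret Q: normal Q G using pureD(1)[OF Q(1)] .
  have PC: "x \<in> C" if "x \<in> P" for x using that pureD(4)[OF P] by blast
  have phiP: "\<phi> x \<in> P" if "x \<in> P" for x using that pureD(5)[OF P] by blast
  have Qm: "Q #> (u \<otimes> v) = (Q #> u) <#> (Q #> v)" if "u \<in> carrier G" "v \<in> carrier G" for u v
    using Q.rcos_sum that by simp
  have Q0: "Q #> u = Q \<longleftrightarrow> u \<in> Q" if "u \<in> carrier G" for u
    using coset_eq_self_iff[OF Q.subgroup_axioms that] .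
  have Qe: "Q #> u = Q #> v \<longleftrightarrow> u \<otimes> inv v \<in> Q" if "u \<in> carrier G" "v \<in> carrier G" for u v
    using coset_eq_iff[OF Q.subgroup_axioms that] .
  define L where "L = powers_mod n P Q"
  have Lg: "good L" unfolding L_def by (rule good_powers_mod[OF pure_good[OF P] pure_good[OF Q(1)] Q(2) c])
  have LP: "L \<subseteq> P" unfolding L_def by (rule powers_mod_subset[OF P.subgroup_axioms Q(2)])
  have QL: "Q \<subseteq> L" unfolding L_def by (rule powers_mod_supset(1)[OF P.subgroup_axioms Q.normal_axioms])
  \<comment> \<open>The preimage of the \<open>n\<close>-torsion of \<open>P/Q\<close>. It is pure,
    so by \<open>pure_eqI\<close> it suffices to place \<open>B\<close> inside the product of
    \<open>\<phi> B\<close> and \<open>Q\<close>.\<close>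
  define B where "B = {x \<in> P. x [^] n \<in> Q}"
  have pows: "(x \<otimes> y) [^] n \<in> Q \<longleftrightarrow> x [^] n \<otimes> y [^] n \<in> Q" if "x \<in> P" "y \<in> P" for x y
    using pow_mult_coset[OF Q.normal_axioms _ _ c[OF that], of n] Q0[of "(x \<otimes> y) [^] n"]
        Q0[of "x [^] n \<otimes> y [^] n"] that
    by simp
  have Bn: "B \<lhd> G"
  proof (rule normalI')
    show "subgroup B G"
      by (rule subgroupI) (auto simp: B_def pows nat_pow_inv intro: exI[of _ \<one>])
    show "g \<otimes> x \<otimes> inv g \<in> B" if "x \<in> B" "g \<in> carrier G" for x g
      using that P.inv_op_closed2 Q.inv_op_closed2[of g "x [^] n"] by (simp add: B_def conj_pow)
  qed
  have "closedin T B"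
  proof -
    have "B = P \<inter> {x \<in> carrier G. x [^] n \<in> Q}" by (auto simp: B_def)
    then show ?thesis
      using closedin_preimage[OF continuous_map_pow[OF continuous_map_id'] pureD(3)[OF Q(1)]]
          pureD(3)[OF P] by auto
  qed
  then have B: "pure B"
    unfolding pure_def good_def
    using Bn PC phiP pureD(5)[OF Q(1)] pure_phi[OF P] pure_phi[OF Q(1)] subgroup_pow[OF C_subgroup]
    by (auto simp: B_def simp flip: phi_pow)
  have QB: "Q \<subseteq> B" using Q(2) subgroup_pow[OF Q.subgroup_axioms] by (auto simp: B_def)
  have BP: "B \<subseteq> P" by (auto simp: B_def)
  have sp: "subgroup (\<phi> ` P) G" "\<phi> ` P \<subseteq> P" using subgroup_phi_image[OF P.subgroup_axioms] phiP by auto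
  define PQ where "PQ = \<phi> ` P <#> Q"
  define PB where "PB = \<phi> ` P <#> B"
  define L' where "L' = \<phi> ` L <#> Q"
  have sub: "subgroup PQ G" "subgroup PB G" "subgroup L' G" "subgroup L G"
    unfolding PQ_def PB_def L'_def
    using subgroup_set_mult[OF sp(1)] Q.normal_axioms Bn
      subgroup_set_mult[OF subgroup_phi_image[OF goodD(2)[OF Lg]]] goodD(2)[OF Lg] by auto
  have phiL: "\<phi> ` L \<subseteq> L" using goodD(5)[OF Lg] by blast
  have inc: "L' \<subseteq> L" "L' \<subseteq> PQ" "PQ \<subseteq> PB" "PB \<subseteq> P" "\<phi> ` P \<subseteq> PB" "PQ \<subseteq> P"
  proof -
    show "L' \<subseteq> L" unfolding L'_def using phiL QL by (intro set_mult_subset sub) auto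
    show "L' \<subseteq> PQ" unfolding L'_def PQ_def using LP by (intro mono_set_mult) auto
    show "PQ \<subseteq> PB" unfolding PB_def PQ_def using QB by (intro mono_set_mult) auto
    show "PB \<subseteq> P" unfolding PB_def using BP sp(2) by (intro set_mult_subset P.subgroup_axioms) auto
    show "\<phi> ` P \<subseteq> PB" unfolding PB_def by (rule set_mult_supset(1)[OF sp(1) normal_imp_subgroup[OF Bn]])
    then show "PQ \<subseteq> P" using \<open>PQ \<subseteq> PB\<close> \<open>PB \<subseteq> P\<close> by blast
  qed
  have L'mem: "z \<in> L' \<longleftrightarrow> (\<exists>p\<in>P. Q #> z = Q #> (\<phi> p) [^] n)" if z: "z \<in> carrier G" for z
  proof
    assume "z \<in> L'"
    then obtain l q where lq: "l \<in> L" "q \<in> Q" "z = \<phi> l \<otimes> q" by (auto simp: L'_def set_mult_def)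
    obtain r p where rp: "r \<in> Q" "p \<in> P" "l = r \<otimes> p [^] n" using lq(1) by (auto simp: L_def powers_mod_def)
    have "z \<otimes> inv ((\<phi> p) [^] n) = \<phi> r \<otimes> ((\<phi> p) [^] n \<otimes> q \<otimes> inv ((\<phi> p) [^] n))"
      using lq rp by (simp add: m_assoc)
    moreover have "\<phi> r \<in> Q" using pureD(5)[OF Q(1) rp(1)] .
    moreover have "(\<phi> p) [^] n \<otimes> q \<otimes> inv ((\<phi> p) [^] n) \<in> Q" using Q.inv_op_closed2 rp lq by simp
    ultimately have "z \<otimes> inv ((\<phi> p) [^] n) \<in> Q" by simp
    then show "\<exists>p\<in>P. Q #> z = Q #> (\<phi> p) [^] n" using Qe[of z "(\<phi> p) [^] n"] z rp by auto
  next
    assume "\<exists>p\<in>P. Q #> z = Q #> (\<phi> p) [^] n"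
    then obtain p where p: "p \<in> P" "z \<otimes> inv ((\<phi> p) [^] n) \<in> Q" using Qe[OF z] by auto
    let ?q = "z \<otimes> inv ((\<phi> p) [^] n)"
    have "inv ((\<phi> p) [^] n) \<otimes> ?q \<otimes> (\<phi> p) [^] n \<in> Q" using Q.inv_op_closed1[OF _ p(2), of "(\<phi> p) [^] n"] p
      by simp
    moreover have "z = \<phi> (p [^] n) \<otimes> (inv ((\<phi> p) [^] n) \<otimes> ?q \<otimes> (\<phi> p) [^] n)" using z p by (simp add: m_assoc)
    moreover have "p [^] n \<in> L" unfolding L_def
      using powers_mod_supset(2)[OF P.subgroup_axioms Q.normal_axioms p(1)] .
    ultimately show "z \<in> L'" unfolding L'_def set_mult_def by blast
  qed
  have QL': "Q \<subseteq> L'" unfolding L'_def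
    by (rule set_mult_supset(2)[OF subgroup_phi_image[OF goodD(2)[OF Lg]] Q.subgroup_axioms])
  \<comment> \<open>\<phi> induces a bijection from \<open>P/L\<close> to \<open>PQ/L'\<close>: onto
    by the choice of \<open>PQ\<close>, and injective because \<open>Q\<close> is pure.\<close>
  have i1: "idx P L = idx PQ L'"
  proof (rule idx_map_eq(2)[OF sub(4) P.subset sub(3), of PQ \<phi>])
    show "PQ \<subseteq> carrier G" using subgroup.subset[OF sub(1)] .
    show "\<phi> ` P \<subseteq> PQ" unfolding PQ_def by (rule set_mult_supset(1)[OF sp(1) Q.subgroup_axioms])
    show "\<exists>x\<in>P. z \<otimes> inv (\<phi> x) \<in> L'" if z: "z \<in> PQ" for z
    proof -
      obtain p q where pq: "p \<in> P" "q \<in> Q" "z = \<phi> p \<otimes> q" using z by (auto simp: PQ_def set_mult_def)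
      then have "z \<otimes> inv (\<phi> p) \<in> Q" using Q.inv_op_closed2[of "\<phi> p" q] by simp
      then show ?thesis using pq QL' by blast
    qed
    fix x y assume xy: "x \<in> P" "y \<in> P"
    let ?z = "x \<otimes> inv y"
    have z: "?z \<in> P" "?z \<in> carrier G" using xy by auto
    have "\<phi> ?z \<in> L' \<longleftrightarrow> ?z \<in> L"
    proof
      show "?z \<in> L \<Longrightarrow> \<phi> ?z \<in> L'"
        unfolding L'_def using set_mult_supset(1)[OF subgroup_phi_image[OF goodD(2)[OF Lg]]
            Q.subgroup_axioms] by blast
      assume "\<phi> ?z \<in> L'"
      then obtain l q where lq: "l \<in> L" "q \<in> Q" "\<phi> ?z = \<phi> l \<otimes> q" by (auto simp: L'_def set_mult_def)
      have lC: "l \<in> C" "l \<in> carrier G" using lq goodD(4)[OF Lg] by auto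
      have "inv l \<otimes> ?z \<in> C" using z PC lC C_subgroup by (meson subgroup.m_closed subgroup.m_inv_closed)
      moreover have "\<phi> (inv l \<otimes> ?z) = q" using lq lC z(2) by (simp only: phi_mult phi_inv inv_closed) simp
      ultimately have "inv l \<otimes> ?z \<in> L" using pure_phi[OF Q(1)] lq(2) QL by blast
      then have "l \<otimes> (inv l \<otimes> ?z) \<in> L" using lq(1) subgroup.m_closed[OF sub(4)] by blast
      then show "?z \<in> L" using lC z(2) by simp
    qed
    then show "x \<otimes> inv y \<in> L \<longleftrightarrow> \<phi> x \<otimes> inv (\<phi> y) \<in> L'" using xy by simp
  qed
  \<comment> \<open>The power map induces a bijection from \<open>P/PB\<close> to
    \<open>L/L'\<close>: modulo \<open>Q\<close> an \<open>n\<close>-th power agrees with one from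
    \<open>\<phi> P\<close> exactly when its root differs from an element of \<open>\<phi> P\<close>
    by \<open>n\<close>-torsion.\<close>
  have i2: "idx P PB = idx L L'"
  proof (rule idx_map_eq(2)[OF sub(2) P.subset sub(3), of L "\<lambda>x. x [^] n"])
    show "L \<subseteq> carrier G" using subgroup.subset[OF sub(4)] .
    show "(\<lambda>x. x [^] n) ` P \<subseteq> L" unfolding L_def
      using powers_mod_supset(2)[OF P.subgroup_axioms Q.normal_axioms] by blast
    show "\<exists>x\<in>P. z \<otimes> inv (x [^] n) \<in> L'" if z: "z \<in> L" for z
    proof -
      obtain q p where "q \<in> Q" "p \<in> P" "z = q \<otimes> p [^] n" using z by (auto simp: L_def powers_mod_def)
      then have "z \<otimes> inv (p [^] n) \<in> L'" using QL' by (auto simp: m_assoc)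
      then show ?thesis using \<open>p \<in> P\<close> by blast
    qed
    have PBmem: "z \<in> PB \<longleftrightarrow> (\<exists>p\<in>P. z \<otimes> inv (\<phi> p) \<in> B)" if z: "z \<in> P" for z
    proof -
      interpret B: normal B G by (rule Bn)
      show ?thesis
      proof
        assume "z \<in> PB"
        then obtain p b where pb: "p \<in> P" "b \<in> B" "z = \<phi> p \<otimes> b" by (auto simp: PB_def set_mult_def)
        then have "z \<otimes> inv (\<phi> p) \<in> B" using B.inv_op_closed2[of "\<phi> p" b] by simp
        then show "\<exists>p\<in>P. z \<otimes> inv (\<phi> p) \<in> B" using pb by blast
      next
        assume "\<exists>p\<in>P. z \<otimes> inv (\<phi> p) \<in> B"
        then obtain p where p: "p \<in> P" "z \<otimes> inv (\<phi> p) \<in> B" by blast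
        then have "z = (z \<otimes> inv (\<phi> p)) \<otimes> \<phi> p" using z by (simp add: m_assoc)
        moreover have "z \<otimes> inv (\<phi> p) \<in> PB" using p(2) unfolding PB_def
          using set_mult_supset(2)[OF sp(1) B.subgroup_axioms] by blast
        ultimately show "z \<in> PB" using subgroup.m_closed[OF sub(2)] inc(5) p(1) by (metis image_subset_iff)
      qed
    qed
    fix x y assume xy: "x \<in> P" "y \<in> P"
    let ?z = "x \<otimes> inv y"
    have z: "?z \<in> P" "?z \<in> carrier G" using xy by auto
    have "?z \<in> PB \<longleftrightarrow> (\<exists>p\<in>P. (?z \<otimes> inv (\<phi> p)) [^] n \<in> Q)"
      using PBmem[OF z(1)] z phiP by (auto simp: B_def)
    also have "\<dots> \<longleftrightarrow> (\<exists>p\<in>P. Q #> (x [^] n \<otimes> inv (y [^] n)) = Q #> (\<phi> p) [^] n)"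
    proof (rule bex_cong[OF refl])
      fix p assume p: "p \<in> P"
      have "(?z \<otimes> inv (\<phi> p)) [^] n \<in> Q \<longleftrightarrow> Q #> (?z \<otimes> inv (\<phi> p)) [^] n = Q" using Q0 z p by simp
      also have "Q #> (?z \<otimes> inv (\<phi> p)) [^] n = Q #> (?z [^] n \<otimes> inv ((\<phi> p) [^] n))"
        using pow_mult_inv_coset[OF Q.normal_axioms z(2) _ c[OF z(1)], of "\<phi> p"] phiP[OF p] p by simp
      also have "\<dots> = (Q #> ?z [^] n) <#> (Q #> inv ((\<phi> p) [^] n))" using Qm z p by simp
      also have "Q #> ?z [^] n = Q #> (x [^] n \<otimes> inv (y [^] n))"
        using pow_mult_inv_coset[OF Q.normal_axioms _ _ c[OF xy(1)], of y] xy by simp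
      also have "\<dots> <#> (Q #> inv ((\<phi> p) [^] n)) = Q #> (x [^] n \<otimes> inv (y [^] n) \<otimes> inv ((\<phi> p) [^] n))"
        using Qm[symmetric] xy p by simp
      also have "\<dots> = Q \<longleftrightarrow> x [^] n \<otimes> inv (y [^] n) \<otimes> inv ((\<phi> p) [^] n) \<in> Q"
        using Q0 xy p by simp
      also have "\<dots> \<longleftrightarrow> Q #> (x [^] n \<otimes> inv (y [^] n)) = Q #> (\<phi> p) [^] n"
        using Qe[of "x [^] n \<otimes> inv (y [^] n)" "(\<phi> p) [^] n"] xy p by simp
      finally show "(?z \<otimes> inv (\<phi> p)) [^] n \<in> Q \<longleftrightarrow> Q #> (x [^] n \<otimes> inv (y [^] n)) = Q #> (\<phi> p) [^] n" .
    qed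
    also have "\<dots> \<longleftrightarrow> x [^] n \<otimes> inv (y [^] n) \<in> L'" using L'mem[of "x [^] n \<otimes> inv (y [^] n)"] xy by simp
    finally show "x \<otimes> inv y \<in> PB \<longleftrightarrow> x [^] n \<otimes> inv (y [^] n) \<in> L'" .
  qed
  have finL: "fin_idx P L"
    using idx_trans(3)[OF P.subgroup_axioms sub(4) subgroup_phik_image[OF P.subgroup_axioms, of k] _ LP]
      fin_idx_phik[OF pure_good[OF P]] k by (auto simp: L_def)
  have finphi: "fin_idx P (\<phi> ` P)" using idx_good(1)[OF pure_good[OF P]] .
  have finPB: "fin_idx P PB" "fin_idx P PQ"
    using idx_trans(3)[OF P.subgroup_axioms sub(2) sp(1) inc(5,4) finphi]
      idx_trans(3)[OF P.subgroup_axioms sub(1) sp(1) _ inc(6) finphi]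
      set_mult_supset(1)[OF sp(1) Q.subgroup_axioms] by (auto simp: PQ_def)
  \<comment> \<open>Both sides are the index of \<open>L'\<close> in \<open>P\<close>, computed
    through \<open>PQ\<close> and through \<open>L\<close>.\<close>
  have "idx P PQ * idx P L = idx P L * idx P PB"
    using idx_trans(1)[OF P.subgroup_axioms sub(1,3) inc(2,6)]
        idx_trans(1)[OF P.subgroup_axioms sub(4,3) inc(1) LP] i1 i2
    by (metis mult.commute)
  moreover have "idx P L > 0" using idx_pos[OF P.subgroup_axioms finL] .
  ultimately have "idx P PQ = idx P PB" by simp
  then have "idx PB PQ = 1"
    using idx_trans(1)[OF P.subgroup_axioms sub(2,1) inc(3,4)] idx_pos[OF P.subgroup_axioms finPB(1)] by simp
  then have "PB = PQ" using idx_one_imp_eq[OF sub(2,1) inc(3)] by simp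
  have "B \<subseteq> \<phi> ` B <#> Q"
  proof
    fix b assume b: "b \<in> B"
    then have "b \<in> PQ" using \<open>PB = PQ\<close> set_mult_supset(2)[OF sp(1) normal_imp_subgroup[OF Bn]]
      by (auto simp: PB_def)
    then obtain p q where pq: "p \<in> P" "q \<in> Q" "b = \<phi> p \<otimes> q" by (auto simp: PQ_def set_mult_def)
    then have "\<phi> p = b \<otimes> inv q" by (simp add: m_assoc)
    then have "\<phi> p \<in> B" using b pq(2) QB Bn
      by (metis normal_imp_subgroup subgroup.m_closed subgroup.m_inv_closed subsetD)
    then have "p \<in> B" using pure_phi[OF B PC[OF pq(1)]] by simp
    then show "b \<in> \<phi> ` B <#> Q" using pq by (auto simp: set_mult_def)
  qed
  then have "B = Q" by (rule pure_eqI[OF B Q(1) QB])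
  then show ?thesis using x by (auto simp: B_def)
qed

text \<open>The condition under which the descent through abelian quotients of finite exponent
  stops. The name is justified by \<open>ser_pow\<close>: up to a power of \<phi>, every element of
  a factor of \<open>ser\<close> is an \<open>n\<close>-th power.\<close>

definition radicable :: "'a set \<Rightarrow> bool" where
  "radicable X \<longleftrightarrow> pure X \<and> (\<forall>A n. pure A \<longrightarrow> A \<subseteq> X \<longrightarrow> n > 0 \<longrightarrow>
     (\<forall>x\<in>X. \<forall>y\<in>X. cm x y \<in> A) \<longrightarrow> (\<forall>x\<in>X. x [^] (n::nat) \<in> A) \<longrightarrow> A = X)"

lemma radicable_pure: "radicable X \<Longrightarrow> pure X"
  by (simp add: radicable_def)

lemma radicable_eq:
  "radicable X \<Longrightarrow> pure A \<Longrightarrow> A \<subseteq> X \<Longrightarrow> n > 0 \<Longrightarrow> (\<And>x y. x \<in> X \<Longrightarrow> y \<in> X \<Longrightarrow> cm x y \<in> A) \<Longrightarrow>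
    (\<And>x. x \<in> X \<Longrightarrow> x [^] (n::nat) \<in> A) \<Longrightarrow> A = X"
  unfolding radicable_def by blast

lemma radicable_centralizes:
  assumes "radicable X" "simple_section H K" "x \<in> X" "h \<in> H"
  shows "cm x h \<in> K"
proof (rule ccontr)
  assume "cm x h \<notin> K"
  then obtain A where A: "pure A" "A \<subseteq> X" "A \<noteq> X" "\<And>x y. x \<in> X \<Longrightarrow> y \<in> X \<Longrightarrow> cm x y \<in> A"
    "\<And>x. x \<in> X \<Longrightarrow> x [^] (fact m :: nat) \<in> A"
    using simple_section_alternative[OF radicable_pure[OF assms(1)] assms(2)] assms(3,4) by metis
  then show False using radicable_eq[OF assms(1) A(1,2) _ A(4,5)] by simp
qed

text \<open>The lower central series of \<open>X\<close> with a pure closure taken at each step, so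
  that \<open>mu\<close> drops as long as the series descends and
  \<open>section_torsion_free\<close> applies to its factors.\<close>

primrec ser :: "'a set \<Rightarrow> nat \<Rightarrow> 'a set" where
  "ser X 0 = X"
| "ser X (Suc i) = pure_closure {cm k x |k x. k \<in> ser X i \<and> x \<in> X}"

declare ser.simps(2) [simp del]

lemma ser_pure_subset:
  assumes "pure X"
  shows "pure (ser X i)" "ser X (Suc i) \<subseteq> ser X i" "ser X i \<subseteq> X"
    "k \<in> ser X i \<Longrightarrow> x \<in> X \<Longrightarrow> cm k x \<in> ser X (Suc i)"
    "k \<in> ser X i \<Longrightarrow> x \<in> X \<Longrightarrow> cm x k \<in> ser X (Suc i)"
proof -
  have XC: "x \<in> C" if "x \<in> X" for x using that pureD(4)[OF assms] by blast
  have p: "pure (ser X i) \<and> ser X i \<subseteq> X" for i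
  proof (induction i)
    case (Suc i)
    have "{cm k x |k x. k \<in> ser X i \<and> x \<in> X} \<subseteq> X"
      using subgroup_cm[OF pureD(2)[OF assms]] Suc by auto
    moreover from this have "{cm k x |k x. k \<in> ser X i \<and> x \<in> X} \<subseteq> C" using XC by blast
    ultimately show ?case
      using pure_pure_closure pure_closure_least[OF assms] by (simp add: ser.simps(2))
  qed (use assms in simp)
  then show 1: "pure (ser X i)" "ser X i \<subseteq> X" for i by auto
  show 2: "ser X (Suc i) \<subseteq> ser X i" for i
    unfolding ser.simps(2)
  proof (rule pure_closure_least[OF 1(1)])
    show "{cm k x |k x. k \<in> ser X i \<and> x \<in> X} \<subseteq> ser X i"
      using normal_cm(1)[OF pureD(1)[OF 1(1)[of i]]] XC C_carrier by blast
  qed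
  show 3: "cm k x \<in> ser X (Suc i)" if "k \<in> ser X i" "x \<in> X" for k x i
    using that pure_closure_supset[of "{cm k x |k x. k \<in> ser X i \<and> x \<in> X}"] unfolding ser.simps(2) by blast
  show "cm x k \<in> ser X (Suc i)" if "k \<in> ser X i" "x \<in> X"
    using cm_swap_mem[OF pureD(2)[OF 1(1)] _ _ 3[OF that]] that 1(2)[of i] XC C_carrier by blast
qed

text \<open>The series is stationary at a term of minimal \<open>mu\<close>. If that term were
  nontrivial, a maximal proper pure subgroup \<open>M\<close> of it would give a simple section,
  which \<open>X\<close> centralises; the next term would then lie in \<open>M\<close>.\<close>

lemma radicable_nilpotent:
  assumes X: "radicable X"
  obtains c where "ser X c = {\<one>}"
proof -
  note S = ser_pure_subset[OF radicable_pure[OF X]]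
  obtain c where c: "\<And>i. mu (ser X c) \<le> mu (ser X i)"
    using ex_has_least_nat[of "\<lambda>_. True" _ "\<lambda>i. mu (ser X i)"] by blast
  have "\<not> mu (ser X (Suc c)) < mu (ser X c)" using c[of "Suc c"] by simp
  then have eq: "ser X (Suc c) = ser X c" using mu_strict[OF S(1) S(1) S(2)] by blast
  have "ser X c = {\<one>}"
  proof (rule ccontr)
    assume n1: "ser X c \<noteq> {\<one>}"
    define \<M> where "\<M> = {M. pure M \<and> M \<subseteq> ser X c \<and> M \<noteq> ser X c}"
    have "{\<one>} \<in> \<M>"
      using pure_one n1 subgroup.one_closed[OF pureD(2)[OF S(1)]] by (auto simp: \<M>_def)
    moreover have "\<forall>M\<in>\<M>. mu M \<le> m" using mu_le by (auto simp: \<M>_def)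
    ultimately obtain M where M: "M \<in> \<M>" "\<And>M'. M' \<in> \<M> \<Longrightarrow> mu M' \<le> mu M"
      using ex_has_greatest_nat[of "\<lambda>M. M \<in> \<M>" "{\<one>}" mu "Suc m"] by (metis le_imp_less_Suc)
    have "simple_section (ser X c) M"
      unfolding simple_section_def
    proof (intro conjI allI impI)
      show "pure (ser X c)" "pure M" "M \<subseteq> ser X c" "M \<noteq> ser X c" using M(1) S(1) by (auto simp: \<M>_def)
      fix P assume P: "pure P" "M \<subseteq> P" "P \<subseteq> ser X c"
      show "P = M \<or> P = ser X c"
      proof (rule ccontr)
        assume "\<not> ?thesis"
        then have "P \<in> \<M>" "M \<noteq> P" using P by (auto simp: \<M>_def)
        then show False using mu_strict[OF P(1) _ P(2)] M by (force simp: \<M>_def)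
      qed
    qed
    then have "cm x h \<in> M" if "x \<in> X" "h \<in> ser X c" for x h
      using radicable_centralizes[OF X] that by blast
    then have "cm h x \<in> M" if "x \<in> X" "h \<in> ser X c" for x h
      using cm_swap_mem[of M x h] that M(1) pureD(2)[of M] pureD(7)[OF radicable_pure[OF X]] pureD(7)[OF S(1)]
      unfolding \<M>_def by blast
    then have "{cm k x |k x. k \<in> ser X c \<and> x \<in> X} \<subseteq> M" by blast
    then have "ser X (Suc c) \<subseteq> M" using M(1) unfolding ser.simps(2) \<M>_def by (intro pure_closure_least) auto
    then show False using eq M(1) by (auto simp: \<M>_def)
  qed
  then show ?thesis by (rule that)
qed

text \<open>Induction on \<open>i\<close>, with radicability as the base. In the step, the elements
  of \<open>ser X i\<close> whose commutators with \<open>X\<close> lie in \<open>B\<close> form a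
  pure subgroup. It contains \<open>ser X (Suc i)\<close> and all \<open>n\<close>-th powers,
  because the commutator of an \<open>n\<close>-th power is the \<open>n\<close>-th power of the
  commutator modulo \<open>B\<close>.\<close>

lemma ser_generated:
  assumes X: "radicable X" and B: "pure B" and n: "n > 0"
    and pow: "\<And>x. x \<in> ser X i \<Longrightarrow> x [^] (n::nat) \<in> B" and sub: "ser X (Suc i) \<subseteq> B"
  shows "ser X i \<subseteq> B"
  using B pow sub
proof (induction i arbitrary: B)
  case 0
  have "B \<inter> X = X"
  proof (rule radicable_eq[OF X pure_Int[OF 0(1) radicable_pure[OF X]] _ n])
    note s = pureD(2)[OF radicable_pure[OF X]]
    show "cm x y \<in> B \<inter> X" if "x \<in> X" "y \<in> X" for x y
      using ser_pure_subset(4)[OF radicable_pure[OF X], of x 0 y] that 0(3) subgroup_cm[OF s that] by auto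
    show "x [^] n \<in> B \<inter> X" if "x \<in> X" for x
      using that 0(2) subgroup_pow[OF s] by simp
  qed auto
  then show ?case by auto
next
  case (Suc i)
  note pX = radicable_pure[OF X]
  note S = ser_pure_subset[OF pX]
  have XC: "x \<in> C" if "x \<in> X" for x using that pureD(4)[OF pX] by blast
  have SX: "x \<in> X" if "x \<in> ser X j" for x j using that S(3) by blast
  note B = \<open>pure B\<close>
  \<comment> \<open>The index \<open>j\<close> and the iterates of \<phi> give \<open>Y\<close> the
    form of \<open>good_centralizer\<close> for constant families.\<close>
  define Y where "Y = {x \<in> ser X i. \<forall>k. \<forall>j::nat. \<forall>w\<in>X. cm ((\<phi> ^^ k) x) w \<in> B}"
  have "pure Y"
    unfolding pure_def
  proof (intro conjI ballI impI)
    show "good Y" unfolding Y_def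
      by (rule good_centralizer[OF pure_good[OF S(1)] pureD(1)[OF pX] pureD(1,3)[OF B]])
    fix x assume x: "x \<in> C" "\<phi> x \<in> Y"
    have "cm ((\<phi> ^^ k) x) w \<in> B" if w: "w \<in> X" for k w
    proof -
      have "cm ((\<phi> ^^ k) (\<phi> x)) (\<phi> w) \<in> B" using x(2) pureD(5)[OF pX w] by (simp add: Y_def)
      then have "\<phi> (cm ((\<phi> ^^ k) x) w) \<in> B" using x XC[OF w] by (simp add: funpow_swap1)
      then show ?thesis
        using pure_phi[OF B subgroup_cm[OF C_subgroup C_phik[OF x(1)] XC[OF w]]] by blast
    qed
    then show "x \<in> Y" using x pure_phi[OF S(1)] by (simp add: Y_def)
  qed
  have 1: "ser X i \<subseteq> Y"
  proof (rule Suc.IH[OF \<open>pure Y\<close>])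
    show "ser X (Suc i) \<subseteq> Y"
    proof
      fix x assume x: "x \<in> ser X (Suc i)"
      have "cm ((\<phi> ^^ k) x) w \<in> B" if "w \<in> X" for k w
        using S(4)[OF pureD(6)[OF S(1) x] that] Suc.prems(3) by blast
      then show "x \<in> Y" using x S(2) by (auto simp: Y_def)
    qed
    fix x assume x: "x \<in> ser X i"
    have "cm ((\<phi> ^^ k) (x [^] n)) w \<in> B" if w: "w \<in> X" for k w
    proof -
      let ?x = "(\<phi> ^^ k) x"
      have xs: "?x \<in> ser X i" using pureD(6)[OF S(1) x] .
      have car: "?x \<in> carrier G" "w \<in> carrier G" "x \<in> carrier G" using SX[OF x] SX[OF xs] w XC by auto
      have c: "cm ?x w \<in> ser X (Suc i)" using S(4)[OF xs w] .
      have "cm ?x (cm ?x w) \<in> B" using S(5)[OF c SX[OF xs]] Suc.prems(3) by blast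
      then have "cm (?x [^] n) w \<otimes> inv (cm ?x w [^] n) \<in> B"
        using pow_cm_mod[OF pureD(1)[OF B] car(1,2)] by blast
      moreover have "cm ?x w [^] n \<in> B" using Suc.prems(2)[OF c] .
      ultimately have "cm (?x [^] n) w \<otimes> inv (cm ?x w [^] n) \<otimes> cm ?x w [^] n \<in> B"
        using subgroup.m_closed[OF pureD(2)[OF B]] by blast
      then show ?thesis using car by (simp add: m_assoc)
    qed
    then show "x [^] n \<in> Y" using x subgroup_pow[OF pureD(2)[OF S(1)]] by (simp add: Y_def)
  qed
  show ?case
    unfolding ser.simps(2)
  proof (rule pure_closure_least[OF B])
    have "cm ((\<phi> ^^ 0) k) x \<in> B" if "k \<in> ser X i" "x \<in> X" for k x
      using 1 that unfolding Y_def by blast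
    then show "{cm k x |k x. k \<in> ser X i \<and> x \<in> X} \<subseteq> B" by auto
  qed
qed

lemma ser_abelian:
  assumes "pure X" "x \<in> ser X i" "y \<in> ser X i"
  shows "cm x y \<in> ser X (Suc i)"
  using ser_pure_subset(3,4)[OF assms(1)] assms by blast

text \<open>By \<open>ser_generated\<close> the \<open>n\<close>-th powers generate the factor up to
  purity, and \<open>pure_closure_good\<close> applies. Later this supplies both finite index of the
  powers and roots after a power of \<phi>.\<close>

lemma ser_pow:
  assumes X: "radicable X" and n: "n > 0"
  obtains k where "\<And>x. x \<in> ser X i \<Longrightarrow> (\<phi> ^^ k) x \<in> powers_mod n (ser X i) (ser X (Suc i))"
proof -
  note S = ser_pure_subset[OF radicable_pure[OF X]]
  have g: "good (powers_mod n (ser X i) (ser X (Suc i)))"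
    using good_powers_mod[OF pure_good[OF S(1)] pure_good[OF S(1)] S(2)] ser_abelian radicable_pure[OF X]
      by metis
  have "ser X i \<subseteq> P" if P: "pure P" "powers_mod n (ser X i) (ser X (Suc i)) \<subseteq> P" for P
  proof (rule ser_generated[OF X P(1) n])
    show "ser X (Suc i) \<subseteq> P" "\<And>x. x \<in> ser X i \<Longrightarrow> x [^] n \<in> P"
      using powers_mod_supset[OF pureD(2)[OF S(1)[of i]] pureD(1)[OF S(1)[of "Suc i"]], where n = n] P(2)
        by blast+
  qed
  then show ?thesis using pure_closure_good[OF g] that by metis
qed

lemma ser_torsion_free:
  assumes X: "radicable X" and n: "n > 0" and x: "x \<in> ser X i" "x [^] (n::nat) \<in> ser X (Suc i)"
  shows "x \<in> ser X (Suc i)"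
proof -
  note S = ser_pure_subset[OF radicable_pure[OF X]]
  obtain k where "\<And>x. x \<in> ser X i \<Longrightarrow> (\<phi> ^^ k) x \<in> powers_mod n (ser X i) (ser X (Suc i))"
    using ser_pow[OF X n, of i] by blast
  then show ?thesis
    using section_torsion_free[OF S(1) S(1) S(2) ser_abelian[OF radicable_pure[OF X]] _ x] by blast
qed

lemma radicable_torsion_free:
  assumes X: "radicable X" and n: "n > 0" and x: "x \<in> X" "x [^] (n::nat) = \<one>"
  shows "x = \<one>"
proof -
  obtain c where c: "ser X c = {\<one>}" using radicable_nilpotent[OF X] .
  have "x \<in> ser X i" for i
  proof (induction i)
    case (Suc i)
    then show ?case
      using ser_torsion_free[OF X n Suc] x subgroup.one_closed[OF pureD(2)[OF ser_pure_subset(1)[OF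
          radicable_pure[OF X]]]]
      by metis
  qed (use x in simp)
  then show ?thesis using c by auto
qed

end

section \<open>Splitting off the torsion\<close>

context comm_group
begin

text \<open>Let \<open>u\<close> be an automorphism with \<open>u ^^ N = id\<close> that is trivial modulo powers with exponent
  \<open>N * N\<close>. Summing \<open>u ^^ j\<close> over \<open>j < N\<close> gives a fixed element \<open>e\<close> close to \<open>a [^] N\<close>.\<close>

lemma finite_order_divisible:
  assumes u: "u \<in> hom G G" and N: "\<And>a. a \<in> carrier G \<Longrightarrow> (u ^^ N) a = a"
    and close: "\<And>a. a \<in> carrier G \<Longrightarrow> \<exists>b\<in>carrier G. u a = a \<otimes> b [^] (N * N)"
    and tf: "\<And>x. x \<in> carrier G \<Longrightarrow> x [^] N = \<one> \<Longrightarrow> x = \<one>"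
    and a: "a \<in> carrier G"
  shows "\<exists>b\<in>carrier G. u a \<otimes> inv a = (u b \<otimes> inv b) [^] N"
proof -
  interpret u: group_hom G G u using u by unfold_locales
  have uj: "(u ^^ j) x \<in> carrier G" if "x \<in> carrier G" for j x using that by (induction j) auto
  have uj': "\<exists>b\<in>carrier G. (u ^^ j) a = a \<otimes> b [^] (N * N)" for j
  proof (induction j)
    case 0
    show ?case using a by (intro bexI[of _ \<one>]) auto
  next
    case (Suc j)
    then obtain b where b: "b \<in> carrier G" "(u ^^ j) a = a \<otimes> b [^] (N * N)" by blast
    obtain c where c: "c \<in> carrier G" "u ((u ^^ j) a) = (u ^^ j) a \<otimes> c [^] (N * N)" using close uj[OF a]
      by blast
    then show ?case using b a by (intro bexI[of _ "b \<otimes> c"]) (auto simp: pow_mult_distrib m_ac)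
  qed
  \<comment> \<open>\<open>e\<close> is the product of the \<open>(u ^^ i) a\<close> over
    \<open>i < j\<close>, so the quotient of \<open>u e\<close> by \<open>e\<close> telescopes to
    that of \<open>(u ^^ j) a\<close> by \<open>a\<close>.\<close>
  have "\<exists>e\<in>carrier G. \<exists>t\<in>carrier G. u e \<otimes> inv e = (u ^^ j) a \<otimes> inv a \<and> e = a [^] j \<otimes> t [^] (N * N)" for j
  proof (induction j)
    case 0
    show ?case using a by (intro bexI[of _ \<one>]) auto
  next
    case (Suc j)
    then obtain e t where e: "e \<in> carrier G" "t \<in> carrier G" "u e \<otimes> inv e = (u ^^ j) a \<otimes> inv a"
      "e = a [^] j \<otimes> t [^] (N * N)" by blast
    obtain b where b: "b \<in> carrier G" "(u ^^ j) a = a \<otimes> b [^] (N * N)" using uj' by blast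
    let ?v = "(u ^^ j) a"
    have v: "?v \<in> carrier G" "u ?v \<in> carrier G" using uj[OF a] by auto
    have "u (e \<otimes> ?v) \<otimes> inv (e \<otimes> ?v) = (u e \<otimes> inv e) \<otimes> (u ?v \<otimes> inv ?v)"
      using e(1) v by (simp add: inv_mult m_ac)
    also have "\<dots> = (?v \<otimes> inv a) \<otimes> (u ?v \<otimes> inv ?v)" by (simp only: e(3))
    also have "\<dots> = (?v \<otimes> inv ?v) \<otimes> (u ?v \<otimes> inv a)" using v a by (simp add: m_ac)
    also have "\<dots> = (u ^^ Suc j) a \<otimes> inv a" using v a by simp
    finally have "u (e \<otimes> ?v) \<otimes> inv (e \<otimes> ?v) = (u ^^ Suc j) a \<otimes> inv a" .
    moreover have "e \<otimes> ?v = a [^] Suc j \<otimes> (t \<otimes> b) [^] (N * N)"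
      using e b a by (simp add: pow_mult_distrib m_ac)
    ultimately show ?case using e b v by (meson m_closed)
  qed
  from this[of N] obtain e t where e: "e \<in> carrier G" "t \<in> carrier G" "u e \<otimes> inv e = (u ^^ N) a \<otimes> inv a"
    "e = a [^] N \<otimes> t [^] (N * N)" by blast
  then have "u e \<otimes> inv e = \<one>" using N[OF a] a by simp
  have "u e \<otimes> inv e = (u a \<otimes> inv a) [^] N \<otimes> (u t \<otimes> inv t) [^] (N * N)"
    using e a by (simp add: pow_mult_distrib inv_mult nat_pow_inv u.hom_nat_pow m_ac)
  also have "\<dots> = ((u a \<otimes> inv a) \<otimes> (u t \<otimes> inv t) [^] N) [^] N"
    using e(1,2) a by (simp add: nat_pow_distrib nat_pow_pow)
  finally have "((u a \<otimes> inv a) \<otimes> (u t \<otimes> inv t) [^] N) [^] N = \<one>" using \<open>u e \<otimes> inv e = \<one>\<close> by metis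
  \<comment> \<open>Torsion-freeness removes one factor \<open>N\<close> of the exponent and the
    other one survives in the conclusion. This is why closeness is assumed modulo exponent
    \<open>N * N\<close>.\<close>
  then have 1: "(u a \<otimes> inv a) \<otimes> (u t \<otimes> inv t) [^] N = \<one>"
    using tf[of "(u a \<otimes> inv a) \<otimes> (u t \<otimes> inv t) [^] N"] e(2) a by simp
  have "u a \<otimes> inv a = inv ((u t \<otimes> inv t) [^] N)"
    using inv_equality[OF 1] e a by simp
  also have "\<dots> = (u (inv t) \<otimes> inv (inv t)) [^] N"
    using e by (simp add: nat_pow_inv[symmetric] inv_mult m_ac)
  finally show ?thesis using e by blast
qed

end

context group
begin

text \<open>Lagrange in \<open>P/Q\<close>. Unlike \<open>pow_fact_mem\<close> it keeps the exact
  index, whose prime divisors matter in \<open>pow_m_mem_I\<close>.\<close>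

lemma pow_idx_mem:
  assumes P: "subgroup P G" and Q: "Q \<lhd> G" "Q \<subseteq> P" "fin_idx P Q" and x: "x \<in> P"
  shows "x [^] (idx P Q) \<in> Q"
proof -
  interpret Q: normal Q G by fact
  interpret P: subgroup P G by fact
  let ?H = "G\<lparr>carrier := P\<rparr>"
  interpret H: group ?H using P.subgroup_is_group[OF group_axioms] .
  have "Q \<lhd> ?H" using normal_restrict_supergroup[OF P Q(1,2)] .
  interpret QH: normal Q ?H by fact
  interpret M: group "?H Mod Q" by (rule QH.factorgroup_is_group)
  have car: "carrier (?H Mod Q) = (\<lambda>x. Q #> x) ` P" by (simp add: carrier_FactGroup)
  have "(Q #> x) [^]\<^bsub>?H Mod Q\<^esub> order (?H Mod Q) = \<one>\<^bsub>?H Mod Q\<^esub>"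
    using M.pow_order_eq_1[of "Q #> x"] x car by blast
  moreover have "order (?H Mod Q) = idx P Q" by (simp add: order_def car idx_def)
  moreover have "(Q #> x) [^]\<^bsub>?H Mod Q\<^esub> idx P Q = Q #> (x [^] idx P Q)"
    using QH.FactGroup_pow[of x "idx P Q"] x by (simp add: nat_pow_consistent[symmetric])
  ultimately show ?thesis using coset_eq_self_iff[OF Q.subgroup_axioms] x by simp
qed

end

section \<open>The torsion of \<open>C\<close> and its complement\<close>

context contraction
begin

text \<open>The chain of abelian steps is recorded because it serves twice: for induction upwards
  from \<open>D\<close> in \<open>torsion_mult_closed\<close>, and for solubility of the torsion
  subgroup.\<close>

inductive ascends :: "'a set \<Rightarrow> 'a set \<Rightarrow> bool" for D where
  refl: "ascends D D"
| step: "ascends D A \<Longrightarrow> pure P \<Longrightarrow> A \<subseteq> P \<Longrightarrow> (\<And>x y. x \<in> P \<Longrightarrow> y \<in> P \<Longrightarrow> cm x y \<in> A) \<Longrightarrow> ascends D P"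

lemma ascends_trans: "ascends D P \<Longrightarrow> ascends A D \<Longrightarrow> ascends A P"
  by (induction rule: ascends.induct) (auto intro: ascends.step)

text \<open>\<open>D\<close> has minimal \<open>mu\<close> among the pure subgroups that are reached
  by abelian steps and contain a common power of all elements of \<open>C\<close>. A failure of
  radicability would allow one more step.\<close>

lemma radicable_residual:
  obtains D N where "radicable D" "ascends D C" "N > 0" "\<And>x. x \<in> C \<Longrightarrow> x [^] (N::nat) \<in> D"
proof -
  define \<D> where "\<D> = {D. pure D \<and> ascends D C \<and> (\<exists>N>0. \<forall>x\<in>C. x [^] (N::nat) \<in> D)}"
  have "C \<in> \<D>" using pure_C ascends.refl by (auto simp: \<D>_def intro!: exI[of _ 1])
  then obtain D where D: "D \<in> \<D>" "\<And>D'. D' \<in> \<D> \<Longrightarrow> mu D \<le> mu D'"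
    using ex_has_least_nat[of "\<lambda>D. D \<in> \<D>" C mu] by blast
  then obtain N where N: "N > 0" "\<And>x. x \<in> C \<Longrightarrow> x [^] (N::nat) \<in> D" and pD: "pure D" and aD: "ascends D C"
    unfolding \<D>_def by blast
  have "radicable D"
    unfolding radicable_def
  proof (intro conjI allI impI pD)
    fix A n assume A: "pure A" "A \<subseteq> D" "n > 0" "\<forall>x\<in>D. \<forall>y\<in>D. cm x y \<in> A" "\<forall>x\<in>D. x [^] (n::nat) \<in> A"
    have "ascends A D" using ascends.step[OF ascends.refl pD A(2)] A(4) by blast
    then have "ascends A C" using ascends_trans[OF aD] by blast
    moreover have "\<forall>x\<in>C. x [^] (N * n) \<in> A" using A(5) N(2) by (auto simp: nat_pow_pow[symmetric])
    ultimately have "A \<in> \<D>" using A N(1) by (auto simp: \<D>_def intro!: exI[of _ "N * n"])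
    then show "A = D" using mu_strict[OF pD A(1,2)] D(2)[of A] by force
  qed
  then show ?thesis using that aD N by blast
qed

lemma idx_phik: "idx C ((\<phi> ^^ k) ` C) = m ^ k"
proof (induction k)
  case 0
  have "C #> x = C" if "x \<in> C" for x using coset_eq_self_iff[OF C_subgroup] that by simp
  then have "(\<lambda>x. C #> x) ` C = {C}" using subgroup.one_closed[OF C_subgroup] by blast
  then show ?case by (simp add: idx_def)
next
  case (Suc k)
  have s: "subgroup ((\<phi> ^^ k) ` C) G" "subgroup ((\<phi> ^^ Suc k) ` C) G"
    using subgroup_phik_image[OF C_subgroup] by blast+
  have e: "(\<phi> ^^ Suc k) ` C = \<phi> ` ((\<phi> ^^ k) ` C)" by (auto simp: image_comp)
  have "\<phi> ` ((\<phi> ^^ k) ` C) \<subseteq> \<phi> ` C" using C_phik by blast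
  then have "idx C ((\<phi> ^^ Suc k) ` C) = idx C (\<phi> ` C) * idx (\<phi> ` C) (\<phi> ` ((\<phi> ^^ k) ` C))"
    unfolding e using idx_trans(1)[OF C_subgroup subgroup_phi_image[OF C_subgroup] s(2)[unfolded e] _
        phi_C] by simp
  also have "\<dots> = m * idx C ((\<phi> ^^ k) ` C)"
    using idx_phi(1)[OF s(1), of C] by (simp add: m_def subset_iff)
  finally show ?case using Suc by simp
qed

text \<open>For large \<open>k\<close> the image of \<open>C\<close> under
  \<open>\<phi> ^^ k\<close> lies in \<open>I n\<close>, and its index in \<open>C\<close> is
  \<open>m ^ k\<close>. So the order of \<open>C\<close> modulo \<open>I n\<close> divides a power
  of \<open>m\<close>: only primes dividing \<open>m\<close> occur in \<open>C\<close>.\<close>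

lemma pow_m_mem_I: "\<exists>k. \<forall>x\<in>C. x [^] (m ^ k) \<in> I n"
proof -
  obtain k where k: "\<forall>x\<in>C. (\<phi> ^^ k) x \<in> I n" using C_contr by blast
  have sub: "(\<phi> ^^ k) ` C \<subseteq> C \<inter> I n" using k C_phik by blast
  have "m ^ k = idx C (C \<inter> I n) * idx (C \<inter> I n) ((\<phi> ^^ k) ` C)"
    using idx_trans(1)[OF C_subgroup goodD(2)[OF good_CI] subgroup_phik_image[OF C_subgroup] sub]
        idx_phik by simp
  moreover have "x [^] idx C (C \<inter> I n) \<in> C \<inter> I n" if "x \<in> C" for x
    using pow_idx_mem[OF C_subgroup goodD(1)[OF good_CI] _ fin_idx_I[OF C_subgroup] that] by blast
  ultimately have "x [^] (m ^ k) \<in> I n" if "x \<in> C" for x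
    using subgroup_pow[OF goodD(2)[OF good_CI]] that by (metis C_carrier IntD2 nat_pow_pow)
  then show ?thesis by blast
qed

lemma coset_conj:
  assumes "Q \<lhd> G" "u \<in> carrier G" "a \<in> carrier G"
  shows "(\<lambda>x. u \<otimes> x \<otimes> inv u) ` (Q #> a) = Q #> (u \<otimes> a \<otimes> inv u)"
proof -
  interpret Q: normal Q G by fact
  show ?thesis
  proof (intro equalityI subsetI)
    fix z assume "z \<in> (\<lambda>x. u \<otimes> x \<otimes> inv u) ` (Q #> a)"
    then obtain q where q: "q \<in> Q" "z = u \<otimes> (q \<otimes> a) \<otimes> inv u" by (auto simp: r_coset_def)
    then have "z = (u \<otimes> q \<otimes> inv u) \<otimes> (u \<otimes> a \<otimes> inv u)" using assms by (simp add: m_assoc)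
    then show "z \<in> Q #> (u \<otimes> a \<otimes> inv u)" using Q.inv_op_closed2[OF assms(2) q(1)] by (auto simp: r_coset_def)
  next
    fix z assume "z \<in> Q #> (u \<otimes> a \<otimes> inv u)"
    then obtain q where q: "q \<in> Q" "z = q \<otimes> (u \<otimes> a \<otimes> inv u)" by (auto simp: r_coset_def)
    then have "z = u \<otimes> ((inv u \<otimes> q \<otimes> u) \<otimes> a) \<otimes> inv u" using assms by (simp add: m_assoc)
    then show "z \<in> (\<lambda>x. u \<otimes> x \<otimes> inv u) ` (Q #> a)" using Q.inv_op_closed1[OF assms(2) q(1)]
      by (auto simp: r_coset_def)
  qed
qed

text \<open>Conjugation by \<open>u\<close> is an automorphism \<open>v\<close> of the abelian group
  \<open>P/Q\<close> whose \<open>N\<close>-th iterate is the identity. By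
  \<open>finite_order_divisible\<close> each \<open>cm u a\<close> is the \<open>N\<close>-th power
  of some \<open>cm u b\<close> modulo \<open>Q\<close>. Iterating gives exponents
  \<open>N ^ k\<close> for all \<open>k\<close>, and such powers tend to \<open>\<one>\<close>
  because \<open>m\<close> divides \<open>N\<close>.\<close>

lemma section_finite_order_trivial:
  assumes P: "pure P" and Q: "pure Q" "Q \<subseteq> P" and c: "\<And>x y. x \<in> P \<Longrightarrow> y \<in> P \<Longrightarrow> cm x y \<in> Q"
    and tf: "\<And>x. x \<in> P \<Longrightarrow> x [^] N \<in> Q \<Longrightarrow> x \<in> Q" and mN: "m dvd N"
    and u: "u \<in> carrier G" and uN: "\<And>a. a \<in> P \<Longrightarrow> cm (u [^] N) a \<in> Q"
    and close: "\<And>a. a \<in> P \<Longrightarrow> cm u a \<in> powers_mod (N * N) P Q"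
    and a: "a \<in> P"
  shows "cm u a \<in> Q"
proof -
  interpret P: normal P G using pureD(1)[OF P] .
  interpret Q: normal Q G using pureD(1)[OF Q(1)] .
  have PC: "x \<in> C" if "x \<in> P" for x using that pureD(4)[OF P] by blast
  interpret M: group "G Mod Q" by (rule Q.factorgroup_is_group)
  have hom: "(#>) Q \<in> hom G (G Mod Q)" by (rule Q.r_coset_hom_Mod)
  interpret h: group_hom G "G Mod Q" "(#>) Q" using hom by unfold_locales
  note [simp del] = mult_FactGroup one_FactGroup h.hom_mult h.hom_inv
  define A where "A = (G Mod Q)\<lparr>carrier := (#>) Q ` P\<rparr>"
  have sA: "subgroup ((#>) Q ` P) (G Mod Q)" using h.subgroup_img_is_subgroup[OF P.subgroup_axioms] .
  interpret A: group A unfolding A_def using M.subgroup_imp_group[OF sA] .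
  have carA: "carrier A = (#>) Q ` P" by (simp add: A_def)
  have multA: "(Q #> x) \<otimes>\<^bsub>A\<^esub> (Q #> y) = Q #> (x \<otimes> y)" if "x \<in> P" "y \<in> P" for x y
    using that by (simp add: A_def h.hom_mult)
  have oneA: "\<one>\<^bsub>A\<^esub> = Q" by (simp add: A_def one_FactGroup)
  have invA: "inv\<^bsub>A\<^esub> (Q #> x) = Q #> inv x" if "x \<in> P" for x
    unfolding A_def using M.m_inv_consistent[OF sA] that by (simp add: h.hom_inv)
  have powA: "(Q #> x) [^]\<^bsub>A\<^esub> (n::nat) = Q #> (x [^] n)" if "x \<in> P" for x n
    unfolding A_def using that by (simp add: h.hom_nat_pow M.nat_pow_consistent[symmetric])
  interpret A: comm_group A
  proof (rule A.group_comm_groupI)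
    fix x y assume "x \<in> carrier A" "y \<in> carrier A"
    then obtain a b where ab: "a \<in> P" "b \<in> P" "x = Q #> a" "y = Q #> b" by (auto simp: carA)
    have "Q #> (a \<otimes> b) = Q #> (cm a b \<otimes> (b \<otimes> a))" using cm_mult ab by simp
    also have "\<dots> = Q #> (b \<otimes> a)"
      using coset_eq_iff[OF Q.subgroup_axioms, of "cm a b \<otimes> (b \<otimes> a)" "b \<otimes> a"] c[OF ab(1,2)] ab
        by (simp add: m_assoc)
    finally show "x \<otimes>\<^bsub>A\<^esub> y = y \<otimes>\<^bsub>A\<^esub> x" using ab multA by simp
  qed
  \<comment> \<open>Conjugation is applied to cosets as sets; by \<open>coset_conj\<close> it sends
    a coset of \<open>a\<close> to the coset of the conjugate of \<open>a\<close>.\<close>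
  define v where "v = (\<lambda>X. (\<lambda>x. u \<otimes> x \<otimes> inv u) ` X)"
  have v: "v (Q #> a) = Q #> (u \<otimes> a \<otimes> inv u)" if "a \<in> P" for a
    unfolding v_def using coset_conj[OF Q.normal_axioms u] that by simp
  have uP: "u \<otimes> a \<otimes> inv u \<in> P" if "a \<in> P" for a using P.inv_op_closed2[OF u that] .
  have vj: "(v ^^ j) (Q #> a) = Q #> (u [^] j \<otimes> a \<otimes> inv (u [^] j))" "u [^] j \<otimes> a \<otimes> inv (u [^] j) \<in> P"
    if "a \<in> P" for a and j :: nat
  proof (induction j)
    case (Suc j)
    { case 1
      have "(v ^^ Suc j) (Q #> a) = Q #> (u \<otimes> (u [^] j \<otimes> a \<otimes> inv (u [^] j)) \<otimes> inv u)"
        using Suc v by simp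
      also have "u \<otimes> (u [^] j \<otimes> a \<otimes> inv (u [^] j)) \<otimes> inv u = u [^] Suc j \<otimes> a \<otimes> inv (u [^] Suc j)"
        using u that by (simp only: nat_pow_Suc2) (simp add: m_assoc inv_mult_group)
      finally show ?case . }
    { case 2 show ?case using P.inv_op_closed2[of "u [^] Suc j" a] u that by simp }
  qed (use that in simp_all)
  have vA: "v \<in> hom A A"
  proof (rule homI)
    show "v x \<in> carrier A" if "x \<in> carrier A" for x using that v uP by (auto simp: carA)
    fix x y assume "x \<in> carrier A" "y \<in> carrier A"
    then obtain a b where ab: "a \<in> P" "b \<in> P" "x = Q #> a" "y = Q #> b" by (auto simp: carA)
    have "u \<otimes> (a \<otimes> b) \<otimes> inv u = (u \<otimes> a \<otimes> inv u) \<otimes> (u \<otimes> b \<otimes> inv u)" using u ab by (simp add: m_assoc)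
    then show "v (x \<otimes>\<^bsub>A\<^esub> y) = v x \<otimes>\<^bsub>A\<^esub> v y" using ab multA v uP by simp
  qed
  have vN: "(v ^^ N) x = x" if x: "x \<in> carrier A" for x
  proof -
    obtain a where a: "a \<in> P" "x = Q #> a" using x unfolding carA by blast
    then show ?thesis
      using vj(1)[OF a(1), of N] coset_eq_iff[OF Q.subgroup_axioms, of "u [^] N \<otimes> a \<otimes> inv (u [^] N)" a]
          uN[OF a(1)] u
      by (simp add: cm_def)
  qed
  have vclose: "\<exists>b\<in>carrier A. v x = x \<otimes>\<^bsub>A\<^esub> b [^]\<^bsub>A\<^esub> (N * N)" if x: "x \<in> carrier A" for x
  proof -
    obtain a where a: "a \<in> P" "x = Q #> a" using x unfolding carA by blast
    obtain b where b: "b \<in> P" "Q #> cm u a = Q #> b [^] (N * N)"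
      using close[OF a(1)] powers_mod_iff[OF P.subset Q.normal_axioms, of "cm u a" "N * N"] u a by auto
    have bP: "b [^] (N * N) \<in> P" using subgroup_pow[OF P.subgroup_axioms b(1)] .
    have cP: "cm u a \<in> P" using normal_cm(2)[OF P.normal_axioms a(1) u] .
    have "v x = Q #> (cm u a \<otimes> a)" using v[OF a(1)] a conj_eq_cm u by simp
    also have "\<dots> = (Q #> b [^] (N * N)) \<otimes>\<^bsub>A\<^esub> x" using multA[OF cP a(1)] a b by simp
    also have "\<dots> = x \<otimes>\<^bsub>A\<^esub> (Q #> b) [^]\<^bsub>A\<^esub> (N * N)" using powA[OF b(1)] a b bP by (simp add: A.m_comm carA)
    finally show ?thesis using b by (auto simp: carA)
  qed
  have vtf: "x = \<one>\<^bsub>A\<^esub>" if x: "x \<in> carrier A" "x [^]\<^bsub>A\<^esub> N = \<one>\<^bsub>A\<^esub>" for x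
  proof -
    obtain a where a: "a \<in> P" "x = Q #> a" using x unfolding carA by blast
    then have "Q #> (a [^] N) = Q" using x(2) powA oneA by simp
    then have "a [^] N \<in> Q" using coset_eq_self_iff[OF Q.subgroup_axioms] a by simp
    then show ?thesis using tf a coset_eq_self_iff[OF Q.subgroup_axioms] by (simp add: oneA)
  qed
  have div: "\<exists>b\<in>P. Q #> cm u a = Q #> (cm u b) [^] N" if aP: "a \<in> P" for a
  proof -
    have d: "v (Q #> a) \<otimes>\<^bsub>A\<^esub> inv\<^bsub>A\<^esub> (Q #> a) = Q #> cm u a" if "a \<in> P" for a
      using v[OF that] invA[OF that] multA[OF uP[OF that]] that by (simp add: cm_def)
    obtain B where "B \<in> carrier A" "v (Q #> a) \<otimes>\<^bsub>A\<^esub> inv\<^bsub>A\<^esub> (Q #> a) = (v B \<otimes>\<^bsub>A\<^esub> inv\<^bsub>A\<^esub> B) [^]\<^bsub>A\<^esub> N"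
      using A.finite_order_divisible[OF vA vN vclose vtf, of "Q #> a"] aP carA by blast
    then obtain b where b: "b \<in> P" "Q #> cm u a = (Q #> cm u b) [^]\<^bsub>A\<^esub> N" using d aP unfolding carA by auto
    moreover have "cm u b \<in> P" using normal_cm(2)[OF P.normal_axioms b(1) u] .
    ultimately show ?thesis using powA by auto
  qed
  have divk: "\<exists>b\<in>P. Q #> cm u a = Q #> (cm u b) [^] (N ^ k)" if "a \<in> P" for a k
  proof (induction k)
    case 0
    then show ?case using that u by (intro bexI[of _ a]) auto
  next
    case (Suc k)
    then obtain b where b: "b \<in> P" "Q #> cm u a = Q #> (cm u b) [^] (N ^ k)" by blast
    obtain b' where b': "b' \<in> P" "Q #> cm u b = Q #> (cm u b') [^] N" using div[OF b(1)] by blast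
    have cP: "cm u b \<in> P" "cm u b' \<in> P" using normal_cm(2)[OF P.normal_axioms _ u] b b' by auto
    have "Q #> (cm u b) [^] (N ^ k) = (Q #> cm u b) [^]\<^bsub>A\<^esub> (N ^ k)" using powA[OF cP(1)] by simp
    also have "\<dots> = Q #> ((cm u b') [^] N) [^] (N ^ k)"
      using b'(2) powA[OF subgroup_pow[OF P.subgroup_axioms cP(2)]] by simp
    also have "\<dots> = Q #> (cm u b') [^] (N ^ Suc k)" using cP by (simp add: nat_pow_pow)
    finally show ?case using b b' by auto
  qed
  show ?thesis
  proof (rule closed_mem[OF pureD(3)[OF Q(1)]])
    show "cm u a \<in> carrier G" using u a by simp
    fix n
    obtain k where k: "\<forall>x\<in>C. x [^] (m ^ k) \<in> I n" using pow_m_mem_I by blast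
    obtain b where b: "b \<in> P" "Q #> cm u a = Q #> (cm u b) [^] (N ^ k)" using divk[OF a] by blast
    obtain r where r: "N ^ k = m ^ k * r" using dvd_power_same[OF mN, of k] by blast
    have cP: "cm u b \<in> P" using normal_cm(2)[OF P.normal_axioms b(1) u] .
    then have "(cm u b) [^] (N ^ k) \<in> I n"
      using k PC subgroup_pow[OF I_subgroup] r by (metis C_carrier nat_pow_pow)
    moreover have "cm u a \<otimes> inv ((cm u b) [^] (N ^ k)) \<in> Q"
      using b coset_eq_iff[OF Q.subgroup_axioms, of "cm u a" "(cm u b) [^] (N ^ k)"] u a cP by simp
    ultimately show "\<exists>y\<in>I n. cm u a \<otimes> y \<in> Q" using subgroup.m_inv_closed[OF I_subgroup] by blast
  qed
qed

text \<open>\<open>D\<close> acts trivially on the factor and contains the \<open>N\<close>-th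
  powers of \<open>C\<close>, so \<open>C\<close> acts with finite exponent. After a power of \<phi>
  the action is also trivial modulo \<open>M * M\<close>-th powers, as these have finite index, and
  \<open>section_finite_order_trivial\<close> applies.\<close>

lemma radicable_central_series:
  assumes X: "radicable D" and N: "N > 0" "\<And>x. x \<in> C \<Longrightarrow> x [^] (N::nat) \<in> D"
    and a: "a \<in> ser D i" and c: "c \<in> C"
  shows "cm c a \<in> ser D (Suc i)"
proof -
  note S = ser_pure_subset[OF radicable_pure[OF X]]
  let ?P = "ser D i" and ?Q = "ser D (Suc i)"
  \<comment> \<open>The exponent is enlarged so that \<open>m\<close> divides it.\<close>
  define M where "M = N * m"
  have M: "M > 0" "m dvd M" using N m_pos by (auto simp: M_def)
  have CM: "x [^] M \<in> D" if "x \<in> C" for x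
    using subgroup_pow[OF pureD(2)[OF radicable_pure[OF X]] N(2)[OF that], of m] that
    by (simp add: M_def nat_pow_pow)
  have PC: "x \<in> C" if "x \<in> ser D j" for x j using that pureD(4)[OF S(1)] by blast
  obtain k where k: "\<And>x. x \<in> ?P \<Longrightarrow> (\<phi> ^^ k) x \<in> powers_mod (M * M) ?P ?Q"
    using ser_pow[OF X, of "M * M" i] M by auto
  have Lg: "good (powers_mod (M * M) ?P ?Q)"
    using good_powers_mod[OF pure_good[OF S(1)] pure_good[OF S(1)] S(2)] ser_abelian radicable_pure[OF X]
      by metis
  have LP: "powers_mod (M * M) ?P ?Q \<subseteq> ?P" by (rule powers_mod_subset[OF pureD(2)[OF S(1)] S(2)])
  have fL: "fin_idx ?P (powers_mod (M * M) ?P ?Q)"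
    using idx_trans(3)[OF pureD(2)[OF S(1)] goodD(2)[OF Lg] subgroup_phik_image[OF pureD(2)[OF S(1)], of
        k] _ LP]
      fin_idx_phik[OF pure_good[OF S(1)]] k by blast
  obtain j where j: "\<forall>x\<in>C. (\<phi> ^^ j) x \<in> I (idx ?P (powers_mod (M * M) ?P ?Q))" using C_contr by blast
  have "cm ((\<phi> ^^ j) c) ((\<phi> ^^ j) a) \<in> ?Q"
  proof (rule section_finite_order_trivial[OF S(1) S(1) S(2) ser_abelian[OF radicable_pure[OF X]]])
    show "m dvd M" by (rule M(2))
    show "x \<in> ?Q" if "x \<in> ?P" "x [^] M \<in> ?Q" for x using ser_torsion_free[OF X M(1) that] .
    show "(\<phi> ^^ j) c \<in> carrier G" using c by simp
    show "(\<phi> ^^ j) a \<in> ?P" using pureD(6)[OF S(1) a] .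
    fix b assume b: "b \<in> ?P"
    show "cm (((\<phi> ^^ j) c) [^] M) b \<in> ?Q" using S(5)[OF b CM[OF C_phik[OF c]]] .
    have "cm b ((\<phi> ^^ j) c) \<in> powers_mod (M * M) ?P ?Q"
      using I_centralizes[OF pureD(1)[OF S(1)] goodD(1,3)[OF Lg] LP fL order_refl b] j c by blast
    then show "cm ((\<phi> ^^ j) c) b \<in> powers_mod (M * M) ?P ?Q"
      using cm_swap_mem[OF goodD(2)[OF Lg]] PC[OF b] c by simp
  qed
  then have "(\<phi> ^^ j) (cm c a) \<in> ?Q" using c PC[OF a] by simp
  then show ?thesis using pure_phik[OF S(1) subgroup_cm[OF C_subgroup c PC[OF a]]] by blast
qed

text \<open>Downwards along \<open>ser D\<close>: if \<open>x [^] N\<close> lies in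
  \<open>ser D i\<close>, then after a power of \<phi> it is the \<open>N\<close>-th power of some
  \<open>y\<close> modulo the next term. As \<open>C\<close> centralises the factor, the
  \<open>N\<close>-th power of \<open>x \<otimes> inv y\<close> falls into that term. When the
  series reaches \<open>\<one>\<close>, a torsion element remains.\<close>

lemma torsion_complement:
  assumes X: "radicable D" and N: "N > 0" "\<And>x. x \<in> C \<Longrightarrow> x [^] (N::nat) \<in> D"
  obtains K where "\<And>x. x \<in> C \<Longrightarrow> \<exists>y\<in>D. ((\<phi> ^^ K) x \<otimes> y) [^] N = \<one>"
proof -
  note S = ser_pure_subset[OF radicable_pure[OF X]]
  note Ds = pureD(2)[OF radicable_pure[OF X]]
  have PC: "x \<in> C" if "x \<in> ser D j" for x j using that pureD(4)[OF S(1)] by blast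
  obtain c where c: "ser D c = {\<one>}" using radicable_nilpotent[OF X] .
  have "\<exists>K. \<forall>x\<in>C. x [^] N \<in> ser D i \<longrightarrow> (\<exists>y\<in>D. ((\<phi> ^^ K) x \<otimes> y) [^] N = \<one>)" if "i \<le> c" for i
    using that
  proof (induction i rule: inc_induct)
    case base
    have "\<exists>y\<in>D. ((\<phi> ^^ 0) x \<otimes> y) [^] N = \<one>" if "x \<in> C" "x [^] N \<in> ser D c" for x
      using that c subgroup.one_closed[OF Ds] by (intro bexI[of _ \<one>]) auto
    then show ?case by blast
  next
    case (step i)
    let ?Q = "ser D (Suc i)"
    interpret Q: normal ?Q G using pureD(1)[OF S(1)] .
    obtain K where K: "\<And>x. x \<in> C \<Longrightarrow> x [^] N \<in> ?Q \<Longrightarrow> \<exists>y\<in>D. ((\<phi> ^^ K) x \<otimes> y) [^] N = \<one>"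
      using step.IH by blast
    obtain k where k: "\<And>x. x \<in> ser D i \<Longrightarrow> (\<phi> ^^ k) x \<in> powers_mod N (ser D i) ?Q"
      using ser_pow[OF X N(1), of i] by blast
    have "\<exists>y\<in>D. ((\<phi> ^^ (K + k)) x \<otimes> y) [^] N = \<one>" if x: "x \<in> C" "x [^] N \<in> ser D i" for x
    proof -
      have "(\<phi> ^^ k) (x [^] N) \<in> powers_mod N (ser D i) ?Q" using k[OF x(2)] .
      then obtain z y where zy: "z \<in> ?Q" "y \<in> ser D i" "((\<phi> ^^ k) x) [^] N = z \<otimes> y [^] N"
        using x by (auto simp: powers_mod_def)
      let ?x = "(\<phi> ^^ k) x"
      have car: "?x \<in> C" "y \<in> C" "z \<in> C" using zy PC C_phik x by auto
      have iy: "inv y \<in> ser D i" "inv y \<in> C"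
        using subgroup.m_inv_closed[OF pureD(2)[OF S(1)] zy(2)] PC by auto
      have "cm ?x (inv y) \<in> ?Q" using radicable_central_series[OF X N iy(1) car(1)] .
      then have "?Q #> (?x \<otimes> inv y) [^] N = ?Q #> (?x [^] N \<otimes> inv (y [^] N))"
        using pow_mult_inv_coset[OF Q.normal_axioms] car by simp
      also have "?x [^] N \<otimes> inv (y [^] N) = z" using zy(3) car by (simp add: m_assoc)
      also have "?Q #> z = ?Q" using coset_eq_self_iff[OF Q.subgroup_axioms] car zy(1) by simp
      finally have "(?x \<otimes> inv y) [^] N \<in> ?Q" using coset_eq_self_iff[OF Q.subgroup_axioms] car by simp
      moreover have "?x \<otimes> inv y \<in> C" using car(1) iy(2) subgroup.m_closed[OF C_subgroup] by blast
      ultimately obtain y' where y': "y' \<in> D" "((\<phi> ^^ K) (?x \<otimes> inv y) \<otimes> y') [^] N = \<one>" using K by blast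
      have "y' \<in> carrier G" using y'(1) subgroup.mem_carrier[OF Ds] by blast
      then have "(\<phi> ^^ K) (?x \<otimes> inv y) \<otimes> y' = (\<phi> ^^ (K + k)) x \<otimes> ((\<phi> ^^ K) (inv y) \<otimes> y')"
        using car by (simp add: phik_add m_assoc)
      moreover have "(\<phi> ^^ K) (inv y) \<otimes> y' \<in> D"
        using subgroup.m_closed[OF Ds pureD(6)[OF radicable_pure[OF X]] y'(1)] iy(1) S(3) by blast
      ultimately show ?thesis using y'(2) by auto
    qed
    then show ?case by blast
  qed
  from this[of 0] obtain K where "\<forall>x\<in>C. x [^] N \<in> D \<longrightarrow> (\<exists>y\<in>D. ((\<phi> ^^ K) x \<otimes> y) [^] N = \<one>)" by auto
  then show ?thesis using that N(2) by blast
qed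

text \<open>If \<open>z = cm t y\<close> lies in \<open>ser D i\<close>, then \<open>cm t z\<close>
  lies one term lower. So \<open>z [^] N\<close> agrees with \<open>cm (t [^] N) y = \<one>\<close>
  modulo that term, and torsion-freeness of the factor pushes \<open>z\<close> down.\<close>

lemma torsion_centralizes:
  assumes X: "radicable D" and N: "N > 0" "\<And>x. x \<in> C \<Longrightarrow> x [^] (N::nat) \<in> D"
    and t: "t \<in> C" "t [^] N = \<one>" and y: "y \<in> D"
  shows "cm t y = \<one>"
proof -
  note S = ser_pure_subset[OF radicable_pure[OF X]]
  obtain c where c: "ser D c = {\<one>}" using radicable_nilpotent[OF X] .
  have yC: "y \<in> carrier G" using y pureD(7)[OF radicable_pure[OF X]] by blast
  have tC: "t \<in> carrier G" using t by simp
  have "cm t y \<in> ser D i" for i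
  proof (induction i)
    case 0
    show ?case using normal_cm(2)[OF pureD(1)[OF radicable_pure[OF X]] y tC] by simp
  next
    case (Suc i)
    let ?z = "cm t y"
    have "cm t ?z \<in> ser D (Suc i)" using radicable_central_series[OF X N Suc t(1)] .
    then have "cm (t [^] N) y \<otimes> inv (?z [^] N) \<in> ser D (Suc i)"
      using pow_cm_mod[OF pureD(1)[OF S(1)] tC yC] by blast
    then have "inv (?z [^] N) \<in> ser D (Suc i)" using t yC tC by simp
    then have "?z [^] N \<in> ser D (Suc i)"
      using subgroup.m_inv_closed[OF pureD(2)[OF S(1)]] yC tC by (metis cm_closed inv_inv nat_pow_closed)
    then show ?case using ser_torsion_free[OF X N(1) Suc] by blast
  qed
  then show ?thesis using c by auto
qed

text \<open>Induction along the abelian chain, with \<open>E\<close> the torsion of the previous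
  term. After a power of \<phi> the commutator of the two elements splits into an
  \<open>E\<close>-part and a \<open>D\<close>-part. The latter turns out to be torsion, hence
  trivial, and modulo \<open>E\<close> the two elements commute.\<close>

lemma torsion_mult_closed:
  assumes X: "radicable D" and N: "N > 0" "\<And>x. x \<in> C \<Longrightarrow> x [^] (N::nat) \<in> D"
    and asc: "ascends D P" and xy: "x \<in> P" "y \<in> P" "x [^] N = \<one>" "y [^] N = \<one>"
  shows "(x \<otimes> y) [^] N = \<one>"
proof -
  note pD = radicable_pure[OF X]
  obtain K where K: "\<And>x. x \<in> C \<Longrightarrow> \<exists>y\<in>D. ((\<phi> ^^ K) x \<otimes> y) [^] N = \<one>"
    using torsion_complement[OF X N] by blast
  have tD: "x = \<one>" if "x \<in> D" "x [^] (n::nat) = \<one>" "n > 0" for x n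
    using radicable_torsion_free[OF X that(3,1,2)] .
  have DC: "x \<in> C" if "x \<in> D" for x using that pureD(4)[OF pD] by blast
  have "pure P \<and> D \<subseteq> P \<and> (\<forall>x\<in>P. \<forall>y\<in>P. x [^] N = \<one> \<longrightarrow> y [^] N = \<one> \<longrightarrow> (x \<otimes> y) [^] N = \<one>)"
    using asc
  proof (induction rule: ascends.induct)
    case refl
    have "(x \<otimes> y) [^] N = \<one>" if "x \<in> D" "y \<in> D" "x [^] N = \<one>" "y [^] N = \<one>" for x y
      using tD[OF _ _ N(1)] that by (metis nat_pow_one one_closed r_one)
    then show ?case using pD by blast
  next
    case (step A P)
    have pA: "pure A" and DA: "D \<subseteq> A" using step by auto
    have PC: "x \<in> C" if "x \<in> P" for x using that pureD(4)[OF step(2)] by blast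
    define E where "E = {x \<in> A. x [^] N = \<one>}"
    interpret A: normal A G using pureD(1)[OF pA] .
    have Ec: "x \<in> carrier G" if "x \<in> E" for x using that by (simp add: E_def)
    have En: "E \<lhd> G"
    proof (rule normalI')
      show "subgroup E G"
        using step by (intro subgroupI) (auto simp: E_def nat_pow_inv intro: exI[of _ \<one>])
      show "g \<otimes> x \<otimes> inv g \<in> E" if "x \<in> E" "g \<in> carrier G" for x g
        using that A.inv_op_closed2 by (simp add: E_def conj_pow)
    qed
    interpret E: normal E G by (rule En)
    have "(x \<otimes> y) [^] N = \<one>" if x: "x \<in> P" "x [^] N = \<one>" and y: "y \<in> P" "y [^] N = \<one>" for x y
    proof -
      let ?x = "(\<phi> ^^ K) x" and ?y = "(\<phi> ^^ K) y"
      have car: "x \<in> carrier G" "y \<in> carrier G" "?x \<in> C" "?y \<in> C" using PC x y C_phik by auto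
      have car': "?x \<in> carrier G" "?y \<in> carrier G" using car by auto
      have tor: "?x [^] N = \<one>" "?y [^] N = \<one>" using x y car by (simp_all flip: phik_pow)
      have wA: "cm x y \<in> A" "cm ?x ?y \<in> A"
        using step(4)[OF x(1) y(1)] step(4)[OF pureD(6)[OF step(2) x(1)] pureD(6)[OF step(2) y(1)]] by auto
      have wC: "cm x y \<in> C" using subgroup_cm[OF C_subgroup PC[OF x(1)] PC[OF y(1)]] .
      obtain d where d: "d \<in> D" "(cm ?x ?y \<otimes> d) [^] N = \<one>" using K[OF wC] car by auto
      have dc: "d \<in> carrier G" using DC[OF d(1)] by simp
      define e where "e = cm ?x ?y \<otimes> d"
      have e: "e \<in> E" unfolding E_def e_def using d wA(2) DA by auto
      have ec: "e \<in> carrier G" "e \<in> C" using e Ec pureD(4)[OF pA] by (auto simp: E_def)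
      have w: "cm ?x ?y = e \<otimes> inv d" unfolding e_def using dc car' by (simp add: m_assoc)
      have id: "inv d \<in> D" using d(1) subgroup.m_inv_closed[OF pureD(2)[OF pD]] by blast
      have xd: "cm ?x (inv d) = \<one>" using torsion_centralizes[OF X N car(3) tor(1) id] .
      have ed: "e \<otimes> inv d = inv d \<otimes> e"
        using torsion_centralizes[OF X N ec(2) _ id] e cm_eq_one_iff[of e "inv d"] ec dc by (simp add: E_def)
      \<comment> \<open>The torsion element \<open>?x\<close> centralises the \<open>D\<close>-part,
        so only \<open>e\<close> contributes and the double commutator lies in \<open>E\<close>.
        Then \<open>cm ?x ?y [^] N\<close> agrees with \<open>cm (?x [^] N) ?y = \<one>\<close>
        modulo \<open>E\<close>.\<close>
      have "cm ?x (cm ?x ?y) = cm ?x e"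
        unfolding w using cm_mult_right[of e "inv d" ?x] ec dc car' xd by simp
      then have "cm ?x (cm ?x ?y) \<in> E" using normal_cm(2)[OF En e car'(1)] by simp
      then have "cm (?x [^] N) ?y \<otimes> inv (cm ?x ?y [^] N) \<in> E" using pow_cm_mod[OF En car'] by blast
      then have "inv (cm ?x ?y [^] N) \<in> E" using tor car' by simp
      then have "cm ?x ?y [^] N \<in> E" using E.m_inv_closed car' by (metis cm_closed inv_inv nat_pow_closed)
      moreover have "cm ?x ?y [^] N = inv d [^] N"
        unfolding w using pow_mult_distrib[OF ed] e ec dc by (simp add: E_def)
      ultimately have "(inv d [^] N) [^] N = \<one>" by (simp add: E_def)
      then have "inv d = \<one>" using tD[OF id, of "N * N"] N(1) dc by (simp add: nat_pow_pow)
      then have "cm ?x ?y \<in> E" using w e ec by simp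
      then have "(?x \<otimes> ?y) [^] N \<otimes> inv (?x [^] N \<otimes> ?y [^] N) \<in> E" using pow_mult_mod[OF En car'] by blast
      then have "((?x \<otimes> ?y) [^] N) [^] N = \<one>" using tor car' by (simp add: E_def)
      then have "(\<phi> ^^ K) (((x \<otimes> y) [^] N) [^] N) = (\<phi> ^^ K) \<one>" using car by simp
      then have z: "((x \<otimes> y) [^] N) [^] N = \<one>" using phik_eq[of "((x \<otimes> y) [^] N) [^] N" \<one> K] car by simp
      \<comment> \<open>Known so far is exponent \<open>N * N\<close>; the \<open>N\<close>-th power
        lies in the torsion-free \<open>D\<close>, which improves this to \<open>N\<close>.\<close>
      have "(x \<otimes> y) [^] N \<in> D" using N(2) subgroup.m_closed[OF C_subgroup PC[OF x(1)] PC[OF y(1)]] by blast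
      then show ?thesis using tD[OF _ z N(1)] by blast
    qed
    then show ?case using step DA by blast
  qed
  then show ?thesis using xy by blast
qed

theorem torsion_splitting:
  obtains D E K N where "radicable D" "ascends D C" "good E" "N > 0" "\<And>x. x \<in> E \<Longrightarrow> x [^] (N::nat) = \<one>"
    "\<And>d e. d \<in> D \<Longrightarrow> e \<in> E \<Longrightarrow> d \<otimes> e = e \<otimes> d" "D \<inter> E = {\<one>}"
    "\<And>x. x \<in> C \<Longrightarrow> \<exists>d\<in>D. \<exists>e\<in>E. (\<phi> ^^ K) x = d \<otimes> e"
proof -
  obtain D N where X: "radicable D" "ascends D C" and N: "N > 0" "\<And>x. x \<in> C \<Longrightarrow> x [^] (N::nat) \<in> D"
    using radicable_residual by blast
  note pD = radicable_pure[OF X(1)]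
  define E where "E = {x \<in> C. x [^] N = \<one>}"
  obtain K where K: "\<And>x. x \<in> C \<Longrightarrow> \<exists>y\<in>D. ((\<phi> ^^ K) x \<otimes> y) [^] N = \<one>"
    using torsion_complement[OF X(1) N] by blast
  have DC: "x \<in> C" if "x \<in> D" for x using that pureD(4)[OF pD] by blast
  have En: "E \<lhd> G"
  proof (rule normalI')
    show "subgroup E G"
      using torsion_mult_closed[OF X(1) N X(2)] C_subgroup
      by (intro subgroupI) (auto simp: E_def nat_pow_inv subgroup.m_closed subgroup.m_inv_closed
          intro: exI[of _ \<one>] subgroup.one_closed)
    show "g \<otimes> x \<otimes> inv g \<in> E" if "x \<in> E" "g \<in> carrier G" for x g
      using that normal_conj[OF C_normal] by (simp add: E_def conj_pow)
  qed
  have "closedin T (C \<inter> {x \<in> carrier G. x [^] N \<in> {\<one>}})"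
    by (intro closedin_Int C_closed closedin_preimage continuous_map_pow continuous_map_id' closedin_one)
  moreover have "C \<inter> {x \<in> carrier G. x [^] N \<in> {\<one>}} = E" by (auto simp: E_def)
  ultimately have Eg: "good E"
    unfolding good_def using En C_phi by (auto simp: E_def simp flip: phi_pow)
  have com: "d \<otimes> e = e \<otimes> d" if "d \<in> D" "e \<in> E" for d e
    using torsion_centralizes[OF X(1) N _ _ that(1), of e] that cm_eq_one_iff[of e d] DC by (simp add: E_def)
  show ?thesis
  proof (rule that[OF X Eg N(1)])
    show "x [^] N = \<one>" if "x \<in> E" for x using that by (simp add: E_def)
    show "D \<inter> E = {\<one>}"
      using radicable_torsion_free[OF X(1) N(1)] subgroup.one_closed[OF pureD(2)[OF pD]]
        subgroup.one_closed[OF goodD(2)[OF Eg]] by (auto simp: E_def)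
    show "\<exists>d\<in>D. \<exists>e\<in>E. (\<phi> ^^ K) x = d \<otimes> e" if x: "x \<in> C" for x
    proof -
      obtain y where y: "y \<in> D" "((\<phi> ^^ K) x \<otimes> y) [^] N = \<one>" using K[OF x] by blast
      have yc: "y \<in> carrier G" using DC[OF y(1)] by simp
      have iy: "inv y \<in> D" using subgroup.m_inv_closed[OF pureD(2)[OF pD] y(1)] .
      have e: "(\<phi> ^^ K) x \<otimes> y \<in> E"
        using y C_phik[OF x] DC[OF y(1)] subgroup.m_closed[OF C_subgroup] by (simp add: E_def)
      have "(\<phi> ^^ K) x = ((\<phi> ^^ K) x \<otimes> y) \<otimes> inv y" using x yc by (simp add: m_assoc)
      also have "\<dots> = inv y \<otimes> ((\<phi> ^^ K) x \<otimes> y)" using com[OF iy e] by simp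
      finally show ?thesis using iy e by blast
    qed
  qed (rule com)
qed

end

section \<open>Primary parts\<close>

context group
begin

lemma subgroup_set_mult':
  assumes A: "subgroup A G" and B: "subgroup B G" and n: "\<And>a b. a \<in> A \<Longrightarrow> b \<in> B \<Longrightarrow> a \<otimes> b \<otimes> inv a \<in> B"
  shows "subgroup (A <#> B) G"
proof -
  interpret A: subgroup A G by fact
  interpret B: subgroup B G by fact
  show ?thesis
  proof (rule subgroupI)
    show "A <#> B \<subseteq> carrier G" by (auto simp: set_mult_def)
    show "A <#> B \<noteq> {}" unfolding set_mult_def using A.one_closed B.one_closed by blast
    fix x assume "x \<in> A <#> B"
    then obtain a b where ab: "a \<in> A" "b \<in> B" "x = a \<otimes> b" by (auto simp: set_mult_def)
    have "inv x = inv a \<otimes> (a \<otimes> inv b \<otimes> inv a)"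
      using ab by (simp add: inv_mult_group m_assoc)
    then show "inv x \<in> A <#> B"
      using ab n[of a "inv b"] by (auto simp: set_mult_def)
    fix y assume "y \<in> A <#> B"
    then obtain c d where cd: "c \<in> A" "d \<in> B" "y = c \<otimes> d" by (auto simp: set_mult_def)
    have "x \<otimes> y = (a \<otimes> c) \<otimes> ((inv c \<otimes> b \<otimes> inv (inv c)) \<otimes> d)"
      using ab cd by (simp add: m_assoc)
    moreover have "inv c \<otimes> b \<otimes> inv (inv c) \<in> B"
      using ab cd n[of "inv c" b] by blast
    ultimately show "x \<otimes> y \<in> A <#> B"
      using ab cd by (auto simp: set_mult_def)
  qed
qed

lemma conj_mem_of_cm:
  assumes "subgroup B G" "b \<in> B" "g \<in> carrier G" "cm g b \<in> B"
  shows "g \<otimes> b \<otimes> inv g \<in> B"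
  using assms conj_eq_cm[of g b] subgroup.m_closed subgroup.mem_carrier by metis

text \<open>The subgroup \<open>M\<close> generated by \<open>x\<close> and \<open>K 1\<close> is normalised by \<open>K 0\<close> and has smaller class, so
  by induction its torsion elements form a normal subgroup; modulo this subgroup
  \<open>x \<otimes> y\<close> equals \<open>y\<close>.\<close>

lemma nilpotent_torsion_mult:
  assumes "\<And>i. subgroup (K i) G" "\<And>i. K (Suc i) \<subseteq> K i"
    and "\<And>i x y. x \<in> K i \<Longrightarrow> y \<in> K 0 \<Longrightarrow> cm x y \<in> K (Suc i)" and "K (Suc c) = {\<one>}"
    and "x \<in> K 0" "y \<in> K 0" "x [^] ((r::nat) ^ a) = \<one>" "y [^] (r ^ b) = \<one>"
  shows "\<exists>j. (x \<otimes> y) [^] (r ^ j) = \<one>"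
  using assms
proof (induction c arbitrary: K x y a b)
  case 0
  interpret K: subgroup "K 0" G by (rule 0(1))
  have "cm x y = \<one>" using 0(3)[OF 0(5,6)] 0(4) by simp
  then have c: "x \<otimes> y = y \<otimes> x" using cm_eq_one_iff 0 by simp
  have "(x \<otimes> y) [^] (r ^ (a + b)) = x [^] (r ^ (a + b)) \<otimes> y [^] (r ^ (a + b))"
    using pow_mult_distrib[OF c] 0 by simp
  also have "x [^] (r ^ (a + b)) = (x [^] (r ^ a)) [^] (r ^ b)"
    using K.mem_carrier[OF 0(5)] by (simp add: nat_pow_pow power_add)
  also have "y [^] (r ^ (a + b)) = (y [^] (r ^ b)) [^] (r ^ a)"
    using K.mem_carrier[OF 0(6)] by (simp add: nat_pow_pow power_add mult.commute)
  finally show ?case using 0 by (intro exI[of _ "a + b"]) simp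
next
  case (Suc c)
  note K = Suc.prems(1-4) and xy = Suc.prems(5-8)
  interpret K0: subgroup "K 0" G by (rule K(1))
  interpret K1: subgroup "K 1" G by (rule K(1))
  interpret K2: subgroup "K 2" G by (rule K(1))
  have K2': "K (Suc (Suc 0)) = K 2" by (simp add: numeral_2_eq_2)
  have Kdec: "K i \<subseteq> K 0" for i by (induction i) (use K(2) in auto)
  have Kc: "k \<in> carrier G" if "k \<in> K i" for k i using that Kdec K0.subset by blast
  have Kn: "g \<otimes> k \<otimes> inv g \<in> K i" if "k \<in> K i" "g \<in> K 0" for k g i
  proof -
    have "cm k g \<in> K i" using K(3)[OF that] K(2) by blast
    then have "cm g k \<in> K i" using cm_swap_mem[OF K(1)] Kc that by blast
    then show ?thesis using conj_mem_of_cm[OF K(1) that(1)] Kc that(2) by blast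
  qed
  define Z where "Z = generate G {x}"
  have xc: "x \<in> carrier G" using xy by simp
  have Z: "subgroup Z G" unfolding Z_def using generate_is_subgroup xc by simp
  interpret Z: subgroup Z G by (rule Z)
  have xZ: "x \<in> Z" unfolding Z_def by (simp add: generate.incl)
  have Zpow: "\<exists>k::int. z = x [^] k" if "z \<in> Z" for z using that generate_pow[OF xc] by (auto simp: Z_def)
  have ZK: "Z \<subseteq> K 0" unfolding Z_def using generate_subgroup_incl[OF _ K(1)] xy by simp
  have Zcom: "cm z z' = \<one>" if zz: "z \<in> Z" "z' \<in> Z" for z z'
  proof -
    obtain k l :: int where "z = x [^] k" "z' = x [^] l" using Zpow[OF zz(1)] Zpow[OF zz(2)] by auto
    then have "z \<otimes> z' = z' \<otimes> z" using int_pow_mult[OF xc, of k l] int_pow_mult[OF xc, of l k]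
      by (simp add: add.commute)
    then show ?thesis using cm_eq_one_iff zz by simp
  qed
  define M where "M = Z <#> K 1"
  have M: "subgroup M G" unfolding M_def using subgroup_set_mult'[OF Z K(1)] Kn ZK by blast
  interpret M: subgroup M G by (rule M)
  have MK: "M \<subseteq> K 0" unfolding M_def using ZK K(2)[of 0] by (intro set_mult_subset K) auto
  have K1M: "K 1 \<subseteq> M" and ZM: "Z \<subseteq> M" unfolding M_def using set_mult_supset[OF Z K(1)] by auto
  have cM: "cm u w \<in> K 2" if uw: "u \<in> M" "w \<in> M" for u w
  proof -
    obtain z k z' k' where zk: "z \<in> Z" "k \<in> K 1" "u = z \<otimes> k" "z' \<in> Z" "k' \<in> K 1" "w = z' \<otimes> k'"
      using uw unfolding M_def set_mult_def by blast
    have wK: "w \<in> K 0" using uw MK by blast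
    have 1: "cm k w \<in> K 2" using K(3)[of k 1 w] zk(2) wK K2' by simp
    have 2: "z \<otimes> cm k w \<otimes> inv z \<in> K 2" using Kn[OF 1] zk ZK by blast
    have "cm k' z \<in> K 2" using K(3)[of k' 1 z] zk ZK K2' by auto
    then have "cm z k' \<in> K 2" using cm_swap_mem[OF K(1)] zk by simp
    then have "z' \<otimes> cm z k' \<otimes> inv z' \<in> K 2" using Kn zk ZK by blast
    then have 3: "cm z w \<in> K 2" using cm_mult_right[of z' k' z] Zcom[of z z'] zk by simp
    have "cm u w = z \<otimes> cm k w \<otimes> inv z \<otimes> cm z w"
      using cm_mult_left[of z k w] zk wK by simp
    then show ?thesis using 2 3 by simp
  qed
  define K' where "K' = (\<lambda>i. if i = 0 then M else K (Suc i))"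
  have K'sub: "K' (Suc i) \<subseteq> K' i" for i
    using K(2)[of 1] K(2) K1M by (auto simp: K'_def)
  have tor: "\<exists>j. (u \<otimes> w) [^] (r ^ j) = \<one>"
    if "u \<in> M" "w \<in> M" "u [^] (r ^ a) = \<one>" "w [^] (r ^ b) = \<one>" for u w a b
  proof (rule Suc.IH[of K' u w a b])
    show "subgroup (K' i) G" for i using M K(1) by (simp add: K'_def)
    show "K' (Suc i) \<subseteq> K' i" for i by (rule K'sub)
    show "K' (Suc c) = {\<one>}" using K(4) by (simp add: K'_def)
    show "cm x y \<in> K' (Suc i)" if "x \<in> K' i" "y \<in> K' 0" for i x y
      using that cM[of x y] K(3)[of x "Suc i" y] MK K2' by (auto simp: K'_def split: if_splits)
  qed (use that in \<open>auto simp: K'_def\<close>)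
  define S where "S = {u \<in> M. \<exists>j. u [^] (r ^ j) = \<one>}"
  have SM: "u \<otimes> w \<in> S" if "u \<in> S" "w \<in> S" for u w
    using tor that by (auto simp: S_def)
  have Sn: "g \<otimes> u \<otimes> inv g \<in> S" if g: "g \<in> K 0" and u: "u \<in> S" for g u
  proof -
    have uM: "u \<in> M" using u by (simp add: S_def)
    have "cm g u \<in> K 1" using K(3)[of g 0 u] g uM MK by auto
    then have "g \<otimes> u \<otimes> inv g \<in> M" using conj_mem_of_cm[OF M uM] g K1M by auto
    moreover obtain j where j: "u [^] (r ^ j) = \<one>" using u by (auto simp: S_def)
    have "(g \<otimes> u \<otimes> inv g) [^] (r ^ j) = \<one>" using conj_pow[of g u] j g uM by simp
    ultimately show ?thesis unfolding S_def by blast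
  qed
  have xS: "x \<in> S" using xZ ZM xy unfolding S_def by blast
  have "\<exists>s\<in>S. (x \<otimes> y) [^] k = s \<otimes> y [^] k" for k :: nat
  proof (induction k)
    case 0
    show ?case by (intro bexI[of _ \<one>]) (auto simp: S_def)
  next
    case (Suc k)
    then obtain s where s: "s \<in> S" "(x \<otimes> y) [^] k = s \<otimes> y [^] k" by blast
    have sc: "s \<in> carrier G" using s by (simp add: S_def)
    have yk: "y [^] k \<otimes> x \<otimes> inv (y [^] k) \<in> S" using Sn[OF _ xS] subgroup_pow[OF K(1)] xy by blast
    have "(x \<otimes> y) [^] Suc k = (s \<otimes> (y [^] k \<otimes> x \<otimes> inv (y [^] k))) \<otimes> y [^] Suc k"
      using s(2) sc xy by (simp add: m_assoc)
    then show ?case using SM[OF s(1) yk] by blast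
  qed
  then obtain s where s: "s \<in> S" "(x \<otimes> y) [^] (r ^ b) = s \<otimes> y [^] (r ^ b)" by blast
  obtain j where j: "s [^] (r ^ j) = \<one>" using s by (auto simp: S_def)
  have "(x \<otimes> y) [^] (r ^ b) = s" using s xy by (simp add: S_def)
  then have "(x \<otimes> y) [^] (r ^ (b + j)) = \<one>" using j xy by (simp add: power_add nat_pow_pow[symmetric])
  then show ?case by blast
qed

end

section \<open>Parts of a radicable subgroup for coprime numbers\<close>

context contraction
begin

text \<open>\<open>r\<close> stands for its set of prime divisors and may be composite, so that
  primes can be split off one at a time. The exponent \<open>j\<close> depends on \<open>n\<close>:
  the condition is one on each finite image.\<close>

definition part :: "nat \<Rightarrow> 'a set \<Rightarrow> 'a set" where
  "part r D = {x \<in> D. \<forall>n. \<exists>j. x [^] (r ^ j) \<in> I n}"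

text \<open>The images of \<open>ser D\<close> in \<open>G Mod I n\<close> form the central series
  that \<open>nilpotent_torsion_mult\<close> asks for.\<close>

lemma radicable_torsion_mult:
  assumes X: "radicable D" and xy: "x \<in> D" "y \<in> D" "x [^] ((r::nat) ^ a) \<in> I n" "y [^] (r ^ b) \<in> I n"
  shows "\<exists>j. (x \<otimes> y) [^] (r ^ j) \<in> I n"
proof -
  note S = ser_pure_subset[OF radicable_pure[OF X]]
  interpret N: normal "I n" G by (rule I_normal)
  interpret Q: group "G Mod I n" by (rule N.factorgroup_is_group)
  have hom: "(#>) (I n) \<in> hom G (G Mod I n)" by (rule N.r_coset_hom_Mod)
  interpret h: group_hom G "G Mod I n" "(#>) (I n)" using hom by unfold_locales
  note [simp del] = mult_FactGroup one_FactGroup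
  note hc = hom_cm[OF hom Q.is_group]
  have one: "I n #> z = \<one>\<^bsub>G Mod I n\<^esub> \<longleftrightarrow> z \<in> I n" if "z \<in> carrier G" for z
    using coset_eq_self_iff[OF N.subgroup_axioms that] by (simp add: one_FactGroup)
  obtain c where c: "ser D c = {\<one>}" using radicable_nilpotent[OF X] .
  have c': "ser D (Suc c) = {\<one>}" using S(2)[of c] c subgroup.one_closed[OF pureD(2)[OF S(1)]] by blast
  have Dc: "z \<in> carrier G" if "z \<in> ser D i" for z i using that pureD(7)[OF S(1)] by blast
  have xyc: "x \<in> carrier G" "y \<in> carrier G" using xy Dc[of _ 0] by auto
  have "\<exists>j. ((I n #> x) \<otimes>\<^bsub>G Mod I n\<^esub> (I n #> y)) [^]\<^bsub>G Mod I n\<^esub> (r ^ j) = \<one>\<^bsub>G Mod I n\<^esub>"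
  proof (rule Q.nilpotent_torsion_mult[of "\<lambda>i. (#>) (I n) ` ser D i" c])
    show "subgroup ((#>) (I n) ` ser D i) (G Mod I n)" for i
      using h.subgroup_img_is_subgroup[OF pureD(2)[OF S(1)]] .
    show "(#>) (I n) ` ser D (Suc i) \<subseteq> (#>) (I n) ` ser D i" for i using S(2) by blast
    show "Q.cm u v \<in> (#>) (I n) ` ser D (Suc i)" if "u \<in> (#>) (I n) ` ser D i" "v \<in> (#>) (I n) ` ser D 0"
        for i u v
      using that S(4) Dc Dc[of _ 0] by (force simp: hc[symmetric])
    show "(#>) (I n) ` ser D (Suc c) = {\<one>\<^bsub>G Mod I n\<^esub>}" using c' by simp
    show "I n #> x \<in> (#>) (I n) ` ser D 0" "I n #> y \<in> (#>) (I n) ` ser D 0" using xy by auto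
    show "(I n #> x) [^]\<^bsub>G Mod I n\<^esub> (r ^ a) = \<one>\<^bsub>G Mod I n\<^esub>" "(I n #> y) [^]\<^bsub>G Mod I n\<^esub> (r ^ b) = \<one>\<^bsub>G Mod I n\<^esub>"
      using xy(3,4) xyc one by (simp_all add: h.hom_nat_pow[symmetric])
  qed
  then show ?thesis using xyc one by (simp add: h.hom_nat_pow[symmetric] h.hom_mult[symmetric] del: h.hom_mult)
qed

lemma closed_of_finite_index:
  assumes H: "subgroup H G" "H \<subseteq> D" and Q: "subgroup Q G" "closedin T Q" "Q \<subseteq> H" "fin_idx D Q"
      and D: "D \<subseteq> carrier G"
  shows "closedin T H"
proof -
  interpret H: subgroup H G by fact
  have "H = \<Union>((\<lambda>x. Q #> x) ` H)"
  proof (intro equalityI subsetI)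
    show "x \<in> \<Union>((\<lambda>x. Q #> x) ` H)" if "x \<in> H" for x using rcos_self[of x Q] Q(1) that by auto
    show "x \<in> H" if "x \<in> \<Union>((\<lambda>x. Q #> x) ` H)" for x using that Q(3) by (auto simp: r_coset_def)
  qed
  moreover have "finite ((\<lambda>x. Q #> x) ` H)"
    using idx_mono(1)[OF Q(1) H(2) D Q(4)] by (simp add: fin_idx_def)
  then have "closedin T (\<Union>((\<lambda>x. Q #> x) ` H))"
    using closedin_coset[OF Q(2)] by (intro closedin_Union) auto
  ultimately show ?thesis by simp
qed

text \<open>The approximation of \<open>part\<close> at level \<open>n\<close>. It contains
  \<open>D \<inter> I n\<close>, which makes it closed, and \<open>part\<close> is the intersection
  of these.\<close>

definition partI :: "nat \<Rightarrow> nat \<Rightarrow> 'a set \<Rightarrow> 'a set" where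
  "partI r n D = {x \<in> D. \<exists>j. x [^] (r ^ j) \<in> I n}"

lemma partI_closed_normal:
  assumes X: "radicable D"
  shows "partI r n D \<lhd> G" "closedin T (partI r n D)"
proof -
  note pD = radicable_pure[OF X]
  interpret D: normal D G using pureD(1)[OF pD] .
  have sub: "subgroup (partI r n D) G"
  proof (rule subgroupI)
    show "partI r n D \<subseteq> carrier G" by (auto simp: partI_def)
    have "\<one> \<in> partI r n D" using subgroup.one_closed[OF I_subgroup] by (simp add: partI_def)
    then show "partI r n D \<noteq> {}" by blast
    show "inv x \<in> partI r n D" if "x \<in> partI r n D" for x
      using that subgroup.m_inv_closed[OF I_subgroup] by (auto simp: partI_def nat_pow_inv)
    show "x \<otimes> y \<in> partI r n D" if "x \<in> partI r n D" "y \<in> partI r n D" for x y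
      using that radicable_torsion_mult[OF X] by (auto simp: partI_def)
  qed
  show "partI r n D \<lhd> G"
  proof (rule normalI'[OF sub])
    fix x g assume x: "x \<in> partI r n D" and g: "g \<in> carrier G"
    then obtain j where j: "x \<in> D" "x [^] (r ^ j) \<in> I n" by (auto simp: partI_def)
    then have "(g \<otimes> x \<otimes> inv g) [^] (r ^ j) \<in> I n" using conj_pow[OF g] normal_conj[OF I_normal _ g] by simp
    then show "g \<otimes> x \<otimes> inv g \<in> partI r n D" using D.inv_op_closed2[OF g j(1)] by (auto simp: partI_def)
  qed
  show "closedin T (partI r n D)"
  proof (rule closed_of_finite_index[OF sub _ goodD(2,3)[OF good_HI[OF pure_good[OF pD]]] _ fin_idx_I[OF
      pureD(2)[OF pD]] D.subset])
    show "partI r n D \<subseteq> D" by (auto simp: partI_def)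
    have "x [^] (r ^ 0) \<in> I n" if "x \<in> D \<inter> I n" for x using that by simp
    then show "D \<inter> I n \<subseteq> partI r n D" unfolding partI_def by blast
  qed
qed

text \<open>The image of \<open>C \<inter> I n\<close> under \<open>\<phi> ^^ k\<close> is closed of
  finite index in \<open>C\<close>, so it contains \<open>C \<inter> I n'\<close> for some
  \<open>n'\<close>; injectivity does the rest. It yields the purity of \<open>part\<close>.\<close>

lemma phi_reflects_I: "\<exists>n'. \<forall>x\<in>C. (\<phi> ^^ k) x \<in> I n' \<longrightarrow> x \<in> I n"
proof -
  have s: "subgroup ((\<phi> ^^ k) ` (C \<inter> I n)) G" using subgroup_phik_image[OF goodD(2)[OF good_CI]] .
  have cl: "closedin T ((\<phi> ^^ k) ` (C \<inter> I n))" using closedin_image[OF phik_cont goodD(3)[OF good_CI]] .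
  obtain k' where k': "\<forall>x\<in>C. (\<phi> ^^ k') x \<in> I n" using C_contr by blast
  have "(\<phi> ^^ (k + k')) ` C \<subseteq> (\<phi> ^^ k) ` (C \<inter> I n)"
    using k' C_phik by (auto simp: phik_add)
  then have "fin_idx C ((\<phi> ^^ k) ` (C \<inter> I n))"
    using idx_trans(3)[OF C_subgroup s subgroup_phik_image[OF C_subgroup]] fin_idx_phik[OF good_C] C_phik
      by blast
  then obtain n' where n': "C \<inter> I n' \<subseteq> (\<phi> ^^ k) ` (C \<inter> I n)" using closed_subgroup_I[OF C_subgroup s cl]
    by blast
  have "x \<in> I n" if "x \<in> C" "(\<phi> ^^ k) x \<in> I n'" for x
  proof -
    have "(\<phi> ^^ k) x \<in> (\<phi> ^^ k) ` (C \<inter> I n)" using n' that C_phik by blast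
    then show ?thesis using that by (auto simp: image_iff)
  qed
  then show ?thesis by blast
qed

lemma part_pure:
  assumes X: "radicable D"
  shows "pure (part r D)" "part r D \<subseteq> D"
proof -
  note pD = radicable_pure[OF X]
  have e: "part r D = (\<Inter>n. partI r n D)" by (auto simp: part_def partI_def)
  have "part r D \<lhd> G"
  proof (rule normalI')
    have "subgroup (\<Inter>(range (\<lambda>n. partI r n D))) G"
      using partI_closed_normal(1)[OF X] normal_imp_subgroup by (intro subgroups_Inter) auto
    then show "subgroup (part r D) G" by (simp add: e)
    show "g \<otimes> x \<otimes> inv g \<in> part r D" if "x \<in> part r D" "g \<in> carrier G" for x g
      using that normal_conj[OF partI_closed_normal(1)[OF X]] by (simp add: e)
  qed
  moreover have "closedin T (part r D)" unfolding e using partI_closed_normal(2)[OF X]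
    by (intro closedin_INT) auto
  moreover show sub: "part r D \<subseteq> D" by (auto simp: part_def)
  moreover have "\<phi> x \<in> part r D" if x: "x \<in> part r D" for x
  proof -
    have "\<exists>j. \<phi> x [^] (r ^ j) \<in> I n" for n
    proof -
      obtain j where "x [^] (r ^ j) \<in> I n" using x by (auto simp: part_def)
      moreover have "x \<in> carrier G" using x pureD(7)[OF pD] by (auto simp: part_def)
      ultimately have "\<phi> x [^] (r ^ j) \<in> I n" using I_phi[of "x [^] (r ^ j)" n] by simp
      then show ?thesis by blast
    qed
    then show ?thesis using x pureD(5)[OF pD] by (simp add: part_def)
  qed
  ultimately have "good (part r D)" unfolding good_def using pureD(4)[OF pD] by blast
  moreover have "x \<in> part r D" if x: "x \<in> C" "\<phi> x \<in> part r D" for x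
  proof -
    have xD: "x \<in> D" using x pure_phi[OF pD] by (auto simp: part_def)
    have "\<exists>j. x [^] (r ^ j) \<in> I n" for n
    proof -
      obtain n' where n': "\<forall>x\<in>C. (\<phi> ^^ 1) x \<in> I n' \<longrightarrow> x \<in> I n" using phi_reflects_I by blast
      obtain j where "\<phi> x [^] (r ^ j) \<in> I n'" using x(2) by (auto simp: part_def)
      then have "(\<phi> ^^ 1) (x [^] (r ^ j)) \<in> I n'" using x by simp
      then show ?thesis using n' subgroup_pow[OF C_subgroup x(1)] by blast
    qed
    then show ?thesis using xD by (simp add: part_def)
  qed
  ultimately show "pure (part r D)" by (simp add: pure_def)
qed

lemma part_Int:
  assumes "coprime r s" "x \<in> part r D" "x \<in> part s D" "D \<subseteq> carrier G"
  shows "x = \<one>"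
proof (rule I_inter_one)
  show xc: "x \<in> carrier G" using assms by (auto simp: part_def)
  fix n
  obtain i j where ij: "x [^] (r ^ i) \<in> I n" "x [^] (s ^ j) \<in> I n" using assms(2,3) unfolding part_def by blast
  show "x \<in> I n"
  proof (cases "r ^ i = 0")
    \<comment> \<open>Bezout asks for a nonzero number; here \<open>r = 0\<close>, and coprimality
      forces \<open>s = 1\<close>.\<close>
    case True
    then have "s = 1" using assms(1) by (simp add: coprime_0_left_iff)
    then show ?thesis using ij xc by simp
  next
    case False
    have "coprime (r ^ i) (s ^ j)" using assms(1) by simp
    then obtain u v where uv: "r ^ i * u = s ^ j * v + 1" using bezout_nat[OF False, of "s ^ j"] by auto
    interpret N: subgroup "I n" G by (rule I_subgroup)
    have "x [^] (r ^ i * u) \<in> I n" "x [^] (s ^ j * v) \<in> I n"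
      using ij subgroup_pow[OF I_subgroup] xc by (auto simp: nat_pow_pow[symmetric])
    then have "x [^] (s ^ j * v) \<otimes> x \<in> I n" "inv (x [^] (s ^ j * v)) \<in> I n" using uv by auto
    then have "inv (x [^] (s ^ j * v)) \<otimes> (x [^] (s ^ j * v) \<otimes> x) \<in> I n" by blast
    then show ?thesis using xc by simp
  qed
qed

lemma part_commute:
  assumes X: "radicable D" and rs: "coprime r s" and xy: "x \<in> part r D" "y \<in> part s D"
  shows "x \<otimes> y = y \<otimes> x"
proof -
  have Dc: "D \<subseteq> carrier G" using pureD(7)[OF radicable_pure[OF X]] .
  have c: "x \<in> carrier G" "y \<in> carrier G" using xy Dc by (auto simp: part_def)
  have "cm x y \<in> part r D" "cm x y \<in> part s D"
    using normal_cm[OF pureD(1)[OF part_pure(1)[OF X]]] xy c by auto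
  then have "cm x y = \<one>" using part_Int[OF rs] Dc by blast
  then show ?thesis using cm_eq_one_iff c by blast
qed

text \<open>At each level \<open>n\<close> Bezout gives a decomposition. The sets \<open>S n\<close>
  of admissible first components are closed and decreasing, so by compactness one component works at
  all levels.\<close>

lemma part_split:
  assumes X: "radicable D" and rs: "coprime r s" "r > 0" and x: "x \<in> part (r * s) D"
  shows "\<exists>y\<in>part r D. \<exists>z\<in>part s D. x = y \<otimes> z"
proof -
  note pD = radicable_pure[OF X]
  interpret D: normal D G using pureD(1)[OF pD] .
  have xD: "x \<in> D" and xc: "x \<in> carrier G" using x by (auto simp: part_def)
  define S where "S = (\<lambda>n. partI r n D \<inter> {y \<in> carrier G. inv y \<otimes> x \<in> partI s n D})"
  have "closedin T (S n)" for n
    unfolding S_def using partI_closed_normal(2)[OF X] xc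
    by (intro closedin_Int closedin_preimage continuous_map_mult continuous_map_inv continuous_map_id'
        continuous_map_const') auto
  moreover have "S n \<noteq> {}" for n
  proof -
    interpret N: subgroup "I n" G by (rule I_subgroup)
    obtain j where j: "x [^] ((r * s) ^ j) \<in> I n" using x by (auto simp: part_def)
    have "coprime (r ^ j) (s ^ j)" using rs(1) by simp
    then obtain u v where uv: "r ^ j * u = s ^ j * v + 1" using bezout_nat[of "r ^ j" "s ^ j"] rs(2) by auto
    have rsw: "x [^] ((r * s) ^ j * w) \<in> I n" for w
      using subgroup_pow[OF I_subgroup j] xc by (simp add: nat_pow_pow)
    \<comment> \<open>By the choice of \<open>u\<close> and \<open>v\<close>, \<open>x\<close> is
      \<open>?y\<close> times \<open>x [^] (r ^ j * u)\<close>. Modulo \<open>I n\<close> the first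
      factor is killed by \<open>r ^ j\<close> and the second by \<open>s ^ j\<close>.\<close>
    let ?y = "inv (x [^] (s ^ j * v))"
    have "?y [^] (r ^ j) = inv (x [^] ((r * s) ^ j * v))"
      using xc by (simp add: nat_pow_inv nat_pow_pow power_mult_distrib mult_ac)
    then have 1: "?y \<in> partI r n D"
      using rsw N.m_inv_closed subgroup_pow[OF D.subgroup_axioms xD]
        by (auto simp: partI_def intro!: exI[of _ j])
    have e: "inv ?y \<otimes> x = x [^] (r ^ j * u)" using xc uv by simp
    have "(x [^] (r ^ j * u)) [^] (s ^ j) = x [^] ((r * s) ^ j * u)"
      using xc by (simp add: nat_pow_pow power_mult_distrib mult_ac)
    then have "inv ?y \<otimes> x \<in> partI s n D"
      unfolding e using rsw subgroup_pow[OF D.subgroup_axioms xD] by (auto simp: partI_def intro!: exI[of _ j])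
    then show ?thesis using 1 xc unfolding S_def by auto
  qed
  moreover have "decseq S"
    using I_anti unfolding decseq_def S_def partI_def by blast
  ultimately have "(\<Inter>n. S n) \<noteq> {}" using compact compact_space_imp_nest by metis
  then obtain y where y: "\<And>n. y \<in> S n" by blast
  have "y \<in> part r D" "inv y \<otimes> x \<in> part s D" using y by (auto simp: S_def partI_def part_def)
  moreover have "x = y \<otimes> (inv y \<otimes> x)" using xc y[of 0] by (simp add: S_def)
  ultimately show ?thesis by blast
qed

text \<open>An ordered product, as \<open>G\<close> is not commutative; rearranging is justified
  only for factors from coprime parts.\<close>

primrec mprod :: "(nat \<Rightarrow> 'a) \<Rightarrow> nat \<Rightarrow> 'a" where
  "mprod d 0 = \<one>"
| "mprod d (Suc k) = mprod d k \<otimes> d k"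

lemma mprod_cong: "(\<And>i. i < k \<Longrightarrow> d i = d' i) \<Longrightarrow> mprod d k = mprod d' k"
  by (induction k) auto

lemma part_mprod:
  assumes X: "radicable D" and p: "\<And>i. i < k \<Longrightarrow> p i > 0" "\<And>i j. i < k \<Longrightarrow> j < k \<Longrightarrow> i \<noteq> j \<Longrightarrow> coprime (p i) (p j)"
    and x: "x \<in> part (\<Prod>i<k. p i) D"
  shows "\<exists>d. (\<forall>i<k. d i \<in> part (p i) D) \<and> x = mprod d k"
  using p x
proof (induction k arbitrary: x)
  case 0
  have "x \<in> carrier G" using 0 pureD(7)[OF radicable_pure[OF X]] by (auto simp: part_def)
  then have "x = \<one>" using I_inter_one 0(3) by (simp add: part_def)
  then show ?case by simp
next
  case (Suc k)
  have "coprime (\<Prod>i<k. p i) (p k)" using Suc.prems(2) by (intro prod_coprime_left) auto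
  moreover have "(\<Prod>i<k. p i) > 0" using Suc.prems(1) by (intro prod_pos) auto
  ultimately obtain y z where yz: "y \<in> part (\<Prod>i<k. p i) D" "z \<in> part (p k) D" "x = y \<otimes> z"
    using part_split[OF X] Suc.prems(3) by (metis prod.lessThan_Suc)
  obtain d where d: "\<forall>i<k. d i \<in> part (p i) D" "y = mprod d k" using Suc.IH[OF _ _ yz(1)] Suc.prems by auto
  have e: "mprod (d(k := z)) k = mprod d k" by (rule mprod_cong) simp
  have "mprod (d(k := z)) (Suc k) = x" by (simp only: mprod.simps fun_upd_same e yz(3) d(2))
  moreover have "\<forall>i<Suc k. (d(k := z)) i \<in> part (p i) D" using d(1) yz(2) by (simp add: less_Suc_eq)
  ultimately show ?case by blast
qed

lemma part_m:
  assumes "D \<subseteq> C" "m dvd r ^ e"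
  shows "part r D = D"
proof -
  have "\<exists>j. x [^] (r ^ j) \<in> I n" if x: "x \<in> D" for x n
  proof -
    have xC: "x \<in> C" using x assms by blast
    obtain k where "\<forall>x\<in>C. x [^] (m ^ k) \<in> I n" using pow_m_mem_I by blast
    then have k: "x [^] (m ^ k) \<in> I n" using xC by blast
    obtain c where "(r ^ e) ^ k = m ^ k * c" using dvd_power_same[OF assms(2)] by blast
    then have "x [^] (r ^ (e * k)) = (x [^] (m ^ k)) [^] c" using xC by (simp add: nat_pow_pow power_mult)
    then show ?thesis using subgroup_pow[OF I_subgroup k] by metis
  qed
  then show ?thesis by (auto simp: part_def)
qed

text \<open>A subgroup \<open>A\<close> of \<open>part r D\<close> that tests radicability extends
  to \<open>A <#> part s D\<close>, which tests it in \<open>D\<close>. Hence this product is all of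
  \<open>D\<close>, and the trivial intersection of the two parts recovers \<open>A\<close>.\<close>

lemma radicable_part:
  assumes X: "radicable D" and rs: "coprime r s" "r > 0" and D: "part (r * s) D = D"
  shows "radicable (part r D)"
  unfolding radicable_def
proof (intro conjI allI impI part_pure(1)[OF X])
  note pD = radicable_pure[OF X]
  let ?X = "part r D" and ?Y = "part s D"
  fix A n assume A: "pure A" "A \<subseteq> ?X" "n > 0" "\<forall>x\<in>?X. \<forall>y\<in>?X. cm x y \<in> A" "\<forall>x\<in>?X. x [^] (n::nat) \<in> A"
  note pX = part_pure[OF X, of r] and pY = part_pure[OF X, of s]
  interpret A: normal A G using pureD(1)[OF A(1)] .
  interpret X: normal ?X G using pureD(1)[OF pX(1)] .
  interpret Y: normal ?Y G using pureD(1)[OF pY(1)] .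
  have com: "x \<otimes> y = y \<otimes> x" if "x \<in> ?X" "y \<in> ?Y" for x y using part_commute[OF X rs(1) that] .
  have int: "x = \<one>" if "x \<in> ?X" "x \<in> ?Y" for x using part_Int[OF rs(1) that pureD(7)[OF pD]] .
  have split: "\<exists>y\<in>?X. \<exists>z\<in>?Y. x = y \<otimes> z" if "x \<in> D" for x using part_split[OF X rs] that D by blast
  define B where "B = A <#> ?Y"
  have Bg: "good B" unfolding B_def using good_set_mult[OF pure_good[OF A(1)] pure_good[OF pY(1)]] .
  interpret B: normal B G using goodD(1)[OF Bg] .
  have AB: "A \<subseteq> B" "?Y \<subseteq> B" unfolding B_def using set_mult_supset[OF A.subgroup_axioms Y.subgroup_axioms]
    by auto
  have XB: "x \<in> A" if x: "x \<in> ?X" "x \<in> B" for x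
  proof -
    obtain a y where ay: "a \<in> A" "y \<in> ?Y" "x = a \<otimes> y" using x(2) by (auto simp: B_def set_mult_def)
    have "y = inv a \<otimes> x" using ay by simp
    then have "y \<in> ?X" using ay(1) x(1) A(2) by blast
    then have "y = \<one>" using int ay by blast
    then show ?thesis using ay by simp
  qed
  have BD: "B \<subseteq> D" unfolding B_def using A(2) pX(2) pY(2) by (intro set_mult_subset pureD(2)[OF pD]) auto
  have "pure B"
    unfolding pure_def
  proof (intro conjI ballI impI Bg)
    fix x assume x: "x \<in> C" "\<phi> x \<in> B"
    then have "x \<in> D" using BD pure_phi[OF pD] by blast
    then obtain y z where yz: "y \<in> ?X" "z \<in> ?Y" "x = y \<otimes> z" using split by blast
    have "\<phi> y = \<phi> x \<otimes> inv (\<phi> z)" using yz by (simp add: m_assoc)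
    moreover have "inv (\<phi> z) \<in> B" using pureD(5)[OF pY(1) yz(2)] AB by blast
    ultimately have "\<phi> y \<in> B" using x(2) by simp
    then have "\<phi> y \<in> A" using XB pureD(5)[OF pX(1) yz(1)] by blast
    then have "y \<in> A" using pure_phi[OF A(1)] yz(1) pureD(4)[OF pX(1)] by blast
    then show "x \<in> B" using yz AB by blast
  qed
  then have "B = D"
  proof (rule radicable_eq[OF X _ BD A(3)])
    fix x w assume "x \<in> D" "w \<in> D"
    then obtain y z y' z' where yz: "y \<in> ?X" "z \<in> ?Y" "x = y \<otimes> z" "y' \<in> ?X" "z' \<in> ?Y" "w = y' \<otimes> z'"
      using split by meson
    have "y \<otimes> cm z w \<otimes> inv y \<in> ?Y" using Y.inv_op_closed2 normal_cm(1)[OF Y.normal_axioms yz(2)] yz by simp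
    moreover have "cm y w = cm y y'"
      using cm_mult_right[of y' z' y] yz com[OF yz(1,5)] cm_eq_one_iff[of y z'] by simp
    moreover have "cm y y' \<in> A" using A(4) yz by blast
    ultimately show "cm x w \<in> B" using cm_mult_left[of y z w] yz AB by auto
  next
    fix x assume "x \<in> D"
    then obtain y z where yz: "y \<in> ?X" "z \<in> ?Y" "x = y \<otimes> z" using split by blast
    then have "x [^] n = y [^] n \<otimes> z [^] n" using pow_mult_distrib[OF com[OF yz(1,2)]] by simp
    moreover have "y [^] n \<in> B" "z [^] n \<in> B" using A(5) yz AB subgroup_pow[OF Y.subgroup_axioms] by auto
    ultimately show "x [^] n \<in> B" by simp
  qed
  then show "A = ?X" using XB A(2) pX(2) by blast
qed

end

section \<open>Uniform subgroups\<close>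

context group
begin

text \<open>\<open>h\<close> induces a well-defined surjection from \<open>P/Q\<close> to
  \<open>P'/Q'\<close>; it is used for power maps and for inclusions.\<close>

lemma idx_surj_le:
  assumes "subgroup Q G" "P \<subseteq> carrier G" "subgroup Q' G" "P' \<subseteq> carrier G" "h ` P \<subseteq> carrier G"
    and k: "\<And>x y. x \<in> P \<Longrightarrow> y \<in> P \<Longrightarrow> x \<otimes> inv y \<in> Q \<Longrightarrow> h x \<otimes> inv (h y) \<in> Q'"
    and s: "\<And>z. z \<in> P' \<Longrightarrow> \<exists>x\<in>P. z \<otimes> inv (h x) \<in> Q'"
    and f: "fin_idx P Q"
  shows "fin_idx P' Q'" "idx P' Q' \<le> idx P Q"
proof -
  define g where "g = (\<lambda>c. Q' #> h (SOME x. x \<in> P \<and> Q #> x = c))"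
  have g: "g (Q #> x) = Q' #> h x" if "x \<in> P" for x
  proof -
    define y where "y = (SOME y. y \<in> P \<and> Q #> y = Q #> x)"
    have y: "y \<in> P \<and> Q #> y = Q #> x" unfolding y_def by (rule someI[of _ x]) (use that in simp)
    then have "y \<otimes> inv x \<in> Q" using coset_eq_iff[OF assms(1), of y x] that assms(2) by blast
    then have "h y \<otimes> inv (h x) \<in> Q'" using k y that by blast
    then show ?thesis
      using coset_eq_iff[OF assms(3), of "h y" "h x"] assms(5) y that by (auto simp: g_def y_def)
  qed
  have sub: "(\<lambda>x. Q' #> x) ` P' \<subseteq> g ` ((\<lambda>x. Q #> x) ` P)"
  proof clarify
    fix z assume z: "z \<in> P'"
    then obtain x where x: "x \<in> P" "z \<otimes> inv (h x) \<in> Q'" using s by blast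
    moreover have "z \<in> carrier G" "h x \<in> carrier G" using z x(1) assms(4,5) by auto
    ultimately have "Q' #> z = g (Q #> x)" using g[OF x(1)] coset_eq_iff[OF assms(3), of z "h x"] by simp
    then show "Q' #> z \<in> g ` ((\<lambda>x. Q #> x) ` P)" using x by blast
  qed
  have fin: "finite ((\<lambda>x. Q #> x) ` P)" using f by (simp add: fin_idx_def)
  show "fin_idx P' Q'" using finite_subset[OF sub] fin by (simp add: fin_idx_def)
  have "card ((\<lambda>x. Q' #> x) ` P') \<le> card (g ` ((\<lambda>x. Q #> x) ` P))"
    by (rule card_mono[OF _ sub]) (use fin in simp)
  also have "\<dots> \<le> card ((\<lambda>x. Q #> x) ` P)" using fin by (rule card_image_le)
  finally show "idx P' Q' \<le> idx P Q" by (simp add: idx_def)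
qed

lemma fin_idx_Int:
  assumes "subgroup X G" "subgroup N G" "subgroup P G" "P \<subseteq> X" "fin_idx X N"
  shows "fin_idx P (P \<inter> N)"
proof -
  interpret P: subgroup P G by fact
  have s: "subgroup (P \<inter> N) G" by (intro subgroups_Inter_pair assms)
  show ?thesis
    using idx_map_le(1)[OF s subgroup.subset[OF assms(3)] assms(2) subgroup.subset[OF assms(1)], of
        "\<lambda>x. x"] assms(4,5)
    by auto
qed

lemma coset_pow:
  assumes "N \<lhd> G" "x \<in> carrier G" "y \<in> carrier G" "N #> x = N #> y"
  shows "N #> x [^] (n::nat) = N #> y [^] n"
proof -
  interpret N: normal N G by fact
  interpret Q: group "G Mod N" by (rule N.factorgroup_is_group)
  interpret h: group_hom G "G Mod N" "(#>) N"
    using N.r_coset_hom_Mod by unfold_locales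
  show ?thesis using assms by (simp add: h.hom_nat_pow)
qed

text \<open>In a torsion-free abelian section \<open>P/Q\<close> the index of the \<open>q\<close>-th powers is the same for
  every subgroup of finite index.\<close>

lemma idx_powers_mod_le:
  assumes P: "P \<lhd> G" and Q: "Q \<lhd> G" "Q \<subseteq> P" and c: "\<And>x y. x \<in> P \<Longrightarrow> y \<in> P \<Longrightarrow> cm x y \<in> Q"
    and tf: "\<And>x. x \<in> P \<Longrightarrow> x [^] q \<in> Q \<Longrightarrow> x \<in> Q"
    and fq: "fin_idx P (powers_mod q P Q)" and N: "N \<lhd> G" "fin_idx P (P \<inter> N)"
  shows "fin_idx (N \<inter> P) (powers_mod q (N \<inter> P) (N \<inter> Q))"
      "idx (N \<inter> P) (powers_mod q (N \<inter> P) (N \<inter> Q)) \<le> idx P (powers_mod q P Q)"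
proof -
  interpret P: normal P G by fact
  interpret Q: normal Q G by fact
  interpret N: normal N G by fact
  have NP: "N \<inter> P \<lhd> G" and NQ: "N \<inter> Q \<lhd> G" using normal_subgroup_intersect assms by auto
  \<comment> \<open>\<open>M/Q\<close> is the image of \<open>N \<inter> P\<close> in
    \<open>P/Q\<close>, the section where torsion-freeness is available.\<close>
  define M where "M = (N \<inter> P) <#> Q"
  have Mn: "M \<lhd> G" unfolding M_def using normal_set_mult[OF NP Q(1)] .
  interpret M: normal M G by (rule Mn)
  have MP: "M \<subseteq> P" unfolding M_def using Q(2) by (intro set_mult_subset P.subgroup_axioms) auto
  have QM: "Q \<subseteq> M" and NPM: "N \<inter> P \<subseteq> M"
    unfolding M_def using set_mult_supset[OF normal_imp_subgroup[OF NP] Q.subgroup_axioms] by auto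
  have fM: "fin_idx P M"
    using idx_trans(3)[OF P.subgroup_axioms M.subgroup_axioms normal_imp_subgroup[OF NP] NPM MP] N(2)
    by (simp add: Int_commute)
  have cMQ: "\<And>x y. x \<in> M \<Longrightarrow> y \<in> M \<Longrightarrow> cm x y \<in> Q" using c MP by blast
  define A where "A = powers_mod q P Q"
  define B where "B = powers_mod q M Q"
  have As: "subgroup A G" and Bs: "subgroup B G"
    unfolding A_def B_def
      using powers_mod_normal[OF P Q c] powers_mod_normal[OF Mn Q(1) QM cMQ] normal_imp_subgroup by auto
  have BA: "B \<subseteq> A" using MP by (auto simp: A_def B_def powers_mod_def)
  have AP: "A \<subseteq> P" and BM: "B \<subseteq> M"
    unfolding A_def B_def
      using powers_mod_subset[OF P.subgroup_axioms Q(2)] powers_mod_subset[OF M.subgroup_axioms QM] by auto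
  have QB: "Q \<subseteq> B" unfolding B_def using powers_mod_supset(1)[OF M.subgroup_axioms Q(1)] .
  have Q0: "Q #> u = Q \<longleftrightarrow> u \<in> Q" if "u \<in> carrier G" for u
    using coset_eq_self_iff[OF Q.subgroup_axioms that] .
  have Qe: "Q #> u = Q #> v \<longleftrightarrow> u \<otimes> inv v \<in> Q" if "u \<in> carrier G" "v \<in> carrier G" for u v
    using coset_eq_iff[OF Q.subgroup_axioms that] .
  have powdiff: "Q #> (x \<otimes> inv y) [^] q = Q #> (x [^] q \<otimes> inv (y [^] q))" if "x \<in> P" "y \<in> P" for x y
    using pow_mult_inv_coset[OF Q(1) _ _ c[OF that(1)], of y] that by simp
  have im: "(\<lambda>x. x [^] q) ` P \<subseteq> A"
    unfolding A_def using powers_mod_supset(2)[OF P.subgroup_axioms Q(1)] by auto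
  have surj: "\<exists>x\<in>P. z \<otimes> inv (x [^] q) \<in> B" if z: "z \<in> A" for z
  proof -
    obtain t p where "t \<in> Q" "p \<in> P" "z = t \<otimes> p [^] q" using z by (auto simp: A_def powers_mod_def)
    then have "z \<otimes> inv (p [^] q) \<in> B" using QB by (auto simp: m_assoc)
    then show ?thesis using \<open>p \<in> P\<close> by blast
  qed
  \<comment> \<open>Torsion-freeness enters here: two elements with equal \<open>q\<close>-th powers
    modulo \<open>Q\<close> agree modulo \<open>Q\<close>. So the power map identifies
    \<open>P/M\<close> with \<open>A/B\<close>.\<close>
  have ker: "x \<otimes> inv y \<in> M \<longleftrightarrow> x [^] q \<otimes> inv (y [^] q) \<in> B" if xy: "x \<in> P" "y \<in> P" for x y
    proof -
      let ?z = "x \<otimes> inv y"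
      have z: "?z \<in> P" "?z \<in> carrier G" using xy by auto
      have "x [^] q \<otimes> inv (y [^] q) \<in> B \<longleftrightarrow> (\<exists>u\<in>M. Q #> ?z [^] q = Q #> u [^] q)"
        unfolding B_def using powers_mod_iff[OF M.subset Q(1), of "x [^] q \<otimes> inv (y [^] q)" q]
            powdiff[OF xy] xy by simp
      also have "\<dots> \<longleftrightarrow> (\<exists>u\<in>M. ?z \<otimes> inv u \<in> Q)"
      proof (rule bex_cong[OF refl])
        fix u assume u: "u \<in> M"
        then have uP: "u \<in> P" "u \<in> carrier G" using MP by auto
        have "Q #> ?z [^] q = Q #> u [^] q \<longleftrightarrow> ?z [^] q \<otimes> inv (u [^] q) \<in> Q" using Qe z uP by simp
        also have "\<dots> \<longleftrightarrow> Q #> (?z [^] q \<otimes> inv (u [^] q)) = Q" using Q0 z uP by simp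
        also have "\<dots> \<longleftrightarrow> Q #> (?z \<otimes> inv u) [^] q = Q" using powdiff[OF z(1) uP(1)] by simp
        also have "\<dots> \<longleftrightarrow> (?z \<otimes> inv u) [^] q \<in> Q" using Q0 z uP by simp
        also have "\<dots> \<longleftrightarrow> ?z \<otimes> inv u \<in> Q"
          using tf[of "?z \<otimes> inv u"] z uP subgroup_pow[OF Q.subgroup_axioms] by blast
        finally show "Q #> ?z [^] q = Q #> u [^] q \<longleftrightarrow> ?z \<otimes> inv u \<in> Q" .
      qed
      also have "\<dots> \<longleftrightarrow> ?z \<in> M"
      proof
        assume "\<exists>u\<in>M. ?z \<otimes> inv u \<in> Q"
        then obtain u where u: "u \<in> M" "?z \<otimes> inv u \<in> Q" by blast
        then have "(?z \<otimes> inv u) \<otimes> u \<in> M" using QM by blast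
        then show "?z \<in> M" using z u by (simp add: m_assoc)
      next
        assume "?z \<in> M"
        then show "\<exists>u\<in>M. ?z \<otimes> inv u \<in> Q" using z by (intro bexI[of _ ?z]) auto
      qed
      finally show ?thesis by simp
    qed
  note i = idx_map_eq[OF M.subgroup_axioms P.subset Bs subgroup.subset[OF As], of "\<lambda>x. x [^] q", OF ker im surj]
  have fA: "fin_idx P A" using fq by (simp add: A_def)
  have "fin_idx P B" using idx_trans(2)[OF P.subgroup_axioms As Bs BA AP fA] i(1) fM by blast
  then have fMB: "fin_idx M B" using idx_trans(4)[OF P.subgroup_axioms M.subgroup_axioms Bs BM MP] by blast
  \<comment> \<open>The index of \<open>B\<close> in \<open>P\<close>, computed through
    \<open>M\<close> and through \<open>A\<close>; the factor \<open>idx P M\<close>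
    cancels.\<close>
  have "idx P M * idx M B = idx P A * idx P M"
    using idx_trans(1)[OF P.subgroup_axioms M.subgroup_axioms Bs BM MP]
        idx_trans(1)[OF P.subgroup_axioms As Bs BA AP] i(2)
    by metis
  then have eq: "idx M B = idx P A" using idx_pos[OF P.subgroup_axioms fM] by simp
  have s': "subgroup (powers_mod q (N \<inter> P) (N \<inter> Q)) G"
  proof (rule normal_imp_subgroup, rule powers_mod_normal[OF NP NQ])
    show "N \<inter> Q \<subseteq> N \<inter> P" using Q(2) by blast
    show "cm x y \<in> N \<inter> Q" if "x \<in> N \<inter> P" "y \<in> N \<inter> P" for x y
      using that c subgroup_cm[OF N.subgroup_axioms] by blast
  qed
  \<comment> \<open>Elements of \<open>M\<close> may be replaced by their components in
    \<open>N \<inter> P\<close>, because the component in \<open>Q\<close> disappears modulo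
    \<open>Q\<close>.\<close>
  have k: "x \<otimes> inv y \<in> powers_mod q (N \<inter> P) (N \<inter> Q) \<longleftrightarrow> x \<otimes> inv y \<in> B" if xy: "x \<in> N \<inter> P" "y \<in> N \<inter> P" for x y
  proof
    show "x \<otimes> inv y \<in> powers_mod q (N \<inter> P) (N \<inter> Q) \<Longrightarrow> x \<otimes> inv y \<in> B"
      using NPM unfolding B_def powers_mod_def by blast
    let ?z = "x \<otimes> inv y"
    assume "?z \<in> B"
    then obtain u where u: "u \<in> M" "Q #> ?z = Q #> u [^] q"
      unfolding B_def using powers_mod_iff[OF M.subset Q(1), of ?z q] xy by auto
    obtain v s where vs: "v \<in> N \<inter> P" "s \<in> Q" "u = v \<otimes> s" using u(1) by (auto simp: M_def set_mult_def)
    have car: "v \<in> carrier G" "s \<in> carrier G" "u \<in> carrier G" using vs by auto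
    have "Q #> u [^] q = Q #> (v [^] q \<otimes> s [^] q)"
      unfolding vs(3) using pow_mult_coset[OF Q(1) car(1,2)] c vs Q(2) by blast
    also have "\<dots> = (Q #> v [^] q) <#> (Q #> s [^] q)" using Q.rcos_sum car by simp
    also have "Q #> s [^] q = Q #> \<one>"
      using Q0[of "s [^] q"] subgroup_pow[OF Q.subgroup_axioms vs(2)] car Q.subset by simp
    also have "(Q #> v [^] q) <#> (Q #> \<one>) = Q #> v [^] q" using Q.rcos_sum[of "v [^] q" \<one>] car by simp
    finally have "?z \<otimes> inv (v [^] q) \<in> Q" using u(2) Qe[of ?z "v [^] q"] xy car by simp
    moreover have "?z \<otimes> inv (v [^] q) \<in> N" using xy vs subgroup_pow[OF N.subgroup_axioms, of v q] by auto
    moreover have "?z = (?z \<otimes> inv (v [^] q)) \<otimes> v [^] q" using xy car by (simp add: m_assoc)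
    ultimately show "?z \<in> powers_mod q (N \<inter> P) (N \<inter> Q)" using vs unfolding powers_mod_def by blast
  qed
  have "idx (N \<inter> P) (powers_mod q (N \<inter> P) (N \<inter> Q)) \<le> idx M B" "fin_idx (N \<inter> P) (powers_mod q (N \<inter> P) (N \<inter> Q))"
    using idx_map_le[OF s' subgroup.subset[OF normal_imp_subgroup[OF NP]] Bs M.subset, of "\<lambda>x. x"] k NPM
        fMB by auto
  then show "fin_idx (N \<inter> P) (powers_mod q (N \<inter> P) (N \<inter> Q))"
      "idx (N \<inter> P) (powers_mod q (N \<inter> P) (N \<inter> Q)) \<le> idx P (powers_mod q P Q)"
    using eq by (simp_all add: A_def)
qed

end

section \<open>Closed power subgroups and their indices\<close>

context contraction
begin

definition closed_powers :: "nat \<Rightarrow> 'a set \<Rightarrow> 'a set" where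
  "closed_powers q N = T closure_of (power_subgroup G q N)"

lemma closure_of_subgroup:
  assumes "subgroup H G"
  shows "T closure_of H = (\<Inter>n. H <#> I n)"
proof -
  have s: "subgroup (H <#> I n) G" for n using subgroup_set_mult[OF assms I_normal] .
  have HI: "H \<subseteq> H <#> I n" "I n \<subseteq> H <#> I n" for n using set_mult_supset[OF assms I_subgroup] by auto
  have "closedin T (H <#> I n)" for n
    using open_subgroup_closed[OF s subgroup_openI[OF s I_open _ HI(2)]]
        subgroup.one_closed[OF I_subgroup] by blast
  then have 1: "T closure_of H \<subseteq> (\<Inter>n. H <#> I n)" using HI(1) by (simp add: closure_of_minimal INT_greatest)
  have 2: "x \<in> T closure_of H" if x: "\<And>n. x \<in> H <#> I n" for x
  proof (rule closed_mem[OF closedin_closure_of])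
    show "x \<in> carrier G" using x[of 0] subgroup.mem_carrier[OF s] by blast
    fix n
    interpret N: subgroup "I n" G by (rule I_subgroup)
    interpret H: subgroup H G by (rule assms)
    obtain h i where hi: "h \<in> H" "i \<in> I n" "x = h \<otimes> i" using x[of n] by (auto simp: set_mult_def)
    then have "x \<otimes> inv i = h" by (simp add: m_assoc)
    moreover have "h \<in> T closure_of H" using hi(1) closure_of_subset[of H T] H.subset topspace_eq by auto
    ultimately show "\<exists>y\<in>I n. x \<otimes> y \<in> T closure_of H" using hi(2) by (intro bexI[of _ "inv i"]) simp_all
  qed
  show ?thesis
  proof (rule equalityI[OF 1 subsetI])
    fix x assume "x \<in> (\<Inter>n. H <#> I n)"
    then show "x \<in> T closure_of H" by (intro 2) auto
  qed
qed

lemma closure_of_normal: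
  assumes "H \<lhd> G"
  shows "T closure_of H \<lhd> G"
proof (rule normalI')
  have e: "T closure_of H = (\<Inter>n. H <#> I n)" using closure_of_subgroup[OF normal_imp_subgroup[OF assms]] .
  have n: "H <#> I n \<lhd> G" for n using normal_set_mult[OF assms I_normal] .
  show "subgroup (T closure_of H) G"
    unfolding e using subgroups_Inter[of "range (\<lambda>n. H <#> I n)"] n normal_imp_subgroup by auto
  show "g \<otimes> x \<otimes> inv g \<in> T closure_of H" if "x \<in> T closure_of H" "g \<in> carrier G" for x g
    using that normal_conj[OF n] unfolding e by blast
qed

lemma power_subgroup_normal:
  assumes "N \<lhd> G"
  shows "power_subgroup G q N \<lhd> G"
proof -
  interpret N: normal N G by fact
  show ?thesis unfolding power_subgroup_def
  proof (rule normal_generateI)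
    show "(\<lambda>x. x [^] q) ` N \<subseteq> carrier G" by auto
    fix h g assume h: "h \<in> (\<lambda>x. x [^] q) ` N" and g: "g \<in> carrier G"
    then obtain x where x: "x \<in> N" "h = x [^] q" by blast
    then have "g \<otimes> h \<otimes> inv g = (g \<otimes> x \<otimes> inv g) [^] q" using conj_pow g by simp
    then show "g \<otimes> h \<otimes> inv g \<in> (\<lambda>x. x [^] q) ` N" using N.inv_op_closed2[OF g x(1)] by blast
  qed
qed

lemma closed_powers_normal: "N \<lhd> G \<Longrightarrow> closed_powers q N \<lhd> G"
  unfolding closed_powers_def by (intro closure_of_normal power_subgroup_normal)

lemma closedin_closed_powers: "closedin T (closed_powers q N)"
  by (simp add: closed_powers_def)

lemma closed_powers_least:
  assumes "subgroup L G" "closedin T L" "\<And>x. x \<in> N \<Longrightarrow> x [^] q \<in> L"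
  shows "closed_powers q N \<subseteq> L"
  unfolding closed_powers_def power_subgroup_def
  using assms by (intro closure_of_minimal generate_subgroup_incl) auto

lemma closed_powers_pow:
  assumes "N \<subseteq> carrier G" "x \<in> N"
  shows "x [^] q \<in> closed_powers q N"
proof -
  have "x [^] q \<in> power_subgroup G q N" unfolding power_subgroup_def using assms(2)
    by (intro generate.incl) auto
  moreover have "power_subgroup G q N \<subseteq> topspace T"
    unfolding power_subgroup_def topspace_eq using assms(1) by (intro generate_incl) auto
  ultimately show ?thesis unfolding closed_powers_def using closure_of_subset by blast
qed

lemma closed_powers_subset: "subgroup N G \<Longrightarrow> closedin T N \<Longrightarrow> closed_powers q N \<subseteq> N"
  by (rule closed_powers_least) (auto intro: subgroup_pow)

lemma closed_powers_mult:
  assumes "N \<lhd> G"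
  shows "closed_powers (p * q) N \<subseteq> closed_powers q (closed_powers p N)"
proof (rule closed_powers_least[OF normal_imp_subgroup[OF closed_powers_normal[OF closed_powers_normal[OF
    assms]]] closedin_closed_powers])
  fix x assume x: "x \<in> N"
  have N: "N \<subseteq> carrier G" "closed_powers p N \<subseteq> carrier G"
    using subgroup.subset normal_imp_subgroup assms closed_powers_normal by blast+
  have "(x [^] p) [^] q \<in> closed_powers q (closed_powers p N)"
    using closed_powers_pow[OF N(2) closed_powers_pow[OF N(1) x]] .
  then show "x [^] (p * q) \<in> closed_powers q (closed_powers p N)" using x N(1)
    by (simp add: nat_pow_pow subset_iff)
qed

text \<open>The bound is the product, over the factors of \<open>ser X\<close>, of the indices of
  their \<open>q\<close>-th powers. The intersections of \<open>ser X\<close> with \<open>N\<close>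
  filter \<open>N\<close> down to its closed powers, and \<open>idx_powers_mod_le\<close> bounds
  each step. Independence of \<open>N\<close> lets a single \<open>I b\<close> act on all terms of a
  power chain.\<close>

lemma closed_powers_index_bound:
  assumes X: "radicable X" and q: "q > 0"
  obtains b where "\<And>N. N \<lhd> G \<Longrightarrow> closedin T N \<Longrightarrow> N \<subseteq> X \<Longrightarrow> fin_idx X N \<Longrightarrow>
    fin_idx N (closed_powers q N) \<and> idx N (closed_powers q N) \<le> b"
proof -
  note pX = radicable_pure[OF X]
  note S = ser_pure_subset[OF pX]
  obtain c where c: "ser X c = {\<one>}" using radicable_nilpotent[OF X] .
  define d where "d = (\<lambda>i. idx (ser X i) (powers_mod q (ser X i) (ser X (Suc i))))"
  have fq: "fin_idx (ser X i) (powers_mod q (ser X i) (ser X (Suc i)))" for i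
  proof -
    obtain k where k: "\<And>x. x \<in> ser X i \<Longrightarrow> (\<phi> ^^ k) x \<in> powers_mod q (ser X i) (ser X (Suc i))"
      using ser_pow[OF X q, of i] by blast
    have "subgroup (powers_mod q (ser X i) (ser X (Suc i))) G"
      using powers_mod_normal[OF pureD(1)[OF S(1)] pureD(1)[OF S(1)] S(2) ser_abelian[OF pX]]
          normal_imp_subgroup by blast
    then show ?thesis
      using idx_trans(3)[OF pureD(2)[OF S(1)] _ subgroup_phik_image[OF pureD(2)[OF S(1)], of k] _
          powers_mod_subset[OF pureD(2)[OF S(1)] S(2)]]
        fin_idx_phik[OF pure_good[OF S(1)]] k by blast
  qed
  have "fin_idx N (closed_powers q N) \<and> idx N (closed_powers q N) \<le> (\<Prod>i<c. d i)"
    if N: "N \<lhd> G" "closedin T N" "N \<subseteq> X" "fin_idx X N" for N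
  proof -
    interpret N: normal N G by (rule N(1))
    let ?V = "closed_powers q N"
    have Vn: "?V \<lhd> G" using closed_powers_normal[OF N(1)] .
    interpret V: normal ?V G by (rule Vn)
    have VN: "?V \<subseteq> N" using closed_powers_subset[OF N.subgroup_axioms N(2)] .
    define R where "R = (\<lambda>i. (N \<inter> ser X i) <#> ?V)"
    have NSn: "N \<inter> ser X i \<lhd> G" for i using normal_subgroup_intersect[OF N(1) pureD(1)[OF S(1)]] .
    have Rs: "subgroup (R i) G" for i
      unfolding R_def using subgroup_set_mult[OF normal_imp_subgroup[OF NSn] Vn] .
    have RN: "R i \<subseteq> N" for i unfolding R_def using VN by (intro set_mult_subset N.subgroup_axioms) auto
    have Rdec: "R (Suc i) \<subseteq> R i" for i unfolding R_def using S(2) by (intro mono_set_mult) auto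
    have VR: "?V \<subseteq> R i" and NSR: "N \<inter> ser X i \<subseteq> R i" for i
      unfolding R_def using set_mult_supset[OF normal_imp_subgroup[OF NSn] V.subgroup_axioms] by auto
    have step: "fin_idx (R i) (R (Suc i)) \<and> idx (R i) (R (Suc i)) \<le> d i" for i
    proof -
      have fN: "fin_idx (ser X i) (ser X i \<inter> N)"
        using fin_idx_Int[OF pureD(2)[OF pX] N.subgroup_axioms pureD(2)[OF S(1)] S(3) N(4)] .
      have tf: "\<And>x. x \<in> ser X i \<Longrightarrow> x [^] q \<in> ser X (Suc i) \<Longrightarrow> x \<in> ser X (Suc i)"
        using ser_torsion_free[OF X q] by blast
      note pwle = idx_powers_mod_le[OF pureD(1)[OF S(1)] pureD(1)[OF S(1)] S(2) ser_abelian[OF pX] tf fq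
          N(1) fN]
      have sub: "powers_mod q (N \<inter> ser X i) (N \<inter> ser X (Suc i)) \<subseteq> R (Suc i)"
        unfolding R_def set_mult_def powers_mod_def using closed_powers_pow[OF N.subset] by blast
      have ps: "subgroup (powers_mod q (N \<inter> ser X i) (N \<inter> ser X (Suc i))) G"
      proof (rule normal_imp_subgroup, rule powers_mod_normal[OF NSn NSn])
        show "N \<inter> ser X (Suc i) \<subseteq> N \<inter> ser X i" using S(2) by blast
        show "cm x y \<in> N \<inter> ser X (Suc i)" if "x \<in> N \<inter> ser X i" "y \<in> N \<inter> ser X i" for x y
          using that ser_abelian[OF pX] subgroup_cm[OF N.subgroup_axioms] by blast
      qed
      have "\<exists>x\<in>N \<inter> ser X i. z \<otimes> inv x \<in> R (Suc i)" if z: "z \<in> R i" for z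
      proof -
        obtain v w where vw: "v \<in> N \<inter> ser X i" "w \<in> ?V" "z = v \<otimes> w" using z by (auto simp: R_def set_mult_def)
        then have "z \<otimes> inv v \<in> ?V" using V.inv_op_closed2[of v w] by simp
        then show ?thesis using vw VR by blast
      qed
      then have "fin_idx (R i) (R (Suc i))" "idx (R i) (R (Suc i)) \<le> idx (N \<inter> ser X i) (powers_mod q (N \<inter> ser X i) (N \<inter> ser X (Suc i)))"
        using idx_surj_le[OF ps _ Rs subgroup.subset[OF Rs], of "N \<inter> ser X i" "\<lambda>x. x" "Suc i" i] sub
            pwle(1) N.subset by auto
      then show ?thesis using pwle(2) by (simp add: d_def)
    qed
    have "fin_idx N (R i) \<and> idx N (R i) \<le> (\<Prod>j<i. d j)" for i
    proof (induction i)
      case 0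
      have "R 0 = N" using RN[of 0] NSR[of 0] N(3) by auto
      moreover have "N #> x = N" if "x \<in> N" for x using coset_eq_self_iff[OF N.subgroup_axioms] that by simp
      then have "(\<lambda>x. N #> x) ` N = {N}" using N.one_closed by blast
      ultimately show ?case by (simp add: fin_idx_def idx_def)
    next
      case (Suc i)
      note t = idx_trans[OF N.subgroup_axioms Rs Rs Rdec RN, of i]
      show ?case using t(1) t(2) step[of i] Suc by (auto intro: mult_le_mono)
    qed
    moreover have "R c = ?V"
    proof -
      have "N \<inter> ser X c = {\<one>}" using c N.one_closed by blast
      then show ?thesis unfolding R_def set_mult_def by auto
    qed
    ultimately show ?thesis by metis
  qed
  then show ?thesis using that by blast
qed

lemma closedin_powers_mod:
  assumes "closedin T P" "closedin T Q"
  shows "closedin T (powers_mod n P Q)"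
proof -
  have "continuous_map (prod_topology T T) T (\<lambda>(q, x). q \<otimes> x [^] n)"
    unfolding case_prod_unfold
    by (intro continuous_map_mult continuous_map_pow continuous_map_fst continuous_map_snd)
  from closedin_image2[OF this assms(2,1)] show ?thesis by (simp add: powers_mod_def)
qed

text \<open>Membership in the part gives an exponent that depends on \<open>x\<close>. Its gcd with
  the common exponent \<open>M = m ^ k\<close> is a power of \<open>p\<close> that is at most
  \<open>M\<close>, so \<open>p ^ M\<close> serves all \<open>x\<close>.\<close>

lemma uniform_exponent:
  assumes X: "X \<subseteq> C" and p: "prime p" and t: "part p X = X"
  shows "\<exists>e. \<forall>x\<in>X. x [^] (p ^ e) \<in> I n"
proof -
  obtain k where k: "\<forall>x\<in>C. x [^] (m ^ k) \<in> I n" using pow_m_mem_I by blast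
  define M where "M = m ^ k"
  have M: "M > 0" using m_pos by (simp add: M_def)
  have "x [^] (p ^ M) \<in> I n" if x: "x \<in> X" for x
  proof -
    interpret N: subgroup "I n" G by (rule I_subgroup)
    have xc: "x \<in> carrier G" using x X by auto
    have xM: "x [^] M \<in> I n" using k x X by (auto simp: M_def)
    obtain j where j: "x [^] (p ^ j) \<in> I n" using x t by (auto simp: part_def)
    have "p ^ j \<noteq> 0" using p by (simp add: prime_gt_0_nat)
    then obtain u v where uv: "p ^ j * u = M * v + gcd (p ^ j) M" using bezout_nat by blast
    have "x [^] (p ^ j * u) \<in> I n" "x [^] (M * v) \<in> I n"
      using j xM subgroup_pow[OF I_subgroup] xc by (auto simp: nat_pow_pow[symmetric])
    then have "inv (x [^] (M * v)) \<otimes> (x [^] (M * v) \<otimes> x [^] gcd (p ^ j) M) \<in> I n"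
      using xc by (simp add: uv nat_pow_mult)
    then have g: "x [^] gcd (p ^ j) M \<in> I n" using xc by simp
    obtain i where i: "gcd (p ^ j) M = p ^ i" using divides_primepow_nat[OF p, of "gcd (p ^ j) M" j] by auto
    have "p ^ i \<le> M" using i M by (metis gcd_le2_nat less_not_refl)
    moreover have "i < p ^ i" using power_gt_expt[of p i] prime_gt_Suc_0_nat[OF p] by simp
    ultimately have "i \<le> M" by simp
    then have "p ^ M = p ^ i * p ^ (M - i)" by (simp flip: power_add)
    then show ?thesis using subgroup_pow[OF I_subgroup g] xc i by (simp add: nat_pow_pow[symmetric])
  qed
  then show ?thesis by blast
qed

text \<open>Descent along \<open>ser X\<close>, modulo \<open>I n\<close>: after \<open>t\<close>
  steps the chain consists of \<open>p ^ t\<close>-th powers up to the next term, and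
  \<open>p ^ e\<close>-th powers of elements of \<open>X\<close> lie in \<open>I n\<close>. Each
  term of \<open>ser X\<close> is thus passed in finitely many steps.\<close>

lemma power_chain_small:
  assumes X: "radicable X" and p: "prime p" "part p X = X"
    and V: "\<And>j. V j \<lhd> G" "V 0 \<subseteq> X" "\<And>j. V (Suc j) = closed_powers p (V j)"
  shows "\<exists>j. V j \<subseteq> I n"
proof -
  note pX = radicable_pure[OF X]
  note S = ser_pure_subset[OF pX]
  obtain e where e: "\<forall>x\<in>X. x [^] (p ^ e) \<in> I n" using uniform_exponent[OF pureD(4)[OF pX] p] by blast
  interpret N: normal "I n" G by (rule I_normal)
  have SI: "ser X i <#> I n \<lhd> G" for i using normal_set_mult[OF pureD(1)[OF S(1)] I_normal] .
  have ISI: "I n \<subseteq> ser X i <#> I n" "ser X i \<subseteq> ser X i <#> I n" for i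
    using set_mult_supset[OF pureD(2)[OF S(1)] I_subgroup] by auto
  have SIcl: "closedin T (ser X i <#> I n)" for i
    using closedin_set_mult[OF pureD(3)[OF S(1)] open_subgroup_closed[OF I_subgroup I_open]] .
  have Sc: "s \<in> carrier G" if "s \<in> ser X i" for s i using that pureD(7)[OF S(1)] by blast
  have SIdec: "ser X (Suc i) <#> I n \<subseteq> ser X i <#> I n" for i using S(2) by (intro mono_set_mult) auto
  have SIc: "cm x y \<in> ser X (Suc i) <#> I n" if xy: "x \<in> ser X i <#> I n" "y \<in> ser X i <#> I n" for x y i
  proof -
    obtain s u s' u' where su: "s \<in> ser X i" "u \<in> I n" "x = s \<otimes> u" "s' \<in> ser X i" "u' \<in> I n" "y = s' \<otimes> u'"
      using xy unfolding set_mult_def by blast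
    have c: "s \<in> carrier G" "s' \<in> carrier G" "u \<in> carrier G" "u' \<in> carrier G" using su Sc by auto
    let ?B = "ser X (Suc i) <#> I n"
    have Bs: "subgroup ?B G" using normal_imp_subgroup[OF SI] .
    have 1: "s \<otimes> cm u y \<otimes> inv s \<in> ?B"
      using N.inv_op_closed2[OF c(1)] normal_cm(1)[OF N.normal_axioms su(2), of y] su c ISI by auto
    have 2: "s' \<otimes> cm s u' \<otimes> inv s' \<in> ?B"
      using N.inv_op_closed2[OF c(2)] normal_cm(2)[OF N.normal_axioms su(5), of s] c ISI by auto
    have "cm s s' \<in> ?B" using ser_abelian[OF pX su(1,4)] ISI by blast
    then have "cm s y \<in> ?B" using 2 cm_mult_right[of s' u' s] c su subgroup.m_closed[OF Bs] by simp
    then show ?thesis using 1 cm_mult_left[of s u y] c su subgroup.m_closed[OF Bs] by simp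
  qed
  obtain c where c: "ser X c = {\<one>}" using radicable_nilpotent[OF X] .
  have "\<exists>j. V j \<subseteq> ser X i <#> I n" for i
  proof (induction i)
    case 0
    then show ?case using V(2) ISI(2)[of 0] by (intro exI[of _ 0]) auto
  next
    case (Suc i)
    then obtain j where j: "V j \<subseteq> ser X i <#> I n" by blast
    let ?A = "ser X i <#> I n" and ?B = "ser X (Suc i) <#> I n"
    interpret A: normal ?A G by (rule SI)
    interpret B: normal ?B G by (rule SI)
    have pwn: "powers_mod r ?A ?B \<lhd> G" for r using powers_mod_normal[OF SI SI SIdec SIc] .
    have "V (j + t) \<subseteq> powers_mod (p ^ t) ?A ?B" for t
    proof (induction t)
      case 0
      have "x \<in> powers_mod 1 ?A ?B" if "x \<in> ?A" for x
        using powers_mod_supset(2)[OF A.subgroup_axioms SI that, of 1] that by simp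
      then show ?case using j by auto
    next
      case (Suc t)
      have "V (j + Suc t) = closed_powers p (V (j + t))" using V(3) by simp
      also have "\<dots> \<subseteq> powers_mod (p ^ Suc t) ?A ?B"
      proof (rule closed_powers_least[OF normal_imp_subgroup[OF pwn] closedin_powers_mod[OF SIcl SIcl]])
        fix x assume "x \<in> V (j + t)"
        then have x: "x \<in> powers_mod (p ^ t) ?A ?B" using Suc by blast
        have xc: "x \<in> carrier G" using x subgroup.mem_carrier[OF normal_imp_subgroup[OF pwn]] by blast
        obtain y where y: "y \<in> ?A" "?B #> x = ?B #> y [^] (p ^ t)"
          using x powers_mod_iff[OF A.subset SI xc] by blast
        then have "?B #> x [^] p = ?B #> y [^] (p ^ Suc t)"
          using coset_pow[OF SI xc _ y(2), of p] by (simp add: nat_pow_pow mult.commute)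
        then show "x [^] p \<in> powers_mod (p ^ Suc t) ?A ?B"
          using powers_mod_iff[OF A.subset SI, of "x [^] p"] y(1) xc by auto
      qed
      finally show ?case .
    qed
    then have "V (j + e) \<subseteq> powers_mod (p ^ e) ?A ?B" .
    also have "\<dots> \<subseteq> ?B"
    proof
      fix z assume "z \<in> powers_mod (p ^ e) ?A ?B"
      then obtain b y where by': "b \<in> ?B" "y \<in> ?A" "z = b \<otimes> y [^] (p ^ e)" by (auto simp: powers_mod_def)
      obtain s u where su: "s \<in> ser X i" "u \<in> I n" "y = s \<otimes> u" using by'(2) by (auto simp: set_mult_def)
      have sc: "s \<in> carrier G" "u \<in> carrier G" "y \<in> carrier G" using su Sc by auto
      have "y \<otimes> inv s \<in> I n" using su(2,3) sc N.inv_op_closed2[of s u] by simp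
      then have "I n #> y = I n #> s" using coset_eq_iff[OF I_subgroup sc(3,1)] by simp
      then have "I n #> y [^] (p ^ e) = I n #> s [^] (p ^ e)" using coset_pow[OF I_normal sc(3,1)] by blast
      also have "\<dots> = I n" using coset_eq_self_iff[OF I_subgroup] e su(1) S(3) sc(1) by blast
      finally have "y [^] (p ^ e) \<in> I n" using coset_eq_self_iff[OF I_subgroup] sc by simp
      then show "z \<in> ?B" using by' ISI(1) by blast
    qed
    finally show ?case by blast
  qed
  then obtain j where "V j \<subseteq> ser X c <#> I n" by blast
  moreover have "ser X c <#> I n = I n" using c by (auto simp: set_mult_def)
  ultimately show ?thesis by auto
qed

text \<open>The power chain starts in \<open>X \<inter> I b\<close>, where \<open>b\<close> bounds
  the indices of closed \<open>p * p\<close>-th powers. So its terms are centralised by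
  \<open>I b\<close> modulo these powers, commutators drop two levels, and
  \<open>x \<mapsto> x [^] p\<close> is a surjective homomorphism from each factor to the next. The
  indices cannot increase and become constant.\<close>

lemma uniform_chain:
  assumes X: "radicable X" and p: "prime p" "part p X = X"
  obtains V where "\<And>j. V j \<lhd> G" "\<And>j. closedin T (V j)" "V 0 \<subseteq> X" "fin_idx X (V 0)"
    "\<And>j. V (Suc j) = closed_powers p (V j)" "\<And>j. V (Suc j) \<subseteq> V j"
    "\<And>j x y. x \<in> V j \<Longrightarrow> y \<in> V 0 \<Longrightarrow> cm x y \<in> closed_powers (p * p) (V j)"
    "\<And>j. closed_powers (p * p) (V j) \<subseteq> V (Suc (Suc j))"
    "\<And>j. fin_idx (V j) (V (Suc j))" "\<And>j. idx (V j) (V (Suc j)) = idx (V 0) (V 1)"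
    "\<And>n. \<exists>j. V j \<subseteq> I n"
proof -
  note pX = radicable_pure[OF X]
  have pp: "p * p > 0" using p by (simp add: prime_gt_0_nat)
  obtain b where b: "\<And>N. N \<lhd> G \<Longrightarrow> closedin T N \<Longrightarrow> N \<subseteq> X \<Longrightarrow> fin_idx X N \<Longrightarrow>
    fin_idx N (closed_powers (p * p) N) \<and> idx N (closed_powers (p * p) N) \<le> b"
    using closed_powers_index_bound[OF X pp] by blast
  define W where "W = (\<lambda>j. (closed_powers p ^^ j) (X \<inter> I b))"
  have WS: "W (Suc j) = closed_powers p (W j)" for j by (simp add: W_def)
  have sq: "closed_powers (p * p) N \<subseteq> closed_powers p (closed_powers p N)" if "N \<lhd> G" for N
    using closed_powers_mult[OF that] .
  have W: "W j \<lhd> G \<and> closedin T (W j) \<and> W j \<subseteq> X \<inter> I b \<and> fin_idx X (W j)" for j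
  proof (induction j)
    case 0
    show ?case using good_HI[OF pure_good[OF pX], of b] fin_idx_I[OF pureD(2)[OF pX], of b]
      by (auto simp: W_def good_def)
  next
    case (Suc j)
    have n: "W (Suc j) \<lhd> G" "closedin T (W (Suc j))"
      using closed_powers_normal closedin_closed_powers Suc by (auto simp: WS)
    have sub: "W (Suc j) \<subseteq> W j" unfolding WS using closed_powers_subset Suc normal_imp_subgroup by blast
    have sp: "subgroup (closed_powers (p * p) (W j)) G"
      using closed_powers_normal Suc normal_imp_subgroup by blast
    have "closed_powers (p * p) (W j) \<subseteq> closed_powers p (closed_powers p (W j))" using sq Suc by blast
    also have "\<dots> \<subseteq> W (Suc j)" unfolding WS[symmetric] using closed_powers_subset n normal_imp_subgroup
      by (metis WS)
    finally have "closed_powers (p * p) (W j) \<subseteq> W (Suc j)" .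
    then have "fin_idx (W j) (W (Suc j))"
      using idx_trans(3)[OF _ normal_imp_subgroup[OF n(1)] sp _ sub] b Suc normal_imp_subgroup by blast
    then have "fin_idx X (W (Suc j))"
      using idx_trans(2)[OF pureD(2)[OF pX] _ normal_imp_subgroup[OF n(1)] sub] Suc normal_imp_subgroup by blast
    then show ?case using n sub Suc by blast
  qed
  have Wn: "W j \<lhd> G" and Wcl: "closedin T (W j)" and WX: "W j \<subseteq> X" and Wf: "fin_idx X (W j)"
      and WI: "W j \<subseteq> I b" for j
    using W by blast+
  have Ws: "subgroup (W j) G" for j using normal_imp_subgroup[OF Wn] .
  have Wc: "x \<in> carrier G" if "x \<in> W j" for x j using that subgroup.mem_carrier[OF Ws] by blast
  have Wdec: "W (Suc j) \<subseteq> W j" for j unfolding WS using closed_powers_subset[OF Ws Wcl] .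
  have Wcm: "cm x y \<in> closed_powers (p * p) (W j)" if x: "x \<in> W j" and y: "y \<in> I b" for x y j
  proof (rule I_centralizes[OF Wn closed_powers_normal[OF Wn] closedin_closed_powers _ _ _ x y])
    show "closed_powers (p * p) (W j) \<subseteq> W j" by (rule closed_powers_subset[OF Ws Wcl])
    show "fin_idx (W j) (closed_powers (p * p) (W j))" "idx (W j) (closed_powers (p * p) (W j)) \<le> b"
      using b[OF Wn Wcl WX Wf] by auto
  qed
  have W2: "closed_powers (p * p) (W j) \<subseteq> W (Suc (Suc j))" for j unfolding WS using sq[OF Wn] .
  have Wfin: "fin_idx (W j) (W (Suc j))" for j
    using idx_trans(4)[OF pureD(2)[OF pX] Ws Ws Wdec WX Wf] .
  have mono: "idx (W (Suc j)) (W (Suc (Suc j))) \<le> idx (W j) (W (Suc j))" for j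
  proof -
    have com: "cm x y \<in> W (Suc (Suc j))" if "x \<in> W j" "y \<in> W j" for x y
      using Wcm[OF that(1)] that(2) WI W2 by blast
    have sub2: "W (Suc (Suc j)) \<subseteq> W j" using Wdec by blast
    \<comment> \<open>The right-hand side is a closed subgroup containing all \<open>p\<close>-th
      powers, so single \<open>p\<close>-th powers exhaust \<open>W (Suc j)\<close> modulo the next
      term.\<close>
    have surj: "W (Suc j) \<subseteq> powers_mod p (W j) (W (Suc (Suc j)))"
      unfolding WS[of j]
      by (rule closed_powers_least[OF normal_imp_subgroup[OF powers_mod_normal[OF Wn Wn sub2 com]]
          closedin_powers_mod[OF Wcl Wcl] powers_mod_supset(2)[OF Ws Wn]])
    show ?thesis
    proof (rule idx_surj_le(2)[OF Ws subgroup.subset[OF Ws] Ws subgroup.subset[OF Ws], of "\<lambda>x. x [^] p" j])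
      show "(\<lambda>x. x [^] p) ` W j \<subseteq> carrier G" using Wc by auto
      show "fin_idx (W j) (W (Suc j))" by (rule Wfin)
      show "\<exists>x\<in>W j. z \<otimes> inv (x [^] p) \<in> W (Suc (Suc j))" if z: "z \<in> W (Suc j)" for z
      proof -
        obtain t x where "t \<in> W (Suc (Suc j))" "x \<in> W j" "z = t \<otimes> x [^] p" using surj z
          by (auto simp: powers_mod_def)
        then have "z \<otimes> inv (x [^] p) = t" using Wc by (simp add: m_assoc)
        then show ?thesis using \<open>t \<in> _\<close> \<open>x \<in> W j\<close> by auto
      qed
      fix x y assume xy: "x \<in> W j" "y \<in> W j" "x \<otimes> inv y \<in> W (Suc j)"
      have c: "x \<in> carrier G" "y \<in> carrier G" using xy Wc by auto
      have iy: "inv y \<in> W j" using xy subgroup.m_inv_closed[OF Ws] by blast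
      have "(x \<otimes> inv y) [^] p \<in> W (Suc (Suc j))" unfolding WS[of "Suc j"]
        using closed_powers_pow[OF subgroup.subset[OF Ws] xy(3)] .
      moreover have "W (Suc (Suc j)) #> (x \<otimes> inv y) [^] p = W (Suc (Suc j)) #> (x [^] p \<otimes> inv (y [^] p))"
        using pow_mult_inv_coset[OF Wn c com[OF xy(1) iy]] .
      ultimately show "x [^] p \<otimes> inv (y [^] p) \<in> W (Suc (Suc j))"
        using coset_eq_self_iff[OF Ws, of "(x \<otimes> inv y) [^] p" "Suc (Suc j)"] c
          coset_eq_self_iff[OF Ws, of "x [^] p \<otimes> inv (y [^] p)" "Suc (Suc j)"]
        by (metis inv_closed m_closed nat_pow_closed)
    qed
  qed
  \<comment> \<open>From the level of minimal index on, monotonicity makes all indices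
    equal.\<close>
  obtain k where k: "\<And>i. idx (W k) (W (Suc k)) \<le> idx (W i) (W (Suc i))"
    using ex_has_least_nat[of "\<lambda>_. True" _ "\<lambda>i. idx (W i) (W (Suc i))"] by blast
  have le: "idx (W (k + j)) (W (Suc (k + j))) \<le> idx (W k) (W (Suc k))" for j
    by (induction j) (use mono in \<open>auto intro: order_trans\<close>)
  have eq: "idx (W (k + j)) (W (Suc (k + j))) = idx (W k) (W (Suc k))" for j
    using le[of j] k[of "k + j"] by simp
  show ?thesis
  proof (rule that[of "\<lambda>j. W (k + j)"])
    show "\<exists>j. W (k + j) \<subseteq> I n" for n
      using power_chain_small[OF X p, of "\<lambda>j. W (k + j)"] Wn WX WS by simp
    show "cm x y \<in> closed_powers (p * p) (W (k + j))" if "x \<in> W (k + j)" "y \<in> W (k + 0)" for j x y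
      using Wcm that WI by blast
    show "idx (W (k + j)) (W (k + Suc j)) = idx (W (k + 0)) (W (k + 1))" for j using eq[of j] by simp
  qed (use Wn Wcl WX Wf WS Wdec W2 Wfin in auto)
qed

end

section \<open>Nilpotency, prime power order and topology of subgroups and quotients\<close>

context group
begin

lemma cm_consistent:
  assumes "subgroup A G" "x \<in> A" "y \<in> A"
  shows "group.cm (G\<lparr>carrier := A\<rparr>) x y = cm x y"
proof -
  interpret A: group "G\<lparr>carrier := A\<rparr>" using subgroup_imp_group[OF assms(1)] .
  show ?thesis using assms by (simp add: A.cm_def cm_def)
qed

lemma nilpotent_groupI:
  assumes Z: "Z 0 = carrier G" "\<And>i::nat. subgroup (Z i) G"
    and cmZ: "\<And>i x y. x \<in> Z i \<Longrightarrow> y \<in> carrier G \<Longrightarrow> cm x y \<in> Z (Suc i)" and c: "Z c = {\<one>}"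
  shows "nilpotent_group G"
proof -
  have "lower_central G i \<subseteq> Z i" for i
  proof (induction i)
    case (Suc i)
    show ?case
      unfolding lower_central.simps commutator_subgroup_def
      by (rule generate_subgroup_incl[OF _ Z(2)]) (use Suc cmZ in \<open>auto simp: cm_def\<close>)
  qed (simp add: Z)
  moreover have "\<one> \<in> lower_central G i" for i
    by (cases i) (auto simp: commutator_subgroup_def generate.one)
  ultimately have "lower_central G c = {\<one>}" using c by blast
  then show ?thesis unfolding nilpotent_group_def using is_group by blast
qed

lemma nilpotent_Mod:
  assumes N: "N \<lhd> G" and Z: "Z 0 = carrier G" "\<And>i::nat. subgroup (Z i) G"
    and cmZ: "\<And>i x y. x \<in> Z i \<Longrightarrow> y \<in> carrier G \<Longrightarrow> cm x y \<in> Z (Suc i)" and c: "Z c \<subseteq> N"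
  shows "nilpotent_group (G Mod N)"
proof -
  interpret N: normal N G by (rule N)
  interpret Q: group "G Mod N" by (rule N.factorgroup_is_group)
  have hom: "(#>) N \<in> hom G (G Mod N)" by (rule N.r_coset_hom_Mod)
  interpret h: group_hom G "G Mod N" "(#>) N" using hom by unfold_locales
  note [simp del] = mult_FactGroup one_FactGroup
  show ?thesis
  proof (rule Q.nilpotent_groupI[of "\<lambda>i. (#>) N ` Z i"])
    show "(#>) N ` Z 0 = carrier (G Mod N)" by (simp add: Z(1) carrier_FactGroup)
    show "subgroup ((#>) N ` Z i) (G Mod N)" for i using h.subgroup_img_is_subgroup[OF Z(2)] .
    show "Q.cm u v \<in> (#>) N ` Z (Suc i)" if "u \<in> (#>) N ` Z i" "v \<in> carrier (G Mod N)" for i u v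
    proof -
      obtain x y where xy: "x \<in> Z i" "y \<in> carrier G" "u = N #> x" "v = N #> y"
        using \<open>u \<in> _\<close> \<open>v \<in> _\<close> by (auto simp: carrier_FactGroup)
      have "x \<in> carrier G" using xy(1) subgroup.mem_carrier[OF Z(2)] by blast
      then have "Q.cm u v = N #> cm x y" using hom_cm[OF hom Q.is_group] xy by simp
      then show ?thesis using cmZ[OF xy(1,2)] by simp
    qed
    have "N #> x = \<one>\<^bsub>G Mod N\<^esub>" if "x \<in> Z c" for x
      using coset_eq_self_iff[OF N.subgroup_axioms, of x] that c by (auto simp: one_FactGroup)
    then show "(#>) N ` Z c = {\<one>\<^bsub>G Mod N\<^esub>}" using subgroup.one_closed[OF Z(2)[of c]] by blast
  qed
qed

lemma comm_group_Mod:
  assumes N: "N \<lhd> G" and c: "\<And>x y. x \<in> carrier G \<Longrightarrow> y \<in> carrier G \<Longrightarrow> cm x y \<in> N"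
  shows "comm_group (G Mod N)"
proof -
  interpret N: normal N G by (rule N)
  interpret Q: group "G Mod N" by (rule N.factorgroup_is_group)
  show ?thesis
  proof (rule Q.group_comm_groupI)
    fix u v assume "u \<in> carrier (G Mod N)" "v \<in> carrier (G Mod N)"
    then obtain x y where xy: "x \<in> carrier G" "y \<in> carrier G" "u = N #> x" "v = N #> y"
      by (auto simp: carrier_FactGroup)
    have "N #> (x \<otimes> y) = N #> (cm x y \<otimes> (y \<otimes> x))" using cm_mult xy by simp
    also have "\<dots> = N #> (y \<otimes> x)"
      using coset_eq_iff[OF N.subgroup_axioms, of "cm x y \<otimes> (y \<otimes> x)" "y \<otimes> x"] c[OF xy(1,2)] xy
        by (simp add: m_assoc)
    finally show "u \<otimes>\<^bsub>G Mod N\<^esub> v = v \<otimes>\<^bsub>G Mod N\<^esub> u" using xy N.rcos_sum by simp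
  qed
qed

text \<open>Cauchy's theorem, read off from Sylow with exponent \<open>1\<close>: another prime
  \<open>l\<close> dividing the order would give a nontrivial element whose order divides both
  \<open>l\<close> and a power of \<open>p\<close>.\<close>

lemma order_prime_power:
  assumes fin: "finite (carrier G)" and p: "prime p" and t: "\<And>x. x \<in> carrier G \<Longrightarrow> \<exists>j. x [^] ((p::nat) ^ j) = \<one>"
  shows "\<exists>k. order G = p ^ k"
proof -
  have pos: "order G > 0" using fin order_gt_0_iff_finite by blast
  have "l = p" if l: "prime l" "l dvd order G" for l
  proof (rule ccontr)
    assume "l \<noteq> p"
    obtain k where "order G = l ^ 1 * k" using l(2) by auto
    then obtain H where H: "subgroup H G" "card H = l ^ 1"
      using sylow_thm[OF l(1) is_group _ fin] by blast
    interpret H: subgroup H G by (rule H(1))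
    interpret HG: group "G\<lparr>carrier := H\<rparr>" using subgroup_imp_group[OF H(1)] .
    have "card H > 1" using H(2) prime_gt_1_nat[OF l(1)] by simp
    then obtain x where x: "x \<in> H" "x \<noteq> \<one>"
      by (metis H.one_closed One_nat_def card_le_Suc0_iff_eq card.infinite not_less le_zero_eq
          not_one_less_zero less_imp_le nat_neq_iff zero_less_one)
    have "x [^]\<^bsub>G\<lparr>carrier := H\<rparr>\<^esub> order (G\<lparr>carrier := H\<rparr>) = \<one>\<^bsub>G\<lparr>carrier := H\<rparr>\<^esub>"
      using HG.pow_order_eq_1[of x] x by simp
    then have xl: "x [^] l = \<one>" using H(2) by (simp add: order_def nat_pow_consistent[symmetric])
    obtain j where j: "x [^] (p ^ j) = \<one>" using t[OF H.mem_carrier[OF x(1)]] by blast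
    have "ord x dvd l" "ord x dvd p ^ j" using pow_eq_id xl j x by auto
    moreover have "coprime l (p ^ j)" using \<open>l \<noteq> p\<close> l(1) p by (simp add: primes_coprime)
    ultimately have "ord x = 1" by (metis coprime_common_divisor_nat)
    then show False using ord_eq_1 x by auto
  qed
  then have "\<forall>q\<in>prime_factors (order G). q = p" by (simp add: in_prime_factors_iff)
  then have "set_mset (prime_factorization (order G)) \<subseteq> {p}" by auto
  then obtain k where "prime_factorization (order G) = replicate_mset k p"
    by (metis set_mset_subset_singletonD)
  then have "order G = p ^ k" using prod_mset_prime_factorization_nat[OF pos] by simp
  then show ?thesis ..
qed

end

lemma (in topological_group) subgroup_topological_group:
  assumes "subgroup A G"
  shows "topological_group (G\<lparr>carrier := A\<rparr>) (subtopology T A)"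
proof -
  interpret A: subgroup A G by fact
  have 0: "prod_topology (subtopology T A) (subtopology T A) = subtopology (prod_topology T T) (A \<times> A)"
    by (simp add: subtopology_Times)
  have 1: "continuous_map (prod_topology (subtopology T A) (subtopology T A)) (subtopology T A) (\<lambda>(x, y). x \<otimes> y)"
    unfolding 0 continuous_map_in_subtopology
    using continuous_map_from_subtopology[OF continuous_mult] by auto
  have "continuous_map (subtopology T A) (subtopology T A) (\<lambda>x. inv x)"
    unfolding continuous_map_in_subtopology
    using continuous_map_from_subtopology[OF continuous_inv] topspace_eq by auto
  then have 2: "continuous_map (subtopology T A) (subtopology T A) (\<lambda>x. inv\<^bsub>G\<lparr>carrier := A\<rparr>\<^esub> x)"
    by (rule continuous_map_eq) (use assms in auto)
  show ?thesis
    using 1 2 topspace_eq A.subset subgroup_imp_group[OF assms]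
    by (simp add: topological_group_def topological_group_axioms_def Int_absorb1)
qed

lemma (in profinite_group) closed_subgroup_profinite:
  assumes "subgroup A G" "closedin T A"
  shows "profinite_group (G\<lparr>carrier := A\<rparr>) (subtopology T A)"
proof -
  interpret A: topological_group "G\<lparr>carrier := A\<rparr>" "subtopology T A"
    by (rule subgroup_topological_group[OF assms(1)])
  show ?thesis
  proof (unfold_locales)
    show "compact_space (subtopology T A)"
      using closed_imp_compact[OF assms(2)] compact_space_subtopology by blast
    show "Hausdorff_space (subtopology T A)" using hausdorff by (rule Hausdorff_space_subtopology)
    show "\<exists>x. S \<subseteq> {x}" if "connectedin (subtopology T A) S" for S
      using that totally_disconnected by (simp add: connectedin_subtopology)
  qed
qed

section \<open>Uniform and pronilpotent subgroups\<close>

context contraction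
begin

lemma power_subgroup_consistent:
  assumes "subgroup A G" "B \<subseteq> A"
  shows "power_subgroup (G\<lparr>carrier := A\<rparr>) q B = power_subgroup G q B"
proof -
  have "(\<lambda>x. x [^] q) ` B \<subseteq> A" using assms subgroup_pow by blast
  then show ?thesis
    unfolding power_subgroup_def using generate_consistent[OF _ assms(1)]
    by (simp add: nat_pow_consistent[symmetric])
qed

lemma rcosets_restrict_idx: "card (rcosets\<^bsub>G\<lparr>carrier := A\<rparr>\<^esub> B) = idx A B"
    "finite (rcosets\<^bsub>G\<lparr>carrier := A\<rparr>\<^esub> B) = fin_idx A B"
proof -
  have "rcosets\<^bsub>G\<lparr>carrier := A\<rparr>\<^esub> B = (\<lambda>x. B #> x) ` A" by (auto simp: RCOSETS_def)
  then show "card (rcosets\<^bsub>G\<lparr>carrier := A\<rparr>\<^esub> B) = idx A B" "finite (rcosets\<^bsub>G\<lparr>carrier := A\<rparr>\<^esub> B) = fin_idx A B"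
    by (simp_all add: idx_def fin_idx_def)
qed

lemma open_in_subgroup:
  assumes "openin (subtopology T A) N" "\<one> \<in> N"
  obtains n where "A \<inter> I n \<subseteq> N"
proof -
  obtain U where U: "openin T U" "N = U \<inter> A" using assms(1) by (auto simp: openin_subtopology)
  then obtain n where "I n \<subseteq> U" using I_base assms(2) by blast
  then show ?thesis using that U by blast
qed

lemma restrict_pro_p:
  assumes A: "subgroup A G" "closedin T A" and p: "prime p" "A \<subseteq> part p X"
  shows "pro_p_group p (G\<lparr>carrier := A\<rparr>) (subtopology T A)"
  unfolding pro_p_group_def
proof (intro conjI allI impI p closed_subgroup_profinite[OF A])
  interpret A: profinite_group "G\<lparr>carrier := A\<rparr>" "subtopology T A" by (rule closed_subgroup_profinite[OF A])
  fix N assume N: "N \<lhd> G\<lparr>carrier := A\<rparr> \<and> openin (subtopology T A) N"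
  then interpret N: normal N "G\<lparr>carrier := A\<rparr>" by blast
  interpret Q: group "G\<lparr>carrier := A\<rparr> Mod N" by (rule N.factorgroup_is_group)
  obtain n where n: "A \<inter> I n \<subseteq> N" using open_in_subgroup[of A N] N N.one_closed by auto
  have "\<exists>k. order (G\<lparr>carrier := A\<rparr> Mod N) = p ^ k"
  proof (rule Q.order_prime_power[OF _ p(1)])
    show "finite (carrier (G\<lparr>carrier := A\<rparr> Mod N))"
      using A.open_subgroup_fin_idx[OF N.subgroup_axioms] N A.rcosets_card_idx(2)[of N]
        by (simp add: FactGroup_def)
    fix u assume "u \<in> carrier (G\<lparr>carrier := A\<rparr> Mod N)"
    then obtain x where x: "x \<in> A" "u = N #>\<^bsub>G\<lparr>carrier := A\<rparr>\<^esub> x" by (auto simp: carrier_FactGroup)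
    obtain j where j: "x [^] (p ^ j) \<in> I n" using x p(2) unfolding part_def by blast
    then have "x [^] (p ^ j) \<in> N" using n subgroup_pow[OF A(1) x(1)] by blast
    then have "N #>\<^bsub>G\<lparr>carrier := A\<rparr>\<^esub> (x [^] (p ^ j)) = N"
      using A.coset_eq_self_iff[OF N.subgroup_axioms, of "x [^] (p ^ j)"] subgroup_pow[OF A(1) x(1)] by simp
    then have "u [^]\<^bsub>G\<lparr>carrier := A\<rparr> Mod N\<^esub> (p ^ j) = \<one>\<^bsub>G\<lparr>carrier := A\<rparr> Mod N\<^esub>"
      using N.FactGroup_pow[of x "p ^ j"] x by (simp add: nat_pow_consistent[symmetric])
    then show "\<exists>j. u [^]\<^bsub>G\<lparr>carrier := A\<rparr> Mod N\<^esub> (p ^ j) = \<one>\<^bsub>G\<lparr>carrier := A\<rparr> Mod N\<^esub>" ..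
  qed
  then show "\<exists>k. card (rcosets\<^bsub>G\<lparr>carrier := A\<rparr>\<^esub> N) = p ^ k" by (simp add: order_def FactGroup_def)
qed

lemma radicable_subgroup_nilpotent:
  assumes X: "radicable X" and A: "subgroup A G" "A \<subseteq> X"
  shows "nilpotent_group (G\<lparr>carrier := A\<rparr>)" "torsion_free_group (G\<lparr>carrier := A\<rparr>)"
proof -
  interpret A: group "G\<lparr>carrier := A\<rparr>" using subgroup_imp_group[OF A(1)] .
  note pX = radicable_pure[OF X]
  note S = ser_pure_subset[OF pX]
  obtain c where c: "ser X c = {\<one>}" using radicable_nilpotent[OF X] .
  show "nilpotent_group (G\<lparr>carrier := A\<rparr>)"
  proof (rule A.nilpotent_groupI[of "\<lambda>i. A \<inter> ser X i" c])
    show "A \<inter> ser X 0 = carrier (G\<lparr>carrier := A\<rparr>)" using A(2) by auto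
    show "subgroup (A \<inter> ser X i) (G\<lparr>carrier := A\<rparr>)" for i
      using subgroups_Inter_pair[OF A(1) pureD(2)[OF S(1)]] subgroup_incl[OF _ A(1)] by blast
    show "A.cm x y \<in> A \<inter> ser X (Suc i)" if "x \<in> A \<inter> ser X i" "y \<in> carrier (G\<lparr>carrier := A\<rparr>)" for i x y
      using that cm_consistent[OF A(1)] subgroup_cm[OF A(1)] S(4) A(2) by auto
    show "A \<inter> ser X c = {\<one>\<^bsub>G\<lparr>carrier := A\<rparr>\<^esub>}" using c subgroup.one_closed[OF A(1)] by auto
  qed
  show "torsion_free_group (G\<lparr>carrier := A\<rparr>)"
    unfolding torsion_free_group_def
    using radicable_torsion_free[OF X] A(2) by (auto simp: nat_pow_consistent[symmetric])
qed

text \<open>For \<open>A = V 0\<close> the commutators of \<open>V i\<close> with \<open>A\<close>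
  lie in \<open>V (Suc (Suc i))\<close>. They add nothing to the closed \<open>p\<close>-th powers,
  so the chain \<open>V\<close> is the lower \<open>p\<close>-series of \<open>A\<close>. The
  exponent \<open>p * p\<close> is the \<open>4\<close> that powerfulness demands for
  \<open>p = 2\<close>.\<close>

lemma uniform_subgroup:
  assumes X: "radicable X" and p: "prime p" "part p X = X"
  obtains A where "subgroup A G" "closedin T A" "A \<subseteq> X" "fin_idx X A"
    "uniform_pro_p_group p (G\<lparr>carrier := A\<rparr>) (subtopology T A)"
proof -
  obtain V where V: "\<And>j. V j \<lhd> G" "\<And>j. closedin T (V j)" "V 0 \<subseteq> X" "fin_idx X (V 0)"
    "\<And>j. V (Suc j) = closed_powers p (V j)" "\<And>j. V (Suc j) \<subseteq> V j"
    "\<And>j x y. x \<in> V j \<Longrightarrow> y \<in> V 0 \<Longrightarrow> cm x y \<in> closed_powers (p * p) (V j)"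
    "\<And>j. closed_powers (p * p) (V j) \<subseteq> V (Suc (Suc j))"
    "\<And>j. fin_idx (V j) (V (Suc j))" "\<And>j. idx (V j) (V (Suc j)) = idx (V 0) (V 1)"
    "\<And>n. \<exists>j. V j \<subseteq> I n"
    using uniform_chain[OF X p] by blast
  define A where "A = V 0"
  let ?U = "G\<lparr>carrier := A\<rparr>" and ?TU = "subtopology T A"
  have Vs: "subgroup (V j) G" for j using V(1) normal_imp_subgroup by blast
  have VA: "V j \<subseteq> A" for j by (induction j) (use V(6) A_def in auto)
  have Vc: "x \<in> carrier G" if "x \<in> V j" for x j using that subgroup.mem_carrier[OF Vs] by blast
  have A: "subgroup A G" "closedin T A" "A \<subseteq> X" "A \<lhd> G" using Vs V by (auto simp: A_def)
  interpret A: profinite_group ?U ?TU by (rule closed_subgroup_profinite[OF A(1,2)])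
  have Vcm: "cm x y \<in> V (Suc (Suc j))" if "x \<in> V j" "y \<in> A" for x y j
    using V(7,8) that A_def by blast
  have clA: "?TU closure_of S = T closure_of S" if "S \<subseteq> A" for S
  proof -
    have "T closure_of S \<subseteq> A" using that A(2) by (rule closure_of_minimal)
    then show ?thesis using that by (auto simp: closure_of_subtopology Int_absorb1)
  qed
  have psA: "power_subgroup G q (V j) \<subseteq> A" for q j
    unfolding power_subgroup_def using subgroup_pow[OF A(1)] VA by (intro generate_subgroup_incl A(1)) blast
  have vpU: "?TU closure_of (power_subgroup ?U q (V j)) = closed_powers q (V j)" for q j
    unfolding power_subgroup_consistent[OF A(1) VA] closed_powers_def using clA[OF psA] .
  have lp: "lower_p_series p ?U ?TU i = V i" for i
  proof (induction i)
    case 0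
    then show ?case by (simp add: A_def)
  next
    case (Suc i)
    let ?C = "commutator_subgroup ?U (V i) (carrier ?U)"
    let ?P = "power_subgroup ?U p (V i)"
    have P: "?P = power_subgroup G p (V i)" by (rule power_subgroup_consistent[OF A(1) VA])
    have Ps: "subgroup ?P G" unfolding P using power_subgroup_normal[OF V(1)] normal_imp_subgroup by blast
    have V2s: "subgroup (V (Suc (Suc i))) ?U" using subgroup_incl[OF Vs A(1) VA] .
    have V1: "?TU closure_of ?P = V (Suc i)" unfolding vpU V(5) ..
    have PV: "?P \<subseteq> V (Suc i)"
      unfolding V(5) closed_powers_def P
        using closure_of_subset[of _ T] psA[of p i] topspace_eq subgroup.subset[OF A(1)] by blast
    have "?C \<subseteq> V (Suc (Suc i))"
      unfolding commutator_subgroup_def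
    proof (rule A.generate_subgroup_incl[OF _ V2s])
      have "a \<otimes> b \<otimes> inv\<^bsub>?U\<^esub> a \<otimes> inv\<^bsub>?U\<^esub> b \<in> V (Suc (Suc i))" if "a \<in> V i" "b \<in> A" for a b
        using Vcm[OF that] that VA[of i] A(1) by (auto simp: cm_def subset_iff)
      then show "(\<Union>a\<in>V i. \<Union>b\<in>carrier ?U. {a \<otimes>\<^bsub>?U\<^esub> b \<otimes>\<^bsub>?U\<^esub> inv\<^bsub>?U\<^esub> a \<otimes>\<^bsub>?U\<^esub> inv\<^bsub>?U\<^esub> b}) \<subseteq> V (Suc (Suc i))"
        by auto
    qed
    then have CV: "?C \<subseteq> V (Suc i)" using V(6) by blast
    have C1: "\<one> \<in> ?C" unfolding commutator_subgroup_def using generate.one[of ?U] by simp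
    have "?P \<subseteq> ?P <#> ?C"
    proof
      fix x assume x: "x \<in> ?P"
      then have "x = x \<otimes> \<one>" using subgroup.mem_carrier[OF Ps] by simp
      then show "x \<in> ?P <#> ?C" using x C1 unfolding set_mult_def by blast
    qed
    then have "V (Suc i) \<subseteq> ?TU closure_of (?P <#> ?C)" unfolding V1[symmetric] by (rule closure_of_mono)
    moreover have "?P <#> ?C \<subseteq> V (Suc i)" using set_mult_subset[OF Vs PV CV] .
    moreover have "closedin ?TU (V (Suc i))" using V(2) VA by (simp add: closedin_closed_subtopology A(2))
    ultimately have "?TU closure_of (?P <#> ?C) = V (Suc i)"
      using closure_of_minimal[of "?P <#> ?C" "V (Suc i)" ?TU] by blast
    then show ?case using Suc by simp
  qed
  have surj: "\<exists>y\<in>V j. \<exists>t\<in>V (Suc (Suc j)). x = t \<otimes> y [^] p" if "x \<in> V (Suc j)" for x j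
  proof -
    have com: "cm x y \<in> V (Suc (Suc j))" if "x \<in> V j" "y \<in> V j" for x y using Vcm that VA by blast
    have sub2: "V (Suc (Suc j)) \<subseteq> V j" using V(6) by blast
    have "V (Suc j) \<subseteq> powers_mod p (V j) (V (Suc (Suc j)))"
      unfolding V(5)[of j]
      by (rule closed_powers_least[OF normal_imp_subgroup[OF powers_mod_normal[OF V(1) V(1) sub2 com]]
          closedin_powers_mod[OF V(2) V(2)] powers_mod_supset(2)[OF Vs V(1)]])
    then show ?thesis using that unfolding powers_mod_def by blast
  qed
  have pro: "pro_p_group p ?U ?TU" using restrict_pro_p[OF A(1,2) p(1), of X] A(3) p(2) by simp
  have pow: "powerful_pro_p_group p ?U ?TU"
    unfolding powerful_pro_p_group_def
  proof (intro conjI pro)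
    let ?q = "if p = 2 then 4 else p"
    have e: "?TU closure_of power_subgroup ?U ?q (carrier ?U) = closed_powers ?q A"
      using vpU[of ?q 0] by (simp add: A_def)
    have n: "closed_powers ?q A \<lhd> ?U"
      using normal_restrict_supergroup[OF A(1) closed_powers_normal[OF A(4)] closed_powers_subset[OF A(1,2)]] .
    have cq: "cm x y \<in> closed_powers ?q A" if "x \<in> A" "y \<in> A" for x y
    proof (cases "p = 2")
      case True
      then show ?thesis using V(7)[of x 0 y] that by (simp add: A_def)
    next
      case False
      then show ?thesis using Vcm[of x 0 y] V(6)[of 1] V(5)[of 0] that by (auto simp: A_def)
    qed
    show "comm_group (?U Mod ?TU closure_of power_subgroup ?U ?q (carrier ?U))"
      unfolding e by (rule A.comm_group_Mod[OF n]) (use cq cm_consistent[OF A(1)] in auto)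
  qed
  \<comment> \<open>Representatives of \<open>A\<close> modulo \<open>V 1\<close> generate
    topologically: the \<open>p\<close>-th power map carries representatives from each factor of the
    chain to the next, and the \<open>V j\<close> shrink to \<open>\<one>\<close>.\<close>
  have tfg: "topologically_finitely_generated ?U ?TU"
  proof -
    have "finite ((\<lambda>x. V 1 #> x) ` A)" using V(9)[of 0] by (simp add: fin_idx_def A_def)
    then obtain S where S: "finite S" "S \<subseteq> A" "(\<lambda>x. V 1 #> x) ` A = (\<lambda>x. V 1 #> x) ` S"
      by (metis finite_subset_image subset_refl)
    have gS: "generate G S \<subseteq> A" using generate_subgroup_incl[OF S(2) A(1)] .
    have gs: "subgroup (generate G S) G" using generate_is_subgroup S(2) subgroup.subset[OF A(1)] by blast
    define H where "H = T closure_of (generate G S)"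
    have Hs: "subgroup H G"
      unfolding H_def closure_of_subgroup[OF gs]
      using subgroups_Inter[of "range (\<lambda>n. generate G S <#> I n)"] subgroup_set_mult[OF gs I_normal] by auto
    interpret H: subgroup H G by (rule Hs)
    have Hcl: "closedin T H" by (simp add: H_def)
    have HA: "H \<subseteq> A" unfolding H_def using gS A(2) by (rule closure_of_minimal)
    have SH: "S \<subseteq> H"
    proof -
      have "generate G S \<subseteq> H" unfolding H_def
        using closure_of_subset[of _ T] gs subgroup.subset topspace_eq by metis
      moreover have "S \<subseteq> generate G S" by (auto intro: generate.incl)
      ultimately show ?thesis by blast
    qed
    have 1: "\<exists>h\<in>H \<inter> V j. x \<otimes> inv h \<in> V (Suc j)" if "x \<in> V j" for x j
      using that
    proof (induction j arbitrary: x)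
      case 0
      then obtain s where s: "s \<in> S" "V 1 #> x = V 1 #> s" using S(3) A_def by blast
      have "x \<otimes> inv s \<in> V 1" using coset_eq_iff[OF Vs, of x s 1] s 0 S(2) Vc A_def by blast
      then show ?case using s SH S(2) by (auto simp: A_def)
    next
      case (Suc j)
      obtain y t where yt: "y \<in> V j" "t \<in> V (Suc (Suc j))" "x = t \<otimes> y [^] p" using surj[OF Suc.prems] by blast
      obtain h where h: "h \<in> H" "h \<in> V j" "y \<otimes> inv h \<in> V (Suc j)" using Suc.IH[OF yt(1)] by blast
      have c: "y \<in> carrier G" "h \<in> carrier G" "t \<in> carrier G" using yt h Vc by auto
      let ?v = "y \<otimes> inv h" and ?N = "V (Suc (Suc j))"
      have pV: "z [^] p \<in> V (Suc i)" if "z \<in> V i" for z i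
        unfolding V(5)[of i] using closed_powers_pow[OF subgroup.subset[OF Vs] that] .
      have iy: "inv h \<in> A" using h(2) VA subgroup.m_inv_closed[OF A(1)] by blast
      have "?v [^] p \<in> ?N" using pV[OF h(3)] .
      moreover have "?N #> ?v [^] p = ?N #> (y [^] p \<otimes> inv (h [^] p))"
        using pow_mult_inv_coset[OF V(1) c(1,2) Vcm[OF yt(1) iy]] .
      ultimately have "y [^] p \<otimes> inv (h [^] p) \<in> ?N"
        using coset_eq_self_iff[OF Vs, of "?v [^] p" "Suc (Suc j)"] c
          coset_eq_self_iff[OF Vs, of "y [^] p \<otimes> inv (h [^] p)" "Suc (Suc j)"]
        by (metis inv_closed m_closed nat_pow_closed)
      then have "t \<otimes> (y [^] p \<otimes> inv (h [^] p)) \<in> ?N" using yt(2) subgroup.m_closed[OF Vs] by blast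
      then have "x \<otimes> inv (h [^] p) \<in> ?N" using yt(3) c by (simp add: m_assoc)
      moreover have "h [^] p \<in> H \<inter> V (Suc j)" using pV[OF h(2)] subgroup_pow[OF Hs h(1)] by blast
      ultimately show ?case by blast
    qed
    have 2: "\<exists>h\<in>H. x \<otimes> inv h \<in> V j" if x: "x \<in> A" for x j
    proof (induction j)
      case 0
      show ?case using x A_def subgroup.mem_carrier[OF A(1)] by (intro bexI[of _ \<one>]) auto
    next
      case (Suc j)
      then obtain h where h: "h \<in> H" "x \<otimes> inv h \<in> V j" by blast
      then obtain h' where h': "h' \<in> H" "x \<otimes> inv h \<otimes> inv h' \<in> V (Suc j)" using 1 by blast
      have "x \<otimes> inv (h' \<otimes> h) = x \<otimes> inv h \<otimes> inv h'"
        using h h' x subgroup.mem_carrier[OF A(1)] by (simp add: inv_mult_group m_assoc)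
      then show ?case using h h' by (metis H.m_closed)
    qed
    have "A \<subseteq> H"
    proof
      fix x assume x: "x \<in> A"
      have xc: "x \<in> carrier G" using x subgroup.mem_carrier[OF A(1)] by blast
      show "x \<in> H"
      proof (rule closed_mem[OF Hcl xc])
        fix n
        obtain j where j: "V j \<subseteq> I n" using V(11) by blast
        obtain h where h: "h \<in> H" "x \<otimes> inv h \<in> V j" using 2[OF x] by blast
        interpret N: normal "I n" G by (rule I_normal)
        have "inv (x \<otimes> inv h) \<in> I n" using h j by blast
        \<comment> \<open>The correction that turns \<open>x\<close> into \<open>h\<close> stands on
          the left; conjugation by \<open>x\<close> moves it to the right, as
          \<open>closed_mem\<close> expects.\<close>
        then have "inv x \<otimes> inv (x \<otimes> inv h) \<otimes> x \<in> I n" using N.inv_op_closed1[OF xc] by blast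
        moreover have "x \<otimes> (inv x \<otimes> inv (x \<otimes> inv h) \<otimes> x) = h"
          using xc h by (simp add: inv_mult_group m_assoc)
        ultimately show "\<exists>y\<in>I n. x \<otimes> y \<in> H" using h by metis
      qed
    qed
    then have "?TU closure_of (generate ?U S) = carrier ?U"
      using generate_consistent[OF S(2) A(1)] clA[OF gS] HA by (auto simp: H_def)
    then show ?thesis unfolding topologically_finitely_generated_def using S by auto
  qed
  have "uniform_pro_p_group p ?U ?TU"
    unfolding uniform_pro_p_group_def
  proof (intro conjI pow tfg allI)
    fix i
    have "card (rcosets\<^bsub>?U\<lparr>carrier := V i\<rparr>\<^esub> (V (Suc i))) = idx (V i) (V (Suc i))"
      using rcosets_restrict_idx(1)[of "V i" "V (Suc i)"] by simp
    moreover have "card (rcosets\<^bsub>?U\<^esub> (V 1)) = idx (V 0) (V 1)"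
      using rcosets_restrict_idx(1)[of A "V 1"] by (simp add: A_def)
    ultimately show "card (rcosets\<^bsub>?U\<lparr>carrier := lower_p_series p ?U ?TU i\<rparr>\<^esub> (lower_p_series p ?U ?TU (Suc i)))
        = card (rcosets\<^bsub>?U\<^esub> (lower_p_series p ?U ?TU 1))"
      unfolding lp using V(10)[of i] by simp
  qed
  then show ?thesis using that[of A] A V(4) by (simp add: A_def)
qed

text \<open>\<open>N k\<close> consists of the elements that \<open>\<phi> ^^ k\<close> brings into
  \<open>I n'\<close>. These subgroups increase to \<open>C\<close> by steps of index at most
  \<open>m\<close>, which \<open>\<phi> ^^ j\<close> of \<open>C\<close> centralises. Read downwards
  from \<open>N (j + K)\<close> to \<open>N j\<close> they form the series.\<close>

lemma C_residually_nilpotent: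
  obtains Z c where "Z 0 = C" "\<And>i::nat. Z i \<lhd> G" "\<And>i x y. x \<in> Z i \<Longrightarrow> y \<in> C \<Longrightarrow> cm x y \<in> Z (Suc i)" "Z c \<subseteq> I n"
proof -
  obtain j where j: "\<forall>x\<in>C. (\<phi> ^^ j) x \<in> I m" using C_contr by blast
  \<comment> \<open>This \<open>n'\<close> puts \<open>N j\<close> inside \<open>I n\<close>. The
    \<open>j\<close> levels are lost because centrality is available only after
    \<open>\<phi> ^^ j\<close>.\<close>
  obtain n' where n': "\<forall>x\<in>C. (\<phi> ^^ j) x \<in> I n' \<longrightarrow> x \<in> I n" using phi_reflects_I by blast
  obtain K where K: "\<forall>x\<in>C. (\<phi> ^^ K) x \<in> I n'" using C_contr by blast
  define N where "N = (\<lambda>k. {x \<in> C. (\<phi> ^^ k) x \<in> C \<inter> I n'})"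
  have Ng: "good (N k)" for k unfolding N_def by (rule good_preimage[OF good_CI])
  have Nphi: "\<phi> x \<in> N k \<longleftrightarrow> x \<in> N (Suc k)" if "x \<in> C" for x k
    using that C_phi by (simp add: N_def funpow_swap1)
  have Nphik: "(\<phi> ^^ i) x \<in> N k \<longleftrightarrow> x \<in> N (k + i)" if "x \<in> C" for x k i
    using that C_phik by (simp add: N_def phik_add)
  have Ninc: "N k \<subseteq> N (Suc k)" for k using goodD(4,5)[OF Ng] Nphi by blast
  \<comment> \<open>\<phi> embeds the factor of \<open>N (Suc k)\<close> by \<open>N k\<close> into
    that of \<open>N k\<close> by \<open>\<phi> (N k)\<close>.\<close>
  have idxN: "fin_idx (N (Suc k)) (N k)" "idx (N (Suc k)) (N k) \<le> m" for k
  proof -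
    have im: "\<phi> ` N (Suc k) \<subseteq> N k" using Nphi goodD(4)[OF Ng] by blast
    have "fin_idx (\<phi> ` N (Suc k)) (\<phi> ` N k)" "idx (\<phi> ` N (Suc k)) (\<phi> ` N k) \<le> idx (N k) (\<phi> ` N k)"
      using idx_mono[OF subgroup_phi_image[OF goodD(2)[OF Ng]] im goodD(7)[OF Ng] idx_good(1)[OF Ng]] by auto
    then show "fin_idx (N (Suc k)) (N k)" "idx (N (Suc k)) (N k) \<le> m"
      using idx_phi[OF goodD(2)[OF Ng] goodD(7)[OF Ng], of "Suc k" k] idx_good(2)[OF Ng, of k] by auto
  qed
  have step: "cm x y \<in> N (j + k)" if x: "x \<in> N (Suc (j + k))" and y: "y \<in> C" for x y k
  proof -
    have xC: "x \<in> C" using x by (simp add: N_def)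
    have "(\<phi> ^^ j) x \<in> N (Suc k)" using Nphik[OF xC, of j "Suc k"] x by (simp add: add.commute)
    then have "cm ((\<phi> ^^ j) x) ((\<phi> ^^ j) y) \<in> N k"
      using I_centralizes[OF goodD(1)[OF Ng] goodD(1,3)[OF Ng] Ninc idxN] j y by blast
    then have "(\<phi> ^^ j) (cm x y) \<in> N k" using xC y by simp
    then show ?thesis using Nphik[OF subgroup_cm[OF C_subgroup xC y]] by (simp add: add.commute)
  qed
  \<comment> \<open>Truncated subtraction keeps the series constant from \<open>K\<close>
    on.\<close>
  define Z where "Z = (\<lambda>i. N (j + (K - i)))"
  show ?thesis
  proof (rule that[of Z K])
    have "(\<phi> ^^ (j + K)) x \<in> I n'" if "x \<in> C" for x
      using K that goodD(6)[OF good_CI, of "(\<phi> ^^ K) x" n' j] C_phik by (simp add: phik_add)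
    then show "Z 0 = C" using C_phik by (auto simp: Z_def N_def)
    show "Z i \<lhd> G" for i using goodD(1)[OF Ng] by (simp add: Z_def)
    show "Z K \<subseteq> I n" using n' by (auto simp: Z_def N_def)
    fix i x y assume x: "x \<in> Z i" and y: "y \<in> C"
    show "cm x y \<in> Z (Suc i)"
    proof (cases "i < K")
      case True
      then have "K - i = Suc (K - Suc i)" by simp
      then show ?thesis using step[of x "K - Suc i" y] x y by (simp add: Z_def)
    next
      case False
      then have "Z (Suc i) = Z i" by (simp add: Z_def)
      then show ?thesis using normal_cm(1)[OF goodD(1)[OF Ng]] x y by (simp add: Z_def)
    qed
  qed
qed

lemma restrict_pronilpotent:
  assumes E: "subgroup E G" "closedin T E" "E \<subseteq> C"
  shows "pronilpotent_group (G\<lparr>carrier := E\<rparr>) (subtopology T E)"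
  unfolding pronilpotent_group_def
proof (intro conjI allI impI closed_subgroup_profinite[OF E(1,2)])
  interpret E: profinite_group "G\<lparr>carrier := E\<rparr>" "subtopology T E"
    by (rule closed_subgroup_profinite[OF E(1,2)])
  fix N assume N: "N \<lhd> G\<lparr>carrier := E\<rparr> \<and> openin (subtopology T E) N"
  then interpret N: normal N "G\<lparr>carrier := E\<rparr>" by blast
  obtain n where n: "E \<inter> I n \<subseteq> N" using open_in_subgroup[of E N] N N.one_closed by auto
  obtain Z c where Z: "Z 0 = C" "\<And>i::nat. Z i \<lhd> G" "\<And>i x y. x \<in> Z i \<Longrightarrow> y \<in> C \<Longrightarrow> cm x y \<in> Z (Suc i)" "Z c \<subseteq> I n"
    using C_residually_nilpotent[of n] by blast
  show "nilpotent_group (G\<lparr>carrier := E\<rparr> Mod N)"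
  proof (rule E.nilpotent_Mod[OF N.normal_axioms, of "\<lambda>i. E \<inter> Z i" c])
    show "E \<inter> Z 0 = carrier (G\<lparr>carrier := E\<rparr>)" using E(3) Z(1) by auto
    show "subgroup (E \<inter> Z i) (G\<lparr>carrier := E\<rparr>)" for i
      using subgroups_Inter_pair[OF E(1) normal_imp_subgroup[OF Z(2)]] subgroup_incl[OF _ E(1)] by blast
    show "E.cm x y \<in> E \<inter> Z (Suc i)" if "x \<in> E \<inter> Z i" "y \<in> carrier (G\<lparr>carrier := E\<rparr>)" for i x y
      using that cm_consistent[OF E(1)] subgroup_cm[OF E(1)] Z(3) E(3) by auto
    show "E \<inter> Z c \<subseteq> N" using n Z(4) by blast
  qed
qed

end

section \<open>The contraction subgroup\<close>

locale self_embedding = profinite_group G T for G (structure) and T +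
  fixes \<phi> :: "'a \<Rightarrow> 'a"
  assumes type_F: "type_F G T" and embedding: "open_self_embedding G T \<phi>"
begin

lemma embeddingD:
  shows "\<phi> \<in> hom G G" "continuous_map T T \<phi>" "inj_on \<phi> (carrier G)" "openin T (\<phi> ` carrier G)"
  using embedding by (auto simp: open_self_embedding_def)

sublocale phi: group_hom G G \<phi>
  using embeddingD(1) by unfold_locales

definition subs :: "nat \<Rightarrow> 'a set set" where
  "subs n = {H. subgroup H G \<and> openin T H \<and> idx (carrier G) H \<le> n}"

text \<open>Inserting \<open>carrier G\<close> keeps the intersection inside \<open>G\<close> when
  \<open>subs n\<close> is empty, as for \<open>n = 0\<close>.\<close>

definition core :: "nat \<Rightarrow> 'a set" where
  "core n = \<Inter>(insert (carrier G) (subs n))"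

text \<open>By compactness open subgroups have finite, hence positive index, so
  \<open>type_F\<close> covers all the values from \<open>1\<close> to \<open>n\<close>.\<close>

lemma finite_subs: "finite (subs n)"
proof -
  have "subs n \<subseteq> (\<Union>k\<in>{1..n}. {H. subgroup H G \<and> openin T H \<and> card (rcosets\<^bsub>G\<^esub> H) = k})"
    using idx_pos[OF subgroup_self] open_subgroup_fin_idx
    by (auto simp: subs_def rcosets_card_idx Suc_le_eq)
  moreover have "finite (\<Union>k\<in>{1..n}. {H. subgroup H G \<and> openin T H \<and> card (rcosets\<^bsub>G\<^esub> H) = k})"
    using type_F by (auto simp: type_F_def)
  ultimately show ?thesis by (rule finite_subset)
qed

lemma core_subset: "H \<in> subs n \<Longrightarrow> core n \<subseteq> H" "core n \<subseteq> carrier G"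
  by (auto simp: core_def)

lemma core_subgroup: "subgroup (core n) G"
  unfolding core_def by (rule subgroups_Inter) (auto simp: subs_def subgroup_self)

lemma core_open: "openin T (core n)"
  unfolding core_def using finite_subs by (intro openin_Inter) (auto simp: subs_def openin_carrier)

lemma subs_preimage:
  assumes f: "f \<in> hom G G" "continuous_map T T f" and H: "H \<in> subs n"
  shows "{x \<in> carrier G. f x \<in> H} \<in> subs n"
proof -
  interpret f: group_hom G G f using f(1) by unfold_locales
  have Hs: "subgroup H G" "openin T H" "idx (carrier G) H \<le> n" using H by (auto simp: subs_def)
  interpret H: subgroup H G by (rule Hs(1))
  let ?P = "{x \<in> carrier G. f x \<in> H}"
  have P: "subgroup ?P G" by (rule subgroupI) (auto intro: exI[of _ \<one>])
  have "openin T ?P" using openin_continuous_map_preimage[OF f(2) Hs(2)] by (simp add: topspace_eq)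
  moreover have "idx (carrier G) ?P \<le> idx (carrier G) H"
    using idx_map_le(2)[OF P subset_refl Hs(1) subset_refl, of f] open_subgroup_fin_idx[OF Hs(1,2)]
        f.hom_closed by (auto simp: image_subset_iff)
  ultimately show ?thesis using P Hs(3) by (simp add: subs_def)
qed

text \<open>Preimages under continuous endomorphisms stay open and do not gain index. Inner
  automorphisms then give normality of \<open>core n\<close>, and \<phi> gives its
  invariance.\<close>

lemma core_hom:
  assumes "f \<in> hom G G" "continuous_map T T f" "x \<in> core n"
  shows "f x \<in> core n"
proof -
  have xc: "x \<in> carrier G" using assms(3) core_subset(2) by blast
  have "f x \<in> H" if "H \<in> subs n" for H
    using core_subset(1)[OF subs_preimage[OF assms(1,2) that]] assms(3) by blast
  moreover have "f x \<in> carrier G" using assms(1) xc by (rule hom_in_carrier)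
  ultimately show ?thesis by (auto simp: core_def)
qed

lemma core_normal: "core n \<lhd> G"
proof (rule normalI'[OF core_subgroup])
  fix x g assume x: "x \<in> core n" and g: "g \<in> carrier G"
  have "(\<lambda>x. g \<otimes> x \<otimes> inv g) \<in> hom G G"
    using g by (intro homI) (auto simp: m_assoc)
  moreover have "continuous_map T T (\<lambda>x. g \<otimes> x \<otimes> inv g)"
    using g by (intro continuous_map_mult continuous_map_const' continuous_map_id') auto
  ultimately show "g \<otimes> x \<otimes> inv g \<in> core n" using core_hom x by blast
qed

lemma core_anti: "n \<le> n' \<Longrightarrow> core n' \<subseteq> core n"
  by (auto simp: core_def subs_def)

lemma core_base:
  assumes "openin T U" "\<one> \<in> U"
  shows "\<exists>n. core n \<subseteq> U"
proof -
  obtain H where H: "subgroup H G" "openin T H" "H \<subseteq> U" using open_subgroup_base[OF assms] .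
  then have "H \<in> subs (idx (carrier G) H)" by (simp add: subs_def)
  then show ?thesis using core_subset(1) H(3) by blast
qed

lemma core_phi: "x \<in> core n \<Longrightarrow> \<phi> x \<in> core n"
  using core_hom embeddingD by blast

lemma core_phik: "x \<in> core n \<Longrightarrow> (\<phi> ^^ k) x \<in> core n"
  by (induction k) (auto intro: core_phi)

lemma pk_closed: "x \<in> carrier G \<Longrightarrow> (\<phi> ^^ k) x \<in> carrier G"
  by (induction k) auto

lemma pk_mult: "x \<in> carrier G \<Longrightarrow> y \<in> carrier G \<Longrightarrow> (\<phi> ^^ k) (x \<otimes> y) = (\<phi> ^^ k) x \<otimes> (\<phi> ^^ k) y"
  by (induction k) (auto simp: pk_closed)

lemma pk_inv: "x \<in> carrier G \<Longrightarrow> (\<phi> ^^ k) (inv x) = inv ((\<phi> ^^ k) x)"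
  by (induction k) (auto simp: pk_closed)

lemma pk_core_le: "(\<phi> ^^ k) x \<in> core n \<Longrightarrow> k \<le> k' \<Longrightarrow> (\<phi> ^^ k') x \<in> core n"
  using core_phik[of "(\<phi> ^^ k) x" n "k' - k"] by (simp flip: funpow_add comp_apply[of "\<phi> ^^ _"])

text \<open>The \<open>core n\<close> form a base at \<open>\<one>\<close> and \<phi> maps them into
  themselves, so an orbit that enters \<open>core n\<close> stays there; convergence asks for one
  entry for each \<open>n\<close>.\<close>

lemma Con_iff: "x \<in> Con G T \<phi> \<longleftrightarrow> x \<in> carrier G \<and> (\<forall>n. \<exists>k. (\<phi> ^^ k) x \<in> core n)"
proof
  assume x: "x \<in> Con G T \<phi>"
  then have lim: "limitin T (\<lambda>n. (\<phi> ^^ n) x) \<one> sequentially" and xc: "x \<in> carrier G" by (auto simp: Con_def)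
  have "\<exists>k. (\<phi> ^^ k) x \<in> core n" for n
  proof -
    have "eventually (\<lambda>k. (\<phi> ^^ k) x \<in> core n) sequentially"
      using lim core_open subgroup.one_closed[OF core_subgroup] unfolding limitin_def by blast
    then show ?thesis by (meson eventually_sequentially le_refl)
  qed
  then show "x \<in> carrier G \<and> (\<forall>n. \<exists>k. (\<phi> ^^ k) x \<in> core n)" using xc by blast
next
  assume x: "x \<in> carrier G \<and> (\<forall>n. \<exists>k. (\<phi> ^^ k) x \<in> core n)"
  have "limitin T (\<lambda>n. (\<phi> ^^ n) x) \<one> sequentially"
    unfolding limitin_def
  proof (intro conjI allI impI)
    show "\<one> \<in> topspace T" by (simp add: topspace_eq)
    fix U assume U: "openin T U \<and> \<one> \<in> U"
    then obtain n where n: "core n \<subseteq> U" using core_base by blast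
    obtain k where "(\<phi> ^^ k) x \<in> core n" using x by blast
    then have "\<forall>k'\<ge>k. (\<phi> ^^ k') x \<in> U" using pk_core_le n by blast
    then show "eventually (\<lambda>n. (\<phi> ^^ n) x \<in> U) sequentially" unfolding eventually_sequentially by blast
  qed
  then show "x \<in> Con G T \<phi>" using x by (simp add: Con_def)
qed

text \<open>The contraction condition at one level. \<open>Cn n\<close> contains
  \<open>core n\<close>, so it is an open and therefore closed subgroup, and \<open>Con\<close> is
  closed as the intersection.\<close>

definition Cn :: "nat \<Rightarrow> 'a set" where
  "Cn n = {x \<in> carrier G. \<exists>k. (\<phi> ^^ k) x \<in> core n}"

lemma Con_eq: "Con G T \<phi> = (\<Inter>n. Cn n)"
  using Con_iff by (auto simp: Cn_def)

lemma Cn_normal: "Cn n \<lhd> G"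
proof (rule normalI')
  interpret N: normal "core n" G by (rule core_normal)
  show "subgroup (Cn n) G"
  proof (rule subgroupI)
    show "Cn n \<subseteq> carrier G" by (auto simp: Cn_def)
    have "(\<phi> ^^ 0) \<one> \<in> core n" by simp
    then show "Cn n \<noteq> {}" unfolding Cn_def by blast
    fix a assume "a \<in> Cn n"
    then obtain k where k: "a \<in> carrier G" "(\<phi> ^^ k) a \<in> core n" by (auto simp: Cn_def)
    then have "(\<phi> ^^ k) (inv a) \<in> core n" by (simp add: pk_inv)
    then show "inv a \<in> Cn n" using k by (auto simp: Cn_def)
    fix b assume "b \<in> Cn n"
    then obtain l where l: "b \<in> carrier G" "(\<phi> ^^ l) b \<in> core n" by (auto simp: Cn_def)
    have "(\<phi> ^^ (max k l)) (a \<otimes> b) \<in> core n"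
      using pk_core_le[OF k(2), of "max k l"] pk_core_le[OF l(2), of "max k l"] k l by (simp add: pk_mult)
    then show "a \<otimes> b \<in> Cn n" using k l by (auto simp: Cn_def)
  qed
  fix x g assume "x \<in> Cn n" and g: "g \<in> carrier G"
  then obtain k where k: "x \<in> carrier G" "(\<phi> ^^ k) x \<in> core n" by (auto simp: Cn_def)
  then have "(\<phi> ^^ k) (g \<otimes> x \<otimes> inv g) \<in> core n"
    using N.inv_op_closed2[OF pk_closed[OF g, of k] k(2)] g by (simp add: pk_mult pk_inv pk_closed)
  then show "g \<otimes> x \<otimes> inv g \<in> Cn n" using k g by (auto simp: Cn_def)
qed

lemma Cn_closed: "closedin T (Cn n)"
proof -
  have s: "subgroup (Cn n) G" using Cn_normal normal_imp_subgroup by blast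
  have "(\<phi> ^^ 0) x \<in> core n" if "x \<in> core n" for x using that by simp
  then have "core n \<subseteq> Cn n" unfolding Cn_def using core_subset(2) by blast
  then show ?thesis
    using open_subgroup_closed[OF s subgroup_openI[OF s core_open subgroup.one_closed[OF core_subgroup]]]
      by blast
qed

lemma Con_normal: "Con G T \<phi> \<lhd> G"
proof (rule normalI')
  show "subgroup (Con G T \<phi>) G"
    unfolding Con_eq using Cn_normal normal_imp_subgroup by (intro subgroups_Inter) auto
  show "g \<otimes> x \<otimes> inv g \<in> Con G T \<phi>" if "x \<in> Con G T \<phi>" "g \<in> carrier G" for x g
    using that normal_conj[OF Cn_normal] by (simp add: Con_eq)
qed

text \<open>This is the stabiliser of the coset of \<open>a\<close> in \<open>A/B\<close> under
  conjugation, so \<open>g \<mapsto> inv g \<otimes> a \<otimes> g\<close> embeds its cosets into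
  \<open>A/B\<close>. Being closed of finite index it is open, and hence it contains
  \<open>core b\<close>.\<close>

lemma stabilizer_open:
  assumes A: "A \<lhd> G" and B: "B \<lhd> G" "closedin T B" and f: "fin_idx A B" "idx A B \<le> b" and a: "a \<in> A"
  shows "{g \<in> carrier G. cm a g \<in> B} \<in> subs b"
proof -
  interpret A: normal A G by (rule A)
  interpret B: normal B G by (rule B(1))
  have ac: "a \<in> carrier G" using a by simp
  let ?S = "{g \<in> carrier G. cm a g \<in> B}"
  have S: "subgroup ?S G"
  proof (rule subgroupI)
    show "?S \<subseteq> carrier G" by blast
    show "?S \<noteq> {}" using ac by (auto intro: exI[of _ \<one>])
    fix g assume g: "g \<in> ?S"
    have "cm a (inv g) = inv g \<otimes> inv (cm a g) \<otimes> g"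
      using ac g by (simp add: cm_def inv_mult_group m_assoc)
    then show "inv g \<in> ?S" using g B.inv_op_closed1[of g "inv (cm a g)"] by simp
    fix h assume h: "h \<in> ?S"
    show "g \<otimes> h \<in> ?S"
      using g h ac cm_mult_right[of g h a] B.inv_op_closed2[of g "cm a h"] by simp
  qed
  have cl: "closedin T ?S"
    using ac by (intro closedin_preimage[OF _ B(2)] continuous_map_cm continuous_map_const' continuous_map_id')
  have k: "g \<otimes> inv h \<in> ?S \<longleftrightarrow> (inv g \<otimes> a \<otimes> g) \<otimes> inv (inv h \<otimes> a \<otimes> h) \<in> B"
    if gh: "g \<in> carrier G" "h \<in> carrier G" for g h
  proof -
    let ?u = "g \<otimes> inv h"
    have e: "(inv g \<otimes> a \<otimes> g) \<otimes> inv (inv h \<otimes> a \<otimes> h) = inv g \<otimes> cm a ?u \<otimes> g"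
      using gh ac by (simp add: cm_def inv_mult_group m_assoc)
    have "cm a ?u = g \<otimes> (inv g \<otimes> cm a ?u \<otimes> g) \<otimes> inv g"
      using gh ac by (simp add: m_assoc)
    then have "inv g \<otimes> cm a ?u \<otimes> g \<in> B \<longleftrightarrow> cm a ?u \<in> B"
      using B.inv_op_closed1[of g "cm a ?u"] B.inv_op_closed2[of g "inv g \<otimes> cm a ?u \<otimes> g"] gh by auto
    then show ?thesis unfolding e using gh by simp
  qed
  have "fin_idx (carrier G) ?S" "idx (carrier G) ?S \<le> idx A B"
    using idx_map_le[OF S subset_refl B.subgroup_axioms A.subset, of "\<lambda>g. inv g \<otimes> a \<otimes> g"] k f(1)
      A.inv_op_closed1[OF _ a] by auto
  moreover obtain U where "openin T U" "\<one> \<in> U" "carrier G \<inter> U \<subseteq> ?S"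
    using closed_subgroup_nbhd[OF subgroup_self S cl \<open>fin_idx (carrier G) ?S\<close>] .
  then have "openin T ?S" using subgroup_openI[OF S] openin_subset_carrier by blast
  ultimately show ?thesis using S f(2) by (simp add: subs_def)
qed

sublocale contraction G T \<phi> core "Con G T \<phi>"
proof (rule contraction.intro[OF profinite_group_axioms], rule contraction_axioms.intro)
  let ?C = "Con G T \<phi>"
  show "\<phi> \<in> hom G G" "inj_on \<phi> (carrier G)" "continuous_map T T \<phi>" using embeddingD by auto
  show "core n \<lhd> G" "openin T (core n)" for n using core_normal core_open by auto
  show "core n' \<subseteq> core n" if "n \<le> n'" for n n' using core_anti[OF that] .
  show "\<phi> x \<in> core n" if "x \<in> core n" for x n using core_phi[OF that] .
  show "\<exists>n. core n \<subseteq> U" if "openin T U" "\<one> \<in> U" for U using core_base[OF that] .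
  show "?C \<lhd> G" by (rule Con_normal)
  show "closedin T ?C" unfolding Con_eq using Cn_closed by (intro closedin_INT) auto
  show "\<phi> x \<in> ?C" if x: "x \<in> ?C" for x
  proof -
    have "\<exists>k. (\<phi> ^^ k) (\<phi> x) \<in> core n" for n
    proof -
      obtain k where "(\<phi> ^^ k) x \<in> core n" using x Con_iff by blast
      then have "\<phi> ((\<phi> ^^ k) x) \<in> core n" by (rule core_phi)
      then show ?thesis by (auto simp: funpow_swap1)
    qed
    then show ?thesis using x by (simp add: Con_iff)
  qed
  show "\<exists>k. \<forall>x\<in>?C. (\<phi> ^^ k) x \<in> core n" for n
  proof -
    interpret C: normal ?C G by (rule Con_normal)
    interpret N: normal "core n" G by (rule core_normal)
    \<comment> \<open>\<open>Con\<close> meets finitely many cosets of \<open>core n\<close>, so the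
      maximum of the entry times of representatives is uniform.\<close>
    have "finite ((\<lambda>x. core n #> x) ` ?C)"
      using idx_mono(1)[OF core_subgroup C.subset subset_refl open_subgroup_fin_idx[OF core_subgroup core_open]]
      by (simp add: fin_idx_def)
    then obtain S where S: "finite S" "S \<subseteq> ?C" "(\<lambda>x. core n #> x) ` ?C = (\<lambda>x. core n #> x) ` S"
      by (metis finite_subset_image subset_refl)
    have "\<forall>s\<in>S. \<exists>k. (\<phi> ^^ k) s \<in> core n" using S(2) Con_iff by blast
    from bchoice[OF this] obtain f where f: "\<forall>s\<in>S. (\<phi> ^^ f s) s \<in> core n" ..
    define K where "K = Max (f ` S)"
    have "(\<phi> ^^ K) x \<in> core n" if x: "x \<in> ?C" for x
    proof -
      obtain s where s: "s \<in> S" "core n #> x = core n #> s" using S(3) x by blast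
      have c: "x \<in> carrier G" "s \<in> carrier G" using x s S(2) C.subset by auto
      have "f s \<le> K" unfolding K_def using S(1) s(1) by simp
      then have 1: "(\<phi> ^^ K) s \<in> core n" using pk_core_le f s(1) by blast
      have "x \<otimes> inv s \<in> core n" using coset_eq_iff[OF core_subgroup c] s(2) by simp
      then have 2: "(\<phi> ^^ K) (x \<otimes> inv s) \<in> core n" by (rule core_phik)
      have "x = (x \<otimes> inv s) \<otimes> s" using c by (simp add: m_assoc)
      then have "(\<phi> ^^ K) x = (\<phi> ^^ K) (x \<otimes> inv s) \<otimes> (\<phi> ^^ K) s" using c by (metis inv_closed m_closed pk_mult)
      then show ?thesis using 1 2 by simp
    qed
    then show ?thesis by blast
  qed
  show "\<exists>n. ?C \<inter> core n \<subseteq> \<phi> ` ?C"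
  proof -
    have "\<one> \<in> \<phi> ` carrier G" using phi.hom_one by (metis image_eqI one_closed)
    \<comment> \<open>The image of \<phi> is open, so it contains some \<open>core n\<close>; and an
      element whose \<phi>-image contracts also contracts itself.\<close>
    then obtain n where n: "core n \<subseteq> \<phi> ` carrier G" using core_base[OF embeddingD(4)] by blast
    have "x \<in> \<phi> ` ?C" if x: "x \<in> ?C" "x \<in> core n" for x
    proof -
      obtain y where y: "y \<in> carrier G" "x = \<phi> y" using x n by blast
      have "\<exists>k. (\<phi> ^^ k) y \<in> core i" for i
      proof -
        obtain k where "(\<phi> ^^ k) x \<in> core i" using x(1) Con_iff by blast
        then have "(\<phi> ^^ Suc k) y \<in> core i" using y(2) by (simp add: funpow_swap1)
        then show ?thesis ..
      qed
      then have "y \<in> ?C" using y(1) Con_iff by blast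
      then show ?thesis using y(2) by blast
    qed
    then show ?thesis by blast
  qed
  show "cm a g \<in> B" if "A \<lhd> G" "B \<lhd> G" "closedin T B" "B \<subseteq> A" "fin_idx A B" "idx A B \<le> b" "a \<in> A"
      "g \<in> core b" for A B b a g
    using core_subset(1)[OF stabilizer_open[OF that(1-3,5-7)]] that(8) by blast
qed

end

section \<open>The product decomposition\<close>

lemma topological_group_transport:
  assumes "topological_group G T" and H: "group H" and f: "f \<in> iso G H"
      and S: "homeomorphic_map T S f" "topspace S = carrier H"
  shows "topological_group H S"
proof -
  interpret G: topological_group G T by fact
  interpret H: group H by fact
  interpret f: group_hom G H f using f by unfold_locales (simp add: iso_def)
  obtain g where g: "homeomorphic_maps T S f g" using S(1) homeomorphic_map_maps by blast
  have fc: "continuous_map T S f" and gc: "continuous_map S T g"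
    and fg: "\<And>y. y \<in> carrier H \<Longrightarrow> f (g y) = y"
    using g S(2) by (auto simp: homeomorphic_maps_def)
  have gcl: "g y \<in> carrier G" if "y \<in> carrier H" for y
    using continuous_map_image_subset_topspace[OF gc] that S(2) G.topspace_eq by auto
  show ?thesis
  proof (intro topological_group.intro topological_group_axioms.intro H S(2))
    have "continuous_map (prod_topology S S) S (\<lambda>z. f (g (fst z) \<otimes>\<^bsub>G\<^esub> g (snd z)))"
      using continuous_map_compose[OF G.continuous_map_mult[OF continuous_map_compose[OF continuous_map_fst gc]
            continuous_map_compose[OF continuous_map_snd gc]] fc]
      by (simp add: o_def)
    then show "continuous_map (prod_topology S S) S (\<lambda>(x, y). x \<otimes>\<^bsub>H\<^esub> y)"
      by (rule continuous_map_eq) (auto simp: S(2) gcl fg)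
    have "continuous_map S S (\<lambda>y. f (inv\<^bsub>G\<^esub> (g y)))"
      using continuous_map_compose[OF G.continuous_map_inv[OF gc] fc] by (simp add: o_def)
    then show "continuous_map S S (\<lambda>y. inv\<^bsub>H\<^esub> y)"
      by (rule continuous_map_eq) (auto simp: S(2) gcl fg)
  qed
qed

text \<open>The exponent \<open>n\<close> is a crude bound for the multiplicities, since
  \<open>k < p ^ k\<close>.\<close>

lemma dvd_prod_prime_factors_power:
  fixes n :: nat
  assumes "n > 0"
  shows "n dvd (\<Prod>p\<in>prime_factors n. p) ^ n"
proof -
  have "multiplicity p n \<le> n" if "p \<in> prime_factors n" for p
  proof -
    have "p ^ multiplicity p n \<le> n" using multiplicity_dvd assms by (rule dvd_imp_le)
    moreover have "multiplicity p n < p ^ multiplicity p n"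
      using that prime_gt_1_nat by (intro power_gt_expt) auto
    ultimately show ?thesis by simp
  qed
  then have "(\<Prod>p\<in>prime_factors n. p ^ multiplicity p n) dvd (\<Prod>p\<in>prime_factors n. p ^ n)"
    by (intro prod_dvd_prod le_imp_power_dvd)
  then show ?thesis using prime_factorization_nat[OF assms] by (simp flip: prod_power_distrib)
qed

section \<open>Pulling back a compact subgroup along a continuous embedding\<close>

context profinite_group
begin

text \<open>\<open>F\<close> on \<open>C\<close> and \<open>h\<close> on \<open>H\<close> are
  continuous bijections from compact spaces onto the same Hausdorff space, hence homeomorphisms. The
  isomorphism is \<open>F\<close> followed by the inverse of \<open>h\<close>.\<close>

lemma topological_group_iso_preimage:
  assumes C: "subgroup C G" "closedin T C"
    and F: "F \<in> hom G G" "continuous_map T T F" "inj_on F C"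
    and P: "group P" "topspace S = carrier P" "compact_space S"
    and h: "h \<in> hom P G" "continuous_map S T h" "inj_on h (carrier P)" "F ` C \<subseteq> h ` carrier P"
  defines "H \<equiv> {z \<in> carrier P. h z \<in> F ` C}"
  shows "subgroup H P"
    "topological_group_iso (G\<lparr>carrier := C\<rparr>) (subtopology T C) (P\<lparr>carrier := H\<rparr>) (subtopology S H)"
proof -
  interpret P: group P by fact
  interpret C: subgroup C G by fact
  interpret F: group_hom G G F using F(1) by unfold_locales
  interpret h: group_hom P G h using h(1) by unfold_locales
  let ?B = "F ` C"
  have B: "subgroup ?B G" using F.subgroup_img_is_subgroup[OF C(1)] .
  have Bcl: "closedin T ?B" using closedin_image[OF F(2) C(2)] .
  interpret B: subgroup ?B G by (rule B)
  have HI: "z \<in> H \<longleftrightarrow> z \<in> carrier P \<and> h z \<in> ?B" for z by (simp only: H_def mem_Collect_eq)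
  show H: "subgroup H P"
  proof (rule P.subgroupI)
    have "\<one>\<^bsub>P\<^esub> \<in> H" using B.one_closed by (simp only: HI h.hom_one P.one_closed)
    then show "H \<noteq> {}" by blast
    fix z assume z: "z \<in> H"
    then have z: "z \<in> carrier P" "h z \<in> ?B" unfolding HI by auto
    show "inv\<^bsub>P\<^esub> z \<in> H" using h.hom_inv[OF z(1)] B.m_inv_closed[OF z(2)] P.inv_closed[OF z(1)]
      by (simp only: HI)
    fix w assume "w \<in> H"
    then have w: "w \<in> carrier P" "h w \<in> ?B" unfolding HI by auto
    show "z \<otimes>\<^bsub>P\<^esub> w \<in> H"
      using h.hom_mult[OF z(1) w(1)] B.m_closed[OF z(2) w(2)] P.m_closed[OF z(1) w(1)] by (simp only: HI)
  next
    show "H \<subseteq> carrier P" unfolding H_def by (rule Collect_restrict)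
  qed
  interpret H: subgroup H P by (rule H)
  have hH: "h ` H = ?B"
  proof (intro equalityI subsetI)
    fix y assume "y \<in> ?B"
    then obtain z where "z \<in> carrier P" "y = h z" using h(4) by (meson imageE subsetD)
    then show "y \<in> h ` H" using \<open>y \<in> ?B\<close> by (metis HI imageI)
  next
    fix y assume "y \<in> h ` H"
    then obtain z where "z \<in> H" "y = h z" by (rule imageE)
    then show "y \<in> ?B" using HI by simp
  qed
  have injH: "inj_on h H" using inj_on_subset[OF h(3) H.subset] .
  have top: "topspace (subtopology T C) = C" "topspace (subtopology T ?B) = ?B" "topspace (subtopology S H) = H"
    using C.subset B.subset H.subset P(2) topspace_eq by auto
  have HB: "Hausdorff_space (subtopology T ?B)" using hausdorff Hausdorff_space_subtopology by blast
  have "homeomorphic_map (subtopology T C) (subtopology T ?B) F"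
  proof (rule continuous_imp_homeomorphic_map[OF _ _ HB])
    show "continuous_map (subtopology T C) (subtopology T ?B) F"
      using continuous_map_from_subtopology[OF F(2)] by (auto simp: continuous_map_in_subtopology)
    show "compact_space (subtopology T C)" using closed_imp_compact[OF C(2)] compact_space_subtopology by blast
  qed (use top F(3) in auto)
  moreover have "homeomorphic_map (subtopology S H) (subtopology T ?B) h"
  proof (rule continuous_imp_homeomorphic_map[OF _ _ HB])
    show "continuous_map (subtopology S H) (subtopology T ?B) h"
      using continuous_map_from_subtopology[OF h(2)] hH top(3)
        by (simp only: continuous_map_in_subtopology image_subset_iff_funcset [symmetric] subset_refl)
    have "closedin S H" using closedin_continuous_map_preimage[OF h(2) Bcl] P(2) unfolding H_def by simp
    then show "compact_space (subtopology S H)"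
      using closedin_compact_space[OF P(3)] compact_space_subtopology by blast
  qed (use top injH hH in auto)
  then obtain g where g: "homeomorphic_maps (subtopology S H) (subtopology T ?B) h g"
    using homeomorphic_map_maps by blast
  then have gh: "homeomorphic_map (subtopology T ?B) (subtopology S H) g"
    using homeomorphic_maps_map homeomorphic_maps_sym by blast
  have ghx: "g (h x) = x" if "x \<in> H" for x using g that top by (auto simp: homeomorphic_maps_def)
  have hg: "h (g y) = y" "g y \<in> H" if "y \<in> ?B" for y
    using that hH ghx by (metis image_iff, metis image_iff)
  have giso: "g \<in> iso (G\<lparr>carrier := ?B\<rparr>) (P\<lparr>carrier := H\<rparr>)"
  proof (rule isoI)
    show "g \<in> hom (G\<lparr>carrier := ?B\<rparr>) (P\<lparr>carrier := H\<rparr>)"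
    proof (rule homI)
      fix x y assume "x \<in> carrier (G\<lparr>carrier := ?B\<rparr>)" "y \<in> carrier (G\<lparr>carrier := ?B\<rparr>)"
      then have xy: "x \<in> ?B" "y \<in> ?B" by auto
      then have g: "g x \<in> H" "g y \<in> H" using hg(2) by blast+
      then have "h (g x \<otimes>\<^bsub>P\<^esub> g y) = x \<otimes> y" using hg(1) xy by simp
      then show "g (x \<otimes>\<^bsub>G\<lparr>carrier := ?B\<rparr>\<^esub> y) = g x \<otimes>\<^bsub>P\<lparr>carrier := H\<rparr>\<^esub> g y"
        using ghx[OF H.m_closed[OF g]] by simp
    next
      fix x assume "x \<in> carrier (G\<lparr>carrier := ?B\<rparr>)"
      then have "x \<in> ?B" by simp
      then show "g x \<in> carrier (P\<lparr>carrier := H\<rparr>)" using hg(2) by simp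
    qed
    have "bij_betw g ?B H"
    proof (rule bij_betwI[where g = h])
      show "h \<in> H \<rightarrow> ?B" using hH by blast
      show "g \<in> ?B \<rightarrow> H" using hg(2) by (rule Pi_I)
      show "h (g y) = y" if "y \<in> ?B" for y using hg(1)[OF that] .
      show "g (h x) = x" if "x \<in> H" for x using ghx[OF that] .
    qed
    then show "bij_betw g (carrier (G\<lparr>carrier := ?B\<rparr>)) (carrier (P\<lparr>carrier := H\<rparr>))" by simp
  qed
  have Fiso: "F \<in> iso (G\<lparr>carrier := C\<rparr>) (G\<lparr>carrier := ?B\<rparr>)"
    using F(3) by (auto intro!: isoI homI simp: bij_betw_def)
  have "topological_group (P\<lparr>carrier := H\<rparr>) (subtopology S H)"
    using topological_group_transport[OF subgroup_topological_group[OF B] H.subgroup_is_group[OF P(1)]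
        giso gh] top by simp
  moreover have "g \<circ> F \<in> iso (G\<lparr>carrier := C\<rparr>) (P\<lparr>carrier := H\<rparr>)"
    using iso_set_trans[OF Fiso giso] .
  moreover have "homeomorphic_map (subtopology T C) (subtopology S H) (g \<circ> F)"
    using homeomorphic_map_compose calculation gh \<open>homeomorphic_map (subtopology T C) (subtopology T ?B)
        F\<close> by blast
  ultimately show "topological_group_iso (G\<lparr>carrier := C\<rparr>) (subtopology T C) (P\<lparr>carrier := H\<rparr>) (subtopology S H)"
    unfolding topological_group_iso_def using subgroup_topological_group[OF C(1)] by blast
qed

end

section \<open>Products of coprime parts and assembly of the decomposition\<close>

context contraction
begin

lemma mprod_closed: "(\<And>i. i < k \<Longrightarrow> d i \<in> carrier G) \<Longrightarrow> mprod d k \<in> carrier G"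
  by (induction k) auto

lemma continuous_map_mprod:
  "(\<And>i. i < k \<Longrightarrow> continuous_map X T (\<lambda>x. d x i)) \<Longrightarrow> continuous_map X T (\<lambda>x. mprod (d x) k)"
  by (induction k) (auto intro: continuous_map_mult simp: topspace_eq)

lemma phik_mprod:
  "(\<And>i. i < k \<Longrightarrow> d i \<in> carrier G) \<Longrightarrow> (\<phi> ^^ j) (mprod d k) = mprod (\<lambda>i. (\<phi> ^^ j) (d i)) k"
  by (induction k) (auto simp: mprod_closed)

lemma part_mono:
  assumes "D \<subseteq> carrier G" "r dvd s"
  shows "part r D \<subseteq> part s D"
proof -
  obtain t where t: "s = r * t" using assms(2) by blast
  have "x [^] (s ^ j) \<in> I n" if "x \<in> D" "x [^] (r ^ j) \<in> I n" for x n j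
    using that assms(1) subgroup_pow[OF I_subgroup that(2), of "t ^ j"]
    by (auto simp: t power_mult_distrib nat_pow_pow subset_iff)
  then show ?thesis by (fastforce simp: part_def)
qed

context
  fixes D :: "'a set" and p :: "nat \<Rightarrow> nat" and k :: nat
  assumes X: "radicable D"
    and coprime_p: "\<And>i j. i < k \<Longrightarrow> j < k \<Longrightarrow> i \<noteq> j \<Longrightarrow> coprime (p i) (p j)"
begin

lemma D_carrier: "D \<subseteq> carrier G"
  using pureD(7)[OF radicable_pure[OF X]] .

lemma part_subgroup: "subgroup (part r D) G"
  using pureD(2)[OF part_pure(1)[OF X]] .

lemma coprime_prod_p: "j < k \<Longrightarrow> coprime (\<Prod>i<j. p i) (p j)"
  using coprime_p by (auto intro!: prod_coprime_left)

lemma mprod_part: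
  assumes "j \<le> k" "\<And>i. i < j \<Longrightarrow> d i \<in> part (p i) D"
  shows "mprod d j \<in> part (\<Prod>i<j. p i) D"
  using assms
proof (induction j)
  case 0
  then show ?case using subgroup.one_closed[OF part_subgroup] by simp
next
  case (Suc j)
  then have "mprod d j \<in> part (\<Prod>i<Suc j. p i) D" "d j \<in> part (\<Prod>i<Suc j. p i) D"
    using part_mono[OF D_carrier, of "\<Prod>i<j. p i" "\<Prod>i<Suc j. p i"]
      part_mono[OF D_carrier, of "p j" "\<Prod>i<Suc j. p i"] by auto
  then show ?case using subgroup.m_closed[OF part_subgroup] by simp
qed

text \<open>\<open>d j\<close> moves past \<open>mprod d' j\<close> because the latter lies in the
  part for the product of the earlier numbers, which is coprime to \<open>p j\<close>.\<close>

lemma mprod_mult: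
  assumes "j \<le> k" "\<And>i. i < j \<Longrightarrow> d i \<in> part (p i) D" "\<And>i. i < j \<Longrightarrow> d' i \<in> part (p i) D"
  shows "mprod (\<lambda>i. d i \<otimes> d' i) j = mprod d j \<otimes> mprod d' j"
  using assms
proof (induction j)
  case (Suc j)
  have j: "j < k" "j \<le> k" using Suc.prems(1) by auto
  have m: "mprod d j \<in> part (\<Prod>i<j. p i) D" "mprod d' j \<in> part (\<Prod>i<j. p i) D"
    using mprod_part[OF j(2)] Suc.prems(2,3) by auto
  have c: "mprod d' j \<otimes> d j = d j \<otimes> mprod d' j"
    using part_commute[OF X coprime_prod_p[OF j(1)] m(2)] Suc.prems(2)[of j] by simp
  have carr: "mprod d j \<in> carrier G" "mprod d' j \<in> carrier G" "d j \<in> carrier G" "d' j \<in> carrier G"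
    using m Suc.prems(2,3)[of j] subgroup.subset[OF part_subgroup] by (auto dest!: subsetD)
  have "mprod (\<lambda>i. d i \<otimes> d' i) (Suc j) = mprod d j \<otimes> (mprod d' j \<otimes> d j) \<otimes> d' j"
    using Suc carr by (simp add: m_assoc)
  also have "\<dots> = mprod d (Suc j) \<otimes> mprod d' (Suc j)" unfolding c using carr by (simp add: m_assoc)
  finally show ?case .
qed simp

text \<open>The discrepancy between the last components lies in two coprime parts, so it is trivial
  and the shorter products agree.\<close>

lemma mprod_inj:
  assumes "j \<le> k" "\<And>i. i < j \<Longrightarrow> d i \<in> part (p i) D" "\<And>i. i < j \<Longrightarrow> d' i \<in> part (p i) D" "mprod d j = mprod d' j"
  shows "\<forall>i<j. d i = d' i"
  using assms
proof (induction j)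
  case (Suc j)
  have j: "j < k" "j \<le> k" using Suc.prems(1) by auto
  have m: "mprod d j \<in> part (\<Prod>i<j. p i) D" "mprod d' j \<in> part (\<Prod>i<j. p i) D"
    using mprod_part[OF j(2)] Suc.prems(2,3) by auto
  have dp: "d j \<in> part (p j) D" "d' j \<in> part (p j) D" using Suc.prems(2,3) by auto
  have carr: "mprod d j \<in> carrier G" "mprod d' j \<in> carrier G" "d j \<in> carrier G" "d' j \<in> carrier G"
    using m dp subgroup.subset[OF part_subgroup] by (auto dest!: subsetD)
  let ?z = "inv (mprod d' j) \<otimes> mprod d j"
  have eq: "mprod d j \<otimes> d j = mprod d' j \<otimes> d' j" using Suc.prems(4) by simp
  have "?z \<otimes> d j = d' j" using eq carr by (simp add: m_assoc)
  then have "?z = d' j \<otimes> inv (d j)" using carr inv_solve_right[of ?z "d' j" "d j"] by simp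
  moreover have "?z \<in> part (\<Prod>i<j. p i) D"
    using m subgroup.m_closed[OF part_subgroup] subgroup.m_inv_closed[OF part_subgroup] by blast
  moreover have "d' j \<otimes> inv (d j) \<in> part (p j) D"
    using dp subgroup.m_closed[OF part_subgroup] subgroup.m_inv_closed[OF part_subgroup] by blast
  ultimately have z: "?z = \<one>" using part_Int[OF coprime_prod_p[OF j(1)] _ _ D_carrier] by metis
  then have e: "mprod d j = mprod d' j" using carr inv_solve_left'[of \<one> "mprod d' j" "mprod d j"] by simp
  then have "d j = d' j" using eq carr by simp
  moreover have "\<forall>i<j. d i = d' i" using Suc e j by simp
  ultimately show ?case using less_Suc_eq by auto
qed simp

end

lemma ascends_derived:
  assumes "ascends D P" "pure D"
  shows "\<exists>n. (derived G ^^ n) P \<subseteq> D"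
  using assms
proof (induction rule: ascends.induct)
  case refl
  have "(derived G ^^ 0) D \<subseteq> D" by simp
  then show ?case by blast
next
  case (step A P)
  then obtain n where n: "(derived G ^^ n) A \<subseteq> D" by blast
  have "pure A" using step(1) \<open>pure D\<close> by (cases rule: ascends.cases) auto
  have "derived_set G P \<subseteq> A" using step(4) by (auto simp: cm_def)
  then have "derived G P \<subseteq> A"
    unfolding derived_def using generate_subgroup_incl pureD(2)[OF \<open>pure A\<close>] by blast
  then have "(derived G ^^ Suc n) P \<subseteq> (derived G ^^ n) A"
    using mono_exp_of_derived by (simp add: funpow_swap1)
  then show ?case using n by blast
qed

text \<open>The abelian chain puts a derived subgroup of \<open>C\<close> into \<open>D\<close>,
  while the derived series of \<open>E\<close> stays in \<open>E\<close>, which meets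
  \<open>D\<close> trivially.\<close>

lemma solvable_of_ascends:
  assumes D: "ascends D C" "pure D" and E: "subgroup E G" "E \<subseteq> C" "D \<inter> E = {\<one>}"
  shows "solvable (G\<lparr>carrier := E\<rparr>)"
proof -
  interpret E: group "G\<lparr>carrier := E\<rparr>" by (rule subgroup_imp_group[OF E(1)])
  obtain n where n: "(derived G ^^ n) C \<subseteq> D" using ascends_derived[OF D] by blast
  have "(derived (G\<lparr>carrier := E\<rparr>) ^^ i) E = (derived G ^^ i) E \<and> (derived G ^^ i) E \<subseteq> E" for i
    by (induction i) (auto simp: derived_consistent[OF _ E(1)] dest: subsetD[OF derived_incl[OF _ E(1)]])
  moreover have "(derived G ^^ n) E \<subseteq> D" using mono_exp_of_derived[OF E(2)] n by blast
  moreover have "\<one> \<in> (derived G ^^ n) E"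
    using subgroup.one_closed[OF exp_of_derived_is_subgroup[OF E(1)]] .
  ultimately have "(derived (G\<lparr>carrier := E\<rparr>) ^^ n) E = {\<one>}" using E(3) by blast
  then show ?thesis
    using E.trivial_derived_seq_imp_solvable[OF E.subgroup_self, of n] by (simp add: solvable_def)
qed

text \<open>The abstract product embeds into \<open>G\<close> by the multiplication map
  \<open>h\<close>. Its image need not contain \<open>C\<close>, but it contains the image of
  \<open>C\<close> under a power of \<phi>; pulling that copy of \<open>C\<close> back along
  \<open>h\<close> gives \<open>H\<close>.\<close>

theorem contraction_group_structure:
  "\<exists>(k::nat) (U :: nat \<Rightarrow> ('a, 'b) monoid_scheme) TU (E :: ('a, 'b) monoid_scheme) TE H.
     (\<forall>i<k. nilpotent_group (U i) \<and> torsion_free_group (U i) \<and> (\<exists>p. uniform_pro_p_group p (U i) (TU i))) \<and>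
     pronilpotent_group E TE \<and> solvable E \<and> finite_exponent E \<and>
     subgroup H (product_group {..<k} U \<times>\<times> E) \<and>
     openin (prod_topology (product_topology TU {..<k}) TE) H \<and>
     topological_group_iso (G\<lparr>carrier := C\<rparr>) (subtopology T C)
       ((product_group {..<k} U \<times>\<times> E)\<lparr>carrier := H\<rparr>)
       (subtopology (prod_topology (product_topology TU {..<k}) TE) H)"
proof -
  obtain D E K N where D: "radicable D" "ascends D C" and E: "good E"
      and N: "N > 0" "\<And>x. x \<in> E \<Longrightarrow> x [^] (N::nat) = \<one>"
    and com: "\<And>d e. d \<in> D \<Longrightarrow> e \<in> E \<Longrightarrow> d \<otimes> e = e \<otimes> d" and DE: "D \<inter> E = {\<one>}"
    and split: "\<And>x. x \<in> C \<Longrightarrow> \<exists>d\<in>D. \<exists>e\<in>E. (\<phi> ^^ K) x = d \<otimes> e"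
    by (rule torsion_splitting) (rule that; assumption)
  note pD = radicable_pure[OF D(1)]
  interpret D: subgroup D G using pureD(2)[OF pD] .
  interpret E: subgroup E G using goodD(2)[OF E] .
  \<comment> \<open>The factors are indexed by the primes dividing \<open>m\<close>; for
    \<open>m = 1\<close> there are none and \<open>k = 0\<close>.\<close>
  obtain p and k :: nat where p: "bij_betw p {..<k} (prime_factors m)"
    using ex_bij_betw_nat_finite[of "prime_factors m"] unfolding atLeast0LessThan by blast
  have pp: "prime (p i)" if "i < k" for i using bij_betwE[OF p] that by auto
  have cop: "coprime (p i) (p j)" if "i < k" "j < k" "i \<noteq> j" for i j
    using primes_coprime[OF pp[OF that(1)] pp[OF that(2)]] that
        inj_onD[OF bij_betw_imp_inj_on[OF p], of i j] by auto
  have "(\<Prod>i<k. p i) = \<Prod>(prime_factors m)" using prod.reindex_bij_betw[OF p, of "\<lambda>x. x"] by simp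
  then have "part (\<Prod>i<k. p i) D = D"
    using part_m[OF pureD(4)[OF pD]] dvd_prod_prime_factors_power[OF m_pos] by simp
  note allD = this
  define X where "X = (\<lambda>i. part (p i) D)"
  have Xr: "radicable (X i)" if i: "i < k" for i
    unfolding X_def
  proof (rule radicable_part[OF D(1)])
    show "coprime (p i) (\<Prod>j\<in>{..<k} - {i}. p j)" using cop i by (auto intro!: prod_coprime_right)
    show "p i > 0" using pp[OF i] prime_gt_0_nat by blast
    show "part (p i * (\<Prod>j\<in>{..<k} - {i}. p j)) D = D"
      using allD prod.remove[of "{..<k}" i p] i by (metis finite_lessThan lessThan_iff)
  qed
  have XX: "part (p i) (X i) = X i" for i by (auto simp: X_def part_def)
  have "\<exists>A. subgroup A G \<and> closedin T A \<and> A \<subseteq> X i \<and> fin_idx (X i) A \<and>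
      uniform_pro_p_group (p i) (G\<lparr>carrier := A\<rparr>) (subtopology T A)" if "i < k" for i
    using uniform_subgroup[OF Xr[OF that] pp[OF that] XX] by metis
  then obtain A where A: "\<And>i. i < k \<Longrightarrow> subgroup (A i) G" "\<And>i. i < k \<Longrightarrow> closedin T (A i)" "\<And>i. i < k \<Longrightarrow> A i \<subseteq> X i"
    "\<And>i. i < k \<Longrightarrow> fin_idx (X i) (A i)"
    "\<And>i. i < k \<Longrightarrow> uniform_pro_p_group (p i) (G\<lparr>carrier := A i\<rparr>) (subtopology T (A i))"
    by metis
  have AX: "x \<in> part (p i) D" if "i < k" "x \<in> A i" for x i using A(3) that by (auto simp: X_def)
  have Ac: "A i \<subseteq> carrier G" if "i < k" for i using A(1)[OF that] by (rule subgroup.subset)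
  have XC: "X i \<subseteq> C" for i using part_pure(2)[OF D(1)] pureD(4)[OF pD] by (auto simp: X_def)
  have "\<exists>n. X i \<inter> I n \<subseteq> A i" if "i < k" for i
    using closed_subgroup_I[OF pureD(2)[OF radicable_pure[OF Xr[OF that]]] A(1,2,4)[OF that]] by metis
  then obtain n where n: "\<And>i. i < k \<Longrightarrow> X i \<inter> I (n i) \<subseteq> A i" by metis
  \<comment> \<open>The maximum serves all factors at once, since \<open>I\<close> is
    decreasing.\<close>
  obtain J where J: "\<forall>x\<in>C. (\<phi> ^^ J) x \<in> I (Max (n ` {..<k}))" using C_contr by blast
  have JA: "(\<phi> ^^ J) x \<in> A i" if i: "i < k" and x: "x \<in> X i" for x i
  proof -
    have "(\<phi> ^^ J) x \<in> I (n i)"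
      using J x XC I_anti[of "n i" "Max (n ` {..<k})"] i by (auto simp: subset_iff)
    then show ?thesis using n[OF i] pureD(6)[OF radicable_pure[OF Xr[OF i]] x] by blast
  qed
  define U where "U = (\<lambda>i. G\<lparr>carrier := A i\<rparr>)"
  define TU where "TU = (\<lambda>i. subtopology T (A i))"
  define P where "P = product_group {..<k} U \<times>\<times> G\<lparr>carrier := E\<rparr>"
  define S where "S = prod_topology (product_topology TU {..<k}) (subtopology T E)"
  define h where "h = (\<lambda>(u, e). mprod u k \<otimes> e)"
  have Pcarr: "carrier P = (\<Pi>\<^sub>E i\<in>{..<k}. A i) \<times> E" by (simp add: P_def U_def)
  have TUtop: "topspace (TU i) = A i" if "i < k" for i using Ac[OF that] topspace_eq by (auto simp: TU_def)
  have Stop: "topspace S = carrier P"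
    using E.subset topspace_eq TUtop by (auto simp: S_def Pcarr PiE_def Pi_def)
  have groupP: "group P"
    unfolding P_def U_def using A(1) E.subgroup_axioms subgroup_imp_group
      by (intro DirProd_group product_group) auto
  have compactS: "compact_space S"
    unfolding S_def TU_def using closed_imp_compact A(2) goodD(3)[OF E] compact_space_subtopology
    by (auto simp: compact_space_prod_topology compact_space_product_topology)
  have uD: "mprod u k \<in> D" if "\<And>i. i < k \<Longrightarrow> u i \<in> A i" for u
    using mprod_part[where p = p and k = k and j = k and d = u, OF D(1) cop] AX that allD by auto
  have hom: "h \<in> hom P G"
  proof (rule homI)
    show "h z \<in> carrier G" if "z \<in> carrier P" for z
      using that uD by (auto simp: h_def Pcarr PiE_iff)
    fix z w assume zw: "z \<in> carrier P" "w \<in> carrier P"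
    then obtain u e v f where z: "z = (u, e)" "w = (v, f)" and u: "\<And>i. i < k \<Longrightarrow> u i \<in> A i" "e \<in> E"
      and v: "\<And>i. i < k \<Longrightarrow> v i \<in> A i" "f \<in> E" by (auto simp: Pcarr PiE_iff)
    note d = uD[OF u(1)] uD[OF v(1)]
    have "mprod (\<lambda>i. u i \<otimes> v i) k = mprod u k \<otimes> mprod v k"
      using mprod_mult[where p = p and k = k and j = k and d = u and d' = v, OF D(1) cop] AX u v by auto
    moreover have "mprod (\<lambda>i\<in>{..<k}. u i \<otimes> v i) k = mprod (\<lambda>i. u i \<otimes> v i) k" by (rule mprod_cong) simp
    ultimately have "h (z \<otimes>\<^bsub>P\<^esub> w) = mprod u k \<otimes> mprod v k \<otimes> (e \<otimes> f)"
      by (simp add: z h_def P_def U_def)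
    also have "\<dots> = mprod u k \<otimes> (mprod v k \<otimes> e) \<otimes> f" using d u(2) v(2) by (simp add: m_assoc)
    also have "\<dots> = mprod u k \<otimes> (e \<otimes> mprod v k) \<otimes> f" using com[OF d(2) u(2)] by simp
    also have "\<dots> = h z \<otimes> h w" using d u(2) v(2) by (simp add: z h_def m_assoc)
    finally show "h (z \<otimes>\<^bsub>P\<^esub> w) = h z \<otimes> h w" .
  qed
  have cont: "continuous_map S T h"
  proof -
    have 1: "continuous_map S T (\<lambda>z. fst z i)" if "i < k" for i
    proof -
      have "continuous_map (product_topology TU {..<k}) (TU i) (\<lambda>u. u i)"
        using that by (intro continuous_map_product_projection) simp
      then have "continuous_map (product_topology TU {..<k}) T (\<lambda>u. u i)"
        unfolding TU_def by (rule continuous_map_into_fulltopology)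
      from continuous_map_compose[OF continuous_map_fst this] show ?thesis by (simp add: S_def o_def)
    qed
    have "continuous_map S T snd"
      unfolding S_def using continuous_map_into_fulltopology[OF continuous_map_snd] .
    then show ?thesis
      using continuous_map_mult[OF continuous_map_mprod[OF 1]] by (simp add: h_def case_prod_unfold)
  qed
  have inj: "inj_on h (carrier P)"
  proof (rule inj_onI)
    fix z w assume zw: "z \<in> carrier P" "w \<in> carrier P" and hzw: "h z = h w"
    then obtain u e v f where z: "z = (u, e)" "w = (v, f)" and u: "u \<in> (\<Pi>\<^sub>E i\<in>{..<k}. A i)" "e \<in> E"
      and v: "v \<in> (\<Pi>\<^sub>E i\<in>{..<k}. A i)" "f \<in> E" by (auto simp: Pcarr)
    have uv: "u i \<in> A i" "v i \<in> A i" if "i < k" for i using u v that by auto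
    note d = uD[OF uv(1)] uD[OF uv(2)]
    have eq: "mprod u k \<otimes> e = mprod v k \<otimes> f" using hzw by (simp add: z h_def)
    have "inv (mprod v k) \<otimes> mprod u k \<otimes> e = f" using eq d u(2) v(2) by (simp add: m_assoc)
    then have "inv (mprod v k) \<otimes> mprod u k = f \<otimes> inv e"
      using d u(2) v(2) inv_solve_right[of "inv (mprod v k) \<otimes> mprod u k" f e] by simp
    moreover have "inv (mprod v k) \<otimes> mprod u k \<in> D" "f \<otimes> inv e \<in> E" using d u(2) v(2) by auto
    ultimately have "inv (mprod v k) \<otimes> mprod u k = \<one>" using DE by auto
    then have m: "mprod u k = mprod v k"
      using inv_solve_left'[of \<one> "mprod v k" "mprod u k"] d by simp
    then have "\<forall>i<k. u i = v i" using mprod_inj[where p = p and k = k and j = k and d = u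
        and d' = v, OF D(1) cop] AX uv by auto
    then have "u = v" using u(1) v(1) by (intro PiE_ext) auto
    moreover have "e = f" using eq m d u(2) v(2) by simp
    ultimately show "z = w" by (simp add: z)
  qed
  \<comment> \<open>\<open>K\<close> iterations split an element of \<open>C\<close> into
    \<open>D\<close> and \<open>E\<close>; \<open>J\<close> more bring the components of its
    \<open>D\<close>-part into the uniform subgroups.\<close>
  let ?F = "\<phi> ^^ (J + K)"
  have img: "?F ` C \<subseteq> h ` carrier P"
  proof (rule image_subsetI)
    fix x assume "x \<in> C"
    then obtain d e where de: "d \<in> D" "e \<in> E" "(\<phi> ^^ K) x = d \<otimes> e" using split by blast
    obtain dd where dd: "\<forall>i<k. dd i \<in> part (p i) D" "d = mprod dd k"
      using part_mprod[where p = p and k = k and x = d, OF D(1) prime_gt_0_nat[OF pp] cop] de(1) allD by auto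
    have ddc: "dd i \<in> carrier G" if "i < k" for i using dd(1) that XC[of i] by (auto simp: X_def)
    let ?u = "\<lambda>i\<in>{..<k}. (\<phi> ^^ J) (dd i)"
    have "?u \<in> (\<Pi>\<^sub>E i\<in>{..<k}. A i)" using JA dd(1) by (auto simp: X_def)
    moreover have "(\<phi> ^^ J) e \<in> E" using goodD(6)[OF E de(2)] .
    moreover have "?F x = h (?u, (\<phi> ^^ J) e)"
    proof -
      have "mprod ?u k = mprod (\<lambda>i. (\<phi> ^^ J) (dd i)) k" by (rule mprod_cong) simp
      also have "\<dots> = (\<phi> ^^ J) d" unfolding dd(2) using phik_mprod[of k dd J] ddc by simp
      finally show ?thesis using de by (simp add: phik_add h_def)
    qed
    ultimately show "?F x \<in> h ` carrier P" unfolding Pcarr by blast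
  qed
  have FC: "subgroup (?F ` C) G" using subgroup_phik_image[OF C_subgroup] .
  have injF: "inj_on ?F C" using subgroup.subset[OF C_subgroup] by (auto intro!: inj_onI)
  define H where "H = {z \<in> carrier P. h z \<in> ?F ` C}"
  have H: "subgroup H P" "topological_group_iso (G\<lparr>carrier := C\<rparr>) (subtopology T C) (P\<lparr>carrier := H\<rparr>) (subtopology S H)"
    unfolding H_def
    using topological_group_iso_preimage[OF C_subgroup C_closed phik_hom phik_cont injF groupP Stop
        compactS hom cont inj img]
    by blast+
  \<comment> \<open>The image of \<open>C\<close> has finite index in \<open>C\<close>, so it is
    relatively open there. It is enlarged to an open \<open>?W\<close> in \<open>G\<close> that adds
    nothing inside \<open>C\<close>; as \<open>h\<close> takes values in \<open>C\<close>, its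
    preimage is still \<open>H\<close>.\<close>
  have Hopen: "openin S H"
  proof -
    have FCC: "?F ` C \<subseteq> C" using C_phik by blast
    obtain n where n: "C \<inter> I n \<subseteq> ?F ` C"
      using closed_subgroup_I[OF C_subgroup FC closedin_image[OF phik_cont C_closed] fin_idx_phik[OF good_C]] .
    let ?W = "?F ` C <#> I n"
    have W: "openin T ?W"
      using subgroup_openI[OF subgroup_set_mult[OF FC I_normal] I_open subgroup.one_closed[OF I_subgroup]]
        set_mult_supset(2)[OF FC I_subgroup] by blast
    have hC: "h z \<in> C" if z: "z \<in> carrier P" for z
    proof -
      have z: "fst z \<in> (\<Pi>\<^sub>E i\<in>{..<k}. A i)" "snd z \<in> E" using z by (simp_all add: Pcarr mem_Times_iff)
      have "mprod (fst z) k \<in> D" using uD PiE_mem[OF z(1)] by simp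
      then have "mprod (fst z) k \<otimes> snd z \<in> C"
        using subgroup.m_closed[OF C_subgroup subsetD[OF pureD(4)[OF pD]] subsetD[OF goodD(4)[OF E]
            z(2)]] by blast
      then show ?thesis by (simp add: h_def case_prod_unfold)
    qed
    have "h z \<in> ?F ` C" if z: "z \<in> carrier P" "h z \<in> ?W" for z
    proof -
      obtain f i where fi: "f \<in> ?F ` C" "i \<in> I n" "h z = f \<otimes> i" using z(2) by (auto simp: set_mult_def)
      have c: "f \<in> carrier G" "i \<in> carrier G"
        using fi(1,2) FC I_subgroup by (auto dest: subgroup.mem_carrier)
      have "i = inv f \<otimes> h z" using fi(3) c by (simp add: m_assoc[symmetric])
      then have "i \<in> C"
        using fi(1) FCC hC[OF z(1)] subgroup.m_closed[OF C_subgroup] subgroup.m_inv_closed[OF C_subgroup]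
          by blast
      then show ?thesis using fi n subgroup.m_closed[OF FC] by auto
    qed
    then have "H = {z \<in> topspace S. h z \<in> ?W}"
      unfolding H_def Stop using set_mult_supset(1)[OF FC I_subgroup] by blast
    then show ?thesis using openin_continuous_map_preimage[OF cont W] by simp
  qed
  have U: "nilpotent_group (U i) \<and> torsion_free_group (U i) \<and> (\<exists>p. uniform_pro_p_group p (U i) (TU i))"
      if "i < k" for i
    unfolding U_def TU_def using radicable_subgroup_nilpotent[OF Xr A(1,3)] A(5) that by blast
  show ?thesis
  proof (intro exI conjI)
    show "\<forall>i<k. nilpotent_group (U i) \<and> torsion_free_group (U i) \<and> (\<exists>p. uniform_pro_p_group p (U i) (TU i))"
      using U by blast
    show "pronilpotent_group (G\<lparr>carrier := E\<rparr>) (subtopology T E)"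
      using restrict_pronilpotent[OF goodD(2,3,4)[OF E]] .
    show "solvable (G\<lparr>carrier := E\<rparr>)"
      using solvable_of_ascends[OF D(2) pD goodD(2,4)[OF E] DE] .
    show "finite_exponent (G\<lparr>carrier := E\<rparr>)"
      unfolding finite_exponent_def using N by (auto simp: nat_pow_def)
  qed (use H Hopen in \<open>simp_all only: P_def S_def\<close>)
qed

end

theorem corollary1p3:
  fixes G :: "'a monoid" and T :: "'a topology" and \<phi> :: "'a \<Rightarrow> 'a"
  assumes "profinite_group G T"
    and "type_F G T"
    and "open_self_embedding G T \<phi>"
  shows "\<exists>(k::nat) (U :: nat \<Rightarrow> 'a monoid) (TU :: nat \<Rightarrow> 'a topology)
           (E :: 'a monoid) (TE :: 'a topology) H.
           (\<forall>i<k. nilpotent_group (U i) \<and> torsion_free_group (U i) \<and>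
                  (\<exists>p. uniform_pro_p_group p (U i) (TU i))) \<and>
           pronilpotent_group E TE \<and> solvable E \<and> finite_exponent E \<and>
           subgroup H (product_group {..<k} U \<times>\<times> E) \<and>
           openin (prod_topology (product_topology TU {..<k}) TE) H \<and>
           topological_group_iso
             (G\<lparr>carrier := Con G T \<phi>\<rparr>) (subtopology T (Con G T \<phi>))
             ((product_group {..<k} U \<times>\<times> E)\<lparr>carrier := H\<rparr>)
             (subtopology (prod_topology (product_topology TU {..<k}) TE) H)"
proof -
  interpret self_embedding G T \<phi>
    using assms by (intro self_embedding.intro self_embedding_axioms.intro)
  show ?thesis by (rule contraction_group_structure)
qed

end
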